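(* Let $\mathcal H$ be a Hilbert space and $A,B\in B(\mathcal H)_+$. Let $\phi_{t^2}(A,B)$ be the extended operator perspective associated with $f(t)=t^2$, and set $Q_{A,B}:=\int_{[0,1)}\frac{t^2}{1-t}\,dE_{R_{A,B}}(t)$, a positive self-adjoint operator on $\mathcal H_{A,B}$. Then the following hold: (1) The essential part $\mathcal H_0$ of $\phi_{t^2}(A,B)$ is $$\mathcal H_0=\overline{\ker(A-[B]A)\cap\mathcal D(Q_{A,B}^{1/2}T_{A,B})}\subseteq\ker(A-[B]A).$$ (2) $\phi_{t^2}(A,B)$ has a dense domain if and only if $A$ is $B$-absolutely continuous and $\mathcal D(Q_{A,B}^{1/2}T_{A,B})$ is dense in $\mathcal H$. (3) $\phi_{t^2}(A,B)$ is bounded if and only if $A^2\le\lambda B$ for some $\lambda>0$ (a condition which is in general strictly weaker than: $A\le\alpha B$ for some $\alpha>0$). In this case, the operator norm of $\phi_{t^2}(A,B)$ is $$\|\phi_{t^2}(A,B)\|=\min\{\lambda\ge0:A^2\le\lambda B\}.$$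
   Context: $B(\mathcal H)_+$ is the set of positive bounded operators on $\mathcal H$. $B(\mathcal H)_*^+$ is the set of positive normal functionals on $B(\mathcal H)$; $\omega_\xi:=\langle\,\cdot\,\xi,\xi\rangle$. $\widehat{B(\mathcal H)}_{\mathrm{lb}}$ is the set of maps $m:B(\mathcal H)_*^+\to(-\infty,\infty]$ that are positively homogeneous (with $0\cdot\infty=0$), additive, lower semicontinuous (in norm), and satisfy $m(\rho)+\ell\rho(I)\ge0$ for all $\rho$ for some $\ell\ge0$. For $T\in\widehat{B(\mathcal H)}_{\mathrm{lb}}$: the essential part of $T$ is the closed subspace $\overline{\{\xi\in\mathcal H:T(\omega_\xi)<\infty\}}$; $T$ has a dense domain if its essential part is $\mathcal H$; $T$ is bounded if there is a bounded self-adjoint operator $X$ on $\mathcal H$ with $T(\rho)=\rho(X)$ for all $\rho$, and then $\|T\|:=\|X\|$. For $A,B\in B(\mathcal H)_+$ put $\mathcal H_{A,B}:=\overline{\mathrm{ran}}(A+B)$ and $T_{A,B}:\mathcal H\to\mathcal H_{A,B}$, $T_{A,B}\xi:=(A+B)^{1/2}\xi$. There are unique positive contractions $R_{A,B},S_{A,B}$ on $\mathcal H_{A,B}$ with $R_{A,B}+S_{A,B}=I$, $A=T_{A,B}^*R_{A,B}T_{A,B}$, $B=T_{A,B}^*S_{A,B}T_{A,B}$; $E_{R_{A,B}}$ is the spectral measure of $R_{A,B}$. $\mathcal D(Q_{A,B}^{1/2}T_{A,B})=\{\xi\in\mathcal H:T_{A,B}\xi\in\mathcal D(Q_{A,B}^{1/2})\}$.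 (In $Q_{A,B}$ the integrand is taken to be $0$ at $t=1$.) The operator perspective $\phi_{t^2}(A,B)\in\widehat{B(\mathcal H)}_{\mathrm{lb}}$ is $\phi_{t^2}(A,B)(\rho):=\int_{[0,1]}\phi(r,1-r)\,d\rho(T_{A,B}^*E_{R_{A,B}}(r)T_{A,B})$, where $\phi(x,y)=x^2/y$ for $x\ge0,y>0$, $\phi(x,0)=\infty$ for $x>0$, $\phi(0,0)=0$. Parallel sum: $A:B:=\lim_{\varepsilon\searrow0}((A+\varepsilon I)^{-1}+(B+\varepsilon I)^{-1})^{-1}$ in the strong operator topology. $[B]A:=\lim_{n\to\infty}(A:nB)$ (an increasing strong limit), the $B$-absolutely continuous part of $A$. $X\in B(\mathcal H)_+$ is $B$-absolutely continuous if there is a sequence $X_n\in B(\mathcal H)_+$ with $X_n\nearrow X$ (increasing, strongly convergent to $X$) and $X_n\le\lambda_nB$ for some $\lambda_n\ge0$. "In general strictly weaker" in (3) means: $A\le\alpha B$ for some $\alpha>0$ implies $A^2\le\lambda B$ for some $\lambda>0$, and the converse fails for some $\mathcal H,A,B$. *)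

theory Defs
  imports "HOL-Analysis.Analysis"
begin

class complex_vector = real_vector +
  fixes scaleC :: "complex \<Rightarrow> 'a \<Rightarrow> 'a" (infixr \<open>*\<^sub>C\<close> 75)
  assumes scaleC_add_right: "c *\<^sub>C (x + y) = c *\<^sub>C x + c *\<^sub>C y"
    and scaleC_add_left: "(c + d) *\<^sub>C x = c *\<^sub>C x + d *\<^sub>C x"
    and scaleC_scaleC: "c *\<^sub>C d *\<^sub>C x = (c * d) *\<^sub>C x"
    and scaleC_of_real: "complex_of_real r *\<^sub>C x = r *\<^sub>R x"

text \<open>The inner product \<^term>\<open>cinner\<close> is linear in the first argument. Definiteness, and the
  fact that the norm is induced by \<^term>\<open>cinner\<close>, are inherited from \<^class>\<open>real_inner\<close>, because
  the real inner product is the real part of \<^term>\<open>cinner\<close>.\<close>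

class complex_hilbert = complex_vector + real_inner + complete_space +
  fixes cinner :: "'a \<Rightarrow> 'a \<Rightarrow> complex"
  assumes cinner_add_left: "cinner (x + y) z = cinner x z + cinner y z"
    and cinner_scaleC_left: "cinner (c *\<^sub>C x) y = c * cinner x y"
    and cinner_commute: "cinner x y = cnj (cinner y x)"
    and Re_cinner: "Re (cinner x y) = inner x y"

lemma cinner_add_right: "cinner x (y + z) = cinner x y + cinner (x::'a::complex_hilbert) z"
  by (metis cinner_add_left cinner_commute complex_cnj_add)

lemma cinner_scaleC_right: "cinner x (c *\<^sub>C y) = cnj c * cinner (x::'a::complex_hilbert) y"
  by (metis cinner_scaleC_left cinner_commute complex_cnj_mult)

lemma cinner_scaleR_left: "cinner (r *\<^sub>R x) y = complex_of_real r * cinner (x::'a::complex_hilbert) y"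
  by (metis cinner_scaleC_left scaleC_of_real)

lemma cinner_minus_left: "cinner (- x) y = - cinner (x::'a::complex_hilbert) y"
  using cinner_scaleR_left[of "-1" x y] by simp

lemma cinner_diff_left: "cinner (x - y) z = cinner x z - cinner (y::'a::complex_hilbert) z"
  using cinner_add_left[of x "- y" z] by (simp add: cinner_minus_left)

lemma cinner_zero_left [simp]: "cinner 0 (y::'a::complex_hilbert) = 0"
  using cinner_add_left[of 0 "0::'a" y] by simp

lemma Im_cinner: "Im (cinner x y) = inner (x::'a::complex_hilbert) (\<i> *\<^sub>C y)"
  by (simp add: Re_cinner[symmetric] cinner_scaleC_right)

lemma norm_scaleC: "norm (c *\<^sub>C x) = cmod c * norm (x::'a::complex_hilbert)"
proof -
  have "inner (c *\<^sub>C x) (c *\<^sub>C x) = Re ((c * cnj c) * cinner x x)"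
    by (simp add: Re_cinner[symmetric] cinner_scaleC_right cinner_scaleC_left mult.assoc
        mult.left_commute)
  also have "\<dots> = (cmod c)\<^sup>2 * inner x x"
    by (simp add: complex_norm_square[symmetric] Re_cinner flip: of_real_power)
  finally show ?thesis by (simp add: norm_eq_sqrt_inner real_sqrt_mult)
qed

lemma cmod_cinner_le: "cmod (cinner x y) \<le> norm x * norm (y::'a::complex_hilbert)"
proof (cases "cinner x y = 0")
  case False
  define c where "c = cnj (cinner x y) / cmod (cinner x y)"
  have "cmod c = 1" using False by (simp add: c_def norm_divide)
  have "cinner (c *\<^sub>C x) y = cnj (cinner x y) * cinner x y / cmod (cinner x y)"
    by (simp add: c_def cinner_scaleC_left)
  also have "cnj (cinner x y) * cinner x y = complex_of_real ((cmod (cinner x y))\<^sup>2)"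
    by (subst complex_norm_square) (rule mult.commute)
  finally have "cinner (c *\<^sub>C x) y = complex_of_real (cmod (cinner x y))"
    using False by (simp add: power2_eq_square)
  then have "cmod (cinner x y) = inner (c *\<^sub>C x) y"
    by (metis Re_cinner Re_complex_of_real)
  also have "\<dots> \<le> norm (c *\<^sub>C x) * norm y" by (rule norm_cauchy_schwarz)
  finally show ?thesis using \<open>cmod c = 1\<close> by (simp add: norm_scaleC)
qed simp

typedef (overloaded) 'a bop =
  "{f :: 'a::complex_hilbert \<Rightarrow> 'a. bounded_linear f \<and> (\<forall>c x. f (c *\<^sub>C x) = c *\<^sub>C f x)}"
  morphisms bop_apply Bop
  by (rule exI[of _ "\<lambda>x. x"]) (simp add: bounded_linear_ident)

setup_lifting type_definition_bop

notation bop_apply (infixr \<open>\<cdot>\<close> 76)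

lemma bop_eqI: "(\<And>x. A \<cdot> x = B \<cdot> x) \<Longrightarrow> A = B"
  by (simp add: bop_apply_inject[symmetric] fun_eq_iff)

lemma bounded_linear_bop: "bounded_linear (bop_apply A)"
  using bop_apply[of A] by blast

lemma bop_scaleC: "A \<cdot> (c *\<^sub>C x) = c *\<^sub>C (A \<cdot> x)"
  using bop_apply[of A] by blast

lemma scaleC_scaleR_commute:
  "c *\<^sub>C (r *\<^sub>R x) = r *\<^sub>R (c *\<^sub>C (x::'a::complex_vector))"
  by (metis scaleC_scaleC scaleC_of_real mult.commute)

lemma scaleC_zero_right: "c *\<^sub>C 0 = (0::'a::complex_vector)"
  using scaleC_add_right[of c 0 "0::'a"] by simp

lemma scaleC_minus_right: "c *\<^sub>C (- x) = - (c *\<^sub>C (x::'a::complex_vector))"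
  using scaleC_scaleR_commute[of c "-1" x] by simp

lemma scaleC_diff_right: "c *\<^sub>C (x - y) = c *\<^sub>C x - c *\<^sub>C (y::'a::complex_vector)"
  using scaleC_add_right[of c x "- y"] by (simp add: scaleC_minus_right)

lemma bounded_linear_scaleC: "bounded_linear (\<lambda>x::'a::complex_hilbert. c *\<^sub>C x)"
proof (rule bounded_linear_intro)
  show "norm (c *\<^sub>C x) \<le> norm x * cmod c" for x :: 'a
    by (simp add: norm_scaleC)
qed (rule scaleC_add_right scaleC_scaleR_commute)+

instantiation bop :: (complex_hilbert) real_normed_vector
begin

lift_definition norm_bop :: "'a bop \<Rightarrow> real" is onorm .
lift_definition zero_bop :: "'a bop" is "\<lambda>x. 0"
  by (simp add: scaleC_zero_right)
lift_definition plus_bop :: "'a bop \<Rightarrow> 'a bop \<Rightarrow> 'a bop" is "\<lambda>f g x. f x + g x"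
  by (simp add: bounded_linear_add scaleC_add_right)
lift_definition minus_bop :: "'a bop \<Rightarrow> 'a bop \<Rightarrow> 'a bop" is "\<lambda>f g x. f x - g x"
  by (simp add: bounded_linear_sub scaleC_diff_right)
lift_definition uminus_bop :: "'a bop \<Rightarrow> 'a bop" is "\<lambda>f x. - f x"
  by (simp add: bounded_linear_minus scaleC_minus_right)
lift_definition scaleR_bop :: "real \<Rightarrow> 'a bop \<Rightarrow> 'a bop" is "\<lambda>r f x. r *\<^sub>R f x"
  by (simp add: bounded_linear_const_scaleR scaleC_scaleR_commute)

definition dist_bop :: "'a bop \<Rightarrow> 'a bop \<Rightarrow> real" where
  "dist_bop A B = norm (A - B)"
definition sgn_bop :: "'a bop \<Rightarrow> 'a bop" where
  "sgn_bop A = inverse (norm A) *\<^sub>R A"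
definition uniformity_bop :: "('a bop \<times> 'a bop) filter" where
  "uniformity_bop = (INF e\<in>{0<..}. principal {(A, B). dist A B < e})"
definition open_bop :: "'a bop set \<Rightarrow> bool" where
  "open_bop U \<longleftrightarrow> (\<forall>A\<in>U. \<forall>\<^sub>F (A', B) in uniformity. A' = A \<longrightarrow> B \<in> U)"

instance
proof
  fix A B C :: "'a bop" and r s :: real
  show "A + B + C = A + (B + C)" "A + B = B + A" "0 + A = A" "- A + A = 0" "A - B = A + - B"
    by (transfer; simp add: fun_eq_iff algebra_simps)+
  show "r *\<^sub>R (A + B) = r *\<^sub>R A + r *\<^sub>R B" "(r + s) *\<^sub>R A = r *\<^sub>R A + s *\<^sub>R A"
    "r *\<^sub>R s *\<^sub>R A = (r * s) *\<^sub>R A" "1 *\<^sub>R A = A"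
    by (transfer; simp add: fun_eq_iff algebra_simps)+
  show "norm A = 0 \<longleftrightarrow> A = 0"
    by transfer (auto simp: onorm_eq_0)
  show "norm (A + B) \<le> norm A + norm B"
    by transfer (simp add: onorm_triangle)
  show "norm (r *\<^sub>R A) = \<bar>r\<bar> * norm A"
    by transfer (simp add: onorm_scaleR)
qed (simp_all add: dist_bop_def sgn_bop_def uniformity_bop_def open_bop_def)

end

instantiation bop :: (complex_hilbert) complex_vector
begin

lift_definition scaleC_bop :: "complex \<Rightarrow> 'a bop \<Rightarrow> 'a bop" is "\<lambda>c f x. c *\<^sub>C f x"
  by (simp add: bounded_linear_compose[OF bounded_linear_scaleC] scaleC_scaleC mult.commute)

instance
  by standard
    (transfer; simp add: fun_eq_iff scaleC_add_right scaleC_add_left scaleC_scaleC scaleC_of_real)+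

end

text \<open>Composition is the product of the algebra. The space may be zero-dimensional, so
  \<^class>\<open>ring_1\<close> is not available.\<close>

instantiation bop :: (complex_hilbert) "{ring, monoid_mult}"
begin

lift_definition times_bop :: "'a bop \<Rightarrow> 'a bop \<Rightarrow> 'a bop" is "\<lambda>f g x. f (g x)"
  by (simp add: bounded_linear_compose)
lift_definition one_bop :: "'a bop" is "\<lambda>x. x"
  by (simp add: bounded_linear_ident)

instance
proof
  fix A B C :: "'a bop"
  show "A * B * C = A * (B * C)" "1 * A = A" "A * 1 = A" "(A + B) * C = A * C + B * C"
    by (transfer; simp)+
  show "A * (B + C) = A * B + A * C"
    by transfer (simp add: linear_simps(1))
qed

end

lemma bop_quadratic_zero:
  fixes A :: "'a::complex_hilbert bop"
  assumes "\<And>x. cinner (A \<cdot> x) x = 0"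
  shows "A = 0"
proof (rule bop_eqI)
  fix x
  have add: "A \<cdot> (u + v) = A \<cdot> u + A \<cdot> v" for u v
    by (simp add: bounded_linear_bop linear_simps)
  have 1: "cinner (A \<cdot> x) y + cinner (A \<cdot> y) x = 0" for y
    using assms[of "x + y"] by (simp add: add cinner_add_left cinner_add_right assms add.commute)
  have "- \<i> * cinner (A \<cdot> x) y + \<i> * cinner (A \<cdot> y) x = 0" for y
    using 1[of "\<i> *\<^sub>C y"] by (simp add: bop_scaleC cinner_scaleC_left cinner_scaleC_right)
  then have 2: "cinner (A \<cdot> x) y = cinner (A \<cdot> y) x" for y
    by (metis (no_types, lifting) add.commute add_eq_0_iff complex_i_not_zero minus_minus
        mult_left_cancel mult_minus_left)
  have "cinner (A \<cdot> x) (A \<cdot> x) = 0"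
    using 1[of "A \<cdot> x"] 2[of "A \<cdot> x"] by simp
  then have "inner (A \<cdot> x) (A \<cdot> x) = 0"
    by (metis Re_cinner zero_complex.sel(1))
  then show "A \<cdot> x = 0 \<cdot> x" by (simp add: zero_bop.rep_eq)
qed

text \<open>The operator order; the operators \<open>A\<close> with \<open>0 \<le> A\<close> are the positive ones. On a complex
  space these are automatically self-adjoint.\<close>

instantiation bop :: (complex_hilbert) order
begin

definition less_eq_bop :: "'a bop \<Rightarrow> 'a bop \<Rightarrow> bool" where
  "A \<le> B \<longleftrightarrow> (\<forall>x. cinner ((B - A) \<cdot> x) x \<in> \<real>\<^sub>\<ge>\<^sub>0)"
definition less_bop :: "'a bop \<Rightarrow> 'a bop \<Rightarrow> bool" where
  "less_bop A B \<longleftrightarrow> A \<le> B \<and> \<not> B \<le> A"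

instance
proof
  fix A B C :: "'a bop"
  show "A < B \<longleftrightarrow> A \<le> B \<and> \<not> B \<le> A" by (rule less_bop_def)
  show "A \<le> A" by (simp add: less_eq_bop_def zero_bop.rep_eq)
  show "A \<le> C" if "A \<le> B" "B \<le> C"
    unfolding less_eq_bop_def
  proof
    fix x
    show "cinner ((C - A) \<cdot> x) x \<in> \<real>\<^sub>\<ge>\<^sub>0"
      using that[unfolded less_eq_bop_def, rule_format, of x]
      by (auto simp: minus_bop.rep_eq cinner_diff_left complex_nonneg_Reals_iff)
  qed
  show "A = B" if "A \<le> B" "B \<le> A"
  proof -
    have "cinner ((A - B) \<cdot> x) x = 0" for x
      using that[unfolded less_eq_bop_def, rule_format, of x]
      by (auto simp: minus_bop.rep_eq cinner_diff_left complex_nonneg_Reals_iff complex_eq_iff)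
    then have "A - B = 0" by (rule bop_quadratic_zero)
    then show ?thesis by simp
  qed
qed

end

definition adj :: "'a::complex_hilbert bop \<Rightarrow> 'a bop" where
  "adj A = (THE B. \<forall>x y. cinner (A \<cdot> x) y = cinner x (B \<cdot> y))"

definition ker :: "'a::complex_hilbert bop \<Rightarrow> 'a set" where
  "ker A = {x. A \<cdot> x = 0}"

definition op_inv :: "'a::complex_hilbert bop \<Rightarrow> 'a bop" where
  "op_inv A = (THE B. A * B = 1 \<and> B * A = 1)"

definition op_sqrt :: "'a::complex_hilbert bop \<Rightarrow> 'a bop" where
  "op_sqrt A = (THE S. 0 \<le> S \<and> S * S = A)"

definition sot_tendsto :: "('i \<Rightarrow> 'a::complex_hilbert bop) \<Rightarrow> 'a bop \<Rightarrow> 'i filter \<Rightarrow> bool" where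
  "sot_tendsto X L F \<longleftrightarrow> (\<forall>x. ((\<lambda>i. X i \<cdot> x) \<longlongrightarrow> L \<cdot> x) F)"

definition sot_lim :: "('i \<Rightarrow> 'a::complex_hilbert bop) \<Rightarrow> 'i filter \<Rightarrow> 'a bop" where
  "sot_lim X F = (THE L. sot_tendsto X L F)"

definition par_sum :: "'a::complex_hilbert bop \<Rightarrow> 'a bop \<Rightarrow> 'a bop" where
  "par_sum A B =
     sot_lim (\<lambda>\<epsilon>::real. op_inv (op_inv (A + \<epsilon> *\<^sub>R 1) + op_inv (B + \<epsilon> *\<^sub>R 1))) (at_right 0)"

definition ac_part :: "'a::complex_hilbert bop \<Rightarrow> 'a bop \<Rightarrow> 'a bop" where
  "ac_part B A = sot_lim (\<lambda>n::nat. par_sum A (real n *\<^sub>R B)) sequentially"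

text \<open>\<open>abs_cont B A\<close>: the operator \<open>A\<close> is \<open>B\<close>-absolutely continuous.\<close>

definition abs_cont :: "'a::complex_hilbert bop \<Rightarrow> 'a bop \<Rightarrow> bool" where
  "abs_cont B A \<longleftrightarrow>
     (\<exists>X :: nat \<Rightarrow> 'a bop. (\<forall>n. 0 \<le> X n) \<and> incseq X \<and> sot_tendsto X A sequentially \<and>
        (\<forall>n. \<exists>l\<ge>0. X n \<le> l *\<^sub>R B))"

text \<open>Normality: suprema of increasing bounded nets (upward directed sets with a least upper bound)
  of positive operators are preserved.\<close>

definition normal_pos :: "('a::complex_hilbert bop \<Rightarrow>\<^sub>L complex) set" where
  "normal_pos = {\<rho>. (\<forall>c X. blinfun_apply \<rho> (c *\<^sub>C X) = c * blinfun_apply \<rho> X) \<and> (\<forall>X\<ge>0. blinfun_apply \<rho> X \<in> \<real>\<^sub>\<ge>\<^sub>0) \<and>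
     (\<forall>D X. D \<noteq> {} \<and> (\<forall>Y\<in>D. 0 \<le> Y) \<and> (\<forall>Y\<in>D. \<forall>Z\<in>D. \<exists>W\<in>D. Y \<le> W \<and> Z \<le> W) \<and>
        (\<forall>Y\<in>D. Y \<le> X) \<and> (\<forall>Z. (\<forall>Y\<in>D. Y \<le> Z) \<longrightarrow> X \<le> Z) \<longrightarrow>
        Re (blinfun_apply \<rho> X) = (SUP Y\<in>D. Re (blinfun_apply \<rho> Y)))}"

lift_definition vec_fun :: "'a::complex_hilbert \<Rightarrow> 'a bop \<Rightarrow>\<^sub>L complex" (\<open>\<omega>\<close>)
  is "\<lambda>\<xi> X. cinner (X \<cdot> \<xi>) \<xi>"
proof (rule bounded_linear_intro)
  fix \<xi> :: 'a and X Y :: "'a bop" and r :: real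
  show "cinner ((X + Y) \<cdot> \<xi>) \<xi> = cinner (X \<cdot> \<xi>) \<xi> + cinner (Y \<cdot> \<xi>) \<xi>"
    by (simp add: plus_bop.rep_eq cinner_add_left)
  show "cinner ((r *\<^sub>R X) \<cdot> \<xi>) \<xi> = r *\<^sub>R cinner (X \<cdot> \<xi>) \<xi>"
    by (simp add: scaleR_bop.rep_eq cinner_scaleR_left scaleR_conv_of_real)
  have "cmod (cinner (X \<cdot> \<xi>) \<xi>) \<le> norm (X \<cdot> \<xi>) * norm \<xi>"
    by (rule cmod_cinner_le)
  also have "\<dots> \<le> (norm X * norm \<xi>) * norm \<xi>"
    by (intro mult_right_mono) (simp_all add: norm_bop.rep_eq onorm[OF bounded_linear_bop])
  finally show "cmod (cinner (X \<cdot> \<xi>) \<xi>) \<le> norm X * (norm \<xi> * norm \<xi>)"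
    by (simp add: mult.assoc)
qed

definition essential_part :: "(('a::complex_hilbert bop \<Rightarrow>\<^sub>L complex) \<Rightarrow> ereal) \<Rightarrow> 'a set" where
  "essential_part T = closure {\<xi>. T (\<omega> \<xi>) < \<infinity>}"

definition dense_domain :: "(('a::complex_hilbert bop \<Rightarrow>\<^sub>L complex) \<Rightarrow> ereal) \<Rightarrow> bool" where
  "dense_domain T \<longleftrightarrow> essential_part T = UNIV"

text \<open>For self-adjoint \<open>X\<close> and positive \<open>\<rho>\<close> the number \<open>\<rho> X\<close> is real.\<close>

definition represents_form ::
    "'a::complex_hilbert bop \<Rightarrow> (('a bop \<Rightarrow>\<^sub>L complex) \<Rightarrow> ereal) \<Rightarrow> bool" where
  "represents_form X T \<longleftrightarrow> adj X = X \<and> (\<forall>\<rho>\<in>normal_pos. T \<rho> = ereal (Re (blinfun_apply \<rho> X)))"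

definition bounded_form :: "(('a::complex_hilbert bop \<Rightarrow>\<^sub>L complex) \<Rightarrow> ereal) \<Rightarrow> bool" where
  "bounded_form T \<longleftrightarrow> (\<exists>X. represents_form X T)"

definition form_norm :: "(('a::complex_hilbert bop \<Rightarrow>\<^sub>L complex) \<Rightarrow> ereal) \<Rightarrow> real" where
  "form_norm T = norm (THE X. represents_form X T)"

text \<open>A bounded operator on a closed subspace \<open>K\<close> is represented by its extension by \<open>0\<close> on the
  orthogonal complement of \<open>K\<close>. In particular the identity of \<open>K\<close> is \<open>proj K\<close>.\<close>

definition proj :: "'a::complex_hilbert set \<Rightarrow> 'a bop" where
  "proj K = (THE P. adj P = P \<and> P * P = P \<and> range (bop_apply P) = K)"

definition op_on :: "'a::complex_hilbert set \<Rightarrow> 'a bop \<Rightarrow> bool" where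
  "op_on K X \<longleftrightarrow> proj K * X * proj K = X"

text \<open>A possibly unbounded operator in \<open>K\<close> is represented by its graph, a subset of \<open>K \<times> K\<close>. The
  equation \<open>adj_graph K G = G\<close> together with density of the domain forces \<open>G\<close> to be linear and
  single-valued; the square of \<open>G\<close> (on its natural domain) is \<open>G O G\<close>.\<close>

definition adj_graph :: "'a::complex_hilbert set \<Rightarrow> ('a \<times> 'a) set \<Rightarrow> ('a \<times> 'a) set" where
  "adj_graph K G = {(x, y). x \<in> K \<and> y \<in> K \<and> (\<forall>(u, v)\<in>G. cinner v x = cinner u y)}"

definition pos_selfadj_on :: "'a::complex_hilbert set \<Rightarrow> ('a \<times> 'a) set \<Rightarrow> bool" where
  "pos_selfadj_on K G \<longleftrightarrow>
     closure (Domain G) = K \<and> adj_graph K G = G \<and> (\<forall>(u, v)\<in>G. cinner v u \<in> \<real>\<^sub>\<ge>\<^sub>0)"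

definition graph_sqrt :: "'a::complex_hilbert set \<Rightarrow> ('a \<times> 'a) set \<Rightarrow> ('a \<times> 'a) set" where
  "graph_sqrt K G = (THE S. pos_selfadj_on K S \<and> S O S = G)"

text \<open>Projection-valued Borel measures on the line with values in the operators on \<open>K\<close>; the value
  on non-Borel sets is fixed to be \<open>0\<close>.\<close>

definition pvm_on :: "'a::complex_hilbert set \<Rightarrow> (real set \<Rightarrow> 'a bop) \<Rightarrow> bool" where
  "pvm_on K E \<longleftrightarrow>
     (\<forall>\<Delta>\<in>sets borel. op_on K (E \<Delta>) \<and> adj (E \<Delta>) = E \<Delta> \<and> E \<Delta> * E \<Delta> = E \<Delta>) \<and>
     (\<forall>\<Delta>. \<Delta> \<notin> sets borel \<longrightarrow> E \<Delta> = 0) \<and>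
     E {} = 0 \<and> E UNIV = proj K \<and>
     (\<forall>\<Delta>\<in>sets borel. \<forall>\<Delta>'\<in>sets borel. E (\<Delta> \<inter> \<Delta>') = E \<Delta> * E \<Delta>') \<and>
     (\<forall>F :: nat \<Rightarrow> real set. range F \<subseteq> sets borel \<and> disjoint_family F \<longrightarrow>
        (\<forall>x. (\<lambda>n. E (F n) \<cdot> x) sums (E (\<Union>n. F n) \<cdot> x)))"

definition vec_measure :: "(real set \<Rightarrow> 'a::complex_hilbert bop) \<Rightarrow> 'a \<Rightarrow> real measure" where
  "vec_measure E \<xi> = measure_of UNIV (sets borel) (\<lambda>\<Delta>. ennreal (Re (cinner (E \<Delta> \<cdot> \<xi>) \<xi>)))"

text \<open>The domain of \<open>\<integral> f dE\<close> consists of the \<open>\<xi>\<close> for which \<open>f\<close> is square integrable with respect to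
  \<open>\<langle>E(\<cdot>)\<xi>,\<xi>\<rangle>\<close>, and there \<open>\<langle>(\<integral> f dE)\<xi>,\<zeta>\<rangle> = \<integral> f d\<langle>E(\<cdot>)\<xi>,\<zeta>\<rangle>\<close> for \<open>\<zeta>\<close> in the same (dense) domain; the
  complex measure \<open>\<langle>E(\<cdot>)\<xi>,\<zeta>\<rangle>\<close> is resolved into positive ones by polarization.\<close>

definition spectral_domain ::
    "'a::complex_hilbert set \<Rightarrow> (real set \<Rightarrow> 'a bop) \<Rightarrow> (real \<Rightarrow> real) \<Rightarrow> 'a set" where
  "spectral_domain K E f = {\<xi>\<in>K. (\<integral>\<^sup>+ t. ennreal ((f t)\<^sup>2) \<partial>vec_measure E \<xi>) < \<infinity>}"

definition spectral_integral ::
    "'a::complex_hilbert set \<Rightarrow> (real set \<Rightarrow> 'a bop) \<Rightarrow> (real \<Rightarrow> real) \<Rightarrow> ('a \<times> 'a) set" where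
  "spectral_integral K E f = {(\<xi>, \<eta>). \<xi> \<in> spectral_domain K E f \<and> \<eta> \<in> K \<and>
     (\<forall>\<zeta>\<in>spectral_domain K E f. cinner \<eta> \<zeta> =
        (\<Sum>k<4. \<i> ^ k * complex_of_real (\<integral>t. f t \<partial>vec_measure E (\<xi> + \<i> ^ k *\<^sub>C \<zeta>))) / 4)}"

definition spectral_measure :: "'a::complex_hilbert set \<Rightarrow> 'a bop \<Rightarrow> real set \<Rightarrow> 'a bop" where
  "spectral_measure K R =
     (THE E. pvm_on K E \<and> spectral_integral K E (\<lambda>t. t) = {(x, R \<cdot> x) |x. x \<in> K})"

definition H_AB :: "'a::complex_hilbert bop \<Rightarrow> 'a bop \<Rightarrow> 'a set" where
  "H_AB A B = closure (range (bop_apply (A + B)))"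

text \<open>As an operator from \<open>\<H>\<close> to \<open>H_AB A B\<close> this has the same adjoint, restricted to \<open>H_AB A B\<close>; the
  adjoint is only ever applied to vectors of \<open>H_AB A B\<close>.\<close>

definition T_AB :: "'a::complex_hilbert bop \<Rightarrow> 'a bop \<Rightarrow> 'a bop" where
  "T_AB A B = op_sqrt (A + B)"

definition pos_contraction_on :: "'a::complex_hilbert set \<Rightarrow> 'a bop \<Rightarrow> bool" where
  "pos_contraction_on K X \<longleftrightarrow> op_on K X \<and> 0 \<le> X \<and> norm X \<le> 1"

definition R_AB :: "'a::complex_hilbert bop \<Rightarrow> 'a bop \<Rightarrow> 'a bop" where
  "R_AB A B = (THE R. \<exists>S.
     pos_contraction_on (H_AB A B) R \<and> pos_contraction_on (H_AB A B) S \<and>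
     R + S = proj (H_AB A B) \<and>
     A = adj (T_AB A B) * R * T_AB A B \<and> B = adj (T_AB A B) * S * T_AB A B)"

definition E_AB :: "'a::complex_hilbert bop \<Rightarrow> 'a bop \<Rightarrow> real set \<Rightarrow> 'a bop" where
  "E_AB A B = spectral_measure (H_AB A B) (R_AB A B)"

text \<open>The measure integrated against is \<open>\<Delta> \<mapsto> \<rho>(T* E(\<Delta>) T)\<close>, which is a nonnegative measure for
  \<open>\<rho> \<in> normal_pos\<close>; forms are only evaluated on that cone.\<close>

definition perspective :: "(real \<Rightarrow> real \<Rightarrow> ennreal) \<Rightarrow>
    'a::complex_hilbert bop \<Rightarrow> 'a bop \<Rightarrow> ('a bop \<Rightarrow>\<^sub>L complex) \<Rightarrow> ereal" where
  "perspective \<phi> A B \<rho> = enn2ereal (\<integral>\<^sup>+ r\<in>{0..1}. \<phi> r (1 - r) \<partial>measure_of UNIV (sets borel)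
     (\<lambda>\<Delta>. ennreal (Re (blinfun_apply \<rho> (adj (T_AB A B) * E_AB A B \<Delta> * T_AB A B)))))"

text \<open>The perspective \<open>x\<^sup>2 / y\<close> of \<open>t\<^sup>2\<close>, extended to \<open>y = 0\<close>; used for \<open>x, y \<ge> 0\<close> only.\<close>

definition phi_sq :: "real \<Rightarrow> real \<Rightarrow> ennreal" where
  "phi_sq x y = (if y > 0 then ennreal (x\<^sup>2 / y) else if x > 0 then \<infinity> else 0)"

definition perspective_sq ::
    "'a::complex_hilbert bop \<Rightarrow> 'a bop \<Rightarrow> ('a bop \<Rightarrow>\<^sub>L complex) \<Rightarrow> ereal" where
  "perspective_sq = perspective phi_sq"

definition Q_AB :: "'a::complex_hilbert bop \<Rightarrow> 'a bop \<Rightarrow> ('a \<times> 'a) set" where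
  "Q_AB A B = spectral_integral (H_AB A B) (E_AB A B)
     (\<lambda>t. if t \<in> {0..<1} then t\<^sup>2 / (1 - t) else 0)"

definition dom_sqrtQ_T :: "'a::complex_hilbert bop \<Rightarrow> 'a bop \<Rightarrow> 'a set" where
  "dom_sqrtQ_T A B = {\<xi>. T_AB A B \<cdot> \<xi> \<in> Domain (graph_sqrt (H_AB A B) (Q_AB A B))}"

text \<open>HOL has no quantification over types, so a claim that something happens on some Hilbert space
  has to name the space; \<open>ell2\<close> is the concrete infinite-dimensional one used for this.\<close>

typedef ell2 = "{f :: nat \<Rightarrow> complex. summable (\<lambda>n. (cmod (f n))\<^sup>2)}"
  morphisms ell2_nth Ell2
  by (rule exI[of _ "\<lambda>n. 0"]) simp

setup_lifting type_definition_ell2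

lemma ell2_summable_mult:
  assumes "summable (\<lambda>n. (cmod (f n))\<^sup>2)" "summable (\<lambda>n. (cmod (g n))\<^sup>2)"
  shows "summable (\<lambda>n. f n * cnj (g n))"
proof (rule summable_comparison_test')
  show "summable (\<lambda>n. (cmod (f n))\<^sup>2 + (cmod (g n))\<^sup>2)" using assms by (rule summable_add)
  show "cmod (f n * cnj (g n)) \<le> (cmod (f n))\<^sup>2 + (cmod (g n))\<^sup>2" for n
  proof -
    have "0 \<le> cmod (f n) * cmod (g n)" by simp
    then have "cmod (f n) * cmod (g n) \<le> (cmod (f n))\<^sup>2 + (cmod (g n))\<^sup>2"
      using sum_squares_bound[of "cmod (f n)" "cmod (g n)"] by linarith
    then show ?thesis by (simp add: norm_mult)
  qed
qed

lemma ell2_summable_add: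
  assumes "summable (\<lambda>n. (cmod (f n))\<^sup>2)" "summable (\<lambda>n. (cmod (g n))\<^sup>2)"
  shows "summable (\<lambda>n. (cmod (f n + g n))\<^sup>2)"
proof (rule summable_comparison_test')
  show "summable (\<lambda>n. 2 * (cmod (f n))\<^sup>2 + 2 * (cmod (g n))\<^sup>2)"
    using assms by (intro summable_add summable_mult)
  show "norm ((cmod (f n + g n))\<^sup>2) \<le> 2 * (cmod (f n))\<^sup>2 + 2 * (cmod (g n))\<^sup>2" for n
  proof -
    have "(cmod (f n + g n))\<^sup>2 \<le> (cmod (f n) + cmod (g n))\<^sup>2"
      by (simp add: norm_triangle_ineq power_mono)
    also have "\<dots> \<le> 2 * (cmod (f n))\<^sup>2 + 2 * (cmod (g n))\<^sup>2"
      using sum_squares_bound[of "cmod (f n)" "cmod (g n)"] by (simp add: power2_sum)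
    finally show ?thesis by simp
  qed
qed

lemma ell2_summable_scale:
  "summable (\<lambda>n. (cmod (f n))\<^sup>2) \<Longrightarrow> summable (\<lambda>n. (cmod (c * f n))\<^sup>2)"
  by (simp add: norm_mult power_mult_distrib summable_mult)

lemma summable_ell2_nth: "summable (\<lambda>n. (cmod (ell2_nth x n))\<^sup>2)"
  using ell2_nth[of x] by simp

lemma summable_Re: "summable f \<Longrightarrow> summable (\<lambda>n. Re (f n))"
  using bounded_linear.summable[OF bounded_linear_Re] .

instantiation ell2 :: real_inner
begin

lift_definition zero_ell2 :: ell2 is "\<lambda>n. 0" by simp
lift_definition plus_ell2 :: "ell2 \<Rightarrow> ell2 \<Rightarrow> ell2" is "\<lambda>f g n. f n + g n"
  by (rule ell2_summable_add)
lift_definition uminus_ell2 :: "ell2 \<Rightarrow> ell2" is "\<lambda>f n. - f n" by simp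
lift_definition scaleR_ell2 :: "real \<Rightarrow> ell2 \<Rightarrow> ell2" is "\<lambda>r f n. complex_of_real r * f n"
  by (rule ell2_summable_scale)
lift_definition inner_ell2 :: "ell2 \<Rightarrow> ell2 \<Rightarrow> real" is "\<lambda>f g. \<Sum>n. Re (f n * cnj (g n))" .

definition minus_ell2 :: "ell2 \<Rightarrow> ell2 \<Rightarrow> ell2" where
  "minus_ell2 x y = x + - y"
definition norm_ell2 :: "ell2 \<Rightarrow> real" where
  "norm_ell2 x = sqrt (inner x x)"
definition dist_ell2 :: "ell2 \<Rightarrow> ell2 \<Rightarrow> real" where
  "dist_ell2 x y = norm (x - y)"
definition sgn_ell2 :: "ell2 \<Rightarrow> ell2" where
  "sgn_ell2 x = inverse (norm x) *\<^sub>R x"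
definition uniformity_ell2 :: "(ell2 \<times> ell2) filter" where
  "uniformity_ell2 = (INF e\<in>{0<..}. principal {(x, y). dist x y < e})"
definition open_ell2 :: "ell2 set \<Rightarrow> bool" where
  "open_ell2 U \<longleftrightarrow> (\<forall>x\<in>U. \<forall>\<^sub>F (x', y) in uniformity. x' = x \<longrightarrow> y \<in> U)"

instance
proof
  fix x y z :: ell2 and r s :: real
  show "x + y + z = x + (y + z)" "x + y = y + x" "0 + x = x" "- x + x = 0"
    by (transfer; simp add: fun_eq_iff algebra_simps)+
  show "r *\<^sub>R (x + y) = r *\<^sub>R x + r *\<^sub>R y" "(r + s) *\<^sub>R x = r *\<^sub>R x + s *\<^sub>R x"
    "r *\<^sub>R s *\<^sub>R x = (r * s) *\<^sub>R x" "1 *\<^sub>R x = x"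
    by (transfer; simp add: fun_eq_iff algebra_simps)+
  show "inner x y = inner y x"
    by transfer (simp add: mult.commute)
  show "inner (x + y) z = inner x z + inner y z"
  proof transfer
    fix f g h :: "nat \<Rightarrow> complex"
    assume *: "summable (\<lambda>n. (cmod (f n))\<^sup>2)" "summable (\<lambda>n. (cmod (g n))\<^sup>2)"
      "summable (\<lambda>n. (cmod (h n))\<^sup>2)"
    show "(\<Sum>n. Re ((f n + g n) * cnj (h n))) = (\<Sum>n. Re (f n * cnj (h n))) + (\<Sum>n. Re (g n * cnj (h n)))"
      by (simp only: distrib_right plus_complex.sel
          suminf_add[OF summable_Re[OF ell2_summable_mult[OF *(1,3)]]
            summable_Re[OF ell2_summable_mult[OF *(2,3)]]])
  qed
  show "inner (r *\<^sub>R x) y = r * inner x y"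
  proof transfer
    fix f g :: "nat \<Rightarrow> complex" and r :: real
    assume *: "summable (\<lambda>n. (cmod (f n))\<^sup>2)" "summable (\<lambda>n. (cmod (g n))\<^sup>2)"
    have "Re (complex_of_real r * f n * cnj (g n)) = r * Re (f n * cnj (g n))" for n
      by (simp add: algebra_simps)
    then show "(\<Sum>n. Re (complex_of_real r * f n * cnj (g n))) = r * (\<Sum>n. Re (f n * cnj (g n)))"
      by (simp only: suminf_mult[OF summable_Re[OF ell2_summable_mult[OF *]]])
  qed
  have sq: "Re (c * cnj c) = (cmod c)\<^sup>2" for c
    by (simp add: complex_norm_square[symmetric] flip: of_real_power)
  show "0 \<le> inner x x"
    by transfer (simp only: sq, simp add: suminf_nonneg)
  show "inner x x = 0 \<longleftrightarrow> x = 0"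
    by transfer (simp only: sq, simp add: suminf_eq_zero_iff fun_eq_iff)
qed (simp_all add: minus_ell2_def norm_ell2_def dist_ell2_def sgn_ell2_def uniformity_ell2_def
    open_ell2_def)

end

lemma ell2_nth_diff: "ell2_nth (x - y) n = ell2_nth x n - ell2_nth y n"
  unfolding minus_ell2_def by (simp only: plus_ell2.rep_eq uminus_ell2.rep_eq diff_conv_add_uminus)

lemma norm_ell2_sq: "(norm (x::ell2))\<^sup>2 = (\<Sum>n. (cmod (ell2_nth x n))\<^sup>2)"
proof -
  have "Re (c * cnj c) = (cmod c)\<^sup>2" for c
    by (simp add: complex_norm_square[symmetric] flip: of_real_power)
  then show ?thesis
    unfolding norm_eq_sqrt_inner using inner_ge_zero[of x]
    by (simp only: inner_ell2.rep_eq real_sqrt_pow2)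
qed

lemma ell2_partial_sum_le:
  "(\<Sum>i<k. (cmod (ell2_nth x i))\<^sup>2) \<le> (norm x)\<^sup>2"
  unfolding norm_ell2_sq by (rule sum_le_suminf) (simp_all add: summable_ell2_nth)

lemma ell2_nth_le: "cmod (ell2_nth x i) \<le> norm x"
proof -
  have "(cmod (ell2_nth x i))\<^sup>2 \<le> (\<Sum>j<Suc i. (cmod (ell2_nth x j))\<^sup>2)"
    by (simp add: sum_nonneg)
  also have "\<dots> \<le> (norm x)\<^sup>2" by (rule ell2_partial_sum_le)
  finally show ?thesis by (rule power2_le_imp_le) simp
qed

instance ell2 :: complete_space
proof
  fix X :: "nat \<Rightarrow> ell2"
  assume X: "Cauchy X"
  have "Cauchy (\<lambda>m. ell2_nth (X m) i)" for i
  proof (rule metric_CauchyI)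
    fix e :: real assume "e > 0"
    then obtain M where "\<forall>m\<ge>M. \<forall>n\<ge>M. dist (X m) (X n) < e"
      using metric_CauchyD[OF X] by blast
    moreover have "dist (ell2_nth (X m) i) (ell2_nth (X n) i) \<le> dist (X m) (X n)" for m n
      using ell2_nth_le[of "X m - X n" i] by (simp add: dist_norm ell2_nth_diff)
    ultimately show "\<exists>M. \<forall>m\<ge>M. \<forall>n\<ge>M. dist (ell2_nth (X m) i) (ell2_nth (X n) i) < e"
      by (meson le_less_trans)
  qed
  then have "\<exists>l. (\<lambda>m. ell2_nth (X m) i) \<longlonglongrightarrow> l" for i
    using Cauchy_convergent convergent_def by blast
  then obtain g where g: "\<And>i. (\<lambda>m. ell2_nth (X m) i) \<longlonglongrightarrow> g i" by metis
  have bd: "\<exists>M. \<forall>m\<ge>M. \<forall>k. (\<Sum>i<k. (cmod (ell2_nth (X m) i - g i))\<^sup>2) \<le> e\<^sup>2" if "e > 0" for e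
  proof -
    obtain M where M: "\<forall>m\<ge>M. \<forall>n\<ge>M. dist (X m) (X n) < e"
      using metric_CauchyD[OF X \<open>e > 0\<close>] by blast
    have "(\<Sum>i<k. (cmod (ell2_nth (X m) i - g i))\<^sup>2) \<le> e\<^sup>2" if "m \<ge> M" for m k
    proof (rule LIMSEQ_le_const2)
      show "(\<lambda>n. \<Sum>i<k. (cmod (ell2_nth (X m) i - ell2_nth (X n) i))\<^sup>2)
          \<longlonglongrightarrow> (\<Sum>i<k. (cmod (ell2_nth (X m) i - g i))\<^sup>2)"
        by (intro tendsto_intros g)
      have "(\<Sum>i<k. (cmod (ell2_nth (X m) i - ell2_nth (X n) i))\<^sup>2) \<le> e\<^sup>2" if "n \<ge> M" for n
      proof -
        have "(\<Sum>i<k. (cmod (ell2_nth (X m) i - ell2_nth (X n) i))\<^sup>2) \<le> (norm (X m - X n))\<^sup>2"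
          using ell2_partial_sum_le[of "X m - X n" k] by (simp add: ell2_nth_diff)
        also have "\<dots> \<le> e\<^sup>2"
          using M \<open>m \<ge> M\<close> \<open>n \<ge> M\<close> by (intro power_mono) (auto simp: dist_norm less_imp_le)
        finally show ?thesis .
      qed
      then show "\<exists>N. \<forall>n\<ge>N. (\<Sum>i<k. (cmod (ell2_nth (X m) i - ell2_nth (X n) i))\<^sup>2) \<le> e\<^sup>2"
        by blast
    qed
    then show ?thesis by blast
  qed
  have sm: "summable (\<lambda>i. (cmod (h i))\<^sup>2)" if "\<And>k. (\<Sum>i<k. (cmod (h i))\<^sup>2) \<le> b" for h b
    by (rule summableI_nonneg_bounded[where x = b]) (use that in auto)
  obtain M where "\<And>k. (\<Sum>i<k. (cmod (ell2_nth (X M) i - g i))\<^sup>2) \<le> 1"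
    using bd[of 1] by auto
  then have "summable (\<lambda>i. (cmod (g i - ell2_nth (X M) i))\<^sup>2)"
    using sm[of "\<lambda>i. ell2_nth (X M) i - g i" 1] by (simp add: norm_minus_commute)
  from ell2_summable_add[OF this summable_ell2_nth[of "X M"]]
  have sg: "summable (\<lambda>i. (cmod (g i))\<^sup>2)" by simp
  define G where "G = Ell2 g"
  have nth_G: "ell2_nth G i = g i" for i
    unfolding G_def using sg by (subst Ell2_inverse) auto
  have "X \<longlonglongrightarrow> G"
  proof (rule metric_LIMSEQ_I)
    fix e :: real assume e: "e > 0"
    then obtain M where M: "\<And>m k. m \<ge> M \<Longrightarrow> (\<Sum>i<k. (cmod (ell2_nth (X m) i - g i))\<^sup>2) \<le> (e/2)\<^sup>2"
      using bd[of "e/2"] by auto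
    have "dist (X m) G < e" if "m \<ge> M" for m
    proof -
      have "(norm (X m - G))\<^sup>2 \<le> (e/2)\<^sup>2"
        unfolding norm_ell2_sq
        by (rule suminf_le_const[OF summable_ell2_nth])
          (use M[OF that] in \<open>simp add: ell2_nth_diff nth_G\<close>)
      then have "norm (X m - G) \<le> e/2" by (rule power2_le_imp_le) (use e in simp)
      then show ?thesis using e by (simp add: dist_norm)
    qed
    then show "\<exists>M. \<forall>m\<ge>M. dist (X m) G < e" by blast
  qed
  then show "convergent X" by (auto simp: convergent_def)
qed

instantiation ell2 :: complex_hilbert
begin

lift_definition scaleC_ell2 :: "complex \<Rightarrow> ell2 \<Rightarrow> ell2" is "\<lambda>c f n. c * f n"
  by (rule ell2_summable_scale)
lift_definition cinner_ell2 :: "ell2 \<Rightarrow> ell2 \<Rightarrow> complex" is "\<lambda>f g. \<Sum>n. f n * cnj (g n)" .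

instance
proof
  fix x y z :: ell2 and c d :: complex and r :: real
  show "c *\<^sub>C (x + y) = c *\<^sub>C x + c *\<^sub>C y" "(c + d) *\<^sub>C x = c *\<^sub>C x + d *\<^sub>C x"
    "c *\<^sub>C d *\<^sub>C x = (c * d) *\<^sub>C x" "complex_of_real r *\<^sub>C x = r *\<^sub>R x"
    by (transfer; simp add: fun_eq_iff algebra_simps)+
  show "cinner (x + y) z = cinner x z + cinner y z"
    by transfer (simp add: distrib_right suminf_add[OF ell2_summable_mult ell2_summable_mult])
  show "cinner (c *\<^sub>C x) y = c * cinner x y"
    by transfer (simp add: mult.assoc suminf_mult[OF ell2_summable_mult])
  show "cinner x y = cnj (cinner y x)"
    by transfer
      (simp add: bounded_linear.suminf[OF bounded_linear_cnj ell2_summable_mult] mult.commute)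
  show "Re (cinner x y) = inner x y"
    by transfer (rule bounded_linear.suminf[OF bounded_linear_Re ell2_summable_mult])
qed

end

end

theory Submission
  imports Defs
begin

text \<open>Write \<open>T = (A+B)\<^sup>1\<^sup>/\<^sup>2\<close>, \<open>A = T R T\<close>, \<open>B = T (1-R) T\<close>, and let \<open>E\<close> be the spectral measure of \<open>R\<close>.

  On the vector functional of \<open>\<xi>\<close> the perspective is the integral of \<open>t\<^sup>2/(1-t)\<close> against
  \<open>\<langle>E(\<cdot>) T\<xi>, T\<xi>\<rangle>\<close>, so it is finite iff \<open>E{1} T\<xi> = 0\<close> and \<open>T\<xi>\<close> lies in the domain of the square root of
  \<open>Q\<close>. The form of \<open>A : nB\<close> at \<open>x\<close> is the infimum over \<open>y\<close> of \<open>\<langle>A(x-y),x-y\<rangle> + n\<langle>By,y\<rangle>\<close>; choosing \<open>T y\<close>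
  near \<open>E{1} T x\<close>, and bounding \<open>1-R\<close> from below away from the spectral point \<open>1\<close>, one gets
  \<open>A - [B]A = T E{1} T\<close>. This gives the first two parts.

  For the third, the perspective is represented by the increasing limit of \<open>T G\<^sub>m\<^sup>2 T\<close>, where \<open>G\<^sub>m\<close> is
  \<open>R (1-R)\<^sup>-\<^sup>1\<^sup>/\<^sup>2\<close> cut off near \<open>1\<close>. Its norm is the supremum of \<open>\<parallel>G\<^sub>m T\<parallel>\<^sup>2 = \<parallel>T G\<^sub>m\<parallel>\<^sup>2\<close>, and
  \<open>\<parallel>T G\<^sub>m\<parallel>\<^sup>2 \<le> \<lambda>\<close> for all \<open>m\<close> says that \<open>\<parallel>T R u\<parallel>\<^sup>2 \<le> \<lambda>\<langle>(1-R)u,u\<rangle>\<close>, which is \<open>A\<^sup>2 \<le> \<lambda> B\<close>.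

  The spectral theorem is obtained from square roots alone: the spectral projection of \<open>R\<close> for
  \<open>(-\<infinity>, t]\<close> is the projection onto the kernel of \<open>|R-t| + (R-t)\<close>.\<close>
section \<open>Projections onto closed subspaces\<close>

text \<open>Most objects of the statement are definite descriptions: adjoints, inverses, square
  roots, projections, strong limits, \<open>R_AB\<close>, spectral measures, square roots of graphs.
  Nothing is known about them until existence and uniqueness are both settled, and that fills most
  of the text. Uniqueness of the spectral measure requires that every candidate commutes with
  \<open>R\<close>, which the definition does not say; uniqueness of an unbounded square root
  requires a passage to bounded operators. The second obstacle is the singularity at the spectral
  point 1. It is always approached by increasing cut-offs, because increasing limits pass through
  quadratic forms, nonnegative integrals and normal functionals alike. For the third part,
  \<open>T\<close> need not commute with \<open>R\<close>: the perspective controls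
  \<open>G T\<close>, whereas \<open>A^2\<close> involves \<open>T G\<close>, and only taking
  adjoints links the two. Moreover the representation has to hold on all normal functionals, while
  its norm can be read off the vector functionals.\<close>

lemma closed_subspace_projection:
  fixes K :: "'h::{real_inner, complete_space} set"
  assumes K: "subspace K" "closed K"
  shows "\<exists>p\<in>K. \<forall>k\<in>K. inner (x - p) k = 0"
proof -
  have ne: "K \<noteq> {}" using subspace_0[OF K(1)] by blast
  define d where "d = infdist x K"
  have dle: "d \<le> norm (x - k)" if "k \<in> K" for k
    unfolding d_def using infdist_le[OF that, of x] by (simp add: dist_norm)
  have d0: "0 \<le> d" by (simp add: d_def infdist_nonneg)
  have "\<exists>k\<in>K. norm (x - k) < d + 1 / Suc n" for n :: nat
  proof (rule ccontr)
    assume "\<not> ?thesis"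
    then have "d + 1 / Suc n \<le> dist x k" if "k \<in> K" for k
      using that by (force simp: dist_norm not_less)
    then have "d + 1 / Suc n \<le> d"
      using ne cINF_greatest[of K "d + 1 / Suc n" "dist x"] by (simp add: d_def infdist_def)
    then show False by simp
  qed
  then obtain k where k: "\<And>n::nat. k n \<in> K" "\<And>n. norm (x - k n) < d + 1 / Suc n" by metis
  \<comment> \<open>An upper bound for the excess of \<open>(d + 1/Suc n)^2\<close> over
    \<open>d^2\<close>, obtained from \<open>1/(Suc n)^2 <= 1/Suc n\<close>.\<close>
  define c where "c n = (2 * d + 1) / Suc n" for n :: nat
  have sq: "(norm (x - k n))\<^sup>2 \<le> d\<^sup>2 + c n" for n
  proof -
    have "(norm (x - k n))\<^sup>2 \<le> (d + 1 / Suc n)\<^sup>2"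
      using k(2)[of n] by (intro power_mono) auto
    also have "\<dots> = d\<^sup>2 + 2 * d / Suc n + (1 / Suc n) * (1 / Suc n)"
      by (simp add: power2_eq_square algebra_simps)
    also have "\<dots> \<le> d\<^sup>2 + 2 * d / Suc n + 1 * (1 / Suc n)"
      by (intro add_left_mono mult_right_mono) auto
    finally show ?thesis by (simp add: c_def add_divide_distrib)
  qed
  \<comment> \<open>The midpoint of two points of \<open>K\<close> has distance at least
    \<open>d\<close> from \<open>x\<close>; by the parallelogram law two almost nearest points are
    then close to each other.\<close>
  have par: "(norm (k m - k n))\<^sup>2 \<le> 2 * c m + 2 * c n" for m n
  proof -
    have "(1/2) *\<^sub>R (k m + k n) \<in> K"
      using K(1) k(1) by (simp add: subspace_add subspace_mul)
    from power_mono[OF dle[OF this] d0, of 2]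
    have "4 * d\<^sup>2 \<le> 4 * (norm (x - (1/2) *\<^sub>R (k m + k n)))\<^sup>2" by simp
    also have "\<dots> = (norm ((x - k m) + (x - k n)))\<^sup>2"
    proof -
      have "(x - k m) + (x - k n) = 2 *\<^sub>R (x - (1/2) *\<^sub>R (k m + k n))"
        by (simp add: algebra_simps scaleR_2)
      then show ?thesis by (simp add: power_mult_distrib)
    qed
    also have "\<dots> = 2 * (norm (x - k m))\<^sup>2 + 2 * (norm (x - k n))\<^sup>2 - (norm (k m - k n))\<^sup>2"
      by (simp add: power2_norm_eq_inner algebra_simps inner_commute)
    finally show ?thesis using sq[of m] sq[of n] by linarith
  qed
  have "Cauchy k"
  proof (rule metric_CauchyI)
    fix e :: real assume e: "0 < e"
    obtain N :: nat where N: "4 * (2 * d + 1) / e\<^sup>2 < N" using reals_Archimedean2 by blast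
    have N': "2 * c m < e\<^sup>2 / 2" if "m \<ge> N" for m
    proof -
      have "4 * (2 * d + 1) / e\<^sup>2 < Suc m" using N that by linarith
      then have "4 * (2 * d + 1) < Suc m * e\<^sup>2" using e by (simp add: divide_less_eq)
      then have "4 * (2 * d + 1) / Suc m < e\<^sup>2" by (simp add: divide_less_eq mult.commute)
      then show ?thesis by (simp add: c_def)
    qed
    have "dist (k m) (k n) < e" if "m \<ge> N" "n \<ge> N" for m n
    proof -
      have "(norm (k m - k n))\<^sup>2 < e\<^sup>2" using par[of m n] N'[OF that(1)] N'[OF that(2)] by linarith
      then show ?thesis using e by (simp add: dist_norm power2_less_imp_less)
    qed
    then show "\<exists>M. \<forall>m\<ge>M. \<forall>n\<ge>M. dist (k m) (k n) < e" by blast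
  qed
  then obtain p where p: "k \<longlonglongrightarrow> p" using Cauchy_convergent convergent_def by blast
  have pK: "p \<in> K" using closed_sequentially[OF K(2)] k(1) p by blast
  have "(\<lambda>n. norm (x - k n)) \<longlonglongrightarrow> norm (x - p)" by (intro tendsto_intros p)
  moreover have "(\<lambda>n. d + 1 / Suc n) \<longlonglongrightarrow> d + 0"
    by (intro tendsto_intros LIMSEQ_Suc lim_1_over_n)
  ultimately have pd: "norm (x - p) \<le> d"
    using k(2) by (intro LIMSEQ_le[where X="\<lambda>n. norm (x - k n)" and Y="\<lambda>n. d + 1 / Suc n"]) (auto intro: less_imp_le)
  have "inner (x - p) h = 0" if h: "h \<in> K" for h
  proof -
    \<comment> \<open>This multiple of \<open>h\<close> minimises
      \<open>norm ((x - p) - t h)\<close>; as it cannot improve on \<open>p\<close>, the linear term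
      has to vanish.\<close>
    define t where "t = inner (x - p) h / (norm h)\<^sup>2"
    have "p + t *\<^sub>R h \<in> K" using K(1) pK h by (simp add: subspace_add subspace_mul)
    from dle[OF this] pd have "norm (x - p) \<le> norm ((x - p) - t *\<^sub>R h)" by (simp add: algebra_simps)
    then have "(norm (x - p))\<^sup>2 \<le> (norm ((x - p) - t *\<^sub>R h))\<^sup>2" by (intro power_mono) auto
    also have "\<dots> = (norm (x - p))\<^sup>2 - 2 * t * inner (x - p) h + t\<^sup>2 * (norm h)\<^sup>2"
      by (simp only: power2_norm_eq_inner inner_diff_left inner_diff_right inner_scaleR_left
          inner_scaleR_right power2_eq_square[of t]) (simp add: inner_commute algebra_simps)
    finally have "2 * t * inner (x - p) h \<le> t\<^sup>2 * (norm h)\<^sup>2" by simp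
    then show ?thesis
    proof (cases "h = 0")
      case False
      then have "t\<^sup>2 * (norm h)\<^sup>2 = t * inner (x - p) h"
        by (simp add: t_def power2_eq_square)
      with \<open>2 * t * inner (x - p) h \<le> t\<^sup>2 * (norm h)\<^sup>2\<close> have "t * inner (x - p) h \<le> 0" by simp
      then have "(inner (x - p) h)\<^sup>2 \<le> 0" using False
        by (simp add: t_def power2_eq_square[of "inner (x - p) h"] divide_le_0_iff)
      then show ?thesis by simp
    qed simp
  qed
  then show ?thesis using pK by blast
qed

text \<open>The orthogonal complement of the kernel is a line, spanned by the residual
  \<open>v\<close> of any \<open>w\<close> with \<open>f w\<close> nonzero. The real version is
  enough, since the real part of \<open>cinner\<close> is a real inner product.\<close>

lemma riesz_representation:
  fixes f :: "'h::{real_inner, complete_space} \<Rightarrow> real"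
  assumes f: "bounded_linear f"
  shows "\<exists>z. \<forall>x. f x = inner z x"
proof (cases "\<forall>x. f x = 0")
  case False
  then obtain w where w: "f w \<noteq> 0" by blast
  interpret bounded_linear f by (rule f)
  let ?K = "{x. f x = 0}"
  have "subspace ?K" by (auto simp: subspace_def add scaleR zero)
  moreover have "closed ?K"
    by (intro closed_Collect_eq continuous_intros linear_continuous_on f)
  ultimately obtain p where p: "f p = 0" "\<And>k. f k = 0 \<Longrightarrow> inner (w - p) k = 0"
    using closed_subspace_projection[of ?K w] by auto
  define v where "v = w - p"
  have fv: "f v = f w" "f v \<noteq> 0" using w p by (simp_all add: v_def diff)
  then have "v \<noteq> 0" using zero by auto
  have "f x = inner ((f v / inner v v) *\<^sub>R v) x" for x
  proof -
    have "f (x - (f x / f v) *\<^sub>R v) = 0" using fv by (simp add: diff scaleR)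
    from p(2)[OF this] have "inner v x = (f x / f v) * inner v v"
      by (simp add: v_def[symmetric] inner_diff_right)
    then show ?thesis using \<open>v \<noteq> 0\<close> fv by (simp add: field_simps)
  qed
  then show ?thesis by blast
qed (auto intro: exI[of _ 0])

section \<open>Bounded operators, adjoints and positivity\<close>

lemma bop_simps [simp]:
  fixes A B :: "'a::complex_hilbert bop"
  shows "(A + B) \<cdot> x = A \<cdot> x + B \<cdot> x" "(A - B) \<cdot> x = A \<cdot> x - B \<cdot> x" "(- A) \<cdot> x = - (A \<cdot> x)"
    "(0::'a bop) \<cdot> x = 0" "(1::'a bop) \<cdot> x = x" "(A * B) \<cdot> x = A \<cdot> B \<cdot> x"
    "(r *\<^sub>R A) \<cdot> x = r *\<^sub>R (A \<cdot> x)"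
  by (simp_all add: plus_bop.rep_eq minus_bop.rep_eq uminus_bop.rep_eq zero_bop.rep_eq
      one_bop.rep_eq times_bop.rep_eq scaleR_bop.rep_eq)

lemma bop_linear [simp]:
  fixes A :: "'a::complex_hilbert bop"
  shows "A \<cdot> (x + y) = A \<cdot> x + A \<cdot> y" "A \<cdot> (x - y) = A \<cdot> x - A \<cdot> y" "A \<cdot> (- x) = - (A \<cdot> x)"
    "A \<cdot> 0 = 0" "A \<cdot> (r *\<^sub>R x) = r *\<^sub>R (A \<cdot> x)" "A \<cdot> (c *\<^sub>C x) = c *\<^sub>C (A \<cdot> x)"
  using bounded_linear_bop[of A] by (simp_all add: linear_simps bop_scaleC)

lemma bop_sum [simp]: "(\<Sum>i\<in>I. F i) \<cdot> x = (\<Sum>i\<in>I. F i \<cdot> x)"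
  by (induction I rule: infinite_finite_induct) auto

lemma bop_scaleR_mult [simp]:
  fixes A B :: "'a::complex_hilbert bop"
  shows "(r *\<^sub>R A) * B = r *\<^sub>R (A * B)" "A * (r *\<^sub>R B) = r *\<^sub>R (A * B)"
  by (auto intro: bop_eqI)

lemma tendsto_bop [tendsto_intros]:
  "(f \<longlongrightarrow> x) F \<Longrightarrow> ((\<lambda>i. A \<cdot> f i) \<longlongrightarrow> A \<cdot> x) F"
  by (rule bounded_linear.tendsto[OF bounded_linear_bop])

lemma continuous_on_bop [continuous_intros]:
  "continuous_on S f \<Longrightarrow> continuous_on S (\<lambda>i. A \<cdot> f i)"
  by (rule bounded_linear.continuous_on[OF bounded_linear_bop])

lemma norm_bop_apply: "norm (A \<cdot> x) \<le> norm A * norm x"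
  by (simp add: norm_bop.rep_eq onorm[OF bounded_linear_bop])

lemma norm_bop_le:
  assumes "0 \<le> c" "\<And>x. norm (A \<cdot> x) \<le> c * norm x"
  shows "norm A \<le> c"
  unfolding norm_bop.rep_eq by (rule onorm_bound) (use assms in auto)

lemma cinner_eq_Complex:
  "cinner x y = Complex (inner x y) (inner x (\<i> *\<^sub>C y))"
  by (simp add: complex_eq_iff Re_cinner Im_cinner)

lemma inner_scaleC_i: "inner (\<i> *\<^sub>C x) (\<i> *\<^sub>C y) = inner x (y::'a::complex_hilbert)"
  by (simp add: Re_cinner[symmetric] cinner_scaleC_left cinner_scaleC_right)

lemma scaleC_i_i: "\<i> *\<^sub>C \<i> *\<^sub>C x = - (x::'a::complex_hilbert)"
  using scaleC_of_real[of "-1" x] by (simp add: scaleC_scaleC)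

lemma inner_scaleC_i_left: "inner (\<i> *\<^sub>C x) y = - inner x (\<i> *\<^sub>C (y::'a::complex_hilbert))"
  by (simp add: inner_scaleC_i[of x "\<i> *\<^sub>C y", symmetric] scaleC_i_i)

lemma scaleC_eq_inner_components:
  "c *\<^sub>C x = Re c *\<^sub>R x + Im c *\<^sub>R (\<i> *\<^sub>C (x::'a::complex_hilbert))"
  by (metis complex_eq mult.commute scaleC_add_left scaleC_of_real scaleC_scaleC)

lemma scaleC_linearI:
  fixes f :: "'a::complex_hilbert \<Rightarrow> 'b::complex_hilbert"
  assumes "linear f" "\<And>x. f (\<i> *\<^sub>C x) = \<i> *\<^sub>C f x"
  shows "f (c *\<^sub>C x) = c *\<^sub>C f x"
  by (simp add: scaleC_eq_inner_components[of c] linear_add[OF assms(1)] linear_scale[OF assms(1)] assms(2))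

text \<open>Turns pointwise limits and unique choices into operators: commuting with the imaginary
  unit upgrades real to complex homogeneity, so three identities and one bound have to be
  checked.\<close>

lemma ex_bop:
  fixes f :: "'a::complex_hilbert \<Rightarrow> 'a"
  assumes "\<And>x y. f (x + y) = f x + f y" "\<And>r x. f (r *\<^sub>R x) = r *\<^sub>R f x"
    and "\<And>x. f (\<i> *\<^sub>C x) = \<i> *\<^sub>C f x" and "\<And>x. norm (f x) \<le> M * norm x"
  shows "\<exists>A. \<forall>x. A \<cdot> x = f x"
proof -
  have "bounded_linear f"
    by (rule bounded_linear_intro[where K=M]) (use assms in \<open>auto simp: mult.commute\<close>)
  moreover from this have "f (c *\<^sub>C x) = c *\<^sub>C f x" for c x
    using scaleC_linearI[of f] assms(3) bounded_linear.linear by blast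
  ultimately have "Bop f \<cdot> x = f x" for x by (subst Bop_inverse) auto
  then show ?thesis by blast
qed

lemma inner_ext: "(\<And>y. inner u y = inner v y) \<Longrightarrow> u = (v::'a::real_inner)"
  using inner_eq_zero_iff[of "u - v"] by (metis inner_diff_left right_minus_eq)

text \<open>Riesz gives the representing vector \<open>g y\<close> for the real inner product. It
  also represents the complex one: the imaginary part is tested by multiplying \<open>y\<close> with
  the imaginary unit.\<close>

lemma ex_adjoint: "\<exists>B. \<forall>x y. cinner (A \<cdot> x) y = cinner x (B \<cdot> (y::'a::complex_hilbert))"
proof -
  have "\<exists>z. \<forall>x. inner (A \<cdot> x) y = inner z x" for y
    by (rule riesz_representation)
      (rule bounded_linear_compose[OF bounded_linear_inner_left bounded_linear_bop])
  then obtain g where g: "\<And>x y. inner (A \<cdot> x) y = inner (g y) x" by metis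
  have "\<exists>B. \<forall>x. B \<cdot> x = g x"
  proof (rule ex_bop)
    show "g (x + y) = g x + g y" for x y
      by (rule inner_ext) (simp add: inner_add_left inner_add_right g[symmetric])
    show "g (r *\<^sub>R x) = r *\<^sub>R g x" for x r
      by (rule inner_ext) (simp add: g[symmetric])
    show "g (\<i> *\<^sub>C x) = \<i> *\<^sub>C g x" for x
      by (rule inner_ext) (simp add: inner_scaleC_i_left g[symmetric])
    show "norm (g y) \<le> norm A * norm y" for y
    proof -
      have "norm (g y) * norm (g y) = inner (A \<cdot> g y) y"
        by (simp add: g power2_norm_eq_inner[symmetric] power2_eq_square)
      also have "\<dots> \<le> norm (A \<cdot> g y) * norm y" by (rule norm_cauchy_schwarz)
      also have "\<dots> \<le> (norm A * norm (g y)) * norm y"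
        by (intro mult_right_mono norm_bop_apply) simp
      finally show ?thesis by (cases "g y = 0") (simp_all add: mult.commute mult.left_commute)
    qed
  qed
  then obtain B where "\<And>x. B \<cdot> x = g x" by blast
  then have "inner (A \<cdot> x) y = inner x (B \<cdot> y)" for x y
    using g[of x y] by (simp add: inner_commute)
  moreover from this have "inner (A \<cdot> x) (\<i> *\<^sub>C y) = inner x (\<i> *\<^sub>C (B \<cdot> y))" for x y by simp
  ultimately show ?thesis by (auto intro!: exI[of _ B] simp: cinner_eq_Complex)
qed

text \<open>Because operators are complex linear, agreement of real inner products implies agreement
  of complex ones. This allows nearly all later computations to use \<open>inner\<close>.\<close>

lemma adj_eqI:
  assumes "\<And>x y. inner (A \<cdot> x) y = inner x (B \<cdot> (y::'a::complex_hilbert))"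
  shows "adj A = B"
  unfolding adj_def
proof (rule the_equality)
  show "\<forall>x y. cinner (A \<cdot> x) y = cinner x (B \<cdot> y)"
    using assms by (simp add: cinner_eq_Complex flip: bop_linear(6))
  show "C = B" if "\<forall>x y. cinner (A \<cdot> x) y = cinner x (C \<cdot> y)" for C
  proof (rule bop_eqI, rule inner_ext)
    show "inner (C \<cdot> x) y = inner (B \<cdot> x) y" for x y
      using that assms by (metis Re_cinner inner_commute)
  qed
qed

lemma inner_adj: "inner (A \<cdot> x) y = inner x (adj A \<cdot> (y::'a::complex_hilbert))"
  using ex_adjoint[of A] adj_eqI[of A] by (metis Re_cinner)

text \<open>Stated through the real inner product, so that it can be used and checked without
  complex scalars; \<open>adj_eq_self_iff\<close> links it with \<open>adj\<close>.\<close>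

definition selfadj :: "'a::complex_hilbert bop \<Rightarrow> bool" where
  "selfadj A \<longleftrightarrow> (\<forall>x y. inner (A \<cdot> x) y = inner x (A \<cdot> y))"

lemma selfadjD: "selfadj A \<Longrightarrow> inner (A \<cdot> x) y = inner x (A \<cdot> y)"
  by (simp add: selfadj_def)

lemma adj_eq_self_iff: "adj A = A \<longleftrightarrow> selfadj A"
  using adj_eqI[of A A] inner_adj[of A] by (auto simp: selfadj_def)

lemma cinner_selfadj: "selfadj A \<Longrightarrow> cinner (A \<cdot> x) y = cinner x (A \<cdot> y)"
  unfolding cinner_eq_Complex by (metis selfadjD bop_linear(6))

lemma selfadj_intros [simp]:
  shows "selfadj 0" "selfadj 1" "selfadj A \<Longrightarrow> selfadj B \<Longrightarrow> selfadj (A + B)"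
    "selfadj A \<Longrightarrow> selfadj B \<Longrightarrow> selfadj (A - B)" "selfadj A \<Longrightarrow> selfadj (r *\<^sub>R A)"
    "selfadj A \<Longrightarrow> selfadj (- A)"
  by (auto simp: selfadj_def inner_simps)

lemma selfadj_mult: "selfadj A \<Longrightarrow> selfadj B \<Longrightarrow> A * B = B * A \<Longrightarrow> selfadj (A * B)"
  unfolding selfadj_def by (metis bop_simps(6))

lemma selfadj_square: "selfadj A \<Longrightarrow> selfadj (A * A)"
  by (simp add: selfadj_mult)

lemma selfadj_sandwich: "selfadj A \<Longrightarrow> selfadj B \<Longrightarrow> selfadj (A * B * A)"
  by (simp add: selfadj_def)

text \<open>A complex quadratic form determines its operator, and for self-adjoint operators this
  form is real, so real parts decide. This is the standard way of proving operator identities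
  below.\<close>

lemma selfadj_form_eqI:
  assumes "selfadj A" "selfadj B" "\<And>x. inner (A \<cdot> x) x = inner (B \<cdot> x) x"
  shows "A = B"
proof -
  have "cinner ((A - B) \<cdot> x) x = 0" for x
  proof -
    have "cinner ((A - B) \<cdot> x) x = cnj (cinner ((A - B) \<cdot> x) x)"
      using cinner_selfadj[of "A - B" x x] cinner_commute[of x "(A - B) \<cdot> x"] assms by simp
    then have "Im (cinner ((A - B) \<cdot> x) x) = 0" by (metis Reals_cnj_iff complex_is_Real_iff)
    moreover have "Re (cinner ((A - B) \<cdot> x) x) = 0"
      using assms(3)[of x] by (simp add: Re_cinner inner_diff_left)
    ultimately show ?thesis by (simp add: complex_eq_iff)
  qed
  from bop_quadratic_zero[OF this] show ?thesis by simp
qed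

text \<open>The order demands that the complex form of the difference be real, and an operator with
  real form has the same form as its adjoint.\<close>

lemma le_bop_selfadj: "A \<le> B \<Longrightarrow> selfadj (B - A)"
proof -
  assume "A \<le> B"
  define C where "C = B - A"
  have im: "Im (cinner (C \<cdot> x) x) = 0" for x
    using \<open>A \<le> B\<close> unfolding less_eq_bop_def C_def complex_nonneg_Reals_iff by blast
  have c: "cinner x (adj C \<cdot> y) = cinner (C \<cdot> x) y" for x y
    by (simp add: cinner_eq_Complex inner_adj flip: bop_linear(6))
  have "cinner ((C - adj C) \<cdot> x) x = 0" for x
  proof -
    have "cinner (adj C \<cdot> x) x = cinner (C \<cdot> x) x"
      by (metis c cinner_commute complex_cnj_cnj im Reals_cnj_iff complex_is_Real_iff)
    then show ?thesis by (simp add: cinner_diff_left)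
  qed
  from bop_quadratic_zero[OF this] have "adj C = C" by simp
  then show ?thesis by (simp add: adj_eq_self_iff C_def)
qed

lemma le_bop_form: "A \<le> B \<Longrightarrow> inner (A \<cdot> x) x \<le> inner (B \<cdot> x) x"
  unfolding less_eq_bop_def complex_nonneg_Reals_iff
  by (auto simp: cinner_eq_Complex inner_diff_left)

lemma le_bopI:
  assumes "selfadj (B - A)" "\<And>x. inner (A \<cdot> x) x \<le> inner (B \<cdot> x) x"
  shows "A \<le> B"
  unfolding less_eq_bop_def complex_nonneg_Reals_iff
proof (intro allI conjI)
  fix x
  show "0 \<le> Re (cinner ((B - A) \<cdot> x) x)"
    using assms(2)[of x] by (simp add: Re_cinner inner_diff_left)
  show "Im (cinner ((B - A) \<cdot> x) x) = 0"
    by (metis assms(1) cinner_selfadj cinner_commute Reals_cnj_iff complex_is_Real_iff)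
qed

lemma pos_selfadj: "0 \<le> A \<Longrightarrow> selfadj A"
  using le_bop_selfadj[of 0 A] by simp

lemma pos_form: "0 \<le> A \<Longrightarrow> 0 \<le> inner (A \<cdot> x) x"
  using le_bop_form[of 0 A x] by simp

lemma posI: "selfadj A \<Longrightarrow> (\<And>x. 0 \<le> inner (A \<cdot> x) x) \<Longrightarrow> 0 \<le> A"
  by (rule le_bopI) auto

lemma pos_add: "0 \<le> A \<Longrightarrow> 0 \<le> B \<Longrightarrow> 0 \<le> A + (B::'a::complex_hilbert bop)"
  by (rule posI) (simp_all add: pos_selfadj inner_add_left pos_form)

lemma pos_scaleR: "0 \<le> A \<Longrightarrow> 0 \<le> r \<Longrightarrow> 0 \<le> r *\<^sub>R (A::'a::complex_hilbert bop)"
  by (rule posI) (simp_all add: pos_selfadj pos_form)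

lemma pos_sandwich: "selfadj A \<Longrightarrow> 0 \<le> B \<Longrightarrow> 0 \<le> A * B * A"
  by (rule posI) (simp_all add: selfadj_sandwich pos_selfadj selfadjD[of A] pos_form)

lemma pos_square: "selfadj A \<Longrightarrow> 0 \<le> A * A"
  by (rule posI) (simp_all add: selfadj_square selfadjD[of A "A \<cdot> _"])

lemma pos_one: "0 \<le> (1::'a::complex_hilbert bop)"
  by (rule posI) simp_all

lemma pos_cauchy_schwarz:
  assumes "0 \<le> A"
  shows "(inner (A \<cdot> x) y)\<^sup>2 \<le> inner (A \<cdot> x) x * inner (A \<cdot> y) y"
proof -
  let ?a = "inner (A \<cdot> x) x" and ?b = "inner (A \<cdot> x) y" and ?c = "inner (A \<cdot> y) y"
  have sym: "inner (A \<cdot> y) x = ?b"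
    using selfadjD[OF pos_selfadj[OF assms], of y x] by (simp add: inner_commute)
  have q: "0 \<le> ?a * s * s + 2 * ?b * s * t + ?c * t * t" for s t
    using pos_form[OF assms, of "s *\<^sub>R x + t *\<^sub>R y"]
    by (simp add: inner_simps sym algebra_simps)
  have a0: "0 \<le> ?a" and c0: "0 \<le> ?c" by (rule pos_form[OF assms])+
  show ?thesis
  proof (cases "?c = 0")
    case True
    have "?b = 0"
    proof (rule ccontr)
      assume b: "?b \<noteq> 0"
      \<comment> \<open>Without a quadratic term the expression is affine in the second variable;
        this value makes it \<open>- ?a - 2\<close>, which is negative.\<close>
      have "0 \<le> ?a + 2 * ?b * (-(?a + 1) / ?b)" using q[of 1 "-(?a + 1) / ?b"] True by simp
      then show False using b a0 by simp
    qed
    then show ?thesis by (simp add: True)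
  next
    case False
    then have c: "0 < ?c" using c0 by simp
    have "0 \<le> ?a + 2 * ?b * (- ?b / ?c) + ?c * (- ?b / ?c) * (- ?b / ?c)"
      using q[of 1 "- ?b / ?c"] by simp
    also have "\<dots> = ?a - ?b\<^sup>2 / ?c" using c by (simp add: field_simps power2_eq_square)
    finally show ?thesis using c by (simp add: field_simps)
  qed
qed

text \<open>Cauchy-Schwarz for the form of \<open>A\<close> between \<open>x\<close> and
  \<open>A x\<close>, after cancelling one factor \<open>(norm (A x))^2\<close>. It makes
  convergence of forms imply strong convergence.\<close>

lemma pos_norm_sq_le:
  assumes "0 \<le> A" and M: "\<And>y. inner (A \<cdot> y) y \<le> M * (norm y)\<^sup>2"
  shows "(norm (A \<cdot> x))\<^sup>2 \<le> M * inner (A \<cdot> x) x"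
proof (cases "A \<cdot> x = 0")
  case False
  have "((norm (A \<cdot> x))\<^sup>2)\<^sup>2 \<le> inner (A \<cdot> x) x * inner (A \<cdot> A \<cdot> x) (A \<cdot> x)"
    using pos_cauchy_schwarz[OF assms(1), of x "A \<cdot> x"] by (simp add: power2_norm_eq_inner)
  also have "\<dots> \<le> inner (A \<cdot> x) x * (M * (norm (A \<cdot> x))\<^sup>2)"
    by (intro mult_left_mono M pos_form assms)
  finally have "(norm (A \<cdot> x))\<^sup>2 * (norm (A \<cdot> x))\<^sup>2 \<le> (M * inner (A \<cdot> x) x) * (norm (A \<cdot> x))\<^sup>2"
    by (simp add: power2_eq_square mult_ac)
  then show ?thesis using False by (subst (asm) mult_le_cancel_right_pos) auto
qed simp

lemma form_le_norm: "inner (A \<cdot> x) x \<le> norm A * (norm x)\<^sup>2"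
proof -
  have "inner (A \<cdot> x) x \<le> norm (A \<cdot> x) * norm x" by (rule norm_cauchy_schwarz)
  also have "\<dots> \<le> norm A * norm x * norm x" by (intro mult_right_mono norm_bop_apply) simp
  finally show ?thesis by (simp add: power2_eq_square mult.assoc)
qed

lemma pos_norm_sq_le': "0 \<le> A \<Longrightarrow> (norm (A \<cdot> x))\<^sup>2 \<le> norm A * inner (A \<cdot> x) x"
  by (rule pos_norm_sq_le[OF _ form_le_norm])

lemma pos_form_zero_iff: "0 \<le> A \<Longrightarrow> inner (A \<cdot> x) x = 0 \<longleftrightarrow> A \<cdot> x = 0"
  using pos_norm_sq_le'[of A x] by auto

lemma pos_norm_le:
  assumes "0 \<le> A" "0 \<le> M" and M: "\<And>y. inner (A \<cdot> y) y \<le> M * (norm y)\<^sup>2"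
  shows "norm A \<le> M"
proof (rule norm_bop_le[OF assms(2)])
  fix x
  have "(norm (A \<cdot> x))\<^sup>2 \<le> M * inner (A \<cdot> x) x" by (rule pos_norm_sq_le[OF assms(1) M])
  also have "\<dots> \<le> M * (M * (norm x)\<^sup>2)" by (intro mult_left_mono M assms)
  finally have "(norm (A \<cdot> x))\<^sup>2 \<le> (M * norm x)\<^sup>2" by (simp add: power2_eq_square mult_ac)
  then show "norm (A \<cdot> x) \<le> M * norm x" by (rule power2_le_imp_le) (use assms in simp)
qed

text \<open>The reason is \<open>\<parallel>Zx\<parallel>\<^sup>2 \<le> M \<langle>Zx,x\<rangle>\<close>.\<close>

lemma form_tendsto_imp_sot:
  assumes pos: "\<And>i. 0 \<le> Z i" and M: "\<And>i y. inner (Z i \<cdot> y) y \<le> M * (norm y)\<^sup>2"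
    and lim: "((\<lambda>i. inner (Z i \<cdot> x) x) \<longlongrightarrow> 0) F"
  shows "((\<lambda>i. Z i \<cdot> x) \<longlongrightarrow> 0) F"
proof -
  have "((\<lambda>i. (norm (Z i \<cdot> x))\<^sup>2) \<longlongrightarrow> 0) F"
  proof (rule tendsto_sandwich)
    show "\<forall>\<^sub>F i in F. 0 \<le> (norm (Z i \<cdot> x))\<^sup>2" by simp
    show "\<forall>\<^sub>F i in F. (norm (Z i \<cdot> x))\<^sup>2 \<le> M * inner (Z i \<cdot> x) x"
      using pos_norm_sq_le[OF pos M] by simp
    show "((\<lambda>i. M * inner (Z i \<cdot> x) x) \<longlongrightarrow> 0) F" using tendsto_mult_left[OF lim, of M] by simp
  qed simp
  then have "((\<lambda>i. sqrt ((norm (Z i \<cdot> x))\<^sup>2)) \<longlongrightarrow> sqrt 0) F" by (rule tendsto_real_sqrt)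
  then show ?thesis by (simp add: tendsto_norm_zero_iff)
qed

lemma le_bop_iff_diff: "A \<le> B \<longleftrightarrow> 0 \<le> B - (A::'a::complex_hilbert bop)"
  by (simp add: less_eq_bop_def)

lemma le_bop_sandwich: "selfadj C \<Longrightarrow> A \<le> B \<Longrightarrow> C * A * C \<le> C * B * C"
  using pos_sandwich[of C "B - A"]
  by (simp add: le_bop_iff_diff[of A B] le_bop_iff_diff[of "C * A * C"] left_diff_distrib right_diff_distrib)

lemma le_bop_iff_form:
  "selfadj A \<Longrightarrow> selfadj B \<Longrightarrow> A \<le> B \<longleftrightarrow> (\<forall>x. inner (A \<cdot> x) x \<le> inner (B \<cdot> x) x)"
  using le_bopI[of B A] le_bop_form by auto

section \<open>Orthogonal projections as bounded operators\<close>

definition closed_csubspace :: "'a::complex_hilbert set \<Rightarrow> bool" where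
  "closed_csubspace K \<longleftrightarrow> subspace K \<and> closed K \<and> (\<forall>x\<in>K. \<i> *\<^sub>C x \<in> K)"

text \<open>The real orthogonal projection is complex linear because \<open>K\<close> is stable
  under the imaginary unit: the residual remains orthogonal to \<open>K\<close> after the unit is
  moved to the other argument.\<close>

lemma ex_proj:
  assumes K: "closed_csubspace K"
  shows "\<exists>P. selfadj P \<and> P * P = P \<and> range (bop_apply P) = K"
proof -
  have sub: "subspace K" and cl: "closed K" and ci: "\<And>x. x \<in> K \<Longrightarrow> \<i> *\<^sub>C x \<in> K"
    using K by (auto simp: closed_csubspace_def)
  obtain p where p: "\<And>x. p x \<in> K" "\<And>x k. k \<in> K \<Longrightarrow> inner (x - p x) k = 0"
    using closed_subspace_projection[OF sub cl] by metis
  have uniq: "q = p x" if "q \<in> K" "\<And>k. k \<in> K \<Longrightarrow> inner (x - q) k = 0" for x q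
  proof -
    have "q - p x \<in> K" using that p sub by (simp add: subspace_diff)
    from that(2)[OF this] p(2)[OF this, of x] have "inner (q - p x) (q - p x) = 0"
      by (simp add: inner_diff_left)
    then show ?thesis by simp
  qed
  have "\<exists>P. \<forall>x. P \<cdot> x = p x"
  proof (rule ex_bop)
    show "p (x + y) = p x + p y" for x y
    proof (rule sym, rule uniq)
      fix k assume "k \<in> K"
      then have "inner (x - p x) k = 0" "inner (y - p y) k = 0" using p(2) by simp_all
      then show "inner (x + y - (p x + p y)) k = 0" by (simp add: inner_simps)
    qed (use p(1) sub in \<open>auto simp: subspace_add\<close>)
    show "p (r *\<^sub>R x) = r *\<^sub>R p x" for r x
    proof (rule sym, rule uniq)
      fix k assume "k \<in> K"
      then have "r * inner (x - p x) k = 0" using p(2) by simp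
      then show "inner (r *\<^sub>R x - r *\<^sub>R p x) k = 0" by (simp add: inner_simps algebra_simps)
    qed (use p(1) sub in \<open>auto simp: subspace_mul\<close>)
    show "p (\<i> *\<^sub>C x) = \<i> *\<^sub>C p x" for x
    proof (rule sym, rule uniq)
      fix k assume "k \<in> K"
      then have "inner (x - p x) (\<i> *\<^sub>C k) = 0" by (intro p(2) ci)
      then show "inner (\<i> *\<^sub>C x - \<i> *\<^sub>C p x) k = 0"
        by (simp add: inner_scaleC_i_left flip: scaleC_diff_right)
    qed (use p(1) ci in auto)
    show "norm (p x) \<le> 1 * norm x" for x
    proof -
      have "norm (p x) * norm (p x) = inner x (p x)"
        using p(2)[OF p(1)[of x], of x]
        by (simp add: inner_diff_left norm_eq_sqrt_inner)
      also have "\<dots> \<le> norm x * norm (p x)" by (rule norm_cauchy_schwarz)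
      finally show ?thesis by (cases "p x = 0") auto
    qed
  qed
  then obtain P where P: "\<And>x. P \<cdot> x = p x" by blast
  have pK: "p x = x" if "x \<in> K" for x using uniq[of x x] that by simp
  have "selfadj P"
  proof (unfold selfadj_def, intro allI)
    fix x y
    have "inner (x - p x) (p y) = 0" "inner (y - p y) (p x) = 0" using p by blast+
    then have "inner x (p y) = inner (p x) (p y)" "inner y (p x) = inner (p y) (p x)"
      by (simp_all add: inner_diff_left)
    then show "inner (P \<cdot> x) y = inner x (P \<cdot> y)" by (metis P inner_commute)
  qed
  moreover have "P * P = P" by (rule bop_eqI) (simp add: P pK p(1))
  moreover have "range (bop_apply P) = K"
    using p(1) pK by (auto simp: P image_iff) (metis pK)
  ultimately show ?thesis by blast
qed

text \<open>Each projection fixes the range of the other, so \<open>P Q = Q\<close> and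
  \<open>Q P = P\<close>; self-adjointness then identifies them.\<close>

lemma projection_eqI:
  assumes P: "selfadj P" "P * P = P" and Q: "selfadj Q" "Q * Q = Q"
    and "range (bop_apply P) = range (bop_apply Q)"
  shows "P = Q"
proof -
  have 1: "P \<cdot> Q \<cdot> x = Q \<cdot> x" for x
    by (metis P(2) assms(5) bop_simps(6) rangeE rangeI)
  have 2: "Q \<cdot> P \<cdot> x = P \<cdot> x" for x
    by (metis Q(2) assms(5) bop_simps(6) rangeE rangeI)
  show ?thesis
  proof (rule bop_eqI, rule inner_ext)
    fix x y
    have "inner (P \<cdot> x) y = inner (P \<cdot> x) (Q \<cdot> y)"
      using 2[of x] selfadjD[OF Q(1), of "P \<cdot> x" y] by simp
    also have "\<dots> = inner x (Q \<cdot> y)"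
      using 1[of y] selfadjD[OF P(1), of x "Q \<cdot> y"] by simp
    finally show "inner (P \<cdot> x) y = inner (Q \<cdot> x) y" by (simp add: selfadjD[OF Q(1)])
  qed
qed

lemma proj:
  assumes K: "closed_csubspace K"
  shows selfadj_proj: "selfadj (proj K)" and proj_idem: "proj K * proj K = proj K"
    and range_proj: "range (bop_apply (proj K)) = K"
proof -
  have "\<exists>!P. adj P = P \<and> P * P = P \<and> range (bop_apply P) = K"
    unfolding adj_eq_self_iff using ex_proj[OF K] projection_eqI by (intro ex_ex1I) auto
  from theI'[OF this] show "selfadj (proj K)" "proj K * proj K = proj K" "range (bop_apply (proj K)) = K"
    by (simp_all add: proj_def adj_eq_self_iff)
qed

lemma proj_in: "closed_csubspace K \<Longrightarrow> proj K \<cdot> x \<in> K"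
  using range_proj by blast

lemma proj_fix_iff: "closed_csubspace K \<Longrightarrow> proj K \<cdot> x = x \<longleftrightarrow> x \<in> K"
  by (metis bop_simps(6) proj_idem proj_in range_proj rangeE)

lemma projection_form:
  assumes "selfadj P" "P * P = P"
  shows "inner (P \<cdot> x) x = (norm (P \<cdot> x))\<^sup>2"
  by (metis assms bop_simps(6) power2_norm_eq_inner selfadjD)

lemma projection_norm_le:
  assumes "selfadj P" "P * P = P"
  shows "norm (P \<cdot> x) \<le> norm x"
proof -
  have "(norm (P \<cdot> x))\<^sup>2 \<le> norm (P \<cdot> x) * norm x"
    using norm_cauchy_schwarz[of "P \<cdot> x" x] by (simp add: projection_form[OF assms])
  then show ?thesis by (cases "P \<cdot> x = 0") (auto simp: power2_eq_square)
qed

lemma projection_pos: "selfadj P \<Longrightarrow> P * P = P \<Longrightarrow> 0 \<le> P"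
  by (rule posI) (simp_all add: projection_form)

lemma projection_compl: "selfadj P \<Longrightarrow> P * P = P \<Longrightarrow> (1 - P) * (1 - P) = 1 - P"
  by (simp add: algebra_simps)

lemma projection_le_one: "selfadj P \<Longrightarrow> P * P = P \<Longrightarrow> P \<le> 1"
  using projection_pos[of "1 - P"] by (simp add: le_bop_iff_diff[of P] projection_compl)

lemma le_one_form: "P \<le> 1 \<Longrightarrow> inner (P \<cdot> x) x \<le> (norm x)\<^sup>2"
  using le_bop_form[of P 1 x] by (simp add: power2_norm_eq_inner)

lemma pos_le_one_norm: "0 \<le> P \<Longrightarrow> P \<le> 1 \<Longrightarrow> norm (P::'a::complex_hilbert bop) \<le> 1"
  by (rule pos_norm_le[of P 1]) (simp_all add: le_one_form)

lemma norm_le_one_imp_le: "selfadj X \<Longrightarrow> norm X \<le> 1 \<Longrightarrow> X \<le> 1"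
proof (rule le_bopI)
  fix x assume "norm X \<le> 1"
  have "inner (X \<cdot> x) x \<le> norm X * (norm x)\<^sup>2" by (rule form_le_norm)
  also have "\<dots> \<le> 1 * (norm x)\<^sup>2" by (intro mult_right_mono \<open>norm X \<le> 1\<close>) simp
  finally show "inner (X \<cdot> x) x \<le> inner (1 \<cdot> x) x" by (simp add: power2_norm_eq_inner)
qed simp

section \<open>Suprema of bounded directed sets\<close>

text \<open>The net \<open>D\<close> is turned into the filter of its upper sections, so that linearity of the limit
  follows from uniqueness of limits.\<close>

lemma directed_supremum:
  fixes D :: "'a::complex_hilbert bop set"
  assumes ne: "D \<noteq> {}" and dir: "\<And>Y Z. Y \<in> D \<Longrightarrow> Z \<in> D \<Longrightarrow> \<exists>W\<in>D. Y \<le> W \<and> Z \<le> W"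
    and pos: "\<And>Y. Y \<in> D \<Longrightarrow> 0 \<le> Y" and bd: "\<And>Y. Y \<in> D \<Longrightarrow> Y \<le> B"
  obtains X where "selfadj X" "\<And>x. inner (X \<cdot> x) x = (SUP Y\<in>D. inner (Y \<cdot> x) x)"
    "\<And>Y. Y \<in> D \<Longrightarrow> Y \<le> X"
proof -
  define F where "F = (INF Y0\<in>D. principal {Y\<in>D. Y0 \<le> Y})"
  have ev: "eventually P F \<longleftrightarrow> (\<exists>Y0\<in>D. \<forall>Y\<in>D. Y0 \<le> Y \<longrightarrow> P Y)" for P
    unfolding F_def
  proof (subst eventually_INF_base[OF ne])
    fix a b assume "a \<in> D" "b \<in> D"
    then obtain W where "W \<in> D" "a \<le> W" "b \<le> W" using dir by blast
    then show "\<exists>x\<in>D. principal {Y \<in> D. x \<le> Y} \<le> inf (principal {Y \<in> D. a \<le> Y}) (principal {Y \<in> D. b \<le> Y})"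
      by (auto simp: le_principal eventually_principal intro!: bexI[of _ W] intro: order_trans)
  qed (auto simp: eventually_principal)
  have nb: "F \<noteq> bot"
    unfolding trivial_limit_def ev by auto
  define M where "M = norm B"
  have M0: "0 \<le> M" by (simp add: M_def)
  have bdf: "inner (Y \<cdot> x) x \<le> M * (norm x)\<^sup>2" if "Y \<in> D" for Y x
    using le_bop_form[OF bd[OF that], of x] form_le_norm[of B x] by (simp add: M_def)
  have bda: "bdd_above ((\<lambda>Y. inner (Y \<cdot> x) x) ` D)" for x
    using bdf by (auto simp: bdd_above_def)
  \<comment> \<open>\<open>Y - Z\<close> is positive with form bound \<open>M\<close>, so the
    distance of the vectors is controlled by the gap between the forms.\<close>
  have diff: "(norm (Y \<cdot> x - Z \<cdot> x))\<^sup>2 \<le> M * (inner (Y \<cdot> x) x - inner (Z \<cdot> x) x)"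
    if "Y \<in> D" "Z \<in> D" "Z \<le> Y" for Y Z x
  proof -
    have "inner ((Y - Z) \<cdot> y) y \<le> M * (norm y)\<^sup>2" for y
      using bdf[OF that(1), of y] pos_form[OF pos[OF that(2)], of y] by (simp add: inner_diff_left)
    from pos_norm_sq_le[OF _ this, of x] that(3) show ?thesis
      by (simp add: le_bop_iff_diff[of Z] inner_diff_left)
  qed
  have "\<exists>v. ((\<lambda>Y. Y \<cdot> x) \<longlongrightarrow> v) F" for x
  proof -
    let ?q = "SUP Y\<in>D. inner (Y \<cdot> x) x"
    have "\<exists>Y\<in>D. ?q - 1 / Suc n < inner (Y \<cdot> x) x" for n :: nat
      using less_cSUP_iff[OF ne bda, of "?q - 1 / Suc n" x] by simp
    then obtain Y where Y: "\<And>n::nat. Y n \<in> D" "\<And>n. ?q - 1 / Suc n < inner (Y n \<cdot> x) x" by metis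
    define c where "c n = sqrt (M * (1 / Suc n))" for n
    have c: "c \<longlonglongrightarrow> 0"
    proof -
      have "(\<lambda>n. sqrt (M * (1 / Suc n))) \<longlonglongrightarrow> sqrt (M * 0)"
        by (intro tendsto_intros LIMSEQ_Suc lim_1_over_n)
      then show ?thesis by (simp add: c_def[abs_def])
    qed
    have close: "norm (Z \<cdot> x - Y n \<cdot> x) \<le> c n" if "Z \<in> D" "Y n \<le> Z" for Z n
    proof -
      have "inner (Z \<cdot> x) x \<le> ?q" by (rule cSUP_upper[OF that(1) bda])
      then have "inner (Z \<cdot> x) x - inner (Y n \<cdot> x) x \<le> 1 / Suc n" using Y(2)[of n] by linarith
      from mult_left_mono[OF this M0] diff[OF that(1) Y(1) that(2), of x]
      have "(norm (Z \<cdot> x - Y n \<cdot> x))\<^sup>2 \<le> M * (1 / Suc n)" by linarith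
      then show ?thesis unfolding c_def by (rule real_le_rsqrt)
    qed
    \<comment> \<open>The chosen \<open>Y n\<close> need not be increasing, so two of them are
      compared through a common upper bound in \<open>D\<close>.\<close>
    have close2: "norm (Y m \<cdot> x - Y n \<cdot> x) \<le> c m + c n" for m n
    proof -
      obtain Z where Z: "Z \<in> D" "Y m \<le> Z" "Y n \<le> Z" using dir Y(1) by blast
      have "Y m \<cdot> x - Y n \<cdot> x = (Z \<cdot> x - Y n \<cdot> x) - (Z \<cdot> x - Y m \<cdot> x)" by simp
      also have "norm \<dots> \<le> norm (Z \<cdot> x - Y n \<cdot> x) + norm (Z \<cdot> x - Y m \<cdot> x)"
        by (rule norm_triangle_ineq4)
      finally show ?thesis using close[OF Z(1,2)] close[OF Z(1,3)] by linarith
    qed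
    have "Cauchy (\<lambda>n. Y n \<cdot> x)"
    proof (rule metric_CauchyI)
      fix e :: real assume "0 < e"
      then obtain N where N: "\<And>n. n \<ge> N \<Longrightarrow> c n < e / 2"
        using order_tendstoD(2)[OF c, of "e/2"] by (auto simp: eventually_sequentially)
      have "dist (Y m \<cdot> x) (Y n \<cdot> x) < e" if "m \<ge> N" "n \<ge> N" for m n
        using close2[of m n] N[OF that(1)] N[OF that(2)] by (simp add: dist_norm)
      then show "\<exists>M. \<forall>m\<ge>M. \<forall>n\<ge>M. dist (Y m \<cdot> x) (Y n \<cdot> x) < e" by blast
    qed
    then obtain v where v: "(\<lambda>n. Y n \<cdot> x) \<longlonglongrightarrow> v" using Cauchy_convergent convergent_def by blast
    have vc: "norm (v - Y n \<cdot> x) \<le> c n" for n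
    proof (rule LIMSEQ_le)
      show "(\<lambda>m. norm (Y m \<cdot> x - Y n \<cdot> x)) \<longlonglongrightarrow> norm (v - Y n \<cdot> x)" by (intro tendsto_intros v)
      show "(\<lambda>m. c m + c n) \<longlonglongrightarrow> c n" using tendsto_add[OF c tendsto_const[of "c n"]] by simp
    qed (use close2 in auto)
    have "((\<lambda>Y. Y \<cdot> x) \<longlongrightarrow> v) F"
    proof (rule tendstoI)
      fix e :: real assume "0 < e"
      then obtain n where n: "c n < e / 2"
        using order_tendstoD(2)[OF c, of "e/2"] by (auto simp: eventually_sequentially)
      have "dist (Z \<cdot> x) v < e" if "Z \<in> D" "Y n \<le> Z" for Z
      proof -
        have "norm (Z \<cdot> x - v) = norm ((Z \<cdot> x - Y n \<cdot> x) - (v - Y n \<cdot> x))" by simp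
        also have "\<dots> \<le> norm (Z \<cdot> x - Y n \<cdot> x) + norm (v - Y n \<cdot> x)" by (rule norm_triangle_ineq4)
        finally show ?thesis using close[OF that] vc[of n] n by (simp add: dist_norm)
      qed
      then show "\<forall>\<^sub>F Z in F. dist (Z \<cdot> x) v < e" unfolding ev using Y(1) by blast
    qed
    then show ?thesis by blast
  qed
  then obtain f where f: "\<And>x. ((\<lambda>Y. Y \<cdot> x) \<longlongrightarrow> f x) F" by metis
  note uniq = tendsto_unique[OF nb f]
  have "\<exists>X. \<forall>x. X \<cdot> x = f x"
  proof (rule ex_bop)
    show "f (x + y) = f x + f y" for x y
      by (rule uniq) (simp add: tendsto_add f)
    show "f (r *\<^sub>R x) = r *\<^sub>R f x" for r x
      by (rule uniq) (simp add: tendsto_scaleR f)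
    show "f (\<i> *\<^sub>C x) = \<i> *\<^sub>C f x" for x
      by (rule uniq) (simp add: bounded_linear.tendsto[OF bounded_linear_scaleC] f)
    show "norm (f x) \<le> M * norm x" for x
    proof (rule tendsto_upperbound[OF tendsto_norm[OF f]])
      have "norm (Y \<cdot> x) \<le> M * norm x" if "Y \<in> D" for Y
      proof -
        have "norm Y \<le> M" by (rule pos_norm_le[OF pos[OF that] M0 bdf[OF that]])
        from mult_right_mono[OF this norm_ge_zero[of x]] norm_bop_apply[of Y x] show ?thesis
          by linarith
      qed
      then show "\<forall>\<^sub>F Y in F. norm (Y \<cdot> x) \<le> M * norm x" unfolding ev using ne by blast
    qed (rule nb)
  qed
  then obtain X where X: "\<And>x. X \<cdot> x = f x" by blast
  have ev_sa: "\<forall>\<^sub>F Y in F. inner (Y \<cdot> x) y = inner x (Y \<cdot> y)" for x y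
    unfolding ev using ne pos pos_selfadj selfadjD by blast
  have sa: "selfadj X"
    unfolding selfadj_def X
  proof (intro allI)
    fix x y
    have "((\<lambda>Y. inner x (Y \<cdot> y)) \<longlongrightarrow> inner (f x) y) F"
      by (rule Lim_transform_eventually[OF _ ev_sa]) (intro tendsto_intros f)
    moreover have "((\<lambda>Y. inner x (Y \<cdot> y)) \<longlongrightarrow> inner x (f y)) F" by (intro tendsto_intros f)
    ultimately show "inner (f x) y = inner x (f y)" by (rule tendsto_unique[OF nb])
  qed
  have lim: "((\<lambda>Y. inner (Y \<cdot> x) x) \<longlongrightarrow> inner (X \<cdot> x) x) F" for x
    unfolding X by (intro tendsto_intros f)
  have up: "inner (Y \<cdot> x) x \<le> inner (X \<cdot> x) x" if "Y \<in> D" for Y x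
    by (rule tendsto_lowerbound[OF lim _ nb]) (use that le_bop_form in \<open>auto simp: ev\<close>)
  have "inner (X \<cdot> x) x = (SUP Y\<in>D. inner (Y \<cdot> x) x)" for x
  proof (rule antisym)
    show "inner (X \<cdot> x) x \<le> (SUP Y\<in>D. inner (Y \<cdot> x) x)"
      by (rule tendsto_upperbound[OF lim _ nb])
        (use ne cSUP_upper[OF _ bda] in \<open>auto simp: ev\<close>)
    show "(SUP Y\<in>D. inner (Y \<cdot> x) x) \<le> inner (X \<cdot> x) x"
      by (rule cSUP_least[OF ne up])
  qed
  moreover have "Y \<le> X" if "Y \<in> D" for Y
    using up[OF that] sa pos_selfadj[OF pos[OF that]] by (simp add: le_bop_iff_form)
  ultimately show ?thesis using that sa by blast
qed

text \<open>Monotone convergence for operators: the forms converge to those of the supremum, and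
  positivity of \<open>X - Y n\<close> upgrades this to strong convergence.\<close>

lemma incseq_sot_limit:
  fixes Y :: "nat \<Rightarrow> 'a::complex_hilbert bop"
  assumes inc: "\<And>n. Y n \<le> Y (Suc n)" and pos: "\<And>n. 0 \<le> Y n" and bd: "\<And>n. Y n \<le> B"
  obtains X where "selfadj X" "0 \<le> X" "X \<le> B" "\<And>n. Y n \<le> X" "sot_tendsto Y X sequentially"
proof -
  have mono: "m \<le> n \<Longrightarrow> Y m \<le> Y n" for m n using lift_Suc_mono_le[of Y] inc by blast
  have dir: "\<exists>W\<in>range Y. A \<le> W \<and> C \<le> W" if AC: "A \<in> range Y" "C \<in> range Y" for A C
  proof -
    obtain m n where "A = Y m" "C = Y n" using AC by blast
    then show ?thesis using mono by (intro bexI[of _ "Y (max m n)"]) auto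
  qed
  obtain X where X: "selfadj X" "\<And>x. inner (X \<cdot> x) x = (SUP Z\<in>range Y. inner (Z \<cdot> x) x)"
    "\<And>Z. Z \<in> range Y \<Longrightarrow> Z \<le> X"
    by (rule directed_supremum[of "range Y" B, OF _ dir]) (use pos bd in auto)
  have form_le: "inner (Y n \<cdot> x) x \<le> inner (B \<cdot> x) x" for n x using le_bop_form bd by blast
  have lim: "(\<lambda>n. inner (Y n \<cdot> x) x) \<longlonglongrightarrow> inner (X \<cdot> x) x" for x
  proof -
    have "(\<lambda>n. inner (Y n \<cdot> x) x) \<longlonglongrightarrow> (SUP n. inner (Y n \<cdot> x) x)"
    proof (rule LIMSEQ_incseq_SUP)
      show "bdd_above (range (\<lambda>n. inner (Y n \<cdot> x) x))" using form_le by (auto simp: bdd_above_def)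
      show "incseq (\<lambda>n. inner (Y n \<cdot> x) x)" by (auto simp: incseq_def intro!: le_bop_form mono)
    qed
    then show ?thesis by (simp add: X(2) image_image)
  qed
  have XY: "Y n \<le> X" for n by (rule X(3)) simp
  have "0 \<le> X" using XY pos order_trans by blast
  have "selfadj B"
    using le_bop_selfadj[OF bd[of 0]] pos_selfadj[OF pos[of 0]] selfadj_intros(3) by (metis diff_add_cancel)
  have "X \<le> B"
    unfolding le_bop_iff_form[OF X(1) \<open>selfadj B\<close>]
    using LIMSEQ_le_const2[OF lim] form_le by blast
  have "sot_tendsto Y X sequentially"
    unfolding sot_tendsto_def
  proof
    fix x
    have "(\<lambda>n. (X - Y n) \<cdot> x) \<longlonglongrightarrow> 0"
    proof (rule form_tendsto_imp_sot)
      show "0 \<le> X - Y n" for n using XY[of n] by (simp add: le_bop_iff_diff[of "Y n"])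
      show "inner ((X - Y n) \<cdot> y) y \<le> norm X * (norm y)\<^sup>2" for n y
        using form_le_norm[of X y] pos_form[OF pos, of n y] by (simp add: inner_diff_left)
      have "(\<lambda>n. inner (X \<cdot> x) x - inner (Y n \<cdot> x) x) \<longlonglongrightarrow> inner (X \<cdot> x) x - inner (X \<cdot> x) x"
        by (intro tendsto_intros lim)
      then show "(\<lambda>n. inner ((X - Y n) \<cdot> x) x) \<longlonglongrightarrow> 0" by (simp add: inner_diff_left)
    qed
    from tendsto_diff[OF tendsto_const[of "X \<cdot> x"] this] show "(\<lambda>n. Y n \<cdot> x) \<longlonglongrightarrow> X \<cdot> x" by simp
  qed
  then show ?thesis using that X(1) XY \<open>0 \<le> X\<close> \<open>X \<le> B\<close> by blast
qed

lemma sot_tendsto_unique: "sot_tendsto X L F \<Longrightarrow> sot_tendsto X L' F \<Longrightarrow> F \<noteq> bot \<Longrightarrow> L = L'"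
  unfolding sot_tendsto_def by (intro bop_eqI) (metis tendsto_unique)

lemma sot_lim_eqI: "sot_tendsto X L F \<Longrightarrow> F \<noteq> bot \<Longrightarrow> sot_lim X F = L"
  unfolding sot_lim_def by (intro the_equality) (auto dest: sot_tendsto_unique)

section \<open>Square roots and inverses\<close>

lemma selfadj_power: "selfadj B \<Longrightarrow> selfadj (B ^ n)"
  by (induction n) (simp_all add: selfadj_mult power_commutes)

text \<open>An even power is the square of a self-adjoint operator, an odd one sandwiches
  \<open>B\<close> between two equal self-adjoint powers.\<close>

lemma pos_power:
  fixes B :: "'a::complex_hilbert bop"
  assumes "0 \<le> B" shows "0 \<le> B ^ n"
proof -
  obtain k where "n = k + k \<or> n = k + Suc k" by (metis add_Suc_right even_two_times_div_two mult_2 odd_two_times_div_two_succ Suc_eq_plus1)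
  then show ?thesis
  proof
    assume "n = k + k"
    then show ?thesis using pos_square[OF selfadj_power[OF pos_selfadj[OF assms]], of k] by (simp add: power_add)
  next
    assume "n = k + Suc k"
    then have "B ^ n = B ^ k * B * B ^ k" by (simp only: power_add power_Suc mult.assoc)
    then show ?thesis using pos_sandwich[OF selfadj_power[OF pos_selfadj[OF assms]] assms, of k] by simp
  qed
qed

text \<open>The differences of consecutive iterates in the construction of the square root stay in this
  cone, hence are positive.\<close>

inductive cone_poly :: "'a::complex_hilbert bop \<Rightarrow> 'a bop \<Rightarrow> bool" for B where
  zero: "cone_poly B 0"
| step: "cone_poly B X \<Longrightarrow> 0 \<le> r \<Longrightarrow> cone_poly B (X + r *\<^sub>R B ^ n)"

lemma cone_poly_add: "cone_poly B Y \<Longrightarrow> cone_poly B X \<Longrightarrow> cone_poly B (X + Y)"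
proof (induction rule: cone_poly.induct)
  case (step Y r n)
  then have "cone_poly B ((X + Y) + r *\<^sub>R B ^ n)" by (intro cone_poly.step) auto
  then show ?case by (simp only: add.assoc)
qed simp

lemma cone_poly_scale: "cone_poly B X \<Longrightarrow> 0 \<le> c \<Longrightarrow> cone_poly B (c *\<^sub>R X)"
  by (induction rule: cone_poly.induct) (simp_all add: cone_poly.intros scaleR_add_right)

lemma cone_poly_mult_power: "cone_poly B X \<Longrightarrow> cone_poly B (X * B ^ n)"
  by (induction rule: cone_poly.induct) (simp_all add: cone_poly.intros distrib_right flip: power_add)

lemma cone_poly_mult: "cone_poly B Y \<Longrightarrow> cone_poly B X \<Longrightarrow> cone_poly B (X * Y)"
proof (induction rule: cone_poly.induct)
  case (step Y r n)
  then have "cone_poly B (X * Y + r *\<^sub>R (X * B ^ n))"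
    by (intro cone_poly_add cone_poly_scale cone_poly_mult_power) auto
  then show ?case by (simp add: distrib_left)
qed (simp add: cone_poly.zero)

lemma cone_poly_pos: "cone_poly B X \<Longrightarrow> 0 \<le> B \<Longrightarrow> 0 \<le> X"
  by (induction rule: cone_poly.induct) (simp_all add: pos_add pos_scaleR pos_power)

lemma cone_poly_self: "cone_poly B B"
  using cone_poly.step[OF cone_poly.zero, of 1 B 1] by simp

lemma cone_poly_commute: "cone_poly B X \<Longrightarrow> Z * B = B * Z \<Longrightarrow> Z * X = X * Z"
proof (induction rule: cone_poly.induct)
  case (step X r n)
  then show ?case by (simp add: algebra_simps power_commuting_commutes)
qed simp

text \<open>With \<open>B = 1 - A\<close> a root \<open>1 - X\<close> is equivalent to the fixed
  point equation \<open>X = (B + X^2)/2\<close>. Iterating from \<open>0\<close> gives increasing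
  polynomials in \<open>B\<close> of norm at most \<open>1\<close>; commutation with
  \<open>A\<close> survives the limit.\<close>

lemma ex_sqrt_contraction:
  fixes A :: "'a::complex_hilbert bop"
  assumes A: "0 \<le> A" "A \<le> 1"
  shows "\<exists>S. 0 \<le> S \<and> S * S = A \<and> (\<forall>Z. Z * A = A * Z \<longrightarrow> Z * S = S * Z)"
proof -
  define B where "B = 1 - A"
  have B: "0 \<le> B" "B \<le> 1" using A by (simp_all add: B_def le_bop_iff_diff[of _ 1])
  have nB: "norm B \<le> 1" using B by (rule pos_le_one_norm)
  define Y where "Y n = ((\<lambda>X. (1/2) *\<^sub>R (B + X * X)) ^^ n) 0" for n
  have Y0: "Y 0 = 0" and YS: "Y (Suc n) = (1/2) *\<^sub>R (B + Y n * Y n)" for n by (simp_all add: Y_def)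
  have pp: "cone_poly B (Y n)" for n
    by (induction n) (simp_all add: Y0 YS cone_poly.zero cone_poly_scale cone_poly_add cone_poly_self cone_poly_mult)
  have dd: "cone_poly B (Y (Suc n) - Y n)" for n
  proof (induction n)
    case 0
    show ?case using cone_poly_scale[OF cone_poly_self[of B], of "1/2"] by (simp add: Y0 YS)
  next
    case (Suc n)
    have "Y n * B = B * Y n" using cone_poly_commute[OF pp, of B] by simp
    from cone_poly_commute[OF pp this, of "Suc n"] have com: "Y n * Y (Suc n) = Y (Suc n) * Y n" .
    \<comment> \<open>A difference of squares, which factors because the iterates commute; so the
      next difference stays in the cone.\<close>
    have "Y (Suc (Suc n)) - Y (Suc n) = (1/2) *\<^sub>R ((Y (Suc n) + Y n) * (Y (Suc n) - Y n))"
      by (subst (1 2) YS) (simp add: algebra_simps com)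
    then show ?case using Suc pp by (simp add: cone_poly_scale cone_poly_mult cone_poly_add)
  qed
  have pos: "0 \<le> Y n" for n using cone_poly_pos[OF pp B(1)] .
  have inc: "Y n \<le> Y (Suc n)" for n
    using cone_poly_pos[OF dd[of n] B(1)] by (simp add: le_bop_iff_diff[of "Y n"])
  have nY: "norm (Y n) \<le> 1" for n
  proof (induction n)
    case (Suc n)
    show ?case
    proof (rule norm_bop_le)
      fix x
      have "norm (Y n \<cdot> Y n \<cdot> x) \<le> 1 * (1 * norm x)"
        by (intro order_trans[OF norm_bop_apply] mult_mono Suc order_trans[OF norm_bop_apply[of "Y n" x]] mult_right_mono) auto
      moreover have "norm (B \<cdot> x) \<le> 1 * norm x"
        by (intro order_trans[OF norm_bop_apply] mult_right_mono nB) auto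
      ultimately show "norm (Y (Suc n) \<cdot> x) \<le> 1 * norm x"
        using norm_triangle_ineq[of "B \<cdot> x" "Y n \<cdot> Y n \<cdot> x"] by (simp add: YS)
    qed simp
  qed (simp add: Y0)
  have le1: "Y n \<le> 1" for n using nY pos pos_selfadj norm_le_one_imp_le by blast
  obtain X where X: "selfadj X" "0 \<le> X" "X \<le> 1" "sot_tendsto Y X sequentially"
    using incseq_sot_limit[of Y 1, OF inc pos le1] by metis
  have lim: "(\<lambda>n. Y n \<cdot> x) \<longlonglongrightarrow> X \<cdot> x" for x using X(4) by (simp add: sot_tendsto_def)
  have lim2: "(\<lambda>n. Y n \<cdot> Y n \<cdot> x) \<longlonglongrightarrow> X \<cdot> X \<cdot> x" for x
  proof -
    \<comment> \<open>The product converges strongly because the left factors stay in the unit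
      ball.\<close>
    have "(\<lambda>n. Y n \<cdot> (Y n \<cdot> x - X \<cdot> x)) \<longlonglongrightarrow> 0"
    proof (rule Lim_null_comparison)
      show "\<forall>\<^sub>F n in sequentially. norm (Y n \<cdot> (Y n \<cdot> x - X \<cdot> x)) \<le> norm (Y n \<cdot> x - X \<cdot> x)"
        using order_trans[OF norm_bop_apply mult_right_mono[OF nY norm_ge_zero]]
        by (intro always_eventually allI) (simp only: mult_1_left)
      show "(\<lambda>n. norm (Y n \<cdot> x - X \<cdot> x)) \<longlonglongrightarrow> 0"
        using tendsto_norm[OF tendsto_diff[OF lim tendsto_const[of "X \<cdot> x"]], of x] by simp
    qed
    from tendsto_add[OF this lim[of "X \<cdot> x"]] show ?thesis by simp
  qed
  have "(\<lambda>n. Y (Suc n) \<cdot> x) \<longlonglongrightarrow> (1/2) *\<^sub>R (B \<cdot> x + X \<cdot> X \<cdot> x)" for x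
    unfolding YS by simp (intro tendsto_intros lim2)
  then have h: "X \<cdot> x = (1/2) *\<^sub>R (B \<cdot> x + X \<cdot> X \<cdot> x)" for x
    using LIMSEQ_unique[OF LIMSEQ_Suc[OF lim[of x]]] by blast
  have eq: "X \<cdot> x + X \<cdot> x = B \<cdot> x + X \<cdot> X \<cdot> x" for x
    using arg_cong[OF h[of x], of "\<lambda>v. 2 *\<^sub>R v"] by (simp add: scaleR_2)
  have "(1 - X) * (1 - X) = A"
  proof (rule bop_eqI)
    fix x show "((1 - X) * (1 - X)) \<cdot> x = A \<cdot> x" using eq[of x] by (simp add: B_def algebra_simps)
  qed
  moreover have "0 \<le> 1 - X" using X(3) by (simp add: le_bop_iff_diff[of X])
  moreover have "Z * (1 - X) = (1 - X) * Z" if "Z * A = A * Z" for Z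
  proof -
    have "Z * B = B * Z" using that by (simp add: B_def algebra_simps)
    then have "Z * Y n = Y n * Z" for n using cone_poly_commute pp by blast
    then have c: "Z \<cdot> Y n \<cdot> x = Y n \<cdot> Z \<cdot> x" for n x by (metis bop_simps(6))
    have "Z \<cdot> X \<cdot> x = X \<cdot> Z \<cdot> x" for x
      by (rule LIMSEQ_unique[OF tendsto_bop[OF lim]]) (simp add: c lim)
    then show ?thesis by (intro bop_eqI) simp
  qed
  ultimately show ?thesis by blast
qed

lemma ex_sqrt:
  fixes A :: "'a::complex_hilbert bop"
  assumes A: "0 \<le> A"
  shows "\<exists>S. 0 \<le> S \<and> S * S = A \<and> (\<forall>Z. Z * A = A * Z \<longrightarrow> Z * S = S * Z)"
proof -
  \<comment> \<open>Adding \<open>1\<close> keeps the divisor positive when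
    \<open>A = 0\<close>.\<close>
  define c where "c = norm A + 1"
  have c: "0 < c" by (simp add: c_def add_nonneg_pos)
  have "(1/c) *\<^sub>R A \<le> 1"
    using c A by (intro norm_le_one_imp_le) (auto simp: pos_selfadj c_def)
  moreover have "0 \<le> (1/c) *\<^sub>R A" using A c by (simp add: pos_scaleR)
  ultimately obtain S where S: "0 \<le> S" "S * S = (1/c) *\<^sub>R A"
    "\<forall>Z. Z * ((1/c) *\<^sub>R A) = ((1/c) *\<^sub>R A) * Z \<longrightarrow> Z * S = S * Z"
    using ex_sqrt_contraction[of "(1/c) *\<^sub>R A"] by blast
  have "0 \<le> sqrt c *\<^sub>R S" using S(1) c by (simp add: pos_scaleR)
  moreover have "(sqrt c *\<^sub>R S) * (sqrt c *\<^sub>R S) = A" using S(2) c by simp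
  moreover have "Z * (sqrt c *\<^sub>R S) = (sqrt c *\<^sub>R S) * Z" if "Z * A = A * Z" for Z
    using S(3)[rule_format, of Z] that by simp
  ultimately show ?thesis by blast
qed

text \<open>Two roots need not be known to commute with each other. The root from
  \<open>ex_sqrt\<close> commutes with everything that commutes with \<open>A\<close>, in particular
  with any root of \<open>A\<close>, so both are compared with it.\<close>

lemma sqrt_unique:
  fixes A :: "'a::complex_hilbert bop"
  assumes S: "0 \<le> S" "S * S = A" and S': "0 \<le> S'" "S' * S' = A"
  shows "S = S'"
proof -
  have gen: "V = W" if V: "0 \<le> V" "V * V = A" "\<And>Z. Z * A = A * Z \<Longrightarrow> Z * V = V * Z"
    and W: "0 \<le> W" "W * W = A" for V W
  proof (rule bop_eqI)
    fix x
    have "W * A = A * W" by (simp add: mult.assoc flip: W(2))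
    then have "W * V = V * W" by (rule V(3))
    then have com: "W \<cdot> V \<cdot> x = V \<cdot> W \<cdot> x" for x by (metis bop_simps(6))
    have sq: "V \<cdot> V \<cdot> x = W \<cdot> W \<cdot> x" for x using V(2) W(2) by (metis bop_simps(6))
    \<comment> \<open>Commutation gives \<open>(V + W) y = 0\<close>. Both forms at \<open>y\<close>
      are nonnegative and add up to zero, so \<open>V y = W y = 0\<close>, and
      \<open>inner y y\<close> is the product of \<open>x\<close> with
      \<open>V y - W y\<close>.\<close>
    define y where "y = V \<cdot> x - W \<cdot> x"
    have "V \<cdot> y + W \<cdot> y = 0" by (simp add: y_def com sq)
    then have "inner (V \<cdot> y) y + inner (W \<cdot> y) y = 0" by (simp flip: inner_add_left)
    then have "inner (V \<cdot> y) y = 0" "inner (W \<cdot> y) y = 0"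
      using pos_form[OF V(1), of y] pos_form[OF W(1), of y] by linarith+
    then have "V \<cdot> y = 0" "W \<cdot> y = 0"
      using pos_form_zero_iff[OF V(1), of y] pos_form_zero_iff[OF W(1), of y] by simp_all
    then have "inner y y = 0"
      using selfadjD[OF pos_selfadj[OF V(1)], of x y] selfadjD[OF pos_selfadj[OF W(1)], of x y]
      by (simp add: y_def inner_diff_left)
    then show "V \<cdot> x = W \<cdot> x" by (simp add: y_def)
  qed
  have "0 \<le> A" using pos_square[OF pos_selfadj[OF S(1)]] S by simp
  then obtain V where V: "0 \<le> V" "V * V = A" "\<And>Z. Z * A = A * Z \<Longrightarrow> Z * V = V * Z"
    using ex_sqrt by metis
  have "V = S" "V = S'" by (rule gen[OF V S], assumption) (rule gen[OF V S'], assumption)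
  then show ?thesis by simp
qed

lemma op_sqrt:
  assumes "0 \<le> A"
  shows op_sqrt_pos: "0 \<le> op_sqrt A" and op_sqrt_square: "op_sqrt A * op_sqrt A = A"
    and op_sqrt_commute: "Z * A = A * Z \<Longrightarrow> Z * op_sqrt A = op_sqrt A * Z"
proof -
  obtain S where S: "0 \<le> S" "S * S = A" "\<forall>Z. Z * A = A * Z \<longrightarrow> Z * S = S * Z"
    using ex_sqrt[OF assms] by blast
  have eq: "op_sqrt A = S"
    unfolding op_sqrt_def
  proof (rule the_equality)
    show "0 \<le> S \<and> S * S = A" using S(1,2) by blast
    show "T = S" if "0 \<le> T \<and> T * T = A" for T
      using sqrt_unique[of T A S] that S(1,2) by blast
  qed
  show "0 \<le> op_sqrt A" "op_sqrt A * op_sqrt A = A" unfolding eq by (rule S)+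
  show "Z * A = A * Z \<Longrightarrow> Z * op_sqrt A = op_sqrt A * Z" unfolding eq using S(3) by blast
qed

section \<open>Inverses of operators that are bounded below\<close>

lemma op_inv_eqI:
  assumes "X * Y = 1" "Y * X = 1"
  shows "op_inv X = Y"
  unfolding op_inv_def
proof (rule the_equality)
  fix Z assume "X * Z = 1 \<and> Z * X = 1"
  then show "Z = Y" by (metis assms(1) mult.assoc mult_1_left mult_1_right)
qed (use assms in simp)

text \<open>The lower bound makes the range complete, hence closed. The residual of a projection
  onto the range is orthogonal to its own image, so its form and thereby the residual vanish: the
  range is everything.\<close>

lemma bounded_below_inverse:
  assumes pos: "0 \<le> X" and e: "0 < e" and low: "\<And>x. e * (norm x)\<^sup>2 \<le> inner (X \<cdot> x) x"
  shows "X * op_inv X = 1" "op_inv X * X = 1" "0 \<le> op_inv X"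
proof -
  have nl: "e * norm x \<le> norm (X \<cdot> x)" for x
  proof -
    have "e * norm x * norm x \<le> norm (X \<cdot> x) * norm x"
      using low[of x] norm_cauchy_schwarz[of "X \<cdot> x" x] by (simp add: power2_eq_square mult.assoc)
    then show ?thesis by (cases "x = 0") auto
  qed
  have "complete (bop_apply X ` UNIV)"
    by (rule complete_isometric_image[OF e _ bounded_linear_bop]) (use nl complete_UNIV in auto)
  then have "closed (range (bop_apply X))" by (rule complete_imp_closed)
  moreover have "subspace (range (bop_apply X))"
    by (intro linear_subspace_image bounded_linear.linear bounded_linear_bop subspace_UNIV)
  ultimately have "\<exists>p. \<forall>k. inner (y - X \<cdot> p) (X \<cdot> k) = 0" for y
    using closed_subspace_projection[of "range (bop_apply X)" y] by blast
  then obtain g where g: "\<And>y k. inner (y - X \<cdot> g y) (X \<cdot> k) = 0" by metis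
  have Xg: "X \<cdot> g y = y" for y
  proof -
    have "e * (norm (y - X \<cdot> g y))\<^sup>2 \<le> inner (X \<cdot> (y - X \<cdot> g y)) (y - X \<cdot> g y)" by (rule low)
    also have "\<dots> = 0" using g[of y "y - X \<cdot> g y"] by (simp only: inner_commute)
    finally show ?thesis using e by (simp add: mult_le_0_iff)
  qed
  have inj: "X \<cdot> a = X \<cdot> b \<Longrightarrow> a = b" for a b
    using nl[of "a - b"] e by (simp add: mult_le_0_iff)
  have "\<exists>Y. \<forall>y. Y \<cdot> y = g y"
  proof (rule ex_bop)
    show "norm (g y) \<le> (1/e) * norm y" for y
      using nl[of "g y"] e by (simp add: Xg field_simps)
  qed (rule inj, simp add: Xg)+
  then obtain Y where Y: "\<And>y. Y \<cdot> y = g y" by blast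
  have XY: "X * Y = 1" by (rule bop_eqI) (simp add: Y Xg)
  have YX: "Y * X = 1" by (rule bop_eqI) (simp add: Y inj Xg)
  have "0 \<le> Y"
  proof (rule posI)
    show "selfadj Y" unfolding selfadj_def
      using Xg selfadjD[OF pos_selfadj[OF pos]] by (metis Y)
    show "0 \<le> inner (Y \<cdot> x) x" for x
      using pos_form[OF pos, of "g x"] by (simp add: Y Xg inner_commute)
  qed
  then show "X * op_inv X = 1" "op_inv X * X = 1" "0 \<le> op_inv X"
    using op_inv_eqI[OF XY YX] XY YX by simp_all
qed

section \<open>Functional calculus of a projection-valued measure\<close>

text \<open>Serves both the scalar measures of a projection-valued measure and the measure induced
  by a normal functional.\<close>

lemma real_measure_of:
  fixes \<mu> :: "real set \<Rightarrow> real"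
  assumes nn: "\<And>\<Delta>. \<Delta> \<in> sets borel \<Longrightarrow> 0 \<le> \<mu> \<Delta>" and e: "\<mu> {} = 0"
    and ca: "\<And>F::nat \<Rightarrow> real set. range F \<subseteq> sets borel \<Longrightarrow> disjoint_family F \<Longrightarrow>
      (\<lambda>n. \<mu> (F n)) sums \<mu> (\<Union>n. F n)"
    and M: "M = measure_of UNIV (sets borel) (\<lambda>\<Delta>. ennreal (\<mu> \<Delta>))"
  shows "sets M = sets borel" "space M = UNIV" "\<Delta> \<in> sets borel \<Longrightarrow> emeasure M \<Delta> = ennreal (\<mu> \<Delta>)"
proof -
  show s: "sets M = sets borel"
    unfolding M using sets.sets_measure_of_eq[of borel] by simp
  show "space M = UNIV" unfolding M by (simp add: space_measure_of_conv)
  show "emeasure M \<Delta> = ennreal (\<mu> \<Delta>)" if D: "\<Delta> \<in> sets borel"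
  proof (rule emeasure_measure_of[OF M])
    show "positive (sets M) (\<lambda>\<Delta>. ennreal (\<mu> \<Delta>))" by (simp add: positive_def e)
    show "countably_additive (sets M) (\<lambda>\<Delta>. ennreal (\<mu> \<Delta>))"
      unfolding countably_additive_def s
    proof (intro allI impI)
      fix F :: "nat \<Rightarrow> real set" assume F: "range F \<subseteq> sets borel" "disjoint_family F"
      then have "\<And>n. 0 \<le> \<mu> (F n)" using nn by auto
      from suminf_ennreal_eq[OF this ca[OF F]]
      show "(\<Sum>n. ennreal (\<mu> (F n))) = ennreal (\<mu> (\<Union> (range F)))" .
    qed
  qed (use D s in auto)
qed

text \<open>The left side has exactly the shape used in \<open>spectral_integral\<close>, so
  integrals that are quadratic forms of a bounded operator can be polarized back.\<close>

lemma polarization: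
  assumes "selfadj X"
  shows "(\<Sum>k<4. \<i> ^ k * complex_of_real (inner (X \<cdot> (z + \<i> ^ k *\<^sub>C w)) (z + \<i> ^ k *\<^sub>C w))) / 4
    = cinner (X \<cdot> z) w"
proof -
  have real: "complex_of_real (inner (X \<cdot> v) v) = cinner (X \<cdot> v) v" for v
    using cinner_selfadj[OF assms, of v v] cinner_commute[of "X \<cdot> v" v]
    by (metis Re_cinner Reals_cnj_iff of_real_Re)
  have ex: "cinner (X \<cdot> (z + c *\<^sub>C w)) (z + c *\<^sub>C w) =
      cinner (X \<cdot> z) z + cnj c * cinner (X \<cdot> z) w + c * cinner (X \<cdot> w) z + c * cnj c * cinner (X \<cdot> w) w" for c
    by (simp add: cinner_add_left cinner_add_right cinner_scaleC_left cinner_scaleC_right algebra_simps)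
  have r: "{..<4::nat} = {0, 1, 2, 3}" by auto
  show ?thesis
    unfolding real ex r by (simp add: power3_eq_cube algebra_simps)
qed

locale pvm =
  fixes K :: "'a::complex_hilbert set" and E :: "real set \<Rightarrow> 'a bop"
  assumes K: "closed_csubspace K" and E: "pvm_on K E"
begin

lemma E_selfadj: "\<Delta> \<in> sets borel \<Longrightarrow> selfadj (E \<Delta>)"
  and E_idem: "\<Delta> \<in> sets borel \<Longrightarrow> E \<Delta> * E \<Delta> = E \<Delta>"
  and E_empty [simp]: "E {} = 0" and E_UNIV: "E UNIV = proj K"
  and E_Int: "\<Delta> \<in> sets borel \<Longrightarrow> \<Delta>' \<in> sets borel \<Longrightarrow> E (\<Delta> \<inter> \<Delta>') = E \<Delta> * E \<Delta>'"
  and E_sums: "range F \<subseteq> sets borel \<Longrightarrow> disjoint_family F \<Longrightarrow> (\<lambda>n. E (F n) \<cdot> x) sums (E (\<Union>n. F n) \<cdot> x)"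
  using E unfolding pvm_on_def adj_eq_self_iff by blast+

lemma E_pos: "\<Delta> \<in> sets borel \<Longrightarrow> 0 \<le> E \<Delta>"
  by (simp add: projection_pos E_selfadj E_idem)

lemma E_form: "\<Delta> \<in> sets borel \<Longrightarrow> inner (E \<Delta> \<cdot> x) x = (norm (E \<Delta> \<cdot> x))\<^sup>2"
  by (simp add: projection_form E_selfadj E_idem)

lemma sets_vm [measurable_cong, simp]: "sets (vec_measure E x) = sets borel"
  and space_vm [simp]: "space (vec_measure E x) = UNIV"
  and emeasure_vm: "\<Delta> \<in> sets borel \<Longrightarrow> emeasure (vec_measure E x) \<Delta> = ennreal (inner (E \<Delta> \<cdot> x) x)"
proof -
  have sums: "(\<lambda>n. inner (E (F n) \<cdot> x) x) sums inner (E (\<Union>n. F n) \<cdot> x) x"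
    if "range F \<subseteq> sets borel" "disjoint_family F" for F :: "nat \<Rightarrow> real set"
    by (rule bounded_linear.sums[OF bounded_linear_inner_left E_sums[OF that]])
  have vm: "vec_measure E x = measure_of UNIV (sets borel) (\<lambda>\<Delta>. ennreal (inner (E \<Delta> \<cdot> x) x))"
    by (simp add: vec_measure_def Re_cinner)
  note * = real_measure_of[where \<mu>="\<lambda>\<Delta>. inner (E \<Delta> \<cdot> x) x", OF _ _ sums vm]
  show "sets (vec_measure E x) = sets borel" "space (vec_measure E x) = UNIV"
    "\<Delta> \<in> sets borel \<Longrightarrow> emeasure (vec_measure E x) \<Delta> = ennreal (inner (E \<Delta> \<cdot> x) x)"
    by (rule *; simp add: pos_form E_pos)+
qed

lemma finite_measure_vm: "finite_measure (vec_measure E x)"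
  by (rule finite_measureI) (simp add: emeasure_vm)

lemma measurable_vm: "f \<in> borel_measurable borel \<Longrightarrow> f \<in> borel_measurable (vec_measure E x)"
  by (simp add: measurable_def)

text \<open>\<open>X\<close> is the weak integral of \<open>g\<close> against \<open>E\<close>,
  tested on the diagonal only; as forms determine positive operators, complex measures are avoided
  altogether.\<close>

definition rep :: "(real \<Rightarrow> real) \<Rightarrow> 'a bop \<Rightarrow> bool" where
  "rep g X \<longleftrightarrow> 0 \<le> X \<and> (\<forall>x. (\<integral>\<^sup>+ t. ennreal (g t) \<partial>vec_measure E x) = ennreal (inner (X \<cdot> x) x))"

lemma rep_unique: "rep g X \<Longrightarrow> rep g Y \<Longrightarrow> X = Y"
proof (rule selfadj_form_eqI)
  assume *: "rep g X" "rep g Y"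
  then show "selfadj X" "selfadj Y" by (simp_all add: rep_def pos_selfadj)
  fix x
  have "ennreal (inner (X \<cdot> x) x) = ennreal (inner (Y \<cdot> x) x)" using * by (simp add: rep_def)
  moreover have "0 \<le> inner (X \<cdot> x) x" "0 \<le> inner (Y \<cdot> x) x" using * by (simp_all add: rep_def pos_form)
  ultimately show "inner (X \<cdot> x) x = inner (Y \<cdot> x) x" by simp
qed

lemma rep_indicator: "\<Delta> \<in> sets borel \<Longrightarrow> rep (indicator \<Delta>) (E \<Delta>)"
  unfolding rep_def by (simp add: E_pos ennreal_indicator emeasure_vm)

lemma rep_scale:
  assumes "rep g X" "0 \<le> c" "g \<in> borel_measurable borel" "\<And>t. 0 \<le> g t"
  shows "rep (\<lambda>t. c * g t) (c *\<^sub>R X)"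
  using assms by (simp add: rep_def pos_scaleR ennreal_mult nn_integral_cmult measurable_vm pos_form)

lemma rep_add:
  assumes "rep g X" "rep h Y" "g \<in> borel_measurable borel" "\<And>t. 0 \<le> g t"
    "h \<in> borel_measurable borel" "\<And>t. 0 \<le> h t"
  shows "rep (\<lambda>t. g t + h t) (X + Y)"
  using assms
  by (simp add: rep_def pos_add nn_integral_add measurable_vm pos_form inner_add_left ennreal_plus)

lemma rep_mono:
  assumes "rep g X" "rep h Y" "\<And>t. g t \<le> h t"
  shows "X \<le> Y"
proof -
  have "inner (X \<cdot> x) x \<le> inner (Y \<cdot> x) x" for x
  proof -
    have "ennreal (inner (X \<cdot> x) x) \<le> ennreal (inner (Y \<cdot> x) x)"
      using nn_integral_mono[of "vec_measure E x" "\<lambda>t. ennreal (g t)" "\<lambda>t. ennreal (h t)"] assms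
      by (simp add: rep_def ennreal_leI)
    then show ?thesis using assms(2) by (simp add: rep_def pos_form)
  qed
  then show ?thesis using assms by (simp add: le_bop_iff_form rep_def pos_selfadj)
qed

lemma rep_limit:
  assumes rep: "\<And>i. rep (U i) (X i)" and mU: "\<And>i. U i \<in> borel_measurable borel"
    and inc: "incseq U" and nn: "\<And>i t. 0 \<le> U i t" and lim: "\<And>t. (\<lambda>i. U i t) \<longlonglongrightarrow> u t"
    and sot: "\<And>x. (\<lambda>i. X i \<cdot> x) \<longlonglongrightarrow> X' \<cdot> x"
  shows "rep u X'"
proof -
  have form: "(\<lambda>i. inner (X i \<cdot> x) y) \<longlonglongrightarrow> inner (X' \<cdot> x) y" for x y by (intro tendsto_intros sot)
  have pos: "0 \<le> X i" for i using rep by (simp add: rep_def)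
  have "0 \<le> X'"
  proof (rule posI)
    have "inner (X' \<cdot> x) y = inner x (X' \<cdot> y)" for x y
    proof (rule LIMSEQ_unique[OF form])
      show "(\<lambda>i. inner (X i \<cdot> x) y) \<longlonglongrightarrow> inner x (X' \<cdot> y)"
        unfolding selfadjD[OF pos_selfadj[OF pos]] by (intro tendsto_intros sot)
    qed
    then show "selfadj X'" by (simp add: selfadj_def)
    show "0 \<le> inner (X' \<cdot> x) x" for x
      by (rule LIMSEQ_le_const[OF form]) (use pos pos_form in blast)
  qed
  moreover have "(\<integral>\<^sup>+ t. ennreal (u t) \<partial>vec_measure E x) = ennreal (inner (X' \<cdot> x) x)" for x
  proof (rule LIMSEQ_unique)
    have "(\<lambda>i. \<integral>\<^sup>+ t. ennreal (U i t) \<partial>vec_measure E x) \<longlonglongrightarrow> (\<integral>\<^sup>+ t. ennreal (u t) \<partial>vec_measure E x)"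
    proof (rule nn_integral_LIMSEQ)
      show "incseq (\<lambda>i t. ennreal (U i t))"
        using inc nn by (auto simp: incseq_def le_fun_def intro!: ennreal_leI)
    qed (auto intro!: measurable_vm mU measurable_compose[OF mU] tendsto_ennrealI lim)
    then show "(\<lambda>i. ennreal (inner (X i \<cdot> x) x)) \<longlonglongrightarrow> (\<integral>\<^sup>+ t. ennreal (u t) \<partial>vec_measure E x)"
      using rep by (simp add: rep_def)
    show "(\<lambda>i. ennreal (inner (X i \<cdot> x) x)) \<longlonglongrightarrow> ennreal (inner (X' \<cdot> x) x)"
      by (intro tendsto_ennrealI form)
  qed
  ultimately show ?thesis by (simp add: rep_def)
qed

text \<open>Boundedness keeps the integral a bounded operator; nonnegativity allows all integrals to
  be nonnegative ones, free of integrability conditions.\<close>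

definition bnn :: "(real \<Rightarrow> real) \<Rightarrow> bool" where
  "bnn g \<longleftrightarrow> g \<in> borel_measurable borel \<and> (\<forall>t. 0 \<le> g t) \<and> (\<exists>c. \<forall>t. g t \<le> c)"

text \<open>Existence and multiplicativity of the integral of \<open>u\<close> in one induction. The
  second factor enters through \<open>w\<close> and \<open>Y\<close>, of which only products with
  spectral projections are known; it is first an indicator and then a general function.\<close>

lemma ex_rep_times:
  assumes u: "u \<in> borel_measurable borel" "\<And>t. 0 \<le> u t"
    and w: "w \<in> borel_measurable borel" "\<And>t. 0 \<le> w t"
    and Y: "\<And>A. A \<in> sets borel \<Longrightarrow> rep (\<lambda>t. indicator A t * w t) (E A * Y)"
    and bd: "\<And>t. u t \<le> c"
  shows "\<exists>X. rep u X \<and> rep (\<lambda>t. u t * w t) (X * Y)"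
  using u bd
proof (induction arbitrary: c rule: borel_measurable_induct_real)
  case (set A)
  then show ?case using rep_indicator Y by auto
next
  case (mult u c c')
  show ?case
  \<comment> \<open>For \<open>c = 0\<close> a bound on \<open>c * u\<close> gives no bound on
    \<open>u\<close>, so the induction hypothesis cannot be invoked.\<close>
  proof (cases "c = 0")
    case True
    have "rep (\<lambda>t. 0) 0" by (simp add: rep_def)
    then show ?thesis using True by (intro exI[of _ 0]) simp
  next
    case False
    have "u t \<le> c' / c" for t using mult(5)[of t] mult(1) False by (simp add: field_simps)
    then obtain X where X: "rep u X" "rep (\<lambda>t. u t * w t) (X * Y)" using mult(4) by blast
    have "rep (\<lambda>t. c * u t) (c *\<^sub>R X)" using X(1) mult by (intro rep_scale) auto
    moreover have "rep (\<lambda>t. c * (u t * w t)) (c *\<^sub>R (X * Y))" using X(2) mult w by (intro rep_scale) auto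
    ultimately show ?thesis by (intro exI[of _ "c *\<^sub>R X"]) (simp add: mult.assoc)
  qed
next
  case (add u v c)
  have "u t \<le> c" "v t \<le> c" for t using add(8)[of t] add(2,4)[of t] by linarith+
  then obtain X X' where X: "rep u X" "rep (\<lambda>t. u t * w t) (X * Y)"
    and X': "rep v X'" "rep (\<lambda>t. v t * w t) (X' * Y)" using add(6,7) by metis
  have "rep (\<lambda>t. v t + u t) (X' + X)" using X(1) X'(1) add by (intro rep_add) auto
  moreover have "rep (\<lambda>t. v t * w t + u t * w t) (X' * Y + X * Y)"
    using X(2) X'(2) add w by (intro rep_add) auto
  ultimately show ?case by (intro exI[of _ "X' + X"]) (simp add: distrib_right)
next
  case (seq U)
  have lim: "(\<lambda>i. U i t) \<longlonglongrightarrow> u t" for t using seq(4) by simp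
  have "U i t \<le> c" for i t
    using incseq_le[of "\<lambda>i. U i t", OF _ lim] seq(3) seq(6)[of t]
    by (meson incseq_def le_funD order_trans)
  then obtain X where X: "\<And>i. rep (U i) (X i)" "\<And>i. rep (\<lambda>t. U i t * w t) (X i * Y)"
    using seq(5) by metis
  have inc: "X i \<le> X (Suc i)" for i
    by (rule rep_mono[OF X(1) X(1)]) (use seq(3) in \<open>auto simp: incseq_Suc_iff le_fun_def\<close>)
  have c0: "0 \<le> c" using seq(2)[of 0 0] \<open>U 0 0 \<le> c\<close> by linarith
  have "X i \<le> c *\<^sub>R E UNIV" for i
    by (rule rep_mono[OF X(1) rep_scale[OF rep_indicator]]) (use c0 \<open>\<And>i t. U i t \<le> c\<close> in auto)
  moreover have "0 \<le> X i" for i using X(1) by (simp add: rep_def)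
  ultimately obtain X' where "sot_tendsto X X' sequentially"
    using incseq_sot_limit[of X, OF inc] by blast
  then have sot: "(\<lambda>i. X i \<cdot> x) \<longlonglongrightarrow> X' \<cdot> x" for x by (simp add: sot_tendsto_def)
  have "rep u X'" by (rule rep_limit[OF X(1) seq(1) seq(3) seq(2) lim sot])
  moreover have "rep (\<lambda>t. u t * w t) (X' * Y)"
  proof (rule rep_limit[OF X(2)])
    show "incseq (\<lambda>i t. U i t * w t)"
      using seq(3) w(2) by (auto simp: incseq_def le_fun_def intro!: mult_right_mono)
    show "(\<lambda>i. (X i * Y) \<cdot> x) \<longlonglongrightarrow> (X' * Y) \<cdot> x" for x using sot[of "Y \<cdot> x"] by simp
  qed (use seq w in \<open>auto intro!: tendsto_intros lim\<close>)
  ultimately show ?case by blast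
qed

definition calc :: "(real \<Rightarrow> real) \<Rightarrow> 'a bop" where
  "calc g = (THE X. rep g X)"

lemma rep_times_E:
  assumes "bnn g"
  shows "\<exists>X. rep g X \<and> (\<forall>\<Delta>\<in>sets borel. rep (\<lambda>t. g t * indicator \<Delta> t) (X * E \<Delta>))"
proof -
  have *: "\<exists>X. rep g X \<and> rep (\<lambda>t. g t * indicator \<Delta> t) (X * E \<Delta>)" if D: "\<Delta> \<in> sets borel" for \<Delta>
  proof -
    obtain c where c: "\<And>t. g t \<le> c" using assms by (auto simp: bnn_def)
    have "rep (\<lambda>t. indicator A t * indicator \<Delta> t) (E A * E \<Delta>)" if "A \<in> sets borel" for A
    proof -
      have "(\<lambda>t. indicator A t * indicator \<Delta> t :: real) = indicator (A \<inter> \<Delta>)"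
        by (auto simp: indicator_inter_arith)
      then show ?thesis using rep_indicator[of "A \<inter> \<Delta>"] that D by (simp add: E_Int)
    qed
    then show ?thesis using assms D c by (intro ex_rep_times) (auto simp: bnn_def)
  qed
  then obtain X where "rep g X" by blast
  moreover have "rep (\<lambda>t. g t * indicator \<Delta> t) (X * E \<Delta>)" if "\<Delta> \<in> sets borel" for \<Delta>
    using *[OF that] rep_unique[OF \<open>rep g X\<close>] by blast
  ultimately show ?thesis by blast
qed

lemma rep_calc: "bnn g \<Longrightarrow> rep g (calc g)"
  unfolding calc_def by (rule theI') (use rep_times_E rep_unique in blast)

lemma calc_eqI: "rep g X \<Longrightarrow> calc g = X"
  unfolding calc_def using rep_unique by blast

lemma calc_nn_integral:
  "bnn g \<Longrightarrow> (\<integral>\<^sup>+ t. ennreal (g t) \<partial>vec_measure E x) = ennreal (inner (calc g \<cdot> x) x)"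
  using rep_calc by (simp add: rep_def)

lemma calc_pos: "bnn g \<Longrightarrow> 0 \<le> calc g"
  using rep_calc by (simp add: rep_def)

lemma calc_selfadj: "bnn g \<Longrightarrow> selfadj (calc g)"
  by (simp add: calc_pos pos_selfadj)

lemma bnn_mult [simp]:
  assumes "bnn g" "bnn h" shows "bnn (\<lambda>t. g t * h t)"
proof -
  obtain c d where "\<And>t. g t \<le> c" "\<And>t. h t \<le> d" using assms by (auto simp: bnn_def)
  then have "g t * h t \<le> c * d" for t
    using assms by (intro mult_mono) (auto simp: bnn_def intro: order_trans)
  then show ?thesis using assms by (auto simp: bnn_def)
qed

lemma bnn_indicator [simp]: "\<Delta> \<in> sets borel \<Longrightarrow> bnn (indicator \<Delta>)"
  by (auto simp: bnn_def intro!: exI[of _ 1])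

lemma bnn_one [simp]: "bnn (\<lambda>t. 1)"
  by (auto simp: bnn_def)

lemma calc_indicator: "\<Delta> \<in> sets borel \<Longrightarrow> calc (indicator \<Delta>) = E \<Delta>"
  by (rule calc_eqI) (rule rep_indicator)

lemma calc_one: "calc (\<lambda>t. 1) = proj K"
  using calc_indicator[of UNIV] by (simp add: E_UNIV indicator_def)

lemma calc_mult:
  assumes g: "bnn g" and h: "bnn h"
  shows "calc (\<lambda>t. g t * h t) = calc g * calc h"
proof -
  obtain X where X: "rep h X" "\<And>\<Delta>. \<Delta> \<in> sets borel \<Longrightarrow> rep (\<lambda>t. h t * indicator \<Delta> t) (X * E \<Delta>)"
    using rep_times_E[OF h] by blast
  \<comment> \<open>\<open>X * E \<Delta>\<close> represents a nonnegative function, so it is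
    self-adjoint, and taking adjoints shows that its factors commute. \<open>ex_rep_times\<close>
    wants the projection on the left.\<close>
  have com: "X * E \<Delta> = E \<Delta> * X" if "\<Delta> \<in> sets borel" for \<Delta>
  proof (rule bop_eqI, rule inner_ext)
    fix x y
    have "selfadj (X * E \<Delta>)" "selfadj X" using X(1) X(2)[OF that] by (simp_all add: rep_def pos_selfadj)
    then show "inner ((X * E \<Delta>) \<cdot> x) y = inner ((E \<Delta> * X) \<cdot> x) y"
      using E_selfadj[OF that] by (simp add: selfadj_def)
  qed
  obtain c where "\<And>t. g t \<le> c" using g by (auto simp: bnn_def)
  then have "\<exists>Z. rep g Z \<and> rep (\<lambda>t. g t * h t) (Z * X)"
    using g h by (intro ex_rep_times) (auto simp: bnn_def com[symmetric] mult.commute[of _ "h _"] intro!: X(2))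
  then obtain Z where "rep g Z" "rep (\<lambda>t. g t * h t) (Z * X)" by blast
  with X(1) show ?thesis by (simp add: calc_eqI)
qed

lemma calc_commute: "bnn g \<Longrightarrow> bnn h \<Longrightarrow> calc g * calc h = calc h * calc g"
  by (simp add: calc_mult[symmetric] mult.commute)

lemma calc_add: "bnn g \<Longrightarrow> bnn h \<Longrightarrow> calc (\<lambda>t. g t + h t) = calc g + calc h"
  by (intro calc_eqI rep_add rep_calc) (auto simp: bnn_def)

lemma calc_mono: "bnn g \<Longrightarrow> bnn h \<Longrightarrow> (\<And>t. g t \<le> h t) \<Longrightarrow> calc g \<le> calc h"
  using rep_mono[OF rep_calc rep_calc] .

lemma proj_calc: "bnn g \<Longrightarrow> proj K * calc g = calc g" "bnn g \<Longrightarrow> calc g * proj K = calc g"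
  using calc_mult[of "\<lambda>t. 1" g] calc_mult[of g "\<lambda>t. 1"] by (simp_all add: calc_one)

lemma calc_in: "bnn g \<Longrightarrow> calc g \<cdot> x \<in> K"
  using proj_in[OF K] proj_calc(1) by (metis bop_simps(6))

lemma calc_proj_apply: "bnn g \<Longrightarrow> calc g \<cdot> proj K \<cdot> x = calc g \<cdot> x"
  using proj_calc(2) by (metis bop_simps(6))

lemma E_in: "\<Delta> \<in> sets borel \<Longrightarrow> E \<Delta> \<cdot> x \<in> K"
  using calc_in[of "indicator \<Delta>"] by (simp add: calc_indicator)

lemma norm_calc_sq: "bnn g \<Longrightarrow> (norm (calc g \<cdot> x))\<^sup>2 = inner (calc (\<lambda>t. g t * g t) \<cdot> x) x"
  by (simp add: calc_mult power2_norm_eq_inner selfadjD[OF calc_selfadj])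

text \<open>\<open>calc g\<close> is self-adjoint and commutes with the projections, so passing from
  \<open>x\<close> to \<open>calc g x\<close> multiplies the scalar measure by \<open>g^2\<close>.
  Integrals at vectors in the range of \<open>calc g\<close> are thereby moved to
  \<open>x\<close>.\<close>

lemma vm_calc:
  assumes g: "bnn g"
  shows "vec_measure E (calc g \<cdot> x) = density (vec_measure E x) (\<lambda>t. ennreal ((g t)\<^sup>2))"
proof (rule measure_eqI)
  fix \<Delta> assume "\<Delta> \<in> sets (vec_measure E (calc g \<cdot> x))"
  then have D: "\<Delta> \<in> sets borel" by simp
  have [measurable]: "g \<in> borel_measurable borel" using g by (simp add: bnn_def)
  have "inner (E \<Delta> \<cdot> calc g \<cdot> x) (calc g \<cdot> x) = inner ((calc g * calc (indicator \<Delta>) * calc g) \<cdot> x) x"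
    by (simp add: selfadjD[OF calc_selfadj[OF g]] calc_indicator[OF D])
  also have "calc g * calc (indicator \<Delta>) * calc g = calc (\<lambda>t. g t * indicator \<Delta> t * g t)"
    using g D by (simp add: calc_mult)
  finally have "emeasure (vec_measure E (calc g \<cdot> x)) \<Delta>
      = (\<integral>\<^sup>+ t. ennreal (g t * indicator \<Delta> t * g t) \<partial>vec_measure E x)"
    using g D by (simp add: emeasure_vm calc_nn_integral)
  also have "\<dots> = (\<integral>\<^sup>+ t. ennreal ((g t)\<^sup>2) * indicator \<Delta> t \<partial>vec_measure E x)"
    by (intro nn_integral_cong) (simp add: power2_eq_square indicator_def)
  also have "\<dots> = emeasure (density (vec_measure E x) (\<lambda>t. ennreal ((g t)\<^sup>2))) \<Delta>"
    using D by (subst emeasure_density) auto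
  finally show "emeasure (vec_measure E (calc g \<cdot> x)) \<Delta>
    = emeasure (density (vec_measure E x) (\<lambda>t. ennreal ((g t)\<^sup>2))) \<Delta>" .
qed simp

lemma nn_integral_calc:
  assumes g: "bnn g" and f: "f \<in> borel_measurable borel"
  shows "(\<integral>\<^sup>+ t. f t \<partial>vec_measure E (calc g \<cdot> x)) = (\<integral>\<^sup>+ t. ennreal ((g t)\<^sup>2) * f t \<partial>vec_measure E x)"
proof -
  have [measurable]: "g \<in> borel_measurable borel" using g by (simp add: bnn_def)
  show ?thesis unfolding vm_calc[OF g] by (rule nn_integral_density) (use f in \<open>auto intro!: measurable_vm\<close>)
qed

lemma E_tendsto:
  assumes "range F \<subseteq> sets borel" "incseq F"
  shows "(\<lambda>n. E (F n) \<cdot> x) \<longlonglongrightarrow> E (\<Union>n. F n) \<cdot> x"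
proof -
  have F: "F n \<in> sets borel" for n using assms(1) by blast
  have sU: "(\<Union>n. F n) \<in> sets borel" using F by blast
  have "(\<lambda>n. emeasure (vec_measure E x) (F n)) \<longlonglongrightarrow> emeasure (vec_measure E x) (\<Union>n. F n)"
    by (rule Lim_emeasure_incseq) (use assms in auto)
  then have "(\<lambda>n. ennreal (inner (E (F n) \<cdot> x) x)) \<longlonglongrightarrow> ennreal (inner (E (\<Union>n. F n) \<cdot> x) x)"
    by (simp add: emeasure_vm F sU)
  then have lim: "(\<lambda>n. inner (E (F n) \<cdot> x) x) \<longlonglongrightarrow> inner (E (\<Union>n. F n) \<cdot> x) x"
    by (rule tendsto_ennrealD) (simp_all add: pos_form E_pos F sU)
  have le: "E (F n) \<le> E (\<Union>n. F n)" for n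
    using calc_mono[of "indicator (F n)" "indicator (\<Union>n. F n)"] F sU
    by (auto simp: calc_indicator indicator_def)
  have "(\<lambda>n. (E (\<Union>n. F n) - E (F n)) \<cdot> x) \<longlonglongrightarrow> 0"
  proof (rule form_tendsto_imp_sot)
    show "0 \<le> E (\<Union>n. F n) - E (F n)" for n using le[of n] by (simp add: le_bop_iff_diff[of "E (F n)"])
    show "inner ((E (\<Union>n. F n) - E (F n)) \<cdot> y) y \<le> norm (E (\<Union>n. F n)) * (norm y)\<^sup>2" for n y
      using form_le_norm[of "E (\<Union>n. F n)" y] pos_form[OF E_pos[OF F], of n y] by (simp add: inner_diff_left)
    show "(\<lambda>n. inner ((E (\<Union>n. F n) - E (F n)) \<cdot> x) x) \<longlonglongrightarrow> 0"
      using tendsto_diff[OF tendsto_const[of "inner (E (\<Union>n. F n) \<cdot> x) x"] lim] by (simp add: inner_diff_left)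
  qed
  from tendsto_diff[OF tendsto_const[of "E (\<Union>n. F n) \<cdot> x"] this] show ?thesis by simp
qed

lemma vm_null_imp_zero:
  assumes "x \<in> K" "p \<in> borel_measurable borel" "\<And>t. 0 < p t"
    and "(\<integral>\<^sup>+ t. ennreal (p t) \<partial>vec_measure E x) = 0"
  shows "x = 0"
proof -
  have "AE t in vec_measure E x. ennreal (p t) = 0"
    using assms(4) by (subst (asm) nn_integral_0_iff_AE) (use assms(2) in \<open>auto intro!: measurable_vm\<close>)
  then have "AE t in vec_measure E x. False" using assms(3) by (auto simp: ennreal_eq_0_iff not_le)
  then have "emeasure (vec_measure E x) UNIV = 0"
    using emeasure_eq_0_AE[of "\<lambda>t. True" "vec_measure E x"] by simp
  then have "ennreal (inner (E UNIV \<cdot> x) x) = 0" by (simp add: emeasure_vm)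
  then have "ennreal ((norm x)\<^sup>2) = 0"
    using assms(1) proj_fix_iff[OF K, of x] by (simp add: E_UNIV power2_norm_eq_inner)
  then show ?thesis by simp
qed

lemma calc_inject:
  assumes "bnn p" "\<And>t. 0 < p t" "x \<in> K" "calc p \<cdot> x = 0"
  shows "x = 0"
proof (rule vm_null_imp_zero[of x p])
  show "(\<integral>\<^sup>+ t. ennreal (p t) \<partial>vec_measure E x) = 0" using assms by (simp add: calc_nn_integral)
qed (use assms in \<open>auto simp: bnn_def\<close>)

text \<open>With \<open>p = 1/(1+f)\<close> and \<open>q = f/(1+f)\<close>, both bounded, the unbounded operator \<open>\<integral> f dE\<close> is
  parametrized by \<open>z \<mapsto> (p z, q z)\<close>.\<close>

lemma bnn_recip:
  assumes "f \<in> borel_measurable borel" "\<And>t. 0 \<le> f t"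
  shows "bnn (\<lambda>t. 1 / (1 + f t))" "bnn (\<lambda>t. f t / (1 + f t))"
proof -
  have "1 / (1 + f t) \<le> 1" "f t / (1 + f t) \<le> 1" "0 \<le> 1 / (1 + f t)" "0 \<le> f t / (1 + f t)" for t
    using assms(2)[of t] by (auto simp: divide_le_eq_1)
  moreover have "(\<lambda>t. 1 / (1 + f t)) \<in> borel_measurable borel" "(\<lambda>t. f t / (1 + f t)) \<in> borel_measurable borel"
    using assms(1) by measurable
  ultimately show "bnn (\<lambda>t. 1 / (1 + f t))" "bnn (\<lambda>t. f t / (1 + f t))" by (auto simp only: bnn_def)
qed

text \<open>Only one inclusion is substantial: a preimage of \<open>x\<close> is the limit of
  \<open>(1 + f) x\<close>, cut off to the sets where \<open>f <= n\<close>. Square integrability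
  bounds the norms of these vectors.\<close>

lemma spectral_domain_nonneg:
  assumes f: "f \<in> borel_measurable borel" "\<And>t. 0 \<le> f t"
  shows "spectral_domain K E f = range (bop_apply (calc (\<lambda>t. 1 / (1 + f t))))"
proof (intro equalityI subsetI)
  note [measurable] = f(1)
  define p where "p = (\<lambda>t. 1 / (1 + f t))"
  have p: "bnn p" unfolding p_def by (rule bnn_recip[OF f])
  have f1: "0 < 1 + f t" for t using f(2)[of t] by linarith
  {
    fix x assume "x \<in> range (bop_apply (calc (\<lambda>t. 1 / (1 + f t))))"
    then obtain z where x: "x = calc p \<cdot> z" by (auto simp: p_def)
    have "(\<integral>\<^sup>+ t. ennreal ((f t)\<^sup>2) \<partial>vec_measure E x)
        = (\<integral>\<^sup>+ t. ennreal ((p t)\<^sup>2) * ennreal ((f t)\<^sup>2) \<partial>vec_measure E z)"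
      unfolding x by (rule nn_integral_calc[OF p]) simp
    also have "\<dots> \<le> (\<integral>\<^sup>+ t. 1 \<partial>vec_measure E z)"
    proof (rule nn_integral_mono)
      fix t
      have "p t * f t \<le> 1" "0 \<le> p t * f t" using f(2)[of t] f1[of t] by (simp_all add: p_def)
      then have "(p t * f t)\<^sup>2 \<le> 1" by (simp add: power_le_one)
      then show "ennreal ((p t)\<^sup>2) * ennreal ((f t)\<^sup>2) \<le> 1"
        by (simp add: power_mult_distrib flip: ennreal_mult)
    qed
    also have "\<dots> < \<infinity>" by (simp add: emeasure_vm)
    finally show "x \<in> spectral_domain K E f" by (simp add: spectral_domain_def x calc_in p)
  }
  {
    fix x assume "x \<in> spectral_domain K E f"
    then have xK: "x \<in> K" and fin: "(\<integral>\<^sup>+ t. ennreal ((f t)\<^sup>2) \<partial>vec_measure E x) < \<infinity>"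
      by (auto simp: spectral_domain_def)
    define D where "D n = {t. f t \<le> real n}" for n
    have D [measurable]: "D n \<in> sets borel" for n unfolding D_def by measurable
    have DU: "(\<Union>n. D n) = UNIV" unfolding D_def using real_arch_simple by auto
    define h where "h n t = (1 + f t) * indicator (D n) t" for n t
    have h: "bnn (h n)" for n
      unfolding bnn_def
    proof (intro conjI allI exI[of _ "1 + real n"])
      show "h n \<in> borel_measurable borel" unfolding h_def by measurable
    qed (use f(2) in \<open>auto simp: h_def D_def indicator_def\<close>)
    define z where "z n = calc (h n) \<cdot> x" for n
    define a where "a n = (norm (z n))\<^sup>2" for n
    have zE: "z n = E (D n) \<cdot> z m" if "n \<le> m" for n m
    proof -
      have "h n t = indicator (D n) t * h m t" for t
        using that by (auto simp: h_def D_def indicator_def)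
      then have "calc (h n) = calc (\<lambda>t. indicator (D n) t * h m t)" by presburger
      then show ?thesis using h D by (simp add: z_def calc_mult calc_indicator)
    qed
    \<comment> \<open>The cut-offs are nested projections of each other, so the squared distance is
      the difference of the squared norms; \<open>z\<close> is Cauchy because the bounded increasing
      \<open>a\<close> is.\<close>
    have dist: "(norm (z m - z n))\<^sup>2 = a m - a n" if "n \<le> m" for n m
      using E_form[OF D[of n], of "z m"] zE[OF that]
      by (simp add: a_def power2_norm_eq_inner inner_diff_left inner_diff_right inner_commute)
    have "incseq a"
    proof (rule incseq_SucI)
      show "a n \<le> a (Suc n)" for n
        using dist[of n "Suc n"] zero_le_power2[of "norm (z (Suc n) - z n)"] by simp
    qed
    define J where "J = (\<integral>\<^sup>+ t. ennreal (2 + 2 * (f t)\<^sup>2) \<partial>vec_measure E x)"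
    have J: "J < \<infinity>"
    proof -
      have "J = 2 * emeasure (vec_measure E x) UNIV + 2 * (\<integral>\<^sup>+ t. ennreal ((f t)\<^sup>2) \<partial>vec_measure E x)"
        unfolding J_def by (simp add: ennreal_plus ennreal_mult nn_integral_add nn_integral_cmult)
      then show ?thesis using fin by (simp add: emeasure_vm ennreal_mult_less_top less_top[symmetric] ennreal_mult_eq_top_iff)
    qed
    have ab: "a n \<le> enn2real J" for n
    proof -
      have "ennreal (a n) = (\<integral>\<^sup>+ t. ennreal (h n t * h n t) \<partial>vec_measure E x)"
        using h by (simp add: a_def z_def norm_calc_sq calc_nn_integral)
      also have "\<dots> \<le> J"
        unfolding J_def
      proof (intro nn_integral_mono ennreal_leI)
        fix t
        have "h n t * h n t \<le> (1 + f t) * (1 + f t)"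
          using f(2)[of t] by (auto simp: h_def indicator_def)
        also have "\<dots> \<le> 2 + 2 * (f t)\<^sup>2"
          using zero_le_power2[of "1 - f t"] by (simp add: power2_eq_square algebra_simps)
        finally show "h n t * h n t \<le> 2 + 2 * (f t)\<^sup>2" .
      qed
      finally have "ennreal (a n) \<le> ennreal (enn2real J)" using J by simp
      then show ?thesis by (simp add: ennreal_le_iff)
    qed
    have "convergent a"
      by (rule Bseq_mono_convergent[OF BseqI'[of _ "enn2real J"]])
        (use ab \<open>incseq a\<close> in \<open>auto simp: incseq_def a_def\<close>)
    then have aC: "Cauchy a" by (rule convergent_Cauchy)
    have "Cauchy z"
    proof (rule metric_CauchyI)
      fix e :: real assume e: "0 < e"
      then obtain N where N: "\<And>m n. m \<ge> N \<Longrightarrow> n \<ge> N \<Longrightarrow> dist (a m) (a n) < e\<^sup>2"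
        using metric_CauchyD[OF aC, of "e\<^sup>2"] by (metis zero_less_power)
      have main: "dist (z m) (z n) < e" if "m \<ge> N" "n \<ge> N" "n \<le> m" for m n
      proof -
        have "(norm (z m - z n))\<^sup>2 < e\<^sup>2"
          using dist[OF that(3)] N[OF that(1,2)] by (simp add: dist_real_def)
        then show ?thesis using e by (simp add: dist_norm power2_less_imp_less)
      qed
      have "dist (z m) (z n) < e" if "m \<ge> N" "n \<ge> N" for m n
        using main[of m n] main[of n m] that by (cases "n \<le> m") (auto simp: dist_commute)
      then show "\<exists>M. \<forall>m\<ge>M. \<forall>n\<ge>M. dist (z m) (z n) < e" by blast
    qed
    then obtain z' where z': "z \<longlonglongrightarrow> z'" using Cauchy_convergent convergent_def by blast
    have pz: "calc p \<cdot> z n = E (D n) \<cdot> x" for n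
    proof -
      have "p t * h n t = indicator (D n) t" for t
        using f1[of t] by (simp add: p_def h_def)
      then have "calc (\<lambda>t. p t * h n t) = E (D n)" using calc_indicator[OF D] by presburger
      then show ?thesis using p h by (simp add: calc_mult z_def flip: bop_simps(6))
    qed
    have "(\<lambda>n. E (D n) \<cdot> x) \<longlonglongrightarrow> E (\<Union>n. D n) \<cdot> x"
      by (rule E_tendsto) (auto simp: D_def incseq_def)
    moreover have "(\<lambda>n. E (D n) \<cdot> x) \<longlonglongrightarrow> calc p \<cdot> z'"
      unfolding pz[symmetric] by (intro tendsto_intros z')
    ultimately have "calc p \<cdot> z' = E UNIV \<cdot> x" unfolding DU by (metis LIMSEQ_unique)
    then have "calc p \<cdot> z' = x" using xK proj_fix_iff[OF K, of x] by (simp add: E_UNIV)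
    then show "x \<in> range (bop_apply (calc (\<lambda>t. 1 / (1 + f t))))" unfolding p_def by blast
  }
qed

text \<open>With \<open>p^2 f = q p\<close> the polarized integrals become inner products with
  \<open>calc q z\<close>. A second component can differ from it only by a vector of
  \<open>K\<close> orthogonal to the range of \<open>calc p\<close>, that is, one killed by
  \<open>calc p\<close>, which is injective on \<open>K\<close>.\<close>

lemma spectral_integral_nonneg:
  assumes f: "f \<in> borel_measurable borel" "\<And>t. 0 \<le> f t"
  shows "spectral_integral K E f
    = range (\<lambda>z. (calc (\<lambda>t. 1 / (1 + f t)) \<cdot> z, calc (\<lambda>t. f t / (1 + f t)) \<cdot> z))"
proof -
  note [measurable] = f(1)
  define p where "p = (\<lambda>t. 1 / (1 + f t))"
  define q where "q = (\<lambda>t. f t / (1 + f t))"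
  have p: "bnn p" and q: "bnn q" unfolding p_def q_def by (rule bnn_recip[OF f])+
  have f1: "0 < 1 + f t" for t using f(2)[of t] by linarith
  have p0: "0 < p t" for t using f1[of t] by (simp add: p_def)
  have dom: "spectral_domain K E f = range (bop_apply (calc p))"
    unfolding p_def by (rule spectral_domain_nonneg[OF f])
  have int: "(\<integral>t. f t \<partial>vec_measure E (calc p \<cdot> v)) = inner ((calc q * calc p) \<cdot> v) v" for v
  proof -
    have "(\<integral>t. f t \<partial>vec_measure E (calc p \<cdot> v)) = enn2real (\<integral>\<^sup>+ t. ennreal (f t) \<partial>vec_measure E (calc p \<cdot> v))"
      by (rule integral_eq_nn_integral) (use f in \<open>auto intro: measurable_vm\<close>)
    also have "(\<integral>\<^sup>+ t. ennreal (f t) \<partial>vec_measure E (calc p \<cdot> v))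
        = (\<integral>\<^sup>+ t. ennreal ((p t)\<^sup>2) * ennreal (f t) \<partial>vec_measure E v)"
      by (rule nn_integral_calc[OF p]) simp
    also have "\<dots> = (\<integral>\<^sup>+ t. ennreal (q t * p t) \<partial>vec_measure E v)"
      by (intro nn_integral_cong) (simp add: p_def q_def power2_eq_square f flip: ennreal_mult)
    also have "\<dots> = ennreal (inner ((calc q * calc p) \<cdot> v) v)"
      using p q by (simp only: calc_nn_integral[OF bnn_mult] calc_mult)
    also have "enn2real \<dots> = inner ((calc q * calc p) \<cdot> v) v"
      using p q by (intro enn2real_ennreal pos_form) (simp add: calc_mult[symmetric] calc_pos)
    finally show ?thesis .
  qed
  have sa: "selfadj (calc q * calc p)" using p q by (simp add: calc_mult[symmetric] calc_selfadj)
  have pol: "(\<Sum>k<4. \<i> ^ k * complex_of_real (\<integral>t. f t \<partial>vec_measure E (calc p \<cdot> z + \<i> ^ k *\<^sub>C (calc p \<cdot> w)))) / 4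
      = cinner (calc q \<cdot> z) (calc p \<cdot> w)" for z w
  proof -
    have "calc p \<cdot> z + \<i> ^ k *\<^sub>C (calc p \<cdot> w) = calc p \<cdot> (z + \<i> ^ k *\<^sub>C w)" for k by simp
    then have "(\<Sum>k<4. \<i> ^ k * complex_of_real (\<integral>t. f t \<partial>vec_measure E (calc p \<cdot> z + \<i> ^ k *\<^sub>C (calc p \<cdot> w)))) / 4
      = cinner ((calc q * calc p) \<cdot> z) w"
      using polarization[OF sa, of z w] by (simp only: int)
    also have "\<dots> = cinner (calc p \<cdot> calc q \<cdot> z) w"
      using calc_commute[OF p q] by (simp flip: bop_simps(6))
    finally show ?thesis by (simp add: cinner_selfadj[OF calc_selfadj[OF p]])
  qed
  have "spectral_integral K E f = range (\<lambda>z. (calc p \<cdot> z, calc q \<cdot> z))"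
  proof (intro equalityI subsetI)
    fix u assume "u \<in> range (\<lambda>z. (calc p \<cdot> z, calc q \<cdot> z))"
    then obtain z where u: "u = (calc p \<cdot> z, calc q \<cdot> z)" by blast
    show "u \<in> spectral_integral K E f"
      unfolding spectral_integral_def u dom using calc_in[OF q] pol by auto
  next
    fix u assume u: "u \<in> spectral_integral K E f"
    obtain \<xi> \<eta> where ue: "u = (\<xi>, \<eta>)" by (cases u)
    obtain z where z: "\<xi> = calc p \<cdot> z" using u by (auto simp: ue spectral_integral_def dom)
    have eK: "\<eta> \<in> K" using u by (auto simp: ue spectral_integral_def)
    have c: "cinner \<eta> (calc p \<cdot> w) = cinner (calc q \<cdot> z) (calc p \<cdot> w)" for w
      using u unfolding ue spectral_integral_def dom z using pol by auto
    define d where "d = \<eta> - calc q \<cdot> z"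
    have "calc p \<cdot> d = 0"
    proof (rule inner_ext)
      fix w
      have "inner (calc p \<cdot> d) w = inner d (calc p \<cdot> w)" by (rule selfadjD[OF calc_selfadj[OF p]])
      also have "\<dots> = Re (cinner d (calc p \<cdot> w))" by (simp add: Re_cinner)
      also have "\<dots> = 0" by (simp add: d_def cinner_diff_left c)
      finally show "inner (calc p \<cdot> d) w = inner 0 w" by simp
    qed
    moreover have "d \<in> K"
      using K eK calc_in[OF q] unfolding d_def closed_csubspace_def by (blast intro: subspace_diff)
    ultimately have "d = 0" using calc_inject[OF p p0] by blast
    then show "u \<in> range (\<lambda>z. (calc p \<cdot> z, calc q \<cdot> z))" by (simp add: ue z d_def)
  qed
  then show ?thesis by (simp add: p_def q_def)
qed

end

section \<open>Square roots of unbounded positive operators\<close>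

lemma norm_proj_le: "closed_csubspace K \<Longrightarrow> norm (proj K \<cdot> x) \<le> norm x"
  by (rule projection_norm_le[OF selfadj_proj proj_idem])

lemma pos_cinner: "0 \<le> A \<Longrightarrow> cinner (A \<cdot> x) x \<in> \<real>\<^sub>\<ge>\<^sub>0"
  by (simp add: less_eq_bop_def)

text \<open>For positive self-adjoint \<open>S\<close> put \<open>C = (1+S\<^sup>2)\<^sup>-\<^sup>1\<close> and \<open>D = S C\<close> (von Neumann). Then \<open>D\<close> is the
  square root of \<open>C - C\<^sup>2\<close>, and \<open>S\<close> is recovered from \<open>C\<close> and \<open>D\<close>. As \<open>C\<close> only depends on \<open>S\<^sup>2\<close>, this
  reduces uniqueness of unbounded square roots to uniqueness of bounded ones.\<close>

lemma pos_selfadj_resolvent: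
  fixes K :: "'a::complex_hilbert set"
  assumes K: "closed_csubspace K" and S: "pos_selfadj_on K S"
  obtains C D where "0 \<le> C" "0 \<le> D" "D * D = C - C * C" "C * proj K = C"
    "S = {(x, y). x \<in> K \<and> y \<in> K \<and> D \<cdot> x = C \<cdot> y}"
    "S O S = {(C \<cdot> x, x - C \<cdot> x) |x. x \<in> K}"
proof -
  have subK: "subspace K" and clK: "closed K" and ciK: "\<And>x. x \<in> K \<Longrightarrow> \<i> *\<^sub>C x \<in> K"
    using K by (auto simp: closed_csubspace_def)
  have dense: "closure (Domain S) = K" and adj: "adj_graph K S = S"
    and pos: "\<And>u v. (u, v) \<in> S \<Longrightarrow> cinner v u \<in> \<real>\<^sub>\<ge>\<^sub>0"
    using S unfolding pos_selfadj_on_def by blast+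
  have memS: "(x, y) \<in> S \<longleftrightarrow> x \<in> K \<and> y \<in> K \<and> (\<forall>(u, v)\<in>S. cinner v x = cinner u y)" for x y
    by (subst adj[symmetric]) (simp add: adj_graph_def)
  have SK: "x \<in> K" "y \<in> K" if "(x, y) \<in> S" for x y using that memS by blast+
  have sym: "inner v x = inner u y" if "(u, v) \<in> S" "(x, y) \<in> S" for u v x y
  proof -
    have "cinner v x = cinner u y" using that memS by blast
    then show ?thesis by (metis Re_cinner)
  qed
  have Si: "(\<i> *\<^sub>C x, \<i> *\<^sub>C y) \<in> S" if xy: "(x, y) \<in> S" for x y
    unfolding memS
  proof (intro conjI)
    show "\<i> *\<^sub>C x \<in> K" "\<i> *\<^sub>C y \<in> K" using SK[OF xy] ciK by blast+
    have "cinner v x = cinner u y" if "(u, v) \<in> S" for u v using that xy memS by blast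
    then show "\<forall>(u, v)\<in>S. cinner v (\<i> *\<^sub>C x) = cinner u (\<i> *\<^sub>C y)" by (auto simp: cinner_scaleC_right)
  qed
  \<comment> \<open>Real inner products suffice for membership because the graph is stable under the
    imaginary unit, which yields the imaginary parts.\<close>
  have SI: "(x, y) \<in> S" if "x \<in> K" "y \<in> K" and *: "\<And>u v. (u, v) \<in> S \<Longrightarrow> inner v x = inner u y" for x y
    unfolding memS
  proof (intro conjI)
    show "\<forall>(u, v)\<in>S. cinner v x = cinner u y"
    proof (clarify)
      fix u v assume uv: "(u, v) \<in> S"
      have "inner v (\<i> *\<^sub>C x) = inner u (\<i> *\<^sub>C y)"
        using *[OF Si[OF uv]] by (simp add: inner_scaleC_i_left)
      then show "cinner v x = cinner u y" using *[OF uv] by (simp add: cinner_eq_Complex)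
    qed
  qed (use that in auto)
  have add: "(x + x', y + y') \<in> S" if "(x, y) \<in> S" "(x', y') \<in> S" for x y x' y'
  proof (rule SI)
    show "x + x' \<in> K" "y + y' \<in> K" using that SK subK by (auto intro: subspace_add)
    show "inner v (x + x') = inner u (y + y')" if "(u, v) \<in> S" for u v
      using sym[OF that \<open>(x, y) \<in> S\<close>] sym[OF that \<open>(x', y') \<in> S\<close>] by (simp add: inner_add_right)
  qed
  have scale: "(r *\<^sub>R x, r *\<^sub>R y) \<in> S" if "(x, y) \<in> S" for x y r
  proof (rule SI)
    show "r *\<^sub>R x \<in> K" "r *\<^sub>R y \<in> K" using that SK subK by (auto intro: subspace_mul)
    show "inner v (r *\<^sub>R x) = inner u (r *\<^sub>R y)" if "(u, v) \<in> S" for u v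
      using sym[OF that \<open>(x, y) \<in> S\<close>] by simp
  qed
  have diff: "(x - x', y - y') \<in> S" if "(x, y) \<in> S" "(x', y') \<in> S" for x y x' y'
    using add[OF that(1) scale[OF that(2), of "-1"]] by simp
  \<comment> \<open>Density of the domain enters here: \<open>(0, d)\<close> in the graph makes
    \<open>d\<close> orthogonal to the domain, hence to \<open>K\<close>, which contains
    \<open>d\<close>.\<close>
  have sv: "y = y'" if "(x, y) \<in> S" "(x, y') \<in> S" for x y y'
  proof -
    define d where "d = y - y'"
    have d: "(0, d) \<in> S" using diff[OF that] by (simp add: d_def)
    have "inner u d = 0" if "u \<in> Domain S" for u
      using that sym[OF _ d] by auto
    then have "Domain S \<subseteq> {u. inner u d = 0}" by blast
    moreover have "closed {u. inner u d = 0}" by (intro closed_Collect_eq continuous_intros)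
    ultimately have "K \<subseteq> {u. inner u d = 0}" unfolding dense[symmetric] by (rule closure_minimal)
    then have "inner d d = 0" using SK[OF d] by blast
    then show ?thesis by (simp add: d_def)
  qed
  have subS: "subspace S"
    unfolding subspace_def
  proof (intro conjI ballI allI)
    show "0 \<in> S" unfolding zero_prod_def by (rule SI) (use subK subspace_0 in auto)
    show "x + y \<in> S" if "x \<in> S" "y \<in> S" for x y
      using that add by (cases x; cases y) auto
    show "c *\<^sub>R x \<in> S" if "x \<in> S" for c x using that scale by (cases x) auto
  qed
  have clS: "closed S"
  proof -
    have "S = (K \<times> K) \<inter> (\<Inter>(u, v)\<in>S. {z. inner v (fst z) = inner u (snd z)})"
    proof (intro equalityI subsetI)
      fix s assume s: "s \<in> S"
      obtain x y where xy: "s = (x, y)" by (cases s)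
      have "inner v x = inner u y" if "(u, v) \<in> S" for u v by (rule sym[OF that]) (use s xy in blast)
      then show "s \<in> (K \<times> K) \<inter> (\<Inter>(u, v)\<in>S. {z. inner v (fst z) = inner u (snd z)})"
        using SK[of x y] s unfolding xy by force
    next
      fix s assume s: "s \<in> (K \<times> K) \<inter> (\<Inter>(u, v)\<in>S. {z. inner v (fst z) = inner u (snd z)})"
      obtain x y where xy: "s = (x, y)" by (cases s)
      show "s \<in> S" unfolding xy
      proof (rule SI)
        show "x \<in> K" "y \<in> K" using s xy by blast+
        show "inner v x = inner u y" if "(u, v) \<in> S" for u v using s that unfolding xy by fastforce
      qed
    qed
    moreover have "closed ((K \<times> K) \<inter> (\<Inter>(u, v)\<in>S. {z. inner v (fst z) = inner u (snd z)}))"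
      by (intro closed_Int closed_Times clK closed_INT ballI)
        (auto intro!: closed_Collect_eq continuous_intros)
    ultimately show ?thesis by simp
  qed
  \<comment> \<open>Project \<open>(h, 0)\<close> onto the closed graph. The residual
    \<open>(h - u, -v)\<close> is orthogonal to the graph, which says that \<open>(v, h - u)\<close>
    belongs to the adjoint graph, that is, to \<open>S\<close>. So \<open>u\<close> and
    \<open>v\<close> are the values at \<open>h\<close> of the later \<open>C\<close> and
    \<open>D\<close>.\<close>
  have ex: "\<exists>u v. (u, v) \<in> S \<and> (v, h - u) \<in> S" if h: "h \<in> K" for h
  proof -
    obtain s where s: "s \<in> S" "\<And>k. k \<in> S \<Longrightarrow> inner ((h, 0) - s) k = 0"
      using closed_subspace_projection[OF subS clS, of "(h, 0)"] by blast
    obtain u v where uv: "s = (u, v)" by (cases s)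
    have "(v, h - u) \<in> S"
    proof (rule SI)
      show "v \<in> K" "h - u \<in> K" using s(1) SK h subK unfolding uv by (auto intro: subspace_diff)
      show "inner q v = inner p (h - u)" if "(p, q) \<in> S" for p q
        using s(2)[OF that] by (simp add: uv inner_prod_def inner_diff_right inner_diff_left inner_commute)
    qed
    then show ?thesis using s(1) uv by blast
  qed
  define P where "P = proj K"
  have PK: "P \<cdot> h \<in> K" for h unfolding P_def by (rule proj_in[OF K])
  have Pid: "h \<in> K \<Longrightarrow> P \<cdot> h = h" for h unfolding P_def using proj_fix_iff[OF K] by blast
  obtain c d where cd: "\<And>h. (c h, d h) \<in> S" "\<And>h. (d h, P \<cdot> h - c h) \<in> S"
    using ex[OF PK] by metis
  have uniq: "u = c h \<and> v = d h" if "(u, v) \<in> S" "(v, P \<cdot> h - u) \<in> S" for u v h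
  proof -
    have 1: "(u - c h, v - d h) \<in> S" by (rule diff[OF that(1) cd(1)])
    have 2: "(v - d h, - (u - c h)) \<in> S" using diff[OF that(2) cd(2)[of h]] by simp
    have "inner (v - d h) (v - d h) = inner (u - c h) (- (u - c h))" by (rule sym[OF 1 2])
    then have "inner (v - d h) (v - d h) + inner (u - c h) (u - c h) = 0"
      by (simp only: inner_minus_right add.left_inverse)
    moreover have "0 \<le> inner (v - d h) (v - d h)" "0 \<le> inner (u - c h) (u - c h)" by simp_all
    ultimately have "inner (v - d h) (v - d h) = 0" "inner (u - c h) (u - c h) = 0" by linarith+
    then show ?thesis by simp
  qed
  have cadd: "c x + c y = c (x + y) \<and> d x + d y = d (x + y)" for x y
  proof (rule uniq)
    show "(c x + c y, d x + d y) \<in> S" by (intro add cd)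
    have "(d x + d y, (P \<cdot> x - c x) + (P \<cdot> y - c y)) \<in> S" by (intro add cd)
    then show "(d x + d y, P \<cdot> (x + y) - (c x + c y)) \<in> S" by (simp add: algebra_simps)
  qed
  have cscale: "r *\<^sub>R c x = c (r *\<^sub>R x) \<and> r *\<^sub>R d x = d (r *\<^sub>R x)" for x r
  proof (rule uniq)
    show "(r *\<^sub>R c x, r *\<^sub>R d x) \<in> S" by (intro scale cd)
    have "(r *\<^sub>R d x, r *\<^sub>R (P \<cdot> x - c x)) \<in> S" by (intro scale cd)
    then show "(r *\<^sub>R d x, P \<cdot> (r *\<^sub>R x) - r *\<^sub>R c x) \<in> S" by (simp add: scaleR_diff_right)
  qed
  have cimg: "\<i> *\<^sub>C c x = c (\<i> *\<^sub>C x) \<and> \<i> *\<^sub>C d x = d (\<i> *\<^sub>C x)" for x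
  proof (rule uniq)
    show "(\<i> *\<^sub>C c x, \<i> *\<^sub>C d x) \<in> S" by (intro Si cd)
    have "(\<i> *\<^sub>C d x, \<i> *\<^sub>C (P \<cdot> x - c x)) \<in> S" by (intro Si cd)
    then show "(\<i> *\<^sub>C d x, P \<cdot> (\<i> *\<^sub>C x) - \<i> *\<^sub>C c x) \<in> S" by (simp add: scaleC_diff_right)
  qed
  have bound: "norm (c h) \<le> 1 * norm h \<and> norm (d h) \<le> 1 * norm h" for h
  proof -
    define w where "w = P \<cdot> h - c h"
    have "inner (d h) (d h) = inner (c h) w" unfolding w_def by (rule sym[OF cd])
    moreover have "P \<cdot> h = c h + w" by (simp add: w_def)
    ultimately have "(norm (P \<cdot> h))\<^sup>2 = (norm (c h))\<^sup>2 + 2 * (norm (d h))\<^sup>2 + (norm w)\<^sup>2"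
      by (simp add: power2_norm_eq_inner inner_add_left inner_add_right inner_commute)
    moreover have "(norm (P \<cdot> h))\<^sup>2 \<le> (norm h)\<^sup>2"
      unfolding P_def by (intro power_mono norm_proj_le K) simp
    ultimately have "(norm (c h))\<^sup>2 \<le> (norm h)\<^sup>2" "(norm (d h))\<^sup>2 \<le> (norm h)\<^sup>2"
      using zero_le_power2[of "norm w"] zero_le_power2[of "norm (d h)"] zero_le_power2[of "norm (c h)"]
      by linarith+
    then show ?thesis
      using power2_le_imp_le[of "norm (c h)" "norm h"] power2_le_imp_le[of "norm (d h)" "norm h"] by simp
  qed
  have "\<exists>C. \<forall>x. C \<cdot> x = c x"
    by (rule ex_bop[of _ 1]) (simp_all only: cadd[THEN conjunct1] cscale[THEN conjunct1] cimg[THEN conjunct1] bound[THEN conjunct1])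
  then obtain C where C: "\<And>x. C \<cdot> x = c x" by blast
  have "\<exists>D. \<forall>x. D \<cdot> x = d x"
    by (rule ex_bop[of _ 1]) (simp_all only: cadd[THEN conjunct2] cscale[THEN conjunct2] cimg[THEN conjunct2] bound[THEN conjunct2])
  then obtain D where D: "\<And>x. D \<cdot> x = d x" by blast
  have CD: "(C \<cdot> h, D \<cdot> h) \<in> S" "(D \<cdot> h, P \<cdot> h - C \<cdot> h) \<in> S" for h using cd by (simp_all add: C D)
  have uniq': "u = C \<cdot> h" "v = D \<cdot> h" if "(u, v) \<in> S" "(v, P \<cdot> h - u) \<in> S" for u v h
    using uniq[OF that] by (simp_all add: C D)
  have CP: "C \<cdot> P \<cdot> h = C \<cdot> h" "D \<cdot> P \<cdot> h = D \<cdot> h" for h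
  proof -
    have "(C \<cdot> h, D \<cdot> h) \<in> S" "(D \<cdot> h, P \<cdot> P \<cdot> h - C \<cdot> h) \<in> S" using CD[of h] Pid[OF PK] by auto
    from uniq'[OF this] show "C \<cdot> P \<cdot> h = C \<cdot> h" "D \<cdot> P \<cdot> h = D \<cdot> h" by simp_all
  qed
  have Psa: "inner (P \<cdot> x) y = inner x (P \<cdot> y)" for x y
    unfolding P_def by (rule selfadjD[OF selfadj_proj[OF K]])
  have inP: "inner z h = inner z (P \<cdot> h)" if "z \<in> K" for z h
    using Psa[of z h] Pid[OF that] by simp
  have Cin: "inner (C \<cdot> h) h' = inner (C \<cdot> h) (C \<cdot> h') + inner (D \<cdot> h) (D \<cdot> h')" for h h'
  proof -
    have "inner (D \<cdot> h) (D \<cdot> h') = inner (C \<cdot> h) (P \<cdot> h' - C \<cdot> h')" by (rule sym[OF CD(1) CD(2)])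
    then show ?thesis using inP[OF SK(1)[OF CD(1)[of h]], of h'] by (simp add: inner_diff_right)
  qed
  have saC: "selfadj C"
    unfolding selfadj_def
  proof (intro allI)
    fix x y
    have "inner x (C \<cdot> y) = inner (C \<cdot> y) x" by (rule inner_commute)
    then show "inner (C \<cdot> x) y = inner x (C \<cdot> y)"
      unfolding Cin[of x y] Cin[of y x] by (simp add: inner_commute)
  qed
  have "0 \<le> inner (C \<cdot> x) x" for x unfolding Cin[of x x] by simp
  with saC have posC: "0 \<le> C" by (rule posI)
  have Din: "inner (D \<cdot> h) h' = inner (D \<cdot> h) (C \<cdot> h') + inner (D \<cdot> h) (P \<cdot> h' - C \<cdot> h')" for h h'
    using inP[OF SK(2)[OF CD(1)[of h]], of h'] by (simp add: inner_diff_right)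
  have saD: "selfadj D"
    unfolding selfadj_def
  proof (intro allI)
    fix x y
    have 1: "inner (D \<cdot> x) (C \<cdot> y) = inner (C \<cdot> x) (D \<cdot> y)" by (rule sym[OF CD(1) CD(1)])
    have 2: "inner (P \<cdot> x - C \<cdot> x) (D \<cdot> y) = inner (D \<cdot> x) (P \<cdot> y - C \<cdot> y)" by (rule sym[OF CD(2) CD(2)])
    have "inner x (D \<cdot> y) = inner (P \<cdot> x) (D \<cdot> y)"
      using inP[OF SK(2)[OF CD(1)[of y]], of x] by (simp add: inner_commute)
    then show "inner (D \<cdot> x) y = inner x (D \<cdot> y)"
      using 1 2 Din[of x y] by (simp add: inner_diff_left)
  qed
  have posD: "0 \<le> D"
  proof (rule posI[OF saD])
    fix x
    have "0 \<le> inner (D \<cdot> x) (C \<cdot> x)" "0 \<le> inner (P \<cdot> x - C \<cdot> x) (D \<cdot> x)"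
      using pos[OF CD(1)[of x]] pos[OF CD(2)[of x]] by (simp_all add: complex_nonneg_Reals_iff flip: Re_cinner)
    then show "0 \<le> inner (D \<cdot> x) x" unfolding Din[of x x] by (simp add: inner_commute)
  qed
  have DD: "D * D = C - C * C"
  proof (rule bop_eqI)
    fix h
    \<comment> \<open>The pair \<open>D C h\<close>, \<open>C w\<close> satisfies the two conditions
      which characterize the values of \<open>C\<close> and \<open>D\<close> at \<open>D h\<close>,
      so \<open>D D h = C w = C h - C C h\<close>.\<close>
    define w where "w = P \<cdot> h - C \<cdot> h"
    have wK: "w \<in> K" "D \<cdot> h \<in> K" unfolding w_def using SK[OF CD(2)[of h]] by auto
    have eq1: "C \<cdot> w = C \<cdot> h - C \<cdot> C \<cdot> h" by (simp add: w_def CP)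
    have "D \<cdot> w = D \<cdot> h - D \<cdot> C \<cdot> h" by (simp add: w_def CP)
    then have e2: "P \<cdot> D \<cdot> h - D \<cdot> C \<cdot> h = D \<cdot> w" using Pid[OF wK(2)] by simp
    have "P \<cdot> C \<cdot> h - C \<cdot> C \<cdot> h = C \<cdot> w" using Pid[OF SK(1)[OF CD(1)[of h]]] eq1 by simp
    then have "(D \<cdot> C \<cdot> h, C \<cdot> w) \<in> S" using CD(2)[of "C \<cdot> h"] by simp
    moreover have "(C \<cdot> w, P \<cdot> D \<cdot> h - D \<cdot> C \<cdot> h) \<in> S" unfolding e2 by (rule CD(1))
    ultimately have "C \<cdot> w = D \<cdot> D \<cdot> h" by (rule uniq'(2))
    then show "(D * D) \<cdot> h = (C - C * C) \<cdot> h" using eq1 by simp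
  qed
  have Seq: "S = {(x, y). x \<in> K \<and> y \<in> K \<and> D \<cdot> x = C \<cdot> y}"
  proof (intro equalityI subsetI)
    fix s assume "s \<in> S"
    then obtain x y where s: "s = (x, y)" "(x, y) \<in> S" by (cases s) auto
    have "D \<cdot> x = C \<cdot> y"
    proof (rule inner_ext)
      fix h
      show "inner (D \<cdot> x) h = inner (C \<cdot> y) h"
        using sym[OF s(2) CD(1)[of h]] by (simp add: selfadjD[OF saD] selfadjD[OF saC])
    qed
    then show "s \<in> {(x, y). x \<in> K \<and> y \<in> K \<and> D \<cdot> x = C \<cdot> y}" using SK[OF s(2)] s(1) by simp
  next
    fix s assume "s \<in> {(x, y). x \<in> K \<and> y \<in> K \<and> D \<cdot> x = C \<cdot> y}"
    then obtain x y where s: "s = (x, y)" and xy: "x \<in> K" "y \<in> K" "D \<cdot> x = C \<cdot> y" by blast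
    \<comment> \<open>The pair \<open>(x, y)\<close> is the sum of \<open>(x - C x, y - C y)\<close>
      and \<open>(C x, D x)\<close>. The first summand lies in \<open>S\<close> once
      \<open>D y\<close> is recognized as \<open>x - C x\<close>, by single-valuedness at
      \<open>D x\<close>.\<close>
    have 1: "(D \<cdot> x, x - C \<cdot> x) \<in> S" using CD(2)[of x] Pid[OF xy(1)] by simp
    have 2: "(D \<cdot> x, D \<cdot> y) \<in> S" using CD(1)[of y] xy(3) by simp
    have "D \<cdot> y = x - C \<cdot> x" by (rule sv[OF 2 1])
    then have "(x - C \<cdot> x, y - C \<cdot> y) \<in> S" using CD(2)[of y] Pid[OF xy(2)] by simp
    from add[OF this CD(1)[of x]] xy(3) show "s \<in> S" by (simp add: s)
  qed
  have SS: "S O S = {(C \<cdot> x, x - C \<cdot> x) |x. x \<in> K}"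
  proof (intro equalityI subsetI)
    fix s assume "s \<in> S O S"
    then obtain u v w where s: "s = (u, w)" "(u, v) \<in> S" "(v, w) \<in> S" by blast
    have K': "u + w \<in> K" using SK[OF s(2)] SK[OF s(3)] subK by (auto intro: subspace_add)
    have "(v, P \<cdot> (u + w) - u) \<in> S" using s(3) Pid[OF K'] by simp
    from uniq'(1)[OF s(2) this] have u: "u = C \<cdot> (u + w)" .
    show "s \<in> {(C \<cdot> x, x - C \<cdot> x) |x. x \<in> K}"
      unfolding s(1) by (rule CollectI, rule exI[of _ "u + w"]) (use u K' in \<open>metis (no_types) add_diff_cancel_left'\<close>)
  next
    fix s assume "s \<in> {(C \<cdot> x, x - C \<cdot> x) |x. x \<in> K}"
    then obtain x where "s = (C \<cdot> x, x - C \<cdot> x)" "x \<in> K" by blast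
    then show "s \<in> S O S" using CD[of x] Pid by auto
  qed
  show ?thesis
    by (rule that[OF posC posD DD _ Seq SS], rule bop_eqI) (use CP(1) in \<open>simp add: P_def\<close>)
qed

lemma pos_selfadj_sqrt_unique:
  fixes K :: "'a::complex_hilbert set"
  assumes K: "closed_csubspace K" and S: "pos_selfadj_on K S" and T: "pos_selfadj_on K T"
    and eq: "S O S = T O T"
  shows "S = T"
proof -
  obtain C D where C: "0 \<le> C" "0 \<le> D" "D * D = C - C * C" "C * proj K = C"
    "S = {(x, y). x \<in> K \<and> y \<in> K \<and> D \<cdot> x = C \<cdot> y}" "S O S = {(C \<cdot> x, x - C \<cdot> x) |x. x \<in> K}"
    by (rule pos_selfadj_resolvent[OF K S])
  obtain C' D' where C': "0 \<le> C'" "0 \<le> D'" "D' * D' = C' - C' * C'" "C' * proj K = C'"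
    "T = {(x, y). x \<in> K \<and> y \<in> K \<and> D' \<cdot> x = C' \<cdot> y}" "T O T = {(C' \<cdot> x, x - C' \<cdot> x) |x. x \<in> K}"
    by (rule pos_selfadj_resolvent[OF K T])
  have "C \<cdot> x = C' \<cdot> x" if "x \<in> K" for x
  proof -
    have "(C \<cdot> x, x - C \<cdot> x) \<in> T O T" using C(6) eq that by blast
    then obtain y where y: "C \<cdot> x = C' \<cdot> y" "x - C \<cdot> x = y - C' \<cdot> y" unfolding C'(6) by blast
    then have "x = y" by simp
    then show ?thesis using y(1) by simp
  qed
  then have "C \<cdot> x = C' \<cdot> x" for x
    using C(4) C'(4) proj_in[OF K, of x] by (metis bop_simps(6))
  then have CC: "C = C'" by (rule bop_eqI)
  then have "D = D'" using sqrt_unique[OF C(2,3) C'(2)] C'(3) by simp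
  then show ?thesis unfolding C(5) C'(5) CC by simp
qed

lemma closed_csubspace_closure_range: "closed_csubspace (closure (range (bop_apply A)))"
  unfolding closed_csubspace_def
proof (intro conjI ballI)
  show "subspace (closure (range (bop_apply A)))"
    unfolding subspace_def
  proof (intro conjI ballI allI)
    have "A \<cdot> 0 \<in> closure (range (bop_apply A))" by (rule subsetD[OF closure_subset rangeI])
    then show "0 \<in> closure (range (bop_apply A))" by simp
    fix x y c assume x: "x \<in> closure (range (bop_apply A))"
    obtain f where f: "\<And>n. f n \<in> range (bop_apply A)" "f \<longlonglongrightarrow> x" using x unfolding closure_sequential by blast
    { assume y: "y \<in> closure (range (bop_apply A))"
      obtain g where g: "\<And>n. g n \<in> range (bop_apply A)" "g \<longlonglongrightarrow> y" using y unfolding closure_sequential by blast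
      have "f n + g n \<in> range (bop_apply A)" for n
      proof -
        obtain a b where "f n = A \<cdot> a" "g n = A \<cdot> b" using f(1)[of n] g(1)[of n] by blast
        then have "f n + g n = A \<cdot> (a + b)" by simp
        then show ?thesis by (simp only: rangeI)
      qed
      then show "x + y \<in> closure (range (bop_apply A))"
        unfolding closure_sequential using tendsto_add[OF f(2) g(2)] by (intro exI[of _ "\<lambda>n. f n + g n"]) auto }
    have "c *\<^sub>R f n \<in> range (bop_apply A)" for n
    proof -
      obtain a where "f n = A \<cdot> a" using f(1)[of n] by blast
      then have "c *\<^sub>R f n = A \<cdot> (c *\<^sub>R a)" by simp
      then show ?thesis by (simp only: rangeI)
    qed
    then show "c *\<^sub>R x \<in> closure (range (bop_apply A))"
      unfolding closure_sequential using tendsto_scaleR[OF tendsto_const f(2)]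
      by (intro exI[of _ "\<lambda>n. c *\<^sub>R f n"]) auto
  qed
  fix x assume "x \<in> closure (range (bop_apply A))"
  then obtain f where f: "\<And>n. f n \<in> range (bop_apply A)" "f \<longlonglongrightarrow> x" unfolding closure_sequential by blast
  have "\<i> *\<^sub>C f n \<in> range (bop_apply A)" for n
  proof -
    obtain a where "f n = A \<cdot> a" using f(1)[of n] by blast
    then have "\<i> *\<^sub>C f n = A \<cdot> (\<i> *\<^sub>C a)" by simp
    then show ?thesis by (simp only: rangeI)
  qed
  then show "\<i> *\<^sub>C x \<in> closure (range (bop_apply A))"
    unfolding closure_sequential using bounded_linear.tendsto[OF bounded_linear_scaleC f(2)]
    by (intro exI[of _ "\<lambda>n. \<i> *\<^sub>C f n"]) auto
qed simp

text \<open>For a self-adjoint operator the orthogonal complement of the range is the kernel. The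
  residual of \<open>x\<close> over the closed range is therefore annihilated by \<open>A\<close>,
  and injectivity on \<open>K\<close> makes it zero.\<close>

lemma dense_range_selfadj:
  assumes sa: "selfadj A" and K: "closed_csubspace K" and ran: "\<And>x. A \<cdot> x \<in> K"
    and inj: "\<And>x. x \<in> K \<Longrightarrow> A \<cdot> x = 0 \<Longrightarrow> x = 0"
  shows "closure (range (bop_apply A)) = K"
proof
  let ?L = "closure (range (bop_apply A))"
  have clK: "closed K" and subK: "subspace K" using K by (auto simp: closed_csubspace_def)
  show LK: "?L \<subseteq> K" by (rule closure_minimal) (use ran clK in auto)
  show "K \<subseteq> ?L"
  proof
    fix x assume x: "x \<in> K"
    have L: "closed_csubspace ?L" by (rule closed_csubspace_closure_range)
    define y where "y = proj ?L \<cdot> x"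
    have yL: "y \<in> ?L" unfolding y_def by (rule proj_in[OF L])
    have "A \<cdot> (x - y) = 0"
    proof (rule inner_ext)
      fix w
      have Aw: "A \<cdot> w \<in> ?L" by (rule subsetD[OF closure_subset rangeI])
      have "inner y (A \<cdot> w) = inner x (proj ?L \<cdot> A \<cdot> w)"
        unfolding y_def by (rule selfadjD[OF selfadj_proj[OF L]])
      also have "\<dots> = inner x (A \<cdot> w)" using proj_fix_iff[OF L, of "A \<cdot> w"] Aw by simp
      finally have "inner (x - y) (A \<cdot> w) = 0" by (simp add: inner_diff_left)
      then show "inner (A \<cdot> (x - y)) w = inner 0 w" by (simp only: selfadjD[OF sa] inner_zero_left)
    qed
    moreover have "x - y \<in> K" using x yL LK subK by (auto intro: subspace_diff)
    ultimately have "x - y = 0" using inj by blast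
    then show "x \<in> ?L" using yL by simp
  qed
qed

context pvm
begin

lemma spectral_integral_pos_selfadj:
  assumes f: "f \<in> borel_measurable borel" "\<And>t. 0 \<le> f t"
  shows "pos_selfadj_on K (spectral_integral K E f)"
proof -
  define p where "p = (\<lambda>t. 1 / (1 + f t))"
  define q where "q = (\<lambda>t. f t / (1 + f t))"
  have p: "bnn p" and q: "bnn q" unfolding p_def q_def by (rule bnn_recip[OF f])+
  have f1: "0 < 1 + f t" for t using f(2)[of t] by linarith
  have p0: "0 < p t" for t using f1[of t] by (simp add: p_def)
  have "p t + q t = 1" for t using f1[of t] by (simp add: p_def q_def add_divide_distrib[symmetric])
  then have "calc p + calc q = proj K" using calc_add[OF p q] calc_one by simp
  then have pq: "calc p \<cdot> x + calc q \<cdot> x = proj K \<cdot> x" for x by (metis bop_simps(1))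
  have com: "calc q \<cdot> calc p \<cdot> x = calc p \<cdot> calc q \<cdot> x" for x
    using calc_commute[OF p q] by (metis bop_simps(6))
  note saq = cinner_selfadj[OF calc_selfadj[OF q]] and sap = cinner_selfadj[OF calc_selfadj[OF p]]
  have eq: "spectral_integral K E f = range (\<lambda>z. (calc p \<cdot> z, calc q \<cdot> z))"
    unfolding p_def q_def by (rule spectral_integral_nonneg[OF f])
  show ?thesis
    unfolding pos_selfadj_on_def eq
  proof (intro conjI)
    have "Domain (range (\<lambda>z. (calc p \<cdot> z, calc q \<cdot> z))) = range (bop_apply (calc p))" by auto
    then show "closure (Domain (range (\<lambda>z. (calc p \<cdot> z, calc q \<cdot> z)))) = K"
      using dense_range_selfadj[OF calc_selfadj[OF p] K calc_in[OF p] calc_inject[OF p p0]] by simp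
    show "adj_graph K (range (\<lambda>z. (calc p \<cdot> z, calc q \<cdot> z))) = range (\<lambda>z. (calc p \<cdot> z, calc q \<cdot> z))"
    proof (intro equalityI subsetI)
      fix s assume s: "s \<in> adj_graph K (range (\<lambda>z. (calc p \<cdot> z, calc q \<cdot> z)))"
      obtain x y where xy: "s = (x, y)" by (cases s)
      have inK: "x \<in> K" "y \<in> K" using s by (auto simp: xy adj_graph_def)
      have c: "cinner (calc q \<cdot> z) x = cinner (calc p \<cdot> z) y" for z using s by (auto simp: xy adj_graph_def)
      have qx: "calc q \<cdot> x = calc p \<cdot> y"
      proof (rule inner_ext)
        fix z
        have "cinner z (calc q \<cdot> x) = cinner z (calc p \<cdot> y)" using c[of z] by (simp only: saq sap)
        then show "inner (calc q \<cdot> x) z = inner (calc p \<cdot> y) z" by (metis Re_cinner inner_commute)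
      qed
      \<comment> \<open>Since \<open>p + q = 1\<close>, a pair with \<open>q x = p y\<close> is the
        point of the graph with parameter \<open>x + y\<close>.\<close>
      have h: "calc p \<cdot> (x + y) = x" "calc q \<cdot> (x + y) = y"
        using pq[of x] pq[of y] qx proj_fix_iff[OF K, of x] proj_fix_iff[OF K, of y] inK by simp_all
      then show "s \<in> range (\<lambda>z. (calc p \<cdot> z, calc q \<cdot> z))"
        by (intro range_eqI[where x="x + y"]) (simp only: xy h)
    next
      fix s assume "s \<in> range (\<lambda>z. (calc p \<cdot> z, calc q \<cdot> z))"
      then obtain v where s: "s = (calc p \<cdot> v, calc q \<cdot> v)" by blast
      have "cinner (calc q \<cdot> z) (calc p \<cdot> v) = cinner (calc p \<cdot> z) (calc q \<cdot> v)" for z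
        unfolding saq sap com ..
      then show "s \<in> adj_graph K (range (\<lambda>z. (calc p \<cdot> z, calc q \<cdot> z)))"
        using calc_in[OF p] calc_in[OF q] by (auto simp: s adj_graph_def)
    qed
    have "cinner (calc q \<cdot> z) (calc p \<cdot> z) \<in> \<real>\<^sub>\<ge>\<^sub>0" for z
    proof -
      have "cinner (calc q \<cdot> z) (calc p \<cdot> z) = cinner ((calc p * calc q) \<cdot> z) z" by (simp add: sap)
      then show ?thesis using pos_cinner[of "calc p * calc q" z] p q by (simp add: calc_mult[symmetric] calc_pos)
    qed
    then show "\<forall>(u, v)\<in>range (\<lambda>z. (calc p \<cdot> z, calc q \<cdot> z)). cinner v u \<in> \<real>\<^sub>\<ge>\<^sub>0" by auto
  qed
qed

lemma spectral_integral_sqrt_square: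
  assumes f: "f \<in> borel_measurable borel" "\<And>t. 0 \<le> f t"
  shows "spectral_integral K E (\<lambda>t. sqrt (f t)) O spectral_integral K E (\<lambda>t. sqrt (f t))
    = spectral_integral K E f"
proof -
  note [measurable] = f(1)
  define g where "g = (\<lambda>t. sqrt (f t))"
  have g: "g \<in> borel_measurable borel" "\<And>t. 0 \<le> g t" using f by (auto simp: g_def)
  have g2: "f t = g t * g t" for t using f(2)[of t] by (simp add: g_def)
  define p where "p = (\<lambda>t. 1 / (1 + g t))"
  define q where "q = (\<lambda>t. g t / (1 + g t))"
  define p' where "p' = (\<lambda>t. 1 / (1 + f t))"
  define q' where "q' = (\<lambda>t. f t / (1 + f t))"
  have p: "bnn p" and q: "bnn q" unfolding p_def q_def by (rule bnn_recip[OF g])+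
  have p': "bnn p'" and q': "bnn q'" unfolding p'_def q'_def by (rule bnn_recip[OF f])+
  have g1: "0 < 1 + g t" and f1: "0 < 1 + g t * g t" for t
    using g(2)[of t] mult_nonneg_nonneg[OF g(2)[of t] g(2)[of t]] by linarith+
  \<comment> \<open>\<open>r\<close> is the common ratio \<open>p^2/p' = q^2/q'\<close> and
    \<open>s\<close> its reciprocal. Both are bounded, so \<open>calc r\<close> and
    \<open>calc s\<close> translate between the parametrization by \<open>p^2\<close>,
    \<open>q^2\<close> and the one by \<open>p'\<close>, \<open>q'\<close>.\<close>
  define r where "r = (\<lambda>t. (1 + g t * g t) / ((1 + g t) * (1 + g t)))"
  define s where "s = (\<lambda>t. (1 + g t) * (1 + g t) / (1 + g t * g t))"
  have r: "bnn r"
    unfolding bnn_def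
  proof (intro conjI allI exI[of _ 1])
    fix t
    show "0 \<le> r t" "r t \<le> 1" using g1[of t] f1[of t] g(2)[of t] by (simp_all add: r_def divide_le_eq_1 algebra_simps)
    show "r \<in> borel_measurable borel" unfolding r_def using g(1) by measurable
  qed
  have s: "bnn s"
    unfolding bnn_def
  proof (intro conjI allI exI[of _ 2])
    fix t
    have "(1 + g t) * (1 + g t) \<le> 2 * (1 + g t * g t)"
      using zero_le_power2[of "1 - g t"] by (simp add: power2_eq_square algebra_simps)
    then show "s t \<le> 2" using f1[of t] by (simp add: s_def pos_divide_le_eq)
    show "0 \<le> s t" using g1[of t] f1[of t] by (simp add: s_def)
    show "s \<in> borel_measurable borel" unfolding s_def using g(1) by measurable
  qed
  have e1: "p t * p t = p' t * r t" "q t * q t = q' t * r t" for t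
    using g1[of t] f1[of t] by (simp_all add: p_def q_def p'_def q'_def r_def g2)
  have e2: "p' t = p t * p t * s t" "q' t = q t * q t * s t" for t
    using g1[of t] f1[of t] by (simp_all add: p_def q_def p'_def q'_def s_def g2)
  have ce1: "calc p * calc p = calc p' * calc r" "calc q * calc q = calc q' * calc r"
    unfolding calc_mult[OF p p, symmetric] calc_mult[OF q q, symmetric] calc_mult[OF p' r, symmetric]
      calc_mult[OF q' r, symmetric] e1 by (rule refl)+
  have ce2: "calc p' = calc p * calc p * calc s" "calc q' = calc q * calc q * calc s"
    using p q s by (simp_all add: calc_mult[symmetric] e2[symmetric])
  have "p t + q t = 1" for t using g1[of t] by (simp add: p_def q_def add_divide_distrib[symmetric])
  then have "calc p + calc q = proj K" using calc_add[OF p q] calc_one by simp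
  then have pq: "calc p \<cdot> x + calc q \<cdot> x = proj K \<cdot> x" for x by (metis bop_simps(1))
  have com: "calc q \<cdot> calc p \<cdot> x = calc p \<cdot> calc q \<cdot> x" for x
    using calc_commute[OF p q] by (metis bop_simps(6))
  have eg: "spectral_integral K E g = range (\<lambda>z. (calc p \<cdot> z, calc q \<cdot> z))"
    unfolding p_def q_def by (rule spectral_integral_nonneg[OF g])
  have ef: "spectral_integral K E f = range (\<lambda>z. (calc p' \<cdot> z, calc q' \<cdot> z))"
    unfolding p'_def q'_def by (rule spectral_integral_nonneg[OF f])
  have step: "spectral_integral K E g O spectral_integral K E g
      = range (\<lambda>v. (calc p \<cdot> calc p \<cdot> v, calc q \<cdot> calc q \<cdot> v))"
  proof (intro equalityI subsetI)
    fix u assume "u \<in> spectral_integral K E g O spectral_integral K E g"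
    then obtain z w where u: "u = (calc p \<cdot> z, calc q \<cdot> w)" and zw: "calc q \<cdot> z = calc p \<cdot> w"
      unfolding eg by blast
    have z: "proj K \<cdot> z = calc p \<cdot> (z + w)" and w: "proj K \<cdot> w = calc q \<cdot> (z + w)"
      using pq[of z] pq[of w] zw by simp_all
    have "u = (calc p \<cdot> calc p \<cdot> (z + w), calc q \<cdot> calc q \<cdot> (z + w))"
      unfolding u z[symmetric] w[symmetric] using calc_proj_apply p q by simp
    then show "u \<in> range (\<lambda>v. (calc p \<cdot> calc p \<cdot> v, calc q \<cdot> calc q \<cdot> v))" by blast
  next
    fix u assume "u \<in> range (\<lambda>v. (calc p \<cdot> calc p \<cdot> v, calc q \<cdot> calc q \<cdot> v))"
    then obtain v where u: "u = (calc p \<cdot> calc p \<cdot> v, calc q \<cdot> calc q \<cdot> v)" by blast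
    have "(calc p \<cdot> calc p \<cdot> v, calc q \<cdot> calc p \<cdot> v) \<in> spectral_integral K E g"
      unfolding eg by (rule rangeI)
    moreover have "(calc q \<cdot> calc p \<cdot> v, calc q \<cdot> calc q \<cdot> v) \<in> spectral_integral K E g"
      unfolding eg by (rule range_eqI[where x="calc q \<cdot> v"]) (simp only: com)
    ultimately show "u \<in> spectral_integral K E g O spectral_integral K E g" unfolding u by blast
  qed
  have "range (\<lambda>v. (calc p \<cdot> calc p \<cdot> v, calc q \<cdot> calc q \<cdot> v)) = range (\<lambda>z. (calc p' \<cdot> z, calc q' \<cdot> z))"
  proof (intro equalityI subsetI)
    fix u assume "u \<in> range (\<lambda>v. (calc p \<cdot> calc p \<cdot> v, calc q \<cdot> calc q \<cdot> v))"
    then obtain v where "u = ((calc p * calc p) \<cdot> v, (calc q * calc q) \<cdot> v)" by auto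
    then have "u = (calc p' \<cdot> calc r \<cdot> v, calc q' \<cdot> calc r \<cdot> v)" by (simp only: ce1 bop_simps(6))
    then show "u \<in> range (\<lambda>z. (calc p' \<cdot> z, calc q' \<cdot> z))" by blast
  next
    fix u assume "u \<in> range (\<lambda>z. (calc p' \<cdot> z, calc q' \<cdot> z))"
    then obtain z where "u = (calc p' \<cdot> z, calc q' \<cdot> z)" by blast
    then have "u = (calc p \<cdot> calc p \<cdot> calc s \<cdot> z, calc q \<cdot> calc q \<cdot> calc s \<cdot> z)" by (simp add: ce2)
    then show "u \<in> range (\<lambda>v. (calc p \<cdot> calc p \<cdot> v, calc q \<cdot> calc q \<cdot> v))" by blast
  qed
  with step ef show ?thesis by (simp add: g_def)
qed

lemma graph_sqrt_spectral_integral: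
  assumes f: "f \<in> borel_measurable borel" "\<And>t. 0 \<le> f t"
  shows "graph_sqrt K (spectral_integral K E f) = spectral_integral K E (\<lambda>t. sqrt (f t))"
  unfolding graph_sqrt_def
proof (rule the_equality)
  have "pos_selfadj_on K (spectral_integral K E (\<lambda>t. sqrt (f t)))"
    by (rule spectral_integral_pos_selfadj) (use f in auto)
  then show *: "pos_selfadj_on K (spectral_integral K E (\<lambda>t. sqrt (f t))) \<and>
      spectral_integral K E (\<lambda>t. sqrt (f t)) O spectral_integral K E (\<lambda>t. sqrt (f t)) = spectral_integral K E f"
    using spectral_integral_sqrt_square[OF f] by blast
  show "S = spectral_integral K E (\<lambda>t. sqrt (f t))"
    if "pos_selfadj_on K S \<and> S O S = spectral_integral K E f" for S
    by (rule pos_selfadj_sqrt_unique[OF K]) (use that * in auto)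
qed

lemma Domain_graph_sqrt:
  assumes f: "f \<in> borel_measurable borel" "\<And>t. 0 \<le> f t"
  shows "Domain (graph_sqrt K (spectral_integral K E f))
    = {x\<in>K. (\<integral>\<^sup>+ t. ennreal (f t) \<partial>vec_measure E x) < \<infinity>}"
proof -
  have s: "(\<lambda>t. sqrt (f t)) \<in> borel_measurable borel" "\<And>t. 0 \<le> sqrt (f t)" using f by auto
  have "Domain (graph_sqrt K (spectral_integral K E f)) = spectral_domain K E (\<lambda>t. sqrt (f t))"
    unfolding graph_sqrt_spectral_integral[OF f] spectral_integral_nonneg[OF s] spectral_domain_nonneg[OF s]
    by auto
  then show ?thesis by (simp add: spectral_domain_def f)
qed

end

section \<open>The spectral theorem\<close>

lemma closed_csubspace_ker: "closed_csubspace (ker A)"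
  unfolding closed_csubspace_def ker_def
proof (intro conjI ballI)
  show "subspace {x. A \<cdot> x = 0}" by (auto simp: subspace_def)
  show "closed {x. A \<cdot> x = 0}" by (intro closed_Collect_eq continuous_intros)
qed (simp add: scaleC_zero_right)

text \<open>The adjoint of the equation \<open>X Y = Z\<close>, in the form in which left and right
  absorption by a projection are exchanged throughout.\<close>

lemma selfadj_mult_adjI:
  assumes "selfadj X" "selfadj Y" "selfadj Z" "X * Y = Z"
  shows "Y * X = Z"
proof (rule bop_eqI, rule inner_ext)
  fix x y
  have "inner ((Y * X) \<cdot> x) y = inner x ((X * Y) \<cdot> y)"
    by (simp add: selfadjD[OF assms(1)] selfadjD[OF assms(2)])
  then show "inner ((Y * X) \<cdot> x) y = inner (Z \<cdot> x) y" by (simp only: assms(4) selfadjD[OF assms(3)])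
qed

text \<open>The projection onto the spectral subspace of \<open>H\<close> for \<open>(-\<infinity>, 0]\<close> is the projection onto the kernel
  of \<open>|H| + H\<close>, twice the positive part of \<open>H\<close>.\<close>

lemma ex_negative_projection:
  fixes H :: "'a::complex_hilbert bop"
  assumes H: "selfadj H"
  shows "\<exists>F. selfadj F \<and> F * F = F \<and> (\<forall>x. F \<cdot> x = x \<longrightarrow> inner (H \<cdot> x) x \<le> 0) \<and>
    (\<forall>x. F \<cdot> x = 0 \<longrightarrow> x \<noteq> 0 \<longrightarrow> 0 < inner (H \<cdot> x) x) \<and>
    (\<forall>Z. selfadj Z \<longrightarrow> Z * H = H * Z \<longrightarrow> Z * F = F * Z)"
proof -
  have H2: "0 \<le> H * H" by (rule pos_square[OF H])
  define J where "J = op_sqrt (H * H)"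
  have J: "0 \<le> J" "J * J = H * H" unfolding J_def by (rule op_sqrt_pos[OF H2] op_sqrt_square[OF H2])+
  have Jcom: "Z * J = J * Z" if "Z * H = H * Z" for Z
  proof -
    have "Z * (H * H) = H * Z * H" by (simp only: mult.assoc[symmetric] that)
    also have "\<dots> = H * H * Z" by (simp only: mult.assoc that)
    finally show ?thesis unfolding J_def by (rule op_sqrt_commute[OF H2])
  qed
  have HJ: "H * J = J * H" by (rule Jcom) simp
  have saJ: "selfadj J" by (rule pos_selfadj[OF J(1)])
  define X where "X = J + H"
  define Y where "Y = J - H"
  have sa: "selfadj X" "selfadj Y" using saJ H by (simp_all add: X_def Y_def)
  have XY: "X * Y = 0"
    unfolding X_def Y_def by (simp only: distrib_right right_diff_distrib J(2) HJ) simp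
  define F where "F = proj (ker X)"
  note N = closed_csubspace_ker[of X]
  have F: "selfadj F" "F * F = F" unfolding F_def by (rule selfadj_proj[OF N] proj_idem[OF N])+
  have Fin: "X \<cdot> F \<cdot> x = 0" for x using proj_in[OF N, of x] by (simp add: F_def ker_def)
  have Ffix: "F \<cdot> x = x" if "X \<cdot> x = 0" for x
    using proj_fix_iff[OF N, of x] that by (simp add: F_def ker_def)
  have FY: "F * Y = Y"
  proof (rule bop_eqI)
    fix x
    have "X \<cdot> Y \<cdot> x = 0" using XY by (metis bop_simps(4,6))
    then show "(F * Y) \<cdot> x = Y \<cdot> x" using Ffix by simp
  qed
  have YF: "Y * F = Y" by (rule selfadj_mult_adjI[OF F(1) sa(2) sa(2) FY])
  have XF: "X * F = 0" by (rule bop_eqI) (simp add: Fin)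
  have dbl: "X + Y = J + J" "X - Y = H + H" by (simp_all add: X_def Y_def)
  \<comment> \<open>\<open>F\<close> kills \<open>X\<close> and fixes \<open>Y\<close>, so
    compressing \<open>X + Y = 2 J\<close> leaves \<open>Y\<close>, which is thus positive.\<close>
  have "F * (J + J) * F = Y"
    unfolding dbl(1)[symmetric] by (simp only: distrib_left distrib_right mult.assoc XF YF FY) simp
  then have Ypos: "0 \<le> Y" using pos_sandwich[OF F(1) pos_add[OF J(1) J(1)]] by simp
  have le0: "inner (H \<cdot> x) x \<le> 0" if "F \<cdot> x = x" for x
  proof -
    have "X \<cdot> x = 0" using Fin[of x] that by simp
    then have "H \<cdot> x + H \<cdot> x = - (Y \<cdot> x)" using dbl(2) by (metis bop_simps(1,2) diff_0)
    then have "inner (H \<cdot> x) x + inner (H \<cdot> x) x = - inner (Y \<cdot> x) x"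
      by (simp flip: inner_add_left)
    then show ?thesis using pos_form[OF Ypos, of x] by linarith
  qed
  have gt0: "0 < inner (H \<cdot> x) x" if "F \<cdot> x = 0" "x \<noteq> 0" for x
  proof -
    have "Y \<cdot> x = 0" using YF that(1) by (metis bop_simps(6) bop_linear(4))
    then have HJx: "H \<cdot> x = J \<cdot> x" by (simp add: Y_def)
    \<comment> \<open>A vanishing form would put \<open>x\<close> into the kernel of
      \<open>X\<close>, the range of \<open>F\<close>. This is why the inequality off the range is
      strict.\<close>
    have "inner (J \<cdot> x) x \<noteq> 0"
    proof
      assume "inner (J \<cdot> x) x = 0"
      then have "J \<cdot> x = 0" using pos_form_zero_iff[OF J(1)] by blast
      then have "X \<cdot> x = 0" using HJx by (simp add: X_def)
      then show False using Ffix that by metis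
    qed
    then show ?thesis unfolding HJx using pos_form[OF J(1), of x] by linarith
  qed
  have com: "Z * F = F * Z" if Z: "selfadj Z" "Z * H = H * Z" for Z
  proof -
    have ZX: "Z * X = X * Z" unfolding X_def by (simp only: distrib_left distrib_right Jcom[OF Z(2)] Z(2))
    \<comment> \<open>\<open>Z\<close> leaves the kernel of \<open>X\<close> invariant; being
      self-adjoint, it then commutes with the projection onto it.\<close>
    have 1: "F * (Z * F) = Z * F"
    proof (rule bop_eqI)
      fix x
      have "X \<cdot> Z \<cdot> F \<cdot> x = Z \<cdot> X \<cdot> F \<cdot> x" using ZX by (metis bop_simps(6))
      then have "X \<cdot> Z \<cdot> F \<cdot> x = 0" by (simp add: Fin)
      then show "(F * (Z * F)) \<cdot> x = (Z * F) \<cdot> x" using Ffix by simp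
    qed
    have "selfadj (Z * F)" using selfadj_sandwich[OF F(1) Z(1)] 1 by (simp add: mult.assoc)
    then show ?thesis by (rule selfadj_mult_adjI[OF Z(1) F(1) _ refl, symmetric])
  qed
  show ?thesis using F le0 gt0 com by blast
qed

lemma ex_spectral_cut:
  fixes R :: "'a::complex_hilbert bop"
  assumes R: "selfadj R"
  shows "\<exists>F. selfadj F \<and> F * F = F \<and> (\<forall>x. F \<cdot> x = x \<longrightarrow> inner (R \<cdot> x) x \<le> t * inner x x) \<and>
    (\<forall>x. F \<cdot> x = 0 \<longrightarrow> x \<noteq> 0 \<longrightarrow> t * inner x x < inner (R \<cdot> x) x) \<and>
    (\<forall>Z. selfadj Z \<longrightarrow> Z * R = R * Z \<longrightarrow> Z * F = F * Z)"
proof -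
  define H where "H = R - t *\<^sub>R 1"
  have saH: "selfadj H" unfolding H_def using R by simp
  have Hf: "inner (H \<cdot> x) x = inner (R \<cdot> x) x - t * inner x x" for x by (simp add: H_def inner_diff_left)
  have Hc: "Z * H = H * Z \<longleftrightarrow> Z * R = R * Z" for Z
    by (simp add: H_def left_diff_distrib right_diff_distrib)
  show ?thesis using ex_negative_projection[OF saH] unfolding Hf Hc by simp
qed

text \<open>A vector in the range of \<open>P\<close> and in the kernel of \<open>F\<close> would
  satisfy both form inequalities at once, so it is zero.\<close>

lemma projection_le_cut:
  assumes P: "P * P = P" and F: "F * F = F" and com: "P * F = F * P"
    and le: "\<And>x. P \<cdot> x = x \<Longrightarrow> inner (R \<cdot> x) x \<le> s * inner x x"
    and gt: "\<And>x. F \<cdot> x = 0 \<Longrightarrow> x \<noteq> 0 \<Longrightarrow> t * inner x x < inner (R \<cdot> x) x"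
    and "s \<le> t"
  shows "F * P = P"
proof (rule bop_eqI)
  fix x
  define y where "y = P \<cdot> x - F \<cdot> P \<cdot> x"
  have FF: "F \<cdot> F \<cdot> v = F \<cdot> v" and PP: "P \<cdot> P \<cdot> v = P \<cdot> v" and PF: "P \<cdot> F \<cdot> v = F \<cdot> P \<cdot> v" for v
    using F P com by (metis bop_simps(6))+
  have "F \<cdot> y = 0" "P \<cdot> y = y" by (simp_all add: y_def FF PP PF)
  then have "y = 0"
    using le[of y] gt[of y] mult_right_mono[OF \<open>s \<le> t\<close>, of "inner y y"] by fastforce
  then show "(F * P) \<cdot> x = P \<cdot> x" by (simp add: y_def)
qed

text \<open>The half-lines are an intersection-stable generator, so complements and disjoint unions
  suffice.\<close>

lemma borel_induct_atMost [consumes 1, case_names atMost empty compl union]: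
  assumes "\<Delta> \<in> sets (borel :: real measure)"
    and "\<And>t. P {..t}" and "P {}"
    and "\<And>\<Delta>. \<Delta> \<in> sets borel \<Longrightarrow> P \<Delta> \<Longrightarrow> P (UNIV - \<Delta>)"
    and "\<And>F::nat \<Rightarrow> real set. disjoint_family F \<Longrightarrow> range F \<subseteq> sets borel \<Longrightarrow> (\<And>i. P (F i)) \<Longrightarrow> P (\<Union>i. F i)"
  shows "P \<Delta>"
proof -
  have eq: "sets (borel :: real measure) = sigma_sets UNIV (range (\<lambda>a. {..a}))"
    by (subst borel_eq_atMost) (simp add: sets_measure_of)
  have "Int_stable (range (\<lambda>a::real. {..a}))"
    by (auto simp: Int_stable_def)
  moreover have "range (\<lambda>a::real. {..a}) \<subseteq> Pow UNIV" by simp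
  moreover have "\<Delta> \<in> sigma_sets UNIV (range (\<lambda>a. {..a}))" using assms(1) by (simp only: eq)
  ultimately show ?thesis
    by (induction rule: sigma_sets_induct_disjoint) (use assms(2-) in \<open>auto simp only: eq\<close>)
qed

lemma scale_vec_measure:
  assumes "pvm K E"
  shows "vec_measure E (c *\<^sub>C x) = density (vec_measure E x) (\<lambda>_. ennreal ((cmod c)\<^sup>2))"
proof -
  interpret pvm K E by (rule assms)
  show ?thesis
  proof (rule measure_eqI)
    fix \<Delta> assume "\<Delta> \<in> sets (vec_measure E (c *\<^sub>C x))"
    then have D: "\<Delta> \<in> sets borel" by simp
    have "inner (E \<Delta> \<cdot> (c *\<^sub>C x)) (c *\<^sub>C x) = Re ((c * cnj c) * cinner (E \<Delta> \<cdot> x) x)"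
      by (simp add: Re_cinner[symmetric] cinner_scaleC_left cinner_scaleC_right mult.assoc mult.left_commute)
    also have "\<dots> = (cmod c)\<^sup>2 * inner (E \<Delta> \<cdot> x) x"
      by (simp add: complex_norm_square[symmetric] Re_cinner flip: of_real_power)
    finally show "emeasure (vec_measure E (c *\<^sub>C x)) \<Delta>
      = emeasure (density (vec_measure E x) (\<lambda>_. ennreal ((cmod c)\<^sup>2))) \<Delta>"
      using D by (subst emeasure_density)
        (auto simp: emeasure_vm ennreal_mult pos_form E_pos nn_integral_cmult)
  qed simp
qed

section \<open>Uniqueness of the spectral measure\<close>

locale pvm_of = pvm K E for K :: "'a::complex_hilbert set" and E +
  fixes R :: "'a bop"
  assumes SI: "spectral_integral K E (\<lambda>t. t) = {(x, R \<cdot> x) |x. x \<in> K}"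
    and saR: "selfadj R" and RK: "R * proj K = R"
begin

lemma square_integrable: "x \<in> K \<Longrightarrow> (\<integral>\<^sup>+ t. ennreal (t\<^sup>2) \<partial>vec_measure E x) < \<infinity>"
proof -
  assume "x \<in> K"
  then have "(x, R \<cdot> x) \<in> spectral_integral K E (\<lambda>t. t)" unfolding SI by blast
  then show ?thesis by (simp add: spectral_integral_def spectral_domain_def)
qed

lemma integrable_id: "x \<in> K \<Longrightarrow> integrable (vec_measure E x) (\<lambda>t. t)"
proof (rule integrableI_bounded)
  assume x: "x \<in> K"
  have "(\<integral>\<^sup>+ t. ennreal (norm t) \<partial>vec_measure E x) \<le> (\<integral>\<^sup>+ t. 1 + ennreal (t\<^sup>2) \<partial>vec_measure E x)"
  proof (rule nn_integral_mono)
    fix t :: real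
    have "\<bar>t\<bar> \<le> 1 + t\<^sup>2" using zero_le_power2[of "\<bar>t\<bar> - 1"] by (simp add: power2_diff)
    from ennreal_leI[OF this] show "ennreal (norm t) \<le> 1 + ennreal (t\<^sup>2)" by (simp add: ennreal_plus)
  qed
  also have "\<dots> = emeasure (vec_measure E x) UNIV + (\<integral>\<^sup>+ t. ennreal (t\<^sup>2) \<partial>vec_measure E x)"
    by (subst nn_integral_add) (auto intro!: measurable_vm)
  also have "\<dots> < \<infinity>" using square_integrable[OF x] by (simp add: emeasure_vm)
  finally show "(\<integral>\<^sup>+ t. ennreal (norm t) \<partial>vec_measure E x) < \<infinity>" .
qed (auto intro: measurable_vm)

text \<open>In the polarized definition with both vectors equal, all four arguments are multiples of
  \<open>x\<close>, and the sum collapses to a single integral.\<close>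

lemma form_eq_integral:
  assumes x: "x \<in> K"
  shows "inner (R \<cdot> x) x = (\<integral>t. t \<partial>vec_measure E x)"
proof -
  let ?I = "\<integral>t. t \<partial>vec_measure E x"
  have dens: "(\<integral>t. t \<partial>vec_measure E (c *\<^sub>C x)) = (cmod c)\<^sup>2 * ?I" for c
    unfolding scale_vec_measure[OF pvm_axioms]
    by (subst integral_real_density) (auto intro: measurable_vm)
  have c: "x + \<i> ^ k *\<^sub>C x = (1 + \<i> ^ k) *\<^sub>C x" for k
    using scaleC_of_real[of 1 x] by (simp add: scaleC_add_left)
  have "(x, R \<cdot> x) \<in> spectral_integral K E (\<lambda>t. t)" unfolding SI using x by blast
  moreover from this have "x \<in> spectral_domain K E (\<lambda>t. t)" by (simp add: spectral_integral_def)
  ultimately have "cinner (R \<cdot> x) x =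
      (\<Sum>k<4. \<i> ^ k * complex_of_real (\<integral>t. t \<partial>vec_measure E (x + \<i> ^ k *\<^sub>C x))) / 4"
    unfolding spectral_integral_def by blast
  also have "\<dots> = (\<Sum>k<4. \<i> ^ k * complex_of_real ((cmod (1 + \<i> ^ k))\<^sup>2)) / 4 * complex_of_real ?I"
    by (simp only: c dens of_real_mult sum_distrib_right times_divide_eq_left mult.assoc)
  \<comment> \<open>The squared moduli are 4, 2, 0 and 2; the two imaginary terms cancel.\<close>
  also have "(\<Sum>k<4. \<i> ^ k * complex_of_real ((cmod (1 + \<i> ^ k))\<^sup>2)) = 4"
  proof -
    have "{..<4::nat} = {0, 1, 2, 3}" by auto
    then show ?thesis by (simp add: cmod_def power3_eq_cube complex_eq_iff)
  qed
  finally show ?thesis by (simp flip: Re_cinner)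
qed

lemma mass_UNIV: "x \<in> K \<Longrightarrow> measure (vec_measure E x) UNIV = inner x x"
  using proj_fix_iff[OF K, of x] by (simp add: measure_def emeasure_vm E_UNIV)

lemma AE_in: "\<Delta> \<in> sets borel \<Longrightarrow> E \<Delta> \<cdot> x = x \<Longrightarrow> AE t in vec_measure E x. t \<in> \<Delta>"
proof -
  assume D: "\<Delta> \<in> sets borel" and x: "E \<Delta> \<cdot> x = x"
  have cD: "UNIV - \<Delta> \<in> sets borel" using D by auto
  have "E (UNIV - \<Delta>) \<cdot> x = (E (UNIV - \<Delta>) * E \<Delta>) \<cdot> x" by (simp add: x)
  also have "\<dots> = E ((UNIV - \<Delta>) \<inter> \<Delta>) \<cdot> x" by (simp only: E_Int[OF cD D])
  also have "(UNIV - \<Delta>) \<inter> \<Delta> = {}" by blast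
  finally have "emeasure (vec_measure E x) (UNIV - \<Delta>) = 0" by (simp add: emeasure_vm[OF cD])
  then show ?thesis using cD by (intro AE_I[where N="UNIV - \<Delta>"]) auto
qed

lemma E_atMost_form: "E {..t} \<cdot> x = x \<Longrightarrow> inner (R \<cdot> x) x \<le> t * inner x x"
proof -
  assume x: "E {..t} \<cdot> x = x"
  have xK: "x \<in> K" using E_in[of "{..t}" x] x by simp
  interpret finite_measure "vec_measure E x" by (rule finite_measure_vm)
  have "(\<integral>s. s \<partial>vec_measure E x) \<le> (\<integral>s. t \<partial>vec_measure E x)"
    by (rule integral_mono_AE) (use AE_in[OF _ x] integrable_id[OF xK] in auto)
  then show ?thesis by (simp add: form_eq_integral[OF xK] mass_UNIV[OF xK] mult.commute)
qed

lemma E_greaterThan_form: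
  assumes x: "E {t<..} \<cdot> x = x" "x \<noteq> 0"
  shows "t * inner x x < inner (R \<cdot> x) x"
proof (rule ccontr)
  assume not: "\<not> t * inner x x < inner (R \<cdot> x) x"
  have xK: "x \<in> K" using E_in[of "{t<..}" x] x by simp
  interpret finite_measure "vec_measure E x" by (rule finite_measure_vm)
  have int: "integrable (vec_measure E x) (\<lambda>s. s - t)" using integrable_id[OF xK] by auto
  have ae: "AE s in vec_measure E x. t < s" using AE_in[OF _ x(1)] by simp
  have "(\<integral>s. s - t \<partial>vec_measure E x) = inner (R \<cdot> x) x - t * inner x x"
    using integrable_id[OF xK] by (simp add: form_eq_integral[OF xK] mass_UNIV[OF xK] mult.commute)
  moreover have "0 \<le> (\<integral>s. s - t \<partial>vec_measure E x)"
    by (rule integral_nonneg_AE) (use ae in eventually_elim, simp)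
  ultimately have "(\<integral>s. s - t \<partial>vec_measure E x) = 0" using not by simp
  then have "AE s in vec_measure E x. s - t = 0"
    by (subst (asm) integral_nonneg_eq_0_iff_AE[OF int]) (use ae in \<open>eventually_elim, simp\<close>)
  with ae have "AE s in vec_measure E x. False" by eventually_elim simp
  then have "emeasure (vec_measure E x) UNIV = 0"
    using emeasure_eq_0_AE[of "\<lambda>t. True" "vec_measure E x"] by simp
  then have "measure (vec_measure E x) UNIV = 0" by (simp add: measure_def)
  then show False using mass_UNIV[OF xK] x(2) by simp
qed

text \<open>The graph condition gives \<open>R\<close> only as a form. Splitting the integral at
  \<open>t\<close> shows that \<open>R\<close> has the same form as its block diagonal part with
  respect to \<open>e\<close> and \<open>e'\<close>, so it equals that part and commutes with
  \<open>e\<close>.\<close>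

lemma E_atMost_commute: "E {..t} * R = R * E {..t}"
proof -
  define e where "e = E {..t}"
  define e' where "e' = E {t<..}"
  have e: "selfadj e" "e * e = e" and e': "selfadj e'" "e' * e' = e'"
    unfolding e_def e'_def by (simp_all add: E_selfadj E_idem)
  have ee': "e * e' = 0" "e' * e = 0"
    unfolding e_def e'_def using E_Int[of "{..t}" "{t<..}"] E_Int[of "{t<..}" "{..t}"]
    by (simp_all add: Int_def not_le[symmetric])
  have PR: "proj K * R = R" by (rule selfadj_mult_adjI[OF saR selfadj_proj[OF K] saR RK])
  have Pe: "e \<cdot> proj K \<cdot> x = e \<cdot> x" "e' \<cdot> proj K \<cdot> x = e' \<cdot> x" for x
    using calc_proj_apply[of "indicator {..t}" x] calc_proj_apply[of "indicator {t<..}" x]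
    by (simp_all add: e_def e'_def calc_indicator)
  have dens: "(\<integral>s. s \<partial>vec_measure E (E \<Delta> \<cdot> x)) = (\<integral>s. indicator \<Delta> s * s \<partial>vec_measure E x)"
    if D: "\<Delta> \<in> sets borel" for \<Delta> x
  proof -
    have "vec_measure E (E \<Delta> \<cdot> x) = density (vec_measure E x) (\<lambda>s. ennreal ((indicator \<Delta> s)\<^sup>2))"
      using vm_calc[of "indicator \<Delta>" x] D by (simp add: calc_indicator)
    also have "\<dots> = density (vec_measure E x) (\<lambda>s. ennreal (indicator \<Delta> s))"
      by (rule arg_cong2[where f=density]) (auto simp: indicator_def)
    finally show ?thesis using D
      by (simp only:) (subst integral_real_density, auto intro!: measurable_vm)
  qed
  have K': "inner ((e * R * e + e' * R * e') \<cdot> x) x = inner (R \<cdot> x) x" if x: "x \<in> K" for x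
  proof -
    have i: "integrable (vec_measure E x) (\<lambda>s. indicator \<Delta> s * s)" if "\<Delta> \<in> sets borel" for \<Delta>
      using integrable_mult_indicator[OF _ integrable_id[OF x], of \<Delta>] that by simp
    have "inner ((e * R * e + e' * R * e') \<cdot> x) x = inner (R \<cdot> e \<cdot> x) (e \<cdot> x) + inner (R \<cdot> e' \<cdot> x) (e' \<cdot> x)"
      by (simp add: inner_add_left selfadjD[OF e(1)] selfadjD[OF e'(1)])
    also have "\<dots> = (\<integral>s. s \<partial>vec_measure E (e \<cdot> x)) + (\<integral>s. s \<partial>vec_measure E (e' \<cdot> x))"
      unfolding e_def e'_def by (simp add: form_eq_integral E_in)
    also have "\<dots> = (\<integral>s. indicator {..t} s * s \<partial>vec_measure E x) + (\<integral>s. indicator {t<..} s * s \<partial>vec_measure E x)"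
      unfolding e_def e'_def by (simp add: dens)
    also have "\<dots> = (\<integral>s. indicator {..t} s * s + indicator {t<..} s * s \<partial>vec_measure E x)"
      by (rule Bochner_Integration.integral_add[symmetric]) (auto intro: i)
    also have "\<dots> = (\<integral>s. s \<partial>vec_measure E x)"
      by (rule Bochner_Integration.integral_cong) (auto simp: indicator_def)
    finally show ?thesis by (simp add: form_eq_integral[OF x])
  qed
  have "e * R * e + e' * R * e' = R"
  proof (rule selfadj_form_eqI)
    show "selfadj (e * R * e + e' * R * e')" using e e' saR by (simp add: selfadj_sandwich)
    fix x
    have "inner ((e * R * e + e' * R * e') \<cdot> x) x = inner ((e * R * e + e' * R * e') \<cdot> proj K \<cdot> x) (proj K \<cdot> x)"
      by (simp add: inner_add_left selfadjD[OF e(1)] selfadjD[OF e'(1)] Pe)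
    also have "\<dots> = inner (R \<cdot> proj K \<cdot> x) (proj K \<cdot> x)" by (rule K'[OF proj_in[OF K]])
    also have "\<dots> = inner ((proj K * R * proj K) \<cdot> x) x" by (simp add: selfadjD[OF selfadj_proj[OF K]])
    also have "proj K * R * proj K = R" by (simp add: PR RK)
    finally show "inner ((e * R * e + e' * R * e') \<cdot> x) x = inner (R \<cdot> x) x" .
  qed (rule saR)
  note R = this
  have "e * R = e * (e * R * e + e' * R * e')" by (simp only: R)
  also have "\<dots> = e * R * e" by (simp only: distrib_left mult.assoc[symmetric] e(2) ee') simp
  also have "\<dots> = (e * R * e + e' * R * e') * e" by (simp only: distrib_right mult.assoc e(2) ee') simp
  finally have "e * R = R * e" by (simp only: R)
  then show ?thesis by (simp only: e_def)
qed

text \<open>The right side does not mention \<open>E\<close>, which is what uniqueness needs. As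
  \<open>e\<close> and \<open>e'\<close> commute with \<open>R\<close>, they commute with
  \<open>F\<close>; then the form inequalities give \<open>F e = e\<close> and
  \<open>F e' = 0\<close>.\<close>

lemma E_atMost_eq:
  assumes F: "selfadj F" "F * F = F"
    and le: "\<And>x. F \<cdot> x = x \<Longrightarrow> inner (R \<cdot> x) x \<le> t * inner x x"
    and gt: "\<And>x. F \<cdot> x = 0 \<Longrightarrow> x \<noteq> 0 \<Longrightarrow> t * inner x x < inner (R \<cdot> x) x"
    and com: "\<And>Z. selfadj Z \<Longrightarrow> Z * R = R * Z \<Longrightarrow> Z * F = F * Z"
  shows "E {..t} = F * proj K"
proof -
  define e where "e = E {..t}"
  define e' where "e' = E {t<..}"
  have e: "selfadj e" "e * e = e" and e': "selfadj e'" "e' * e' = e'"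
    unfolding e_def e'_def by (simp_all add: E_selfadj E_idem)
  have "calc (\<lambda>s. indicator {..t} s + indicator {t<..} s) = calc (\<lambda>s. 1)"
    by (rule arg_cong[where f=calc]) (auto simp: indicator_def)
  then have sum: "e + e' = proj K" by (simp add: calc_add calc_indicator calc_one e_def e'_def)
  have PR: "proj K * R = R" by (rule selfadj_mult_adjI[OF saR selfadj_proj[OF K] saR RK])
  have eR: "e * R = R * e" unfolding e_def by (rule E_atMost_commute)
  have eF: "e * F = F * e" by (rule com[OF e(1) eR])
  have e'_eq: "e' = proj K - e" using sum by (simp add: algebra_simps)
  have "e' * R = R * e'" unfolding e'_eq by (simp only: left_diff_distrib right_diff_distrib eR PR RK)
  then have e'F: "e' * F = F * e'" by (rule com[OF e'(1)])
  have Fe: "F * e = e"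
    by (rule projection_le_cut[OF e(2) F(2) eF _ gt order_refl]) (auto simp: e_def E_atMost_form)
  have "F * e' = 0"
  proof (rule bop_eqI)
    fix x
    define y where "y = F \<cdot> e' \<cdot> x"
    have y1: "F \<cdot> y = y" unfolding y_def using F(2) by (metis bop_simps(6))
    have y2: "e' \<cdot> y = y" unfolding y_def using e'(2) e'F by (metis bop_simps(6))
    have "y = 0" using le[OF y1] E_greaterThan_form[of t y] y2 unfolding e'_def by fastforce
    then show "(F * e') \<cdot> x = 0 \<cdot> x" by (simp add: y_def)
  qed
  then have "F * proj K = e" unfolding sum[symmetric] by (simp add: distrib_left Fe)
  then show ?thesis by (simp add: e_def)
qed

end

lemma pvm_of_unique:
  assumes "pvm_of K E R" "pvm_of K E' R"
  shows "E = E'"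
proof
  fix \<Delta>
  interpret A: pvm_of K E R by (rule assms(1))
  interpret B: pvm_of K E' R by (rule assms(2))
  have at: "E {..t} = E' {..t}" for t
  proof -
    obtain F where F: "selfadj F" "F * F = F" "\<forall>x. F \<cdot> x = x \<longrightarrow> inner (R \<cdot> x) x \<le> t * inner x x"
      "\<forall>x. F \<cdot> x = 0 \<longrightarrow> x \<noteq> 0 \<longrightarrow> t * inner x x < inner (R \<cdot> x) x"
      "\<forall>Z. selfadj Z \<longrightarrow> Z * R = R * Z \<longrightarrow> Z * F = F * Z"
      using ex_spectral_cut[OF A.saR, of t] by (elim exE conjE) (rule that)
    note cut = F(1,2) F(3)[rule_format] F(4)[rule_format] F(5)[rule_format]
    have "E {..t} = F * proj K" by (rule A.E_atMost_eq[OF cut])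
    moreover have "E' {..t} = F * proj K" by (rule B.E_atMost_eq[OF cut])
    ultimately show ?thesis by simp
  qed
  have "E \<Delta> = E' \<Delta>" if "\<Delta> \<in> sets borel"
    using that
  proof (induction rule: borel_induct_atMost)
    case (compl \<Delta>)
    have *: "EE (UNIV - \<Delta>) = proj K - EE \<Delta>" if "pvm K EE" for EE
    proof -
      interpret pvm K EE by (rule that)
      have c: "UNIV - \<Delta> \<in> sets borel" using compl by auto
      have "calc (\<lambda>s. indicator \<Delta> s + indicator (UNIV - \<Delta>) s) = calc (\<lambda>s. 1)"
        by (rule arg_cong[where f=calc]) (auto simp: indicator_def)
      then have "EE \<Delta> + EE (UNIV - \<Delta>) = proj K"
        using compl c by (simp add: calc_add calc_indicator calc_one)
      then show ?thesis by (simp add: algebra_simps)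
    qed
    show ?case using *[OF A.pvm_axioms] *[OF B.pvm_axioms] compl by simp
  next
    case (union F)
    show ?case
    proof (rule bop_eqI)
      fix x
      have "(\<lambda>n. E (F n) \<cdot> x) sums (E (\<Union>n. F n) \<cdot> x)" by (rule A.E_sums) (use union in auto)
      moreover have "(\<lambda>n. E (F n) \<cdot> x) sums (E' (\<Union>n. F n) \<cdot> x)"
        unfolding union(3) by (rule B.E_sums) (use union in auto)
      ultimately show "E (\<Union>n. F n) \<cdot> x = E' (\<Union>n. F n) \<cdot> x" by (rule sums_unique2)
    qed
  qed (simp_all add: at)
  \<comment> \<open>Off the Borel sets both take the value \<open>0\<close> fixed in
    \<open>pvm_on\<close>; equality as functions depends on this convention.\<close>
  moreover have "E \<Delta> = E' \<Delta>" if "\<Delta> \<notin> sets borel"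
    using that A.E B.E unfolding pvm_on_def by metis
  ultimately show "E \<Delta> = E' \<Delta>" by blast
qed

section \<open>Construction of a spectral measure from its half-line projections\<close>

locale spectral_family =
  fixes R :: "'a::complex_hilbert bop" and F :: "real \<Rightarrow> 'a bop"
  assumes Rpos: "0 \<le> R" and Rle: "R \<le> 1"
    and F_sa: "selfadj (F t)" and F_idem: "F t * F t = F t"
    and F_le: "F t \<cdot> x = x \<Longrightarrow> inner (R \<cdot> x) x \<le> t * inner x x"
    and F_gt: "F t \<cdot> x = 0 \<Longrightarrow> x \<noteq> 0 \<Longrightarrow> t * inner x x < inner (R \<cdot> x) x"
    and F_com: "selfadj Z \<Longrightarrow> Z * R = R * Z \<Longrightarrow> Z * F t = F t * Z"
begin

lemma R_F: "R * F t = F t * R"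
  by (rule F_com[OF pos_selfadj[OF Rpos] refl])

lemma F_F: "F s * F t = F t * F s"
  by (rule F_com[OF F_sa R_F[symmetric]])

lemma F_mono: "s \<le> t \<Longrightarrow> F t * F s = F s"
  by (rule projection_le_cut[OF F_idem F_idem F_F F_le F_gt])

lemma F_mono_apply: "s \<le> t \<Longrightarrow> F t \<cdot> F s \<cdot> x = F s \<cdot> x" "s \<le> t \<Longrightarrow> F s \<cdot> F t \<cdot> x = F s \<cdot> x"
  using F_mono[of s t] F_F[of s t] by (metis bop_simps(6))+

lemma F_neg: "t < 0 \<Longrightarrow> F t = 0"
proof (rule bop_eqI)
  fix x assume t: "t < 0"
  define y where "y = F t \<cdot> x"
  have "F t \<cdot> y = y" unfolding y_def using F_idem by (metis bop_simps(6))
  then have "0 \<le> t * inner y y" using F_le[of t y] pos_form[OF Rpos, of y] by linarith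
  then have "inner y y = 0" using t inner_ge_zero[of y] by (simp add: zero_le_mult_iff)
  then show "F t \<cdot> x = 0 \<cdot> x" by (simp add: y_def)
qed

lemma F_one: "1 \<le> t \<Longrightarrow> F t = 1"
proof (rule bop_eqI)
  fix x assume t: "1 \<le> t"
  define y where "y = x - F t \<cdot> x"
  have "F t \<cdot> F t \<cdot> x = F t \<cdot> x" using F_idem by (metis bop_simps(6))
  then have y0: "F t \<cdot> y = 0" by (simp add: y_def)
  have "inner (R \<cdot> y) y \<le> inner y y" using le_bop_form[OF Rle, of y] by simp
  also have "\<dots> \<le> t * inner y y" using mult_right_mono[OF t, of "inner y y"] by simp
  finally have "y = 0" using F_gt[OF y0] by fastforce
  then show "F t \<cdot> x = 1 \<cdot> x" by (simp add: y_def)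
qed

definition G :: "'a \<Rightarrow> real \<Rightarrow> real" where
  "G x t = inner (F t \<cdot> x) x"

lemma G_mono: "s \<le> t \<Longrightarrow> G x s \<le> G x t"
proof -
  assume st: "s \<le> t"
  have "norm (F s \<cdot> x) \<le> norm (F t \<cdot> x)"
    using projection_norm_le[OF F_sa F_idem, of s "F t \<cdot> x"] F_mono_apply(2)[OF st] by simp
  then show ?thesis unfolding G_def projection_form[OF F_sa F_idem] by (intro power_mono) auto
qed

text \<open>The cuts satisfy a non-strict upper bound. The strong limit from the right inherits it
  at \<open>a\<close>, so the difference \<open>y\<close> to \<open>F a\<close> obeys both
  \<open>R <= a\<close> and, being killed by \<open>F a\<close>, the strict opposite, unless it is
  zero.\<close>

lemma G_right_cont: "continuous (at_right a) (G x)"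
proof -
  define t where "t n = a + 1 / Suc n" for n :: nat
  have tlim: "t \<longlonglongrightarrow> a"
    using tendsto_add[OF tendsto_const[of a] LIMSEQ_Suc[OF lim_1_over_n]] by (simp add: t_def[abs_def])
  have ta: "a < t n" for n by (simp add: t_def)
  have tdec: "m \<le> n \<Longrightarrow> t n \<le> t m" for m n by (auto simp: t_def intro!: divide_left_mono)
  \<comment> \<open>The projections decrease along \<open>t\<close>; their complements increase, as
    \<open>incseq_sot_limit\<close> requires.\<close>
  define Y where "Y n = 1 - F (t n)" for n
  have Yinc: "Y n \<le> Y (Suc n)" for n
  proof (rule le_bopI)
    show "selfadj (Y (Suc n) - Y n)" by (simp add: Y_def F_sa)
    show "inner (Y n \<cdot> x) x \<le> inner (Y (Suc n) \<cdot> x) x" for x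
      using G_mono[OF tdec[of n "Suc n"], of x] by (simp add: Y_def G_def inner_diff_left)
  qed
  have Ysa: "selfadj (Y n)" "Y n * Y n = Y n" for n
    unfolding Y_def by (simp add: F_sa) (rule projection_compl[OF F_sa F_idem])
  have Ypos: "0 \<le> Y n" and Yle: "Y n \<le> 1" for n
    by (rule projection_pos[OF Ysa] projection_le_one[OF Ysa])+
  obtain X where X: "sot_tendsto Y X sequentially"
    using incseq_sot_limit[of Y 1, OF Yinc Ypos Yle] by blast
  define L where "L = 1 - X"
  have Llim: "(\<lambda>n. F (t n) \<cdot> z) \<longlonglongrightarrow> L \<cdot> z" for z
    using tendsto_diff[OF tendsto_const[of z] X[unfolded sot_tendsto_def, rule_format, of z]]
    by (simp add: Y_def L_def)
  have LF: "L \<cdot> x = F a \<cdot> x"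
  proof -
    define y where "y = L \<cdot> x - F a \<cdot> x"
    have "F (t m) \<cdot> L \<cdot> x = L \<cdot> x" for m
    proof (rule LIMSEQ_unique)
      show "(\<lambda>n. F (t m) \<cdot> F (t n) \<cdot> x) \<longlonglongrightarrow> F (t m) \<cdot> L \<cdot> x" by (intro tendsto_intros Llim)
      show "(\<lambda>n. F (t m) \<cdot> F (t n) \<cdot> x) \<longlonglongrightarrow> L \<cdot> x"
        by (rule Lim_transform_eventually[OF Llim[of x]])
          (use F_mono_apply(1)[OF tdec] in \<open>auto simp: eventually_sequentially intro!: exI[of _ m]\<close>)
    qed
    then have "F (t m) \<cdot> y = y" for m using F_mono_apply(1)[of a "t m" x] ta[of m] by (simp add: y_def)
    then have "inner (R \<cdot> y) y \<le> t m * inner y y" for m by (rule F_le)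
    then have le: "inner (R \<cdot> y) y \<le> a * inner y y"
      by (intro LIMSEQ_le_const[OF tendsto_mult_right[OF tlim]]) auto
    have "F a \<cdot> L \<cdot> x = F a \<cdot> x"
    proof (rule LIMSEQ_unique)
      show "(\<lambda>n. F a \<cdot> F (t n) \<cdot> x) \<longlonglongrightarrow> F a \<cdot> L \<cdot> x" by (intro tendsto_intros Llim)
      show "(\<lambda>n. F a \<cdot> F (t n) \<cdot> x) \<longlonglongrightarrow> F a \<cdot> x"
        using F_mono_apply(2)[of a "t _" x] ta by (simp add: less_imp_le)
    qed
    then have "F a \<cdot> y = 0" using F_mono_apply(1)[of a a x] by (simp add: y_def)
    then have "y = 0" using F_gt[of a y] le by fastforce
    then show ?thesis by (simp add: y_def)
  qed
  have Glim: "(\<lambda>n. G x (t n)) \<longlonglongrightarrow> G x a"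
    unfolding G_def LF[symmetric] by (intro tendsto_intros Llim)
  show ?thesis
    unfolding continuous_within
  proof (rule tendstoI)
    fix e :: real assume "0 < e"
    then obtain n where n: "dist (G x (t n)) (G x a) < e"
      using tendstoD[OF Glim] by (auto simp: eventually_sequentially)
    have "dist (G x s) (G x a) < e" if "a < s" "s < t n" for s
      using n G_mono[of a s x] G_mono[of s "t n" x] that by (auto simp: dist_real_def)
    then show "\<forall>\<^sub>F s in at_right a. dist (G x s) (G x a) < e"
      using ta[of n] by (auto simp: eventually_at_right[OF ta[of n]])
  qed
qed

definition M :: "'a \<Rightarrow> real measure" where
  "M x = interval_measure (G x)"

lemma sets_M [simp]: "sets (M x) = sets borel"
  by (simp add: M_def)

lemma space_M [simp]: "space (M x) = UNIV"
  by (simp add: M_def)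

lemma emeasure_M_atMost: "emeasure (M x) {..t} = ennreal (G x t)"
proof (rule LIMSEQ_unique)
  define I where "I n = {- real (Suc n)<..t}" for n :: nat
  have Gneg: "G x s = 0" if "s < 0" for s using F_neg[OF that] by (simp add: G_def)
  have I: "emeasure (M x) (I n) = ennreal (G x t)" for n
    unfolding I_def M_def
    by (subst emeasure_interval_measure_Ioc_eq[OF G_mono G_right_cont]) (auto simp: Gneg)
  have "(\<Union>n. I n) = {..t}"
  proof -
    have "\<exists>n. - real (Suc n) < s" for s
    proof -
      obtain n :: nat where "- s < real n" using reals_Archimedean2 by blast
      then show ?thesis by (intro exI[of _ n]) simp
    qed
    then show ?thesis unfolding I_def by auto
  qed
  moreover have "(\<lambda>n. emeasure (M x) (I n)) \<longlonglongrightarrow> emeasure (M x) (\<Union>n. I n)"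
    by (rule Lim_emeasure_incseq) (auto simp: I_def incseq_def)
  ultimately show "(\<lambda>n. emeasure (M x) (I n)) \<longlonglongrightarrow> emeasure (M x) {..t}" by simp
  show "(\<lambda>n. emeasure (M x) (I n)) \<longlonglongrightarrow> ennreal (G x t)" by (simp add: I)
qed

lemma emeasure_M_UNIV: "emeasure (M x) UNIV = ennreal (inner x x)"
proof (rule LIMSEQ_unique)
  define I where "I n = {..real (Suc n)}" for n :: nat
  have "emeasure (M x) (I n) = ennreal (inner x x)" for n
    unfolding I_def emeasure_M_atMost by (simp add: G_def F_one)
  then show "(\<lambda>n. emeasure (M x) (I n)) \<longlonglongrightarrow> ennreal (inner x x)" by simp
  have "(\<Union>n. I n) = UNIV"
  proof -
    have "\<exists>n. s \<le> real (Suc n)" for s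
    proof -
      obtain n :: nat where "s \<le> real n" using real_arch_simple by blast
      then show ?thesis by (intro exI[of _ n]) simp
    qed
    then show ?thesis unfolding I_def by auto
  qed
  moreover have "(\<lambda>n. emeasure (M x) (I n)) \<longlonglongrightarrow> emeasure (M x) (\<Union>n. I n)"
    by (rule Lim_emeasure_incseq) (auto simp: I_def incseq_def)
  ultimately show "(\<lambda>n. emeasure (M x) (I n)) \<longlonglongrightarrow> emeasure (M x) UNIV" by simp
qed

text \<open>The counterpart of \<open>rep\<close> for single sets, usable before a projection-valued
  measure exists.\<close>

definition rep0 :: "real set \<Rightarrow> 'a bop \<Rightarrow> bool" where
  "rep0 \<Delta> X \<longleftrightarrow> 0 \<le> X \<and> (\<forall>x. emeasure (M x) \<Delta> = ennreal (inner (X \<cdot> x) x))"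

lemma rep0_unique: "rep0 \<Delta> X \<Longrightarrow> rep0 \<Delta> Y \<Longrightarrow> X = Y"
proof (rule selfadj_form_eqI)
  assume *: "rep0 \<Delta> X" "rep0 \<Delta> Y"
  then show "selfadj X" "selfadj Y" by (simp_all add: rep0_def pos_selfadj)
  fix x
  have "ennreal (inner (X \<cdot> x) x) = ennreal (inner (Y \<cdot> x) x)" using * by (simp add: rep0_def)
  moreover have "0 \<le> inner (X \<cdot> x) x" "0 \<le> inner (Y \<cdot> x) x" using * by (simp_all add: rep0_def pos_form)
  ultimately show "inner (X \<cdot> x) x = inner (Y \<cdot> x) x" by simp
qed

lemma rep0_atMost: "rep0 {..t} (F t)"
  unfolding rep0_def by (simp add: emeasure_M_atMost G_def projection_pos F_sa F_idem)

lemma rep0_empty: "rep0 {} 0"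
  by (simp add: rep0_def)

lemma rep0_compl:
  assumes D: "\<Delta> \<in> sets borel" and X: "rep0 \<Delta> X"
  shows "rep0 (UNIV - \<Delta>) (1 - X)"
proof -
  have f: "inner (X \<cdot> x) x \<le> inner x x" for x
  proof -
    have "ennreal (inner (X \<cdot> x) x) \<le> ennreal (inner x x)"
      using emeasure_mono[of \<Delta> UNIV "M x"] X by (simp add: rep0_def emeasure_M_UNIV)
    then show ?thesis by simp
  qed
  have "0 \<le> 1 - X"
    by (rule posI) (use X f in \<open>auto simp: rep0_def pos_selfadj inner_diff_left\<close>)
  moreover have "emeasure (M x) (UNIV - \<Delta>) = ennreal (inner ((1 - X) \<cdot> x) x)" for x
  proof -
    have "emeasure (M x) (UNIV - \<Delta>) = emeasure (M x) UNIV - emeasure (M x) \<Delta>"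
      by (rule emeasure_Diff) (use D X in \<open>auto simp: rep0_def\<close>)
    also have "\<dots> = ennreal (inner x x - inner (X \<cdot> x) x)"
      using X by (simp add: rep0_def emeasure_M_UNIV ennreal_minus pos_form)
    finally show ?thesis by (simp add: inner_diff_left)
  qed
  ultimately show ?thesis by (simp add: rep0_def)
qed

text \<open>The partial sums increase and stay below \<open>1\<close>, because the scalar measures
  have total mass \<open>inner x x\<close>; their strong limit gives existence and strong countable
  additivity together.\<close>

lemma rep0_union:
  assumes Fd: "disjoint_family D" "range D \<subseteq> sets borel" and X: "\<And>i::nat. rep0 (D i) (X i)"
  shows "\<exists>Y. rep0 (\<Union>i. D i) Y \<and> (\<forall>x. (\<lambda>i. X i \<cdot> x) sums (Y \<cdot> x))"
proof -
  define S where "S n = (\<Sum>i<n. X i)" for n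
  have Xpos: "0 \<le> X i" for i using X by (simp add: rep0_def)
  have Spos: "0 \<le> S n" for n
    by (induction n) (simp_all add: S_def pos_add Xpos)
  have inc: "S n \<le> S (Suc n)" for n
    using Xpos[of n] by (simp add: S_def le_bop_iff_diff[of "sum X _"])
  have sum_em: "(\<Sum>i. ennreal (inner (X i \<cdot> x) x)) = emeasure (M x) (\<Union>i. D i)" for x
    using suminf_emeasure[of D "M x"] Fd X by (simp add: rep0_def)
  have "S n \<le> 1" for n
  proof (rule le_bopI)
    show "selfadj (1 - S n)" using Spos by (simp add: pos_selfadj)
    fix x
    have "ennreal (inner (S n \<cdot> x) x) = (\<Sum>i<n. ennreal (inner (X i \<cdot> x) x))"
      by (subst sum_ennreal) (simp_all add: S_def inner_sum_left pos_form Xpos)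
    also have "\<dots> \<le> (\<Sum>i. ennreal (inner (X i \<cdot> x) x))" by (rule sum_le_suminf) auto
    also have "\<dots> \<le> emeasure (M x) UNIV"
      unfolding sum_em by (rule emeasure_mono) auto
    finally have "ennreal (inner (S n \<cdot> x) x) \<le> ennreal (inner x x)" by (simp add: emeasure_M_UNIV)
    then show "inner (S n \<cdot> x) x \<le> inner (1 \<cdot> x) x" by simp
  qed
  then obtain Y where Y: "0 \<le> Y" "sot_tendsto S Y sequentially"
    using incseq_sot_limit[of S 1, OF inc Spos] by blast
  have sums: "(\<lambda>i. X i \<cdot> x) sums (Y \<cdot> x)" for x
    using Y(2) by (simp add: sot_tendsto_def S_def sums_def)
  have "emeasure (M x) (\<Union>i. D i) = ennreal (inner (Y \<cdot> x) x)" for x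
    unfolding sum_em[symmetric]
    by (rule suminf_ennreal_eq) (simp_all add: pos_form Xpos bounded_linear.sums[OF bounded_linear_inner_left sums])
  then show ?thesis using Y(1) sums by (auto simp: rep0_def)
qed

lemma ex_rep0: "\<Delta> \<in> sets borel \<Longrightarrow> \<exists>X. rep0 \<Delta> X"
proof (induction rule: borel_induct_atMost)
  case (atMost t) show ?case using rep0_atMost by blast
next
  case empty show ?case using rep0_empty by blast
next
  case (compl \<Delta>) then show ?case using rep0_compl by blast
next
  case (union D)
  then obtain X where "\<And>i. rep0 (D i) (X i)" by metis
  from rep0_union[OF union(1,2) this] show ?case by blast
qed

definition E0 :: "real set \<Rightarrow> 'a bop" where
  "E0 \<Delta> = (SOME X. rep0 \<Delta> X)"

lemma rep0_E0: "\<Delta> \<in> sets borel \<Longrightarrow> rep0 \<Delta> (E0 \<Delta>)"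
  unfolding E0_def using ex_rep0 by (rule someI_ex)

lemma E0_eqI: "\<Delta> \<in> sets borel \<Longrightarrow> rep0 \<Delta> X \<Longrightarrow> E0 \<Delta> = X"
  using rep0_E0 rep0_unique by blast

lemma E0_atMost: "E0 {..t} = F t"
  by (rule E0_eqI[OF _ rep0_atMost]) simp

lemma E0_empty: "E0 {} = 0"
  by (rule E0_eqI[OF _ rep0_empty]) simp

lemma E0_compl: "\<Delta> \<in> sets borel \<Longrightarrow> E0 (UNIV - \<Delta>) = 1 - E0 \<Delta>"
  by (rule E0_eqI[OF _ rep0_compl[OF _ rep0_E0]]) auto

lemma E0_selfadj: "\<Delta> \<in> sets borel \<Longrightarrow> selfadj (E0 \<Delta>)"
  using rep0_E0 by (auto simp: rep0_def pos_selfadj)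

lemma E0_sums:
  assumes "disjoint_family D" "range D \<subseteq> sets borel"
  shows "(\<lambda>i::nat. E0 (D i) \<cdot> x) sums (E0 (\<Union>i. D i) \<cdot> x)"
proof -
  have rep: "\<And>i. rep0 (D i) (E0 (D i))" using assms(2) rep0_E0 by blast
  obtain Y where Y: "rep0 (\<Union>i. D i) Y" "\<forall>x. (\<lambda>i. E0 (D i) \<cdot> x) sums (Y \<cdot> x)"
    using rep0_union[OF assms rep] by blast
  have "(\<Union>i. D i) \<in> sets borel" using assms(2) by blast
  then show ?thesis using E0_eqI[OF _ Y(1)] Y(2) by simp
qed

lemma E0_commute:
  assumes Z: "\<And>t. Z * F t = F t * Z"
  shows "\<Delta> \<in> sets borel \<Longrightarrow> Z * E0 \<Delta> = E0 \<Delta> * Z"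
proof (induction rule: borel_induct_atMost)
  case (atMost t) show ?case unfolding E0_atMost by (rule Z)
next
  case empty show ?case by (simp add: E0_empty)
next
  case (compl \<Delta>)
  then show ?case unfolding E0_compl[OF compl(1)] by (simp only: left_diff_distrib right_diff_distrib) simp
next
  case (union D)
  show ?case
  proof (rule bop_eqI)
    fix x
    have 1: "(\<lambda>i. Z \<cdot> E0 (D i) \<cdot> x) sums (Z \<cdot> E0 (\<Union>i. D i) \<cdot> x)"
      by (rule bounded_linear.sums[OF bounded_linear_bop E0_sums[OF union(1,2)]])
    have "Z \<cdot> E0 (D i) \<cdot> x = E0 (D i) \<cdot> Z \<cdot> x" for i using union(3)[of i] by (metis bop_simps(6))
    then have "(\<lambda>i. Z \<cdot> E0 (D i) \<cdot> x) sums (E0 (\<Union>i. D i) \<cdot> Z \<cdot> x)"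
      using E0_sums[OF union(1,2), of "Z \<cdot> x"] by simp
    then show "(Z * E0 (\<Union>i. D i)) \<cdot> x = (E0 (\<Union>i. D i) * Z) \<cdot> x" using sums_unique2[OF 1] by simp
  qed
qed

text \<open>One half of a two-stage induction: the second set is fixed and the half-lines are
  assumed. Used first with a half-line as the fixed set and then, after taking adjoints, with an
  arbitrary one.\<close>

lemma E0_Int_step:
  assumes D0: "\<Delta>0 \<in> sets borel" and at: "\<And>t. E0 ({..t} \<inter> \<Delta>0) = F t * E0 \<Delta>0"
  shows "\<Delta> \<in> sets borel \<Longrightarrow> E0 (\<Delta> \<inter> \<Delta>0) = E0 \<Delta> * E0 \<Delta>0"
proof (induction rule: borel_induct_atMost)
  case (atMost t) show ?case unfolding E0_atMost by (rule at)
next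
  case empty show ?case by (simp add: E0_empty)
next
  case (compl \<Delta>)
  have b: "\<Delta> \<inter> \<Delta>0 \<in> sets borel" "(UNIV - \<Delta>) \<inter> \<Delta>0 \<in> sets borel" using compl D0 by auto
  have "rep0 ((UNIV - \<Delta>) \<inter> \<Delta>0) (E0 \<Delta>0 - E0 (\<Delta> \<inter> \<Delta>0))"
  proof -
    have em: "emeasure (M x) \<Delta>0 = emeasure (M x) (\<Delta> \<inter> \<Delta>0) + emeasure (M x) ((UNIV - \<Delta>) \<inter> \<Delta>0)" for x
      by (subst plus_emeasure) (use b in \<open>auto intro!: arg_cong[where f="emeasure (M x)"]\<close>)
    have f: "inner (E0 \<Delta>0 \<cdot> x) x = inner (E0 (\<Delta> \<inter> \<Delta>0) \<cdot> x) x + inner (E0 ((UNIV - \<Delta>) \<inter> \<Delta>0) \<cdot> x) x" for x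
    proof -
      note r = rep0_E0[OF D0] rep0_E0[OF b(1)] rep0_E0[OF b(2)]
      have "ennreal (inner (E0 \<Delta>0 \<cdot> x) x)
        = ennreal (inner (E0 (\<Delta> \<inter> \<Delta>0) \<cdot> x) x + inner (E0 ((UNIV - \<Delta>) \<inter> \<Delta>0) \<cdot> x) x)"
        using em[of x] r by (simp add: rep0_def pos_form ennreal_plus)
      moreover have "0 \<le> inner (E0 \<Delta>0 \<cdot> x) x" "0 \<le> inner (E0 (\<Delta> \<inter> \<Delta>0) \<cdot> x) x"
        "0 \<le> inner (E0 ((UNIV - \<Delta>) \<inter> \<Delta>0) \<cdot> x) x"
        using r by (simp_all add: rep0_def pos_form)
      ultimately show ?thesis by (metis add_nonneg_nonneg ennreal_inj)
    qed
    have "E0 \<Delta>0 - E0 (\<Delta> \<inter> \<Delta>0) = E0 ((UNIV - \<Delta>) \<inter> \<Delta>0)"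
      by (rule selfadj_form_eqI) (use f D0 b E0_selfadj in \<open>auto simp: inner_diff_left\<close>)
    then show ?thesis using rep0_E0[OF b(2)] by simp
  qed
  then have "E0 ((UNIV - \<Delta>) \<inter> \<Delta>0) = E0 \<Delta>0 - E0 (\<Delta> \<inter> \<Delta>0)" by (rule E0_eqI[OF b(2)])
  then show ?case unfolding E0_compl[OF compl(1)] compl(2) by (simp add: left_diff_distrib)
next
  case (union D)
  show ?case
  proof (rule bop_eqI)
    fix x
    have "(\<lambda>i. E0 (D i \<inter> \<Delta>0) \<cdot> x) sums (E0 (\<Union>i. D i \<inter> \<Delta>0) \<cdot> x)"
      by (rule E0_sums) (use union(1,2) D0 in \<open>auto simp: disjoint_family_on_def\<close>)
    moreover have "(\<lambda>i. E0 (D i \<inter> \<Delta>0) \<cdot> x) sums (E0 (\<Union>i. D i) \<cdot> E0 \<Delta>0 \<cdot> x)"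
      unfolding union(3) using E0_sums[OF union(1,2), of "E0 \<Delta>0 \<cdot> x"] by simp
    ultimately have "E0 (\<Union>i. D i \<inter> \<Delta>0) \<cdot> x = E0 (\<Union>i. D i) \<cdot> E0 \<Delta>0 \<cdot> x" by (rule sums_unique2)
    then show "E0 ((\<Union>i. D i) \<inter> \<Delta>0) \<cdot> x = (E0 (\<Union>i. D i) * E0 \<Delta>0) \<cdot> x" by simp
  qed
qed

lemma E0_Int:
  assumes D: "\<Delta> \<in> sets borel" and D': "\<Delta>' \<in> sets borel"
  shows "E0 (\<Delta> \<inter> \<Delta>') = E0 \<Delta> * E0 \<Delta>'"
proof (rule E0_Int_step[OF D' _ D])
  fix t
  have "E0 (\<Delta>' \<inter> {..t}) = E0 \<Delta>' * E0 {..t}"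
  proof (rule E0_Int_step[OF _ _ D'])
    fix s
    have "{..s} \<inter> {..t} = {..min s t}" by auto
    then show "E0 ({..s} \<inter> {..t}) = F s * E0 {..t}"
      using F_mono[of s t] F_mono[of t s] F_F[of s t] by (cases "s \<le> t") (auto simp: E0_atMost min_def)
  qed simp
  from selfadj_mult_adjI[OF _ _ _ this[symmetric]]
  have "E0 {..t} * E0 \<Delta>' = E0 (\<Delta>' \<inter> {..t})" using D' by (simp add: E0_selfadj)
  then show "E0 ({..t} \<inter> \<Delta>') = F t * E0 \<Delta>'" by (simp add: E0_atMost Int_commute)
qed

end

context pvm
begin

lemma bnn_unit_id: "bnn (\<lambda>t. t * indicator {0..1} t)"
  by (auto simp: bnn_def indicator_def intro!: exI[of _ 1])

lemma AE_unit:
  assumes "E (- {0..1}) = 0"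
  shows "AE t in vec_measure E x. t \<in> {0..1}"
  by (rule AE_I[where N="- {0..1}"]) (use assms in \<open>auto simp: emeasure_vm\<close>)

lemma spectral_integral_unit_id:
  assumes E0: "E (- {0..1}) = 0"
  shows "spectral_integral K E (\<lambda>t. t) = {(x, calc (\<lambda>t. t * indicator {0..1} t) \<cdot> x) |x. x \<in> K}"
proof -
  define g where "g = (\<lambda>t::real. t * indicator {0..1} t)"
  have g: "bnn g" unfolding g_def by (rule bnn_unit_id)
  have [measurable]: "g \<in> borel_measurable borel" using g by (simp add: bnn_def)
  have dom: "spectral_domain K E (\<lambda>t. t) = K"
  proof -
    have "(\<integral>\<^sup>+ t. ennreal (t\<^sup>2) \<partial>vec_measure E x) < \<infinity>" for x
    proof -
      have "(\<integral>\<^sup>+ t. ennreal (t\<^sup>2) \<partial>vec_measure E x) \<le> (\<integral>\<^sup>+ t. 1 \<partial>vec_measure E x)"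
        by (rule nn_integral_mono_AE, use AE_unit[OF E0, of x] in eventually_elim)
          (auto simp: power_le_one)
      also have "\<dots> < \<infinity>" by (simp add: emeasure_vm)
      finally show ?thesis .
    qed
    then show ?thesis by (auto simp: spectral_domain_def)
  qed
  have int: "(\<integral>t. t \<partial>vec_measure E v) = inner (calc g \<cdot> v) v" for v
  proof -
    have "(\<integral>t. t \<partial>vec_measure E v) = (\<integral>t. g t \<partial>vec_measure E v)"
      by (rule integral_cong_AE) (use AE_unit[OF E0, of v] in \<open>auto simp: g_def intro!: measurable_vm\<close>)
    also have "\<dots> = enn2real (\<integral>\<^sup>+ t. ennreal (g t) \<partial>vec_measure E v)"
      by (rule integral_eq_nn_integral) (use g in \<open>auto simp: bnn_def intro!: measurable_vm\<close>)
    also have "\<dots> = inner (calc g \<cdot> v) v" using g by (simp add: calc_nn_integral pos_form calc_pos)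
    finally show ?thesis .
  qed
  have pol: "(\<Sum>k<4. \<i> ^ k * complex_of_real (\<integral>t. t \<partial>vec_measure E (x + \<i> ^ k *\<^sub>C z))) / 4
      = cinner (calc g \<cdot> x) z" for x z
    unfolding int by (rule polarization[OF calc_selfadj[OF g]])
  have subK: "subspace K" using K by (simp add: closed_csubspace_def)
  have "y = calc g \<cdot> x" if y: "y \<in> K" "\<forall>z\<in>K. cinner y z = cinner (calc g \<cdot> x) z" for x y
  proof -
    define d where "d = y - calc g \<cdot> x"
    have "d \<in> K" unfolding d_def by (rule subspace_diff[OF subK y(1) calc_in[OF g]])
    then have "cinner d d = 0" using y(2) by (simp add: d_def cinner_diff_left)
    then have "inner d d = 0" by (metis Re_cinner zero_complex.sel(1))
    then show ?thesis by (simp add: d_def)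
  qed
  then show ?thesis
    unfolding spectral_integral_def dom pol g_def[symmetric] using calc_in[OF g] by blast
qed

end

section \<open>Restriction to a closed subspace and the spectral theorem\<close>

locale spectral_family_on = spectral_family R F for R :: "'a::complex_hilbert bop" and F +
  fixes K :: "'a set"
  assumes K: "closed_csubspace K" and RK: "R * proj K = R"
begin

text \<open>\<open>E0\<close> resolves the identity of the whole space and places the complement of
  \<open>K\<close>, on which \<open>R\<close> vanishes, at the point 0; the factor
  \<open>proj K\<close> removes it.\<close>

definition EK :: "real set \<Rightarrow> 'a bop" where
  "EK \<Delta> = (if \<Delta> \<in> sets borel then E0 \<Delta> * proj K else 0)"

lemma KR: "proj K * R = R"
  by (rule selfadj_mult_adjI[OF pos_selfadj[OF Rpos] selfadj_proj[OF K] pos_selfadj[OF Rpos] RK])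

lemma E0_proj: "\<Delta> \<in> sets borel \<Longrightarrow> proj K * E0 \<Delta> = E0 \<Delta> * proj K"
  by (rule E0_commute[OF F_com[OF selfadj_proj[OF K]]]) (simp_all only: RK KR)

lemma E0_R: "\<Delta> \<in> sets borel \<Longrightarrow> R * E0 \<Delta> = E0 \<Delta> * R"
  by (rule E0_commute[OF R_F])

lemma pvm_EK: "pvm K EK"
proof
  note P = selfadj_proj[OF K] proj_idem[OF K]
  have PP: "X * proj K * proj K = X * proj K" for X by (simp only: mult.assoc P(2))
  have Ec: "proj K * (E0 \<Delta> * X) = E0 \<Delta> * (proj K * X)" if "\<Delta> \<in> sets borel" for \<Delta> X
    by (simp only: mult.assoc[symmetric] E0_proj[OF that])
  have Int: "EK (\<Delta> \<inter> \<Delta>') = EK \<Delta> * EK \<Delta>'" if "\<Delta> \<in> sets borel" "\<Delta>' \<in> sets borel" for \<Delta> \<Delta>'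
  proof -
    have b: "\<Delta> \<inter> \<Delta>' \<in> sets borel" using that by auto
    show ?thesis unfolding EK_def if_P[OF that(1)] if_P[OF that(2)] if_P[OF b]
      by (simp only: E0_Int[OF that] mult.assoc Ec[OF that(2)] P(2))
  qed
  show "pvm_on K EK"
    unfolding pvm_on_def
  proof (intro conjI ballI allI impI)
    fix \<Delta> :: "real set" assume D: "\<Delta> \<in> sets borel"
    show "op_on K (EK \<Delta>)" unfolding op_on_def EK_def if_P[OF D] by (simp only: mult.assoc Ec[OF D] P(2))
    show "adj (EK \<Delta>) = EK \<Delta>"
      unfolding adj_eq_self_iff EK_def if_P[OF D] by (rule selfadj_mult[OF E0_selfadj[OF D] P(1) E0_proj[OF D, symmetric]])
    show "EK \<Delta> * EK \<Delta> = EK \<Delta>" using Int[OF D D] by simp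
  next
    show "EK {} = 0" by (simp add: EK_def E0_empty)
    show "EK UNIV = proj K" using E0_compl[of "{}"] by (simp add: EK_def E0_empty)
  next
    fix D :: "nat \<Rightarrow> real set" and x
    assume D: "range D \<subseteq> sets borel \<and> disjoint_family D"
    then have b: "D n \<in> sets borel" "(\<Union>n. D n) \<in> sets borel" for n by auto
    show "(\<lambda>n. EK (D n) \<cdot> x) sums (EK (\<Union>n. D n) \<cdot> x)"
      using E0_sums[of D "proj K \<cdot> x"] D b by (simp add: EK_def)
  next
    fix \<Delta> \<Delta>' :: "real set" assume "\<Delta> \<in> sets borel" "\<Delta>' \<in> sets borel"
    then show "EK (\<Delta> \<inter> \<Delta>') = EK \<Delta> * EK \<Delta>'" by (rule Int)
  next
    fix \<Delta> :: "real set" assume "\<Delta> \<notin> sets borel"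
    then show "EK \<Delta> = 0" by (simp add: EK_def)
  qed
qed (rule K)

sublocale P: pvm K EK by (rule pvm_EK)

lemma EK_atMost: "EK {..t} = F t * proj K"
  by (simp add: EK_def E0_atMost)

lemma EK_Un: "\<Delta> \<in> sets borel \<Longrightarrow> \<Delta>' \<in> sets borel \<Longrightarrow> \<Delta> \<inter> \<Delta>' = {} \<Longrightarrow> EK (\<Delta> \<union> \<Delta>') = EK \<Delta> + EK \<Delta>'"
proof -
  assume D: "\<Delta> \<in> sets borel" "\<Delta>' \<in> sets borel" "\<Delta> \<inter> \<Delta>' = {}"
  have "P.calc (indicator (\<Delta> \<union> \<Delta>')) = P.calc (\<lambda>s. indicator \<Delta> s + indicator \<Delta>' s)"
    by (rule arg_cong[where f=P.calc], rule ext) (use D in \<open>auto simp: indicator_def\<close>)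
  then show ?thesis using D by (simp add: P.calc_add P.calc_indicator)
qed

lemma EK_unit: "EK (- {0..1}) = 0"
proof -
  have neg: "EK {..<0} = 0"
  proof (rule bop_eqI)
    fix x
    define I where "I n = {..- (1 / real (Suc n))}" for n
    have "(\<Union>n. I n) = {..<0}"
    proof -
      have "\<exists>n. s \<le> - (1 / real (Suc n))" if s: "s < 0" for s
      proof -
        obtain n where "inverse (real (Suc n)) < - s" using reals_Archimedean[of "- s"] s by auto
        then show ?thesis by (intro exI[of _ n]) (simp add: inverse_eq_divide)
      qed
      moreover have "- (1 / real (Suc n)) < 0" for n by simp
      ultimately show ?thesis unfolding I_def by (auto intro: le_less_trans)
    qed
    moreover have "(\<lambda>n. EK (I n) \<cdot> x) \<longlonglongrightarrow> EK (\<Union>n. I n) \<cdot> x"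
    proof (rule P.E_tendsto)
      show "range I \<subseteq> sets borel" by (auto simp: I_def)
      show "incseq I"
        unfolding incseq_def
      proof (intro allI impI)
        fix m n :: nat assume "m \<le> n"
        then have "1 / real (Suc n) \<le> 1 / real (Suc m)" by (intro divide_left_mono) auto
        then show "I m \<subseteq> I n" unfolding I_def atMost_subset_iff by linarith
      qed
    qed
    moreover have "EK (I n) \<cdot> x = 0" for n unfolding I_def EK_atMost by (simp add: F_neg)
    ultimately show "EK {..<0} \<cdot> x = 0 \<cdot> x" using LIMSEQ_unique[OF _ tendsto_const] by fastforce
  qed
  have "EK ({..1} \<union> {1<..}) = EK {..1} + EK {1<..}" by (rule EK_Un) auto
  moreover have "{..1} \<union> {1<..} = (UNIV :: real set)" by auto
  ultimately have "EK {1<..} = 0" by (simp add: P.E_UNIV EK_atMost F_one)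
  moreover have "EK ({..<0} \<union> {1<..}) = EK {..<0} + EK {1<..}" by (rule EK_Un) auto
  moreover have "{..<0} \<union> {1<..} = - {0..1::real}" by auto
  ultimately show ?thesis using neg by simp
qed

text \<open>On the range of \<open>E(a,b]\<close> the forms of \<open>R\<close> and of \<open>\<integral> t dE\<close> both lie between \<open>a\<close> and \<open>b\<close>;
  summing over a partition of mesh \<open>1/n\<close> shows that they agree.\<close>

lemma calc_EK: "P.calc (\<lambda>t. t * indicator {0..1} t) = R"
proof -
  define g where "g = (\<lambda>t::real. t * indicator {0..1} t)"
  have g: "P.bnn g" unfolding g_def by (rule P.bnn_unit_id)
  define D where "D = P.calc g - R"
  have saD: "selfadj D" unfolding D_def by (simp add: P.calc_selfadj[OF g] pos_selfadj[OF Rpos])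
  have com: "D * EK \<Delta> = EK \<Delta> * D" if "\<Delta> \<in> sets borel" for \<Delta>
  proof -
    have 1: "P.calc g * EK \<Delta> = EK \<Delta> * P.calc g"
      using P.calc_commute[OF g P.bnn_indicator[OF that]] by (simp only: P.calc_indicator[OF that])
    have "R * EK \<Delta> = E0 \<Delta> * (R * proj K)"
      unfolding EK_def if_P[OF that] by (simp only: mult.assoc[symmetric] E0_R[OF that])
    also have "\<dots> = EK \<Delta> * R"
      unfolding EK_def if_P[OF that] by (simp only: RK mult.assoc KR)
    finally show ?thesis unfolding D_def by (simp only: left_diff_distrib right_diff_distrib 1)
  qed
  have bound: "\<bar>inner (D \<cdot> y) y\<bar> \<le> (b - a) * inner y y"
    if y: "EK {a<..b} \<cdot> y = y" and ab: "a \<le> b" "0 \<le> b" for a b y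
  proof -
    have yK: "proj K \<cdot> y = y" using proj_fix_iff[OF K] P.E_in[of "{a<..b}" y] y by simp
    have "(EK {..b} * EK {a<..b}) \<cdot> y = EK ({..b} \<inter> {a<..b}) \<cdot> y" by (subst P.E_Int) auto
    also have "{..b} \<inter> {a<..b} = {a<..b}" by auto
    finally have "F b \<cdot> y = y" using y yK by (simp add: EK_atMost)
    then have R1: "inner (R \<cdot> y) y \<le> b * inner y y" by (rule F_le)
    have "(EK {..a} * EK {a<..b}) \<cdot> y = EK ({..a} \<inter> {a<..b}) \<cdot> y" by (subst P.E_Int) auto
    also have "{..a} \<inter> {a<..b} = {}" by auto
    finally have "F a \<cdot> y = 0" using y yK by (simp add: EK_atMost)
    then have R2: "a * inner y y \<le> inner (R \<cdot> y) y" using F_gt[of a y] by (cases "y = 0") auto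
    define h where "h = (\<lambda>t::real. indicator {a<..b} t * g t * indicator {a<..b} t)"
    have h: "P.bnn h" unfolding h_def by (intro P.bnn_mult P.bnn_indicator g) auto
    have "P.calc h = EK {a<..b} * P.calc g * EK {a<..b}"
      unfolding h_def using g by (simp add: P.calc_mult P.calc_indicator)
    then have gh: "inner (P.calc g \<cdot> y) y = inner (P.calc h \<cdot> y) y"
      using y by (simp add: selfadjD[OF P.E_selfadj])
    have G0: "0 \<le> inner (P.calc g \<cdot> y) y" by (rule pos_form[OF P.calc_pos[OF g]])
    have scale: "P.rep (\<lambda>t. c * indicator {a<..b} t) (c *\<^sub>R EK {a<..b})" if "0 \<le> c" for c
      by (rule P.rep_scale[OF P.rep_indicator]) (use that in auto)
    have "P.calc h \<le> b *\<^sub>R EK {a<..b}"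
      by (rule P.rep_mono[OF P.rep_calc[OF h] scale]) (use ab in \<open>auto simp: h_def g_def indicator_def\<close>)
    from le_bop_form[OF this, of y] have G1: "inner (P.calc g \<cdot> y) y \<le> b * inner y y" using y gh by simp
    \<comment> \<open>\<open>g\<close> is cut off at 1. If \<open>b\<close> exceeds 1, the interval
      is shortened to its part below 1, with the same projection; for negative \<open>a\<close>,
      positivity suffices.\<close>
    have G2: "a * inner y y \<le> inner (P.calc g \<cdot> y) y"
    proof (cases "0 \<le> a \<and> b \<le> 1")
      case True
      have "a *\<^sub>R EK {a<..b} \<le> P.calc h"
        by (rule P.rep_mono[OF scale P.rep_calc[OF h]]) (use True in \<open>auto simp: h_def g_def indicator_def\<close>)
      from le_bop_form[OF this, of y] show ?thesis using y gh by simp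
    next
      case False
      show ?thesis
      proof (cases "0 \<le> a")
        case True
        have "a *\<^sub>R EK ({a<..b} \<inter> {..1}) \<le> P.calc h"
        proof (rule P.rep_mono[OF P.rep_scale[OF P.rep_indicator] P.rep_calc[OF h]])
          show "a * indicat_real ({a<..b} \<inter> {..1}) t \<le> h t" for t
            using True by (auto simp: h_def g_def indicator_def)
        qed (use True in auto)
        moreover have "EK ({a<..b} \<inter> {..1}) = EK {a<..b}"
        proof -
          have "EK ({a<..b} \<inter> {..1}) = EK {a<..b} * EK {..1}" by (rule P.E_Int) auto
          also have "EK {..1} = EK UNIV" by (simp add: P.E_UNIV EK_atMost F_one)
          also have "EK {a<..b} * EK UNIV = EK ({a<..b} \<inter> UNIV)" by (rule P.E_Int[symmetric]) auto
          finally show ?thesis by simp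
        qed
        ultimately have "a *\<^sub>R EK {a<..b} \<le> P.calc h" by simp
        from le_bop_form[OF this, of y] show ?thesis using y gh by simp
      next
        case False
        then have "a * inner y y \<le> 0" by (simp add: mult_nonpos_nonneg)
        then show ?thesis using G0 by linarith
      qed
    qed
    show ?thesis using R1 R2 G1 G2 by (simp add: D_def inner_diff_left abs_le_iff algebra_simps)
  qed
  have fine: "\<bar>inner (D \<cdot> x) x\<bar> \<le> (1 / real n) * inner x x" if x: "x \<in> K" and n: "0 < n" for x n
  proof -
    \<comment> \<open>The grid starts one step below 0, so that the first half-open interval
      contains the point 0, where \<open>R\<close> may have an eigenvalue.\<close>
    define u where "u j = (real j - 1) / real n" for j
    define I where "I j = {u j<..u (Suc j)}" for j
    have Ib: "I j \<in> sets borel" for j by (simp add: I_def)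
    have uS: "u j \<le> u (Suc j)" "0 \<le> u (Suc j)" "u (Suc j) - u j = 1 / real n" for j
      using n by (simp_all add: u_def divide_right_mono diff_divide_distrib)
    have EI: "EK (I j) = EK {..u (Suc j)} - EK {..u j}" for j
    proof -
      have "EK ({..u j} \<union> I j) = EK {..u j} + EK (I j)" by (rule EK_Un) (auto simp: I_def)
      moreover have "{..u j} \<union> I j = {..u (Suc j)}" using uS(1)[of j] by (auto simp: I_def)
      ultimately show ?thesis by simp
    qed
    define y where "y j = EK (I j) \<cdot> x" for j
    have yfix: "EK (I j) \<cdot> y j = y j" for j
      unfolding y_def using P.E_idem[OF Ib] by (metis bop_simps(6))
    have xsum: "(\<Sum>j<Suc n. y j) = x"
    proof -
      have "(\<Sum>j<Suc n. y j) = (\<Sum>j<Suc n. EK {..u (Suc j)} \<cdot> x - EK {..u j} \<cdot> x)"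
        by (simp add: y_def EI)
      also have "\<dots> = EK {..u (Suc n)} \<cdot> x - EK {..u 0} \<cdot> x" by (rule sum_lessThan_telescope)
      also have "u (Suc n) = 1" using n by (simp add: u_def)
      also have "EK {..u 0} = 0" using n by (simp add: EK_atMost F_neg u_def)
      finally show ?thesis using x proj_fix_iff[OF K, of x] by (simp add: EK_atMost F_one)
    qed
    \<comment> \<open>\<open>D\<close> commutes with the projections of the partition, so it has no
      cross terms between different pieces.\<close>
    have Dy: "inner (D \<cdot> y j) x = inner (D \<cdot> y j) (y j)" for j
    proof -
      have "inner (D \<cdot> y j) x = inner (D \<cdot> EK (I j) \<cdot> y j) x" by (simp add: yfix)
      also have "D \<cdot> EK (I j) \<cdot> y j = EK (I j) \<cdot> D \<cdot> y j" using com[OF Ib] by (metis bop_simps(6))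
      finally show ?thesis by (simp only: selfadjD[OF P.E_selfadj[OF Ib]] y_def[symmetric])
    qed
    have yx: "inner (y j) x = inner (y j) (y j)" for j
      using yfix[of j] selfadjD[OF P.E_selfadj[OF Ib], of j "y j" x] by (simp add: y_def)
    have "inner (D \<cdot> x) x = inner (D \<cdot> (\<Sum>j<Suc n. y j)) x" by (simp only: xsum)
    also have "D \<cdot> (\<Sum>j<Suc n. y j) = (\<Sum>j<Suc n. D \<cdot> y j)"
      by (rule linear_sum[OF bounded_linear.linear[OF bounded_linear_bop]])
    also have "inner \<dots> x = (\<Sum>j<Suc n. inner (D \<cdot> y j) (y j))" by (simp only: inner_sum_left Dy)
    finally have "\<bar>inner (D \<cdot> x) x\<bar> \<le> (\<Sum>j<Suc n. \<bar>inner (D \<cdot> y j) (y j)\<bar>)"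
      by (simp only: sum_abs)
    also have "\<dots> \<le> (\<Sum>j<Suc n. (1 / real n) * inner (y j) (y j))"
    proof (rule sum_mono)
      fix j
      show "\<bar>inner (D \<cdot> y j) (y j)\<bar> \<le> (1 / real n) * inner (y j) (y j)"
        using bound[OF yfix[of j, unfolded I_def] uS(1,2)] by (simp only: uS(3))
    qed
    also have "\<dots> = (1 / real n) * inner (\<Sum>j<Suc n. y j) x"
      by (simp only: inner_sum_left sum_distrib_left yx)
    finally show ?thesis by (simp only: xsum)
  qed
  have zero: "inner (D \<cdot> x) x = 0" if x: "x \<in> K" for x
  proof -
    have "(\<lambda>n. (1 / real (Suc n)) * inner x x) \<longlonglongrightarrow> 0 * inner x x"
      by (intro tendsto_intros LIMSEQ_Suc lim_1_over_n)
    then have "\<bar>inner (D \<cdot> x) x\<bar> \<le> 0 * inner x x"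
      by (rule LIMSEQ_le_const) (use fine[OF x] in blast)
    then show ?thesis by simp
  qed
  have DK: "D * proj K = D" unfolding D_def by (simp only: left_diff_distrib RK P.proj_calc(2)[OF g])
  have KD: "proj K * D = D" by (rule selfadj_mult_adjI[OF saD selfadj_proj[OF K] saD DK])
  have "D = 0"
  proof (rule selfadj_form_eqI[OF saD])
    fix x
    have "inner (D \<cdot> x) x = inner ((proj K * D * proj K) \<cdot> x) x" by (simp only: KD DK)
    also have "\<dots> = inner (D \<cdot> proj K \<cdot> x) (proj K \<cdot> x)" by (simp add: selfadjD[OF selfadj_proj[OF K]])
    also have "\<dots> = 0" by (rule zero[OF proj_in[OF K]])
    finally show "inner (D \<cdot> x) x = inner (0 \<cdot> x) x" by simp
  qed simp
  then show ?thesis by (simp add: D_def g_def)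
qed

end

lemma spectral_measure:
  fixes R :: "'a::complex_hilbert bop"
  assumes K: "closed_csubspace K" and R: "0 \<le> R" "R \<le> 1" and RK: "R * proj K = R"
  shows pvm_spectral_measure: "pvm K (spectral_measure K R)"
    and spectral_measure_unit: "spectral_measure K R (- {0..1}) = 0"
    and calc_spectral_measure: "pvm.calc (spectral_measure K R) (\<lambda>t. t * indicator {0..1} t) = R"
proof -
  have "\<forall>t. \<exists>F. selfadj F \<and> F * F = F \<and> (\<forall>x. F \<cdot> x = x \<longrightarrow> inner (R \<cdot> x) x \<le> t * inner x x) \<and>
    (\<forall>x. F \<cdot> x = 0 \<longrightarrow> x \<noteq> 0 \<longrightarrow> t * inner x x < inner (R \<cdot> x) x) \<and>
    (\<forall>Z. selfadj Z \<longrightarrow> Z * R = R * Z \<longrightarrow> Z * F = F * Z)"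
    using ex_spectral_cut[OF pos_selfadj[OF R(1)]] by blast
  from choice[OF this] obtain F where F: "\<forall>t. selfadj (F t) \<and> F t * F t = F t \<and>
    (\<forall>x. F t \<cdot> x = x \<longrightarrow> inner (R \<cdot> x) x \<le> t * inner x x) \<and>
    (\<forall>x. F t \<cdot> x = 0 \<longrightarrow> x \<noteq> 0 \<longrightarrow> t * inner x x < inner (R \<cdot> x) x) \<and>
    (\<forall>Z. selfadj Z \<longrightarrow> Z * R = R * Z \<longrightarrow> Z * F t = F t * Z)" ..
  note c1 = F[THEN spec]
  note c2 = c1[THEN conjunct2]
  note c3 = c2[THEN conjunct2] and c4 = c2[THEN conjunct2, THEN conjunct2]
  interpret spectral_family_on R F K
  proof
    show "F t \<cdot> x = x \<Longrightarrow> inner (R \<cdot> x) x \<le> t * inner x x" for t x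
      by (rule c3[THEN conjunct1, rule_format])
    show "F t \<cdot> x = 0 \<Longrightarrow> x \<noteq> 0 \<Longrightarrow> t * inner x x < inner (R \<cdot> x) x" for t x
      by (rule c4[THEN conjunct1, rule_format])
    show "selfadj Z \<Longrightarrow> Z * R = R * Z \<Longrightarrow> Z * F t = F t * Z" for Z t
      by (rule c4[THEN conjunct2, rule_format])
  qed (rule R K RK c1[THEN conjunct1] c2[THEN conjunct1])+
  have saR: "selfadj R" by (rule pos_selfadj[OF R(1)])
  have of: "pvm_of K EE R" if "pvm_on K EE \<and> spectral_integral K EE (\<lambda>t. t) = {(x, R \<cdot> x) |x. x \<in> K}" for EE
    by unfold_locales (rule K saR RK that[THEN conjunct1] that[THEN conjunct2])+
  have SI: "spectral_integral K EK (\<lambda>t. t) = {(x, R \<cdot> x) |x. x \<in> K}"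
    using P.spectral_integral_unit_id[OF EK_unit] by (simp only: calc_EK)
  have "spectral_measure K R = EK"
    unfolding spectral_measure_def
  proof (rule the_equality)
    show *: "pvm_on K EK \<and> spectral_integral K EK (\<lambda>t. t) = {(x, R \<cdot> x) |x. x \<in> K}"
      using P.E SI by blast
    show "EE = EK" if "pvm_on K EE \<and> spectral_integral K EE (\<lambda>t. t) = {(x, R \<cdot> x) |x. x \<in> K}" for EE
      by (rule pvm_of_unique[OF of[OF that] of[OF *]])
  qed
  then show "pvm K (spectral_measure K R)" "spectral_measure K R (- {0..1}) = 0"
    "pvm.calc (spectral_measure K R) (\<lambda>t. t * indicator {0..1} t) = R"
    using pvm_EK EK_unit calc_EK by simp_all
qed

section \<open>The operators of a pair of positive operators\<close>

text \<open>\<open>rel\<close> is the closure of the pairs \<open>(T x, Y x)\<close>. The norm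
  inequality passes to it and gives single-valuedness, existence on all of \<open>K\<close> and
  contractivity at once.\<close>

lemma bounded_extension:
  fixes T Y :: "'a::complex_hilbert bop"
  assumes K: "closed_csubspace K" and dense: "closure (range (bop_apply T)) = K"
    and le: "\<And>x. norm (Y \<cdot> x) \<le> norm (T \<cdot> x)"
  shows "\<exists>C. C * T = Y \<and> C * proj K = C \<and> (\<forall>x. norm (C \<cdot> x) \<le> norm x)"
proof -
  define rel where "rel u v \<longleftrightarrow> (\<exists>f. (\<lambda>n. T \<cdot> f n) \<longlonglongrightarrow> u \<and> (\<lambda>n. Y \<cdot> f n) \<longlonglongrightarrow> v)" for u v
  have bound: "norm v \<le> norm u" if "rel u v" for u v
  proof -
    obtain f where f: "(\<lambda>n. T \<cdot> f n) \<longlonglongrightarrow> u" "(\<lambda>n. Y \<cdot> f n) \<longlonglongrightarrow> v" using \<open>rel u v\<close> unfolding rel_def by blast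
    show ?thesis by (rule LIMSEQ_le[OF tendsto_norm[OF f(2)] tendsto_norm[OF f(1)]]) (use le in blast)
  qed
  have radd: "rel (u + u') (v + v')" if uv: "rel u v" "rel u' v'" for u u' v v'
  proof -
    obtain f where f: "(\<lambda>n. T \<cdot> f n) \<longlonglongrightarrow> u" "(\<lambda>n. Y \<cdot> f n) \<longlonglongrightarrow> v" using uv(1) unfolding rel_def by blast
    obtain g where g: "(\<lambda>n. T \<cdot> g n) \<longlonglongrightarrow> u'" "(\<lambda>n. Y \<cdot> g n) \<longlonglongrightarrow> v'" using uv(2) unfolding rel_def by blast
    show ?thesis
      unfolding rel_def using tendsto_add[OF f(1) g(1)] tendsto_add[OF f(2) g(2)]
      by (intro exI[of _ "\<lambda>n. f n + g n"]) simp
  qed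
  have rscale: "rel (r *\<^sub>R u) (r *\<^sub>R v)" if uv: "rel u v" for r u v
  proof -
    obtain f where f: "(\<lambda>n. T \<cdot> f n) \<longlonglongrightarrow> u" "(\<lambda>n. Y \<cdot> f n) \<longlonglongrightarrow> v" using uv unfolding rel_def by blast
    show ?thesis
      unfolding rel_def using tendsto_scaleR[OF tendsto_const f(1)] tendsto_scaleR[OF tendsto_const f(2)]
      by (intro exI[of _ "\<lambda>n. r *\<^sub>R f n"]) simp
  qed
  have ri: "rel (\<i> *\<^sub>C u) (\<i> *\<^sub>C v)" if uv: "rel u v" for u v
  proof -
    obtain f where f: "(\<lambda>n. T \<cdot> f n) \<longlonglongrightarrow> u" "(\<lambda>n. Y \<cdot> f n) \<longlonglongrightarrow> v" using uv unfolding rel_def by blast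
    show ?thesis
      unfolding rel_def using bounded_linear.tendsto[OF bounded_linear_scaleC f(1)]
        bounded_linear.tendsto[OF bounded_linear_scaleC f(2)]
      by (intro exI[of _ "\<lambda>n. \<i> *\<^sub>C f n"]) simp
  qed
  have uniq: "v = v'" if uv: "rel u v" "rel u v'" for u v v'
  proof -
    have "rel (u + (-1) *\<^sub>R u) (v + (-1) *\<^sub>R v')" by (intro radd rscale uv)
    from bound[OF this] show ?thesis by simp
  qed
  have ex: "\<exists>v. rel u v" if u: "u \<in> K" for u
  proof -
    obtain z where z: "\<And>n. z n \<in> range (bop_apply T)" "z \<longlonglongrightarrow> u"
      using u unfolding dense[symmetric] closure_sequential by blast
    have "\<forall>n. \<exists>x. z n = T \<cdot> x" using z(1) by blast
    then obtain f where f: "\<And>n. z n = T \<cdot> f n" by metis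
    have zf: "z = (\<lambda>n. T \<cdot> f n)" using f by blast
    have Tc: "Cauchy (\<lambda>n. T \<cdot> f n)" using LIMSEQ_imp_Cauchy[OF z(2)] unfolding zf .
    have d: "dist (Y \<cdot> f m) (Y \<cdot> f n) \<le> dist (T \<cdot> f m) (T \<cdot> f n)" for m n
      using le[of "f m - f n"] by (simp add: dist_norm)
    have "Cauchy (\<lambda>n. Y \<cdot> f n)"
    proof (rule metric_CauchyI)
      fix e :: real assume "0 < e"
      then obtain N where "\<And>m n. m \<ge> N \<Longrightarrow> n \<ge> N \<Longrightarrow> dist (T \<cdot> f m) (T \<cdot> f n) < e"
        using metric_CauchyD[OF Tc] by blast
      then show "\<exists>M. \<forall>m\<ge>M. \<forall>n\<ge>M. dist (Y \<cdot> f m) (Y \<cdot> f n) < e"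
        using d le_less_trans by blast
    qed
    then obtain v where "(\<lambda>n. Y \<cdot> f n) \<longlonglongrightarrow> v" using Cauchy_convergent convergent_def by blast
    then show ?thesis using z(2) unfolding rel_def zf by blast
  qed
  obtain c where c: "\<And>h. rel (proj K \<cdot> h) (c h)" using ex[OF proj_in[OF K]] by metis
  have "\<exists>C. \<forall>x. C \<cdot> x = c x"
  proof (rule ex_bop)
    show "c (x + y) = c x + c y" for x y
      by (rule uniq[OF c]) (use radd[OF c[of x] c[of y]] in simp)
    show "c (r *\<^sub>R x) = r *\<^sub>R c x" for r x
      by (rule uniq[OF c]) (use rscale[OF c[of x]] in simp)
    show "c (\<i> *\<^sub>C x) = \<i> *\<^sub>C c x" for x
      by (rule uniq[OF c]) (use ri[OF c[of x]] in simp)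
    show "norm (c x) \<le> 1 * norm x" for x
      using bound[OF c[of x]] norm_proj_le[OF K, of x] by simp
  qed
  then obtain C where C: "\<And>x. C \<cdot> x = c x" by blast
  have "C * T = Y"
  proof (rule bop_eqI)
    fix x
    have "T \<cdot> x \<in> K" unfolding dense[symmetric] by (rule subsetD[OF closure_subset rangeI])
    then have "rel (T \<cdot> x) (c (T \<cdot> x))" using c[of "T \<cdot> x"] proj_fix_iff[OF K, of "T \<cdot> x"] by simp
    moreover have "rel (T \<cdot> x) (Y \<cdot> x)" unfolding rel_def by (intro exI[of _ "\<lambda>n. x"]) simp
    ultimately show "(C * T) \<cdot> x = Y \<cdot> x" using uniq by (simp add: C)
  qed
  moreover have "C * proj K = C"
  proof (rule bop_eqI)
    fix x
    have "proj K \<cdot> proj K \<cdot> x = proj K \<cdot> x" using proj_idem[OF K] by (metis bop_simps(6))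
    then have "c (proj K \<cdot> x) = c x" using uniq[OF c[of "proj K \<cdot> x"]] c[of x] by simp
    then show "(C * proj K) \<cdot> x = C \<cdot> x" by (simp add: C)
  qed
  moreover have "norm (C \<cdot> x) \<le> norm x" for x
    using bound[OF c[of x]] norm_proj_le[OF K, of x] by (simp add: C)
  ultimately show ?thesis by blast
qed

text \<open>With \<open>Y\<close> the square root of \<open>X\<close>, domination by
  \<open>T T\<close> yields a contraction \<open>C\<close> with \<open>C T = Y\<close>;
  \<open>R\<close> is the adjoint of \<open>C\<close> times \<open>C\<close>.\<close>

lemma douglas_factor:
  fixes T X :: "'a::complex_hilbert bop"
  assumes K: "closed_csubspace K" and dense: "closure (range (bop_apply T)) = K"
    and T: "selfadj T" and X: "0 \<le> X" "X \<le> T * T"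
  shows "\<exists>R. 0 \<le> R \<and> R \<le> 1 \<and> R * proj K = R \<and> T * R * T = X"
proof -
  define Y where "Y = op_sqrt X"
  have Y: "selfadj Y" "Y * Y = X"
    unfolding Y_def by (rule pos_selfadj[OF op_sqrt_pos[OF X(1)]] op_sqrt_square[OF X(1)])+
  have "norm (Y \<cdot> x) \<le> norm (T \<cdot> x)" for x
  proof -
    have "(norm (Y \<cdot> x))\<^sup>2 = inner (X \<cdot> x) x" "(norm (T \<cdot> x))\<^sup>2 = inner ((T * T) \<cdot> x) x"
      by (simp_all add: power2_norm_eq_inner Y(2)[symmetric] selfadjD[OF Y(1)] selfadjD[OF T])
    then have "(norm (Y \<cdot> x))\<^sup>2 \<le> (norm (T \<cdot> x))\<^sup>2" using le_bop_form[OF X(2), of x] by simp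
    then show ?thesis by (rule power2_le_imp_le) simp
  qed
  from bounded_extension[OF K dense this] obtain C where
    C: "C * T = Y" "C * proj K = C" "\<forall>x. norm (C \<cdot> x) \<le> norm x" by (elim exE conjE) (rule that)
  define R where "R = adj C * C"
  have Rf: "inner (R \<cdot> x) y = inner (C \<cdot> x) (C \<cdot> y)" for x y
    using inner_adj[of C y "C \<cdot> x"] by (simp add: R_def inner_commute)
  have sa: "selfadj R" unfolding selfadj_def using Rf by (metis inner_commute)
  have "0 \<le> R" by (rule posI[OF sa]) (simp add: Rf)
  moreover have "R \<le> 1"
  proof (rule le_bopI)
    fix x
    have "(norm (C \<cdot> x))\<^sup>2 \<le> (norm x)\<^sup>2" using C(3) by (intro power_mono) auto
    then show "inner (R \<cdot> x) x \<le> inner (1 \<cdot> x) x" by (simp add: Rf power2_norm_eq_inner)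
  qed (simp add: sa)
  moreover have "R * proj K = R" by (simp only: R_def mult.assoc C(2))
  moreover have "T * R * T = X"
  proof (rule bop_eqI, rule inner_ext)
    fix x y
    have CT: "C \<cdot> T \<cdot> z = Y \<cdot> z" for z using C(1) by (metis bop_simps(6))
    have "inner ((T * R * T) \<cdot> x) y = inner (Y \<cdot> x) (Y \<cdot> y)" by (simp add: selfadjD[OF T] Rf CT)
    then show "inner ((T * R * T) \<cdot> x) y = inner (X \<cdot> x) y" by (simp add: selfadjD[OF Y(1)] flip: Y(2))
  qed
  ultimately show ?thesis by blast
qed

locale pos_pair =
  fixes A B :: "'a::complex_hilbert bop"
  assumes A: "0 \<le> A" and B: "0 \<le> B"
begin

abbreviation "HH \<equiv> H_AB A B"
abbreviation "TT \<equiv> T_AB A B"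
abbreviation "RR \<equiv> R_AB A B"
abbreviation "EE \<equiv> E_AB A B"
abbreviation "PP \<equiv> proj (H_AB A B)"

lemma H_closed: "closed_csubspace HH"
  unfolding H_AB_def by (rule closed_csubspace_closure_range)

lemma T_pos: "0 \<le> TT" and T_square: "TT * TT = A + B"
  unfolding T_AB_def by (rule op_sqrt_pos op_sqrt_square, rule pos_add[OF A B])+

lemma T_sa: "selfadj TT"
  by (rule pos_selfadj[OF T_pos])

lemma adj_T: "adj TT = TT"
  using T_sa by (simp add: adj_eq_self_iff)

lemma P_sa: "selfadj PP" and P_idem: "PP * PP = PP"
  by (rule selfadj_proj[OF H_closed] proj_idem[OF H_closed])+

lemma norm_T_sq: "(norm (TT \<cdot> x))\<^sup>2 = inner ((A + B) \<cdot> x) x"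
  by (simp add: power2_norm_eq_inner selfadjD[OF T_sa] flip: T_square)

lemma TP: "TT * PP = TT"
proof (rule bop_eqI)
  fix x
  have AB: "selfadj (A + B)" by (simp add: A B pos_selfadj)
  have "PP * (A + B) = A + B"
  proof (rule bop_eqI)
    fix z
    have "(A + B) \<cdot> z \<in> HH" unfolding H_AB_def by (rule subsetD[OF closure_subset rangeI])
    then show "(PP * (A + B)) \<cdot> z = (A + B) \<cdot> z"
      using proj_fix_iff[OF H_closed, of "(A + B) \<cdot> z"] by (simp only: bop_simps(6))
  qed
  then have "(A + B) * PP = A + B" by (rule selfadj_mult_adjI[OF P_sa AB AB])
  then have "(A + B) \<cdot> PP \<cdot> x = (A + B) \<cdot> x" by (metis bop_simps(6))
  then have "(A + B) \<cdot> (x - PP \<cdot> x) = 0" by (simp only: bop_linear(2)) simp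
  then have "(norm (TT \<cdot> (x - PP \<cdot> x)))\<^sup>2 = 0" unfolding norm_T_sq by simp
  then show "(TT * PP) \<cdot> x = TT \<cdot> x" by simp
qed

lemma PT: "PP * TT = TT"
  by (rule selfadj_mult_adjI[OF T_sa P_sa T_sa TP])

lemma PT_apply: "PP \<cdot> TT \<cdot> x = TT \<cdot> x"
  using PT by (metis bop_simps(6))

lemma T_in: "TT \<cdot> x \<in> HH"
  using PT_apply[of x] proj_fix_iff[OF H_closed] by blast

lemma T_inject: "x \<in> HH \<Longrightarrow> TT \<cdot> x = 0 \<Longrightarrow> x = 0"
proof -
  assume x: "x \<in> HH" and T0: "TT \<cdot> x = 0"
  have ABx: "(A + B) \<cdot> x = 0" using T0 T_square by (metis bop_simps(6) bop_linear(4))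
  have AB: "selfadj (A + B)" by (simp add: A B pos_selfadj)
  have "inner x ((A + B) \<cdot> w) = 0" for w
    using selfadjD[OF AB, of x w] ABx by simp
  then have "range (bop_apply (A + B)) \<subseteq> {z. inner x z = 0}" by blast
  moreover have "closed {z. inner x z = 0}" by (intro closed_Collect_eq continuous_intros)
  ultimately have "HH \<subseteq> {z. inner x z = 0}" unfolding H_AB_def by (rule closure_minimal)
  then have "inner x x = 0" using x by blast
  then show "x = 0" by simp
qed

lemma T_dense: "closure (range (bop_apply TT)) = HH"
  by (rule dense_range_selfadj[OF T_sa H_closed T_in T_inject])

text \<open>\<open>T\<close> is injective on \<open>HH\<close>, so it cancels on the left; taking
  adjoints turns the remaining right factor into a left one, which cancels again.\<close>

lemma sandwich_unique:
  assumes D: "selfadj D" "D * PP = D" "TT * D * TT = 0"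
  shows "D = 0"
proof -
  have PD: "PP * D = D" by (rule selfadj_mult_adjI[OF D(1) P_sa D(1) D(2)])
  have DK: "D \<cdot> x \<in> HH" for x
    using proj_in[OF H_closed, of "D \<cdot> x"] PD by (metis bop_simps(6))
  have "D * TT = 0"
  proof (rule bop_eqI)
    fix x
    have "TT \<cdot> D \<cdot> TT \<cdot> x = 0" using D(3) by (metis bop_simps(4,6))
    from T_inject[OF DK this] show "(D * TT) \<cdot> x = 0 \<cdot> x" by simp
  qed
  then have "TT * D = 0" by (rule selfadj_mult_adjI[OF D(1) T_sa selfadj_intros(1)])
  then have "TT \<cdot> D \<cdot> x = 0" for x by (metis bop_simps(4,6))
  then show ?thesis using T_inject[OF DK] by (intro bop_eqI) simp
qed

text \<open>Existence is the Douglas factor of \<open>A <= A + B\<close>. The companion contraction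
  is forced to be \<open>PP - R\<close>, so only \<open>R\<close> has to be shown unique.\<close>

lemma R: shows R_pos: "0 \<le> RR" and R_le_one: "RR \<le> 1" and R_P: "RR * PP = RR"
  and A_eq: "A = TT * RR * TT" and B_eq: "B = TT * (PP - RR) * TT"
proof -
  have "A \<le> TT * TT"
    unfolding T_square using B by (simp add: le_bop_iff_diff[of A])
  from douglas_factor[OF H_closed T_dense T_sa A this] obtain R where
    R: "0 \<le> R" "R \<le> 1" "R * PP = R" "TT * R * TT = A" by (elim exE conjE) (rule that)
  have saR: "selfadj R" by (rule pos_selfadj[OF R(1)])
  have PR: "PP * R = R" by (rule selfadj_mult_adjI[OF saR P_sa saR R(3)])
  have "PP * R * PP \<le> PP * 1 * PP" by (rule le_bop_sandwich[OF P_sa R(2)])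
  then have RP: "R \<le> PP" by (simp add: PR R(3) P_idem)
  then have S0: "0 \<le> PP - R" by (simp add: le_bop_iff_diff[of R])
  have S1: "PP - R \<le> 1"
  proof -
    have "PP - R \<le> PP" using R(1) by (simp add: le_bop_iff_diff[of "PP - R"])
    then show ?thesis using projection_le_one[OF P_sa P_idem] by (rule order_trans)
  qed
  have TS: "TT * (PP - R) * TT = B"
    by (simp add: left_diff_distrib right_diff_distrib R(4)) (simp add: mult.assoc PT T_square)
  have good: "pos_contraction_on HH R \<and> pos_contraction_on HH (PP - R) \<and> R + (PP - R) = PP \<and>
      A = adj TT * R * TT \<and> B = adj TT * (PP - R) * TT"
    unfolding pos_contraction_on_def op_on_def adj_T
    using R S0 S1 PR TS P_idem
    by (auto simp: left_diff_distrib right_diff_distrib mult.assoc pos_le_one_norm)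
  have "RR = R"
    unfolding R_AB_def
  proof (rule the_equality)
    show "\<exists>S. pos_contraction_on HH R \<and> pos_contraction_on HH S \<and> R + S = PP \<and>
      A = adj TT * R * TT \<and> B = adj TT * S * TT"
      using good by blast
    fix R' assume "\<exists>S. pos_contraction_on HH R' \<and> pos_contraction_on HH S \<and> R' + S = PP \<and>
      A = adj TT * R' * TT \<and> B = adj TT * S * TT"
    then have R': "PP * R' * PP = R'" "0 \<le> R'" "A = TT * R' * TT"
      unfolding pos_contraction_on_def op_on_def adj_T by blast+
    have "R' * PP = R'" by (metis R'(1) P_idem mult.assoc)
    then have 1: "(R' - R) * PP = R' - R" by (simp add: left_diff_distrib R(3))
    have 2: "TT * (R' - R) * TT = 0"
      by (simp add: left_diff_distrib right_diff_distrib R(4) R'(3)[symmetric])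
    have "selfadj (R' - R)" using R'(2) saR by (simp add: pos_selfadj)
    from sandwich_unique[OF this 1 2] show "R' = R" by simp
  qed
  then show "0 \<le> RR" "RR \<le> 1" "RR * PP = RR" "A = TT * RR * TT" "B = TT * (PP - RR) * TT"
    using R TS by simp_all
qed

lemma R_sa: "selfadj RR"
  by (rule pos_selfadj[OF R_pos])

lemma P_R: "PP * RR = RR"
  by (rule selfadj_mult_adjI[OF R_sa P_sa R_sa R_P])

lemma T_sandwich_form: "inner ((TT * X * TT) \<cdot> x) y = inner (X \<cdot> TT \<cdot> x) (TT \<cdot> y)"
  by (simp add: selfadjD[OF T_sa])

lemma A_form: "inner (A \<cdot> x) y = inner (RR \<cdot> TT \<cdot> x) (TT \<cdot> y)"
  using T_sandwich_form[of RR x y] by (simp only: A_eq[symmetric])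

lemma B_form: "inner (B \<cdot> x) y = inner ((PP - RR) \<cdot> TT \<cdot> x) (TT \<cdot> y)"
  using T_sandwich_form[of "PP - RR" x y] by (simp only: B_eq[symmetric])

lemma T_approx:
  assumes "u \<in> HH"
  obtains f where "(\<lambda>n. TT \<cdot> f n) \<longlonglongrightarrow> u"
proof -
  obtain z where z: "\<And>n. z n \<in> range (bop_apply TT)" "z \<longlonglongrightarrow> u"
    using assms unfolding T_dense[symmetric] closure_sequential by blast
  have "\<forall>n. \<exists>x. z n = TT \<cdot> x" using z(1) by blast
  then obtain f where f: "\<And>n. z n = TT \<cdot> f n" by metis
  have "z = (\<lambda>n. TT \<cdot> f n)" using f by blast
  with z(2) that show ?thesis by simp
qed

end

section \<open>Parallel sums\<close>

text \<open>Allows \<open>bounded_below_inverse\<close> to be applied a second time, to a sum of two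
  inverses.\<close>

lemma inverse_bounded_below:
  assumes pos: "0 \<le> X" and e: "0 < e" and low: "\<And>x. e * (norm x)\<^sup>2 \<le> inner (X \<cdot> x) x"
  shows "\<exists>c>0. \<forall>x. c * (norm x)\<^sup>2 \<le> inner (op_inv X \<cdot> x) x"
proof (intro exI conjI allI)
  note inv = bounded_below_inverse[OF pos e low]
  let ?N = "norm X + 1"
  have N: "0 < ?N" by (simp add: add_nonneg_pos)
  show "0 < e / ?N\<^sup>2" using e N by simp
  fix x
  define y where "y = op_inv X \<cdot> x"
  have x: "X \<cdot> y = x" unfolding y_def using inv(1) by (metis bop_simps(5,6))
  have "norm x \<le> norm X * norm y" using norm_bop_apply[of X y] by (simp only: x)
  also have "\<dots> \<le> ?N * norm y" by (intro mult_right_mono) auto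
  finally have "(norm x)\<^sup>2 \<le> (?N * norm y)\<^sup>2" by (intro power_mono) auto
  then have "(norm x)\<^sup>2 / ?N\<^sup>2 \<le> (norm y)\<^sup>2" using N by (simp add: power_mult_distrib pos_divide_le_eq mult.commute)
  from mult_left_mono[OF this, of e] e have "e / ?N\<^sup>2 * (norm x)\<^sup>2 \<le> e * (norm y)\<^sup>2" by simp
  also have "\<dots> \<le> inner (X \<cdot> y) y" by (rule low)
  also have "\<dots> = inner (op_inv X \<cdot> x) x" by (simp only: x y_def[symmetric] inner_commute)
  finally show "e / ?N\<^sup>2 * (norm x)\<^sup>2 \<le> inner (op_inv X \<cdot> x) x" .
qed

text \<open>The infimum is attained at \<open>y0\<close> with
  \<open>a (x - y0) = b y0 = Z x\<close>, where the linear terms in a displacement \<open>d\<close>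
  cancel and the forms of \<open>a\<close> and \<open>b\<close> at \<open>d\<close> are the
  excess.\<close>

lemma inverse_sum_form:
  fixes a b :: "'a::complex_hilbert bop"
  assumes a: "0 \<le> a" and b: "0 \<le> b" and e: "0 < e"
    and la: "\<And>x. e * (norm x)\<^sup>2 \<le> inner (a \<cdot> x) x" and lb: "\<And>x. e * (norm x)\<^sup>2 \<le> inner (b \<cdot> x) x"
  defines "Z \<equiv> op_inv (op_inv a + op_inv b)"
  shows "0 \<le> Z" "inner (Z \<cdot> x) x \<le> inner (a \<cdot> (x - y)) (x - y) + inner (b \<cdot> y) y"
    "\<exists>y. inner (Z \<cdot> x) x = inner (a \<cdot> (x - y)) (x - y) + inner (b \<cdot> y) y"
proof -
  note ia = bounded_below_inverse[OF a e la] and ib = bounded_below_inverse[OF b e lb]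
  obtain c where c: "0 < c" "\<forall>x. c * (norm x)\<^sup>2 \<le> inner (op_inv a \<cdot> x) x"
    using inverse_bounded_below[OF a e la] by blast
  define V where "V = op_inv a + op_inv b"
  have Vpos: "0 \<le> V" unfolding V_def by (rule pos_add[OF ia(3) ib(3)])
  have Vlow: "c * (norm x)\<^sup>2 \<le> inner (V \<cdot> x) x" for x
    using c(2)[rule_format, of x] pos_form[OF ib(3), of x] by (simp add: V_def inner_add_left)
  note iV = bounded_below_inverse[OF Vpos c(1) Vlow]
  show "0 \<le> Z" unfolding Z_def V_def[symmetric] by (rule iV(3))
  define w where "w = Z \<cdot> x"
  have VZ: "V \<cdot> w = x"
    unfolding w_def Z_def V_def[symmetric] using iV(1) by (metis bop_simps(5,6))
  define y0 where "y0 = op_inv b \<cdot> w"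
  have by0: "b \<cdot> y0 = w" unfolding y0_def using ib(1) by (metis bop_simps(5,6))
  have xy0: "x - y0 = op_inv a \<cdot> w" using VZ[symmetric] by (simp add: V_def y0_def)
  have axy: "a \<cdot> (x - y0) = w" unfolding xy0 using ia(1) by (metis bop_simps(5,6))
  have eq: "inner (Z \<cdot> x) x = inner (a \<cdot> (x - y0)) (x - y0) + inner (b \<cdot> y0) y0"
    unfolding axy by0 w_def[symmetric] by (simp add: inner_diff_right)
  then show "\<exists>y. inner (Z \<cdot> x) x = inner (a \<cdot> (x - y)) (x - y) + inner (b \<cdot> y) y" by blast
  define d where "d = y - y0"
  define z where "z = x - y0"
  have y: "y = y0 + d" "x - y = z - d" by (simp_all add: d_def z_def)
  have az: "a \<cdot> z = w" using axy by (simp only: z_def)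
  have "inner (a \<cdot> d) z = inner w d"
    using selfadjD[OF pos_selfadj[OF a], of d z] by (simp add: az inner_commute)
  then have "inner (a \<cdot> (x - y)) (x - y) = inner (a \<cdot> (x - y0)) (x - y0) - 2 * inner w d + inner (a \<cdot> d) d"
    unfolding y(2) z_def[symmetric] bop_linear(2) inner_diff_left inner_diff_right az by simp
  moreover have "inner (b \<cdot> y) y = inner (b \<cdot> y0) y0 + 2 * inner w d + inner (b \<cdot> d) d"
    unfolding y(1) using selfadjD[OF pos_selfadj[OF b], of d y0] by0
    by (simp only: bop_linear(1) inner_add_left inner_add_right) (simp add: inner_commute)
  ultimately show "inner (Z \<cdot> x) x \<le> inner (a \<cdot> (x - y)) (x - y) + inner (b \<cdot> y) y"
    unfolding eq using pos_form[OF a, of d] pos_form[OF b, of d] by linarith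
qed

context pos_pair
begin

text \<open>\<open>q\<close> is the functional whose infimum over \<open>y\<close> is the quadratic form of the parallel sum. As
  \<open>B = T\<^sup>*(1-R)T\<close>, the infimum is approached when \<open>T y\<close> tends to \<open>R T x\<close>.\<close>

definition q :: "'a \<Rightarrow> 'a \<Rightarrow> real" where
  "q x y = inner (A \<cdot> (x - y)) (x - y) + inner (B \<cdot> y) y"

text \<open>For the commuting pair \<open>R\<close>, \<open>1 - R\<close> the parallel sum is
  \<open>R (1 - R) / (R + (1 - R)) = R (1 - R)\<close>; the factors \<open>T\<close> transport this
  to \<open>A\<close> and \<open>B\<close>.\<close>

definition W :: "'a bop" where
  "W = TT * (RR * (PP - RR)) * TT"

lemma q_T: "q x y = inner (RR \<cdot> (TT \<cdot> x - TT \<cdot> y)) (TT \<cdot> x - TT \<cdot> y) + inner ((PP - RR) \<cdot> TT \<cdot> y) (TT \<cdot> y)"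
  unfolding q_def A_form B_form by (simp only: bop_linear(2))

lemma W_sa: "selfadj W"
proof -
  have "RR * (PP - RR) = (PP - RR) * RR" by (simp only: left_diff_distrib right_diff_distrib R_P P_R)
  then have "selfadj (RR * (PP - RR))" by (intro selfadj_mult selfadj_intros(4) P_sa R_sa) auto
  then show ?thesis unfolding W_def by (rule selfadj_sandwich[OF T_sa])
qed

text \<open>Completion of the square in the variable \<open>T y\<close>, whose quadratic coefficient
  \<open>R + (1 - R)\<close> is the identity.\<close>

lemma q_eq: "q x y = inner (W \<cdot> x) x + (norm (TT \<cdot> y - RR \<cdot> TT \<cdot> x))\<^sup>2"
proof -
  define u where "u = TT \<cdot> x"
  define v where "v = TT \<cdot> y"
  have Pu: "PP \<cdot> u = u" and Pv: "PP \<cdot> v = v" by (simp_all add: u_def v_def PT_apply)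
  have PRu: "PP \<cdot> RR \<cdot> z = RR \<cdot> z" for z using P_R by (metis bop_simps(6))
  have W: "inner (W \<cdot> x) x = inner (RR \<cdot> u) u - inner (RR \<cdot> u) (RR \<cdot> u)"
    unfolding W_def by (simp add: selfadjD[OF T_sa] inner_diff_left u_def[symmetric] Pu)
      (simp add: selfadjD[OF R_sa])
  have "inner (RR \<cdot> v) u = inner (RR \<cdot> u) v" using selfadjD[OF R_sa, of v u] by (simp add: inner_commute)
  then show ?thesis
    unfolding q_T W u_def[symmetric] v_def[symmetric] power2_norm_eq_inner
    by (simp add: inner_diff_left inner_diff_right Pv inner_commute)
qed

lemma q_ge: "inner (W \<cdot> x) x \<le> q x y"
  unfolding q_eq by simp

lemma q_approx:
  assumes "0 < e"
  shows "\<exists>y. q x y < inner (W \<cdot> x) x + e"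
proof -
  have RK: "RR \<cdot> TT \<cdot> x \<in> HH"
    using proj_in[OF H_closed, of "RR \<cdot> TT \<cdot> x"] P_R by (metis bop_simps(6))
  obtain f where f: "(\<lambda>n. TT \<cdot> f n) \<longlonglongrightarrow> RR \<cdot> TT \<cdot> x" by (rule T_approx[OF RK])
  have "(\<lambda>n. (norm (TT \<cdot> f n - RR \<cdot> TT \<cdot> x))\<^sup>2) \<longlonglongrightarrow> (norm (RR \<cdot> TT \<cdot> x - RR \<cdot> TT \<cdot> x))\<^sup>2"
    by (intro tendsto_intros f)
  then have "\<forall>\<^sub>F n in sequentially. (norm (TT \<cdot> f n - RR \<cdot> TT \<cdot> x))\<^sup>2 < e"
    using assms by (intro order_tendstoD(2)) auto
  then obtain n where "(norm (TT \<cdot> f n - RR \<cdot> TT \<cdot> x))\<^sup>2 < e" by (auto simp: eventually_sequentially)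
  then show ?thesis unfolding q_eq by (intro exI[of _ "f n"]) simp
qed

lemma W_pos: "0 \<le> W"
proof (rule posI[OF W_sa])
  fix x
  show "0 \<le> inner (W \<cdot> x) x"
  proof (rule field_le_epsilon)
    fix e :: real assume "0 < e"
    from q_approx[OF this, of x] obtain y where "q x y < inner (W \<cdot> x) x + e" by blast
    moreover have "0 \<le> q x y" unfolding q_def by (intro add_nonneg_nonneg pos_form A B)
    ultimately show "0 \<le> inner (W \<cdot> x) x + e" by linarith
  qed
qed

text \<open>The regularized functional exceeds \<open>q\<close> by \<open>e\<close> times a quantity
  independent of \<open>e\<close>. Its minimum is thus above the form of \<open>W\<close>, and a
  fixed near-minimiser of \<open>q\<close> brings it down to that form as \<open>e\<close> tends to
  0.\<close>

lemma par_sum_eq: "par_sum A B = W"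
proof -
  define Z where "Z e = op_inv (op_inv (A + e *\<^sub>R 1) + op_inv (B + e *\<^sub>R 1))" for e :: real
  define q' where "q' e x y = inner ((A + e *\<^sub>R 1) \<cdot> (x - y)) (x - y) + inner ((B + e *\<^sub>R 1) \<cdot> y) y" for e x y
  have q': "q' e x y = q x y + e * (inner (x - y) (x - y) + inner y y)" for e x y
  proof -
    have f: "inner ((X + e *\<^sub>R 1) \<cdot> z) z = inner (X \<cdot> z) z + e * inner z z" for X :: "'a bop" and z
      by (simp add: inner_add_left)
    show ?thesis unfolding q'_def q_def f distrib_left by linarith
  qed
  have Z: "0 \<le> Z e" "inner (Z e \<cdot> x) x \<le> q' e x y" "\<exists>y. inner (Z e \<cdot> x) x = q' e x y" if e: "0 < e" for e x y
  proof -
    have p: "0 \<le> X + e *\<^sub>R 1" "\<And>x. e * (norm x)\<^sup>2 \<le> inner ((X + e *\<^sub>R 1) \<cdot> x) x" if "0 \<le> X" for X :: "'a bop"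
      using that e pos_form[OF that] by (auto simp: pos_add pos_scaleR pos_one inner_add_left power2_norm_eq_inner)
    note * = inverse_sum_form[OF p(1)[OF A] p(1)[OF B] e p(2)[OF A] p(2)[OF B]]
    show "0 \<le> Z e" unfolding Z_def by (rule *(1))
    show "inner (Z e \<cdot> x) x \<le> q' e x y" unfolding Z_def q'_def by (rule *(2))
    show "\<exists>y. inner (Z e \<cdot> x) x = q' e x y" unfolding Z_def q'_def by (rule *(3))
  qed
  \<comment> \<open>Set to \<open>0\<close> outside \<open>(0, 1)\<close>, so that positivity and
    the bound hold for every index, as \<open>form_tendsto_imp_sot\<close> demands.\<close>
  define D where "D e = (if 0 < e \<and> e < 1 then Z e - W else 0)" for e
  have WZ: "inner (W \<cdot> x) x \<le> inner (Z e \<cdot> x) x" if e: "0 < e" for e x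
  proof -
    obtain y where y: "inner (Z e \<cdot> x) x = q' e x y" using Z(3)[OF e, of x] by blast
    have "0 \<le> e * (inner (x - y) (x - y) + inner y y)" using e by simp
    then show ?thesis unfolding y q' using q_ge[of x y] by linarith
  qed
  have Dpos: "0 \<le> D e" for e
  proof (cases "0 < e \<and> e < 1")
    case True
    have "0 \<le> Z e - W"
      by (rule posI) (use True W_sa Z(1)[of e] WZ in \<open>auto simp: pos_selfadj inner_diff_left\<close>)
    then show ?thesis using True by (simp add: D_def)
  next
    case False
    then show ?thesis unfolding D_def by (subst if_not_P) auto
  qed
  have Dbd: "inner (D e \<cdot> x) x \<le> (norm A + 1) * (norm x)\<^sup>2" for e x
  proof (cases "0 < e \<and> e < 1")
    case True
    have "inner (D e \<cdot> x) x \<le> inner (Z e \<cdot> x) x"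
      using True pos_form[OF W_pos, of x] by (simp add: D_def inner_diff_left)
    also have "\<dots> \<le> q' e x 0" using True Z(2) by blast
    also have "\<dots> = inner (A \<cdot> x) x + e * (norm x)\<^sup>2" by (simp add: q' q_def power2_norm_eq_inner)
    also have "\<dots> \<le> norm A * (norm x)\<^sup>2 + 1 * (norm x)\<^sup>2"
      using True by (intro add_mono form_le_norm mult_right_mono) auto
    finally show ?thesis by (simp add: distrib_right)
  next
    case False
    then show ?thesis unfolding D_def by (subst if_not_P) auto
  qed
  have ev01: "\<forall>\<^sub>F e::real in at_right 0. 0 < e \<and> e < 1"
    by (rule eventually_at_rightI[of 0 1]) auto
  have Dlim: "((\<lambda>e. inner (D e \<cdot> x) x) \<longlongrightarrow> 0) (at_right 0)" for x
  proof (rule tendstoI)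
    fix r :: real assume r: "0 < r"
    obtain y where y: "q x y < inner (W \<cdot> x) x + r / 2" using q_approx[of "r/2" x] r by auto
    define s where "s = inner (x - y) (x - y) + inner y y"
    have "((\<lambda>e. e * s) \<longlongrightarrow> 0 * s) (at_right 0)" by (intro tendsto_intros)
    then have "\<forall>\<^sub>F e in at_right 0. e * s < r / 2" using r by (intro order_tendstoD(2)) auto
    then show "\<forall>\<^sub>F e in at_right 0. dist (inner (D e \<cdot> x) x) 0 < r"
      using ev01
    proof eventually_elim
      fix e assume e: "e * s < r / 2" "0 < e \<and> e < 1"
      have "inner (D e \<cdot> x) x = inner (Z e \<cdot> x) x - inner (W \<cdot> x) x"
        using e by (simp add: D_def inner_diff_left)
      also have "\<dots> < r" using Z(2)[of e x y] e y by (simp add: q' s_def[symmetric])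
      finally show "dist (inner (D e \<cdot> x) x) 0 < r" using pos_form[OF Dpos, of e x] by (simp add: dist_real_def)
    qed
  qed
  have "sot_tendsto Z W (at_right 0)"
    unfolding sot_tendsto_def
  proof
    fix x
    have "((\<lambda>e. D e \<cdot> x) \<longlongrightarrow> 0) (at_right 0)"
      by (rule form_tendsto_imp_sot[OF Dpos Dbd Dlim])
    then have "((\<lambda>e. D e \<cdot> x + W \<cdot> x) \<longlongrightarrow> 0 + W \<cdot> x) (at_right 0)" by (intro tendsto_intros)
    then have "((\<lambda>e. D e \<cdot> x + W \<cdot> x) \<longlongrightarrow> W \<cdot> x) (at_right 0)" by simp
    then show "((\<lambda>e. Z e \<cdot> x) \<longlongrightarrow> W \<cdot> x) (at_right 0)"
      by (rule Lim_transform_eventually) (use ev01 in eventually_elim, simp add: D_def)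
  qed
  then show ?thesis unfolding par_sum_def Z_def by (rule sot_lim_eqI) simp
qed

end

context pvm
begin

lemma bnn_scale: "bnn g \<Longrightarrow> 0 \<le> c \<Longrightarrow> bnn (\<lambda>t. c * g t)"
  unfolding bnn_def by (auto intro!: exI mult_left_mono)

lemma calc_scale: "bnn g \<Longrightarrow> 0 \<le> c \<Longrightarrow> calc (\<lambda>t. c * g t) = c *\<^sub>R calc g"
  by (intro calc_eqI rep_scale rep_calc) (auto simp: bnn_def)

lemma calc_le_one: "bnn g \<Longrightarrow> (\<And>t. g t \<le> 1) \<Longrightarrow> calc g \<le> 1"
  using calc_mono[of g "\<lambda>t. 1"] projection_le_one[OF selfadj_proj[OF K] proj_idem[OF K]]
  by (auto simp: calc_one intro: order_trans)

lemma calc_norm_le: "bnn g \<Longrightarrow> (\<And>t. g t \<le> 1) \<Longrightarrow> norm (calc g \<cdot> x) \<le> norm x"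
proof -
  assume g: "bnn g" "\<And>t. g t \<le> 1"
  have "norm (calc g) \<le> 1" by (rule pos_le_one_norm[OF calc_pos[OF g(1)] calc_le_one[OF g]])
  from mult_right_mono[OF this norm_ge_zero[of x]] norm_bop_apply[of "calc g" x]
  show ?thesis by linarith
qed

end

section \<open>The absolutely continuous part\<close>

context pos_pair
begin

lemma pvm_E: "pvm HH EE" and E_unit: "EE (- {0..1}) = 0"
  and calc_R: "pvm.calc EE (\<lambda>t. t * indicator {0..1} t) = RR"
  unfolding E_AB_def
  by (rule spectral_measure[OF H_closed R_pos R_le_one R_P])+

sublocale E: pvm HH EE
  by (rule pvm_E)

abbreviation "E1 \<equiv> E_AB A B {1}"

text \<open>The sets \<open>DD m\<close> exhaust \<open>[0,1)\<close> and stay away from the point \<open>1\<close>, where the perspective is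
  singular.\<close>

definition DD :: "nat \<Rightarrow> real set" where
  "DD m = {0..1 - 1 / real (Suc m)}"

lemma DD_borel [simp, measurable]: "DD m \<in> sets borel"
  by (simp add: DD_def)

lemma DD_mono: "m \<le> n \<Longrightarrow> DD m \<subseteq> DD n"
proof -
  assume "m \<le> n"
  then have "1 / real (Suc n) \<le> 1 / real (Suc m)" by (intro divide_left_mono) auto
  then show ?thesis unfolding DD_def atLeastatMost_subset_iff by simp
qed

lemma DD_D: "t \<in> DD m \<Longrightarrow> 0 \<le> t \<and> t < 1 \<and> 1 \<le> real (Suc m) * (1 - t)"
proof -
  assume "t \<in> DD m"
  then have t: "0 \<le> t" "1 / real (Suc m) \<le> 1 - t" by (auto simp: DD_def)
  have p: "0 < 1 / real (Suc m)" by simp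
  from t(2) have "1 \<le> real (Suc m) * (1 - t)" by (simp add: pos_divide_le_eq mult.commute)
  then show ?thesis using t p by linarith
qed

lemma DD_Union: "(\<Union>m. DD m) = {0..<1}"
proof
  show "(\<Union>m. DD m) \<subseteq> {0..<1}" using DD_D by fastforce
  show "{0..<1} \<subseteq> (\<Union>m. DD m)"
  proof
    fix t :: real assume t: "t \<in> {0..<1}"
    then obtain n where "inverse (real (Suc n)) < 1 - t" using reals_Archimedean[of "1 - t"] by auto
    then have "t \<in> DD n" using t by (simp add: DD_def inverse_eq_divide)
    then show "t \<in> (\<Union>m. DD m)" by blast
  qed
qed

lemma E_DD_tendsto: "(\<lambda>m. EE (DD m) \<cdot> x) \<longlonglongrightarrow> EE {0..<1} \<cdot> x"
proof -
  have "range DD \<subseteq> sets borel" "incseq DD" using DD_mono by (auto simp: incseq_def)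
  from E.E_tendsto[OF this, of x] show ?thesis by (simp only: DD_Union)
qed

lemma E_unit_eq: "EE {0..1} = PP"
proof -
  have "E.calc (\<lambda>t. indicator {0..1} t + indicator (- {0..1}) t) = E.calc (\<lambda>t. 1)"
    by (rule arg_cong[where f=E.calc], rule ext) (auto simp: indicator_def)
  then show ?thesis by (simp add: E.calc_add E.calc_indicator E.calc_one E_unit)
qed

lemma E_halfopen: "EE {0..<1} = PP - E1"
proof -
  have "E.calc (\<lambda>t. indicator {0..<1} t + indicator {1} t) = E.calc (indicator {0..1})"
    by (rule arg_cong[where f=E.calc], rule ext) (auto simp: indicator_def)
  then have "EE {0..<1} + E1 = PP" by (simp add: E.calc_add E.calc_indicator E_unit_eq)
  then show ?thesis by (simp add: algebra_simps)
qed

lemma bnn_co: "E.bnn (\<lambda>t. (1 - t) * indicator {0..1} t)"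
  by (auto simp: E.bnn_def indicator_def intro!: exI[of _ 1])

lemma calc_S: "E.calc (\<lambda>t. (1 - t) * indicator {0..1} t) = PP - RR"
proof -
  have "E.calc (\<lambda>t. t * indicator {0..1} t + (1 - t) * indicator {0..1} t) = E.calc (indicator {0..1})"
    by (rule arg_cong[where f=E.calc], rule ext) (auto simp: indicator_def)
  then have "RR + E.calc (\<lambda>t. (1 - t) * indicator {0..1} t) = PP"
    by (simp add: E.calc_add[OF E.bnn_unit_id bnn_co] calc_R E.calc_indicator E_unit_eq)
  then show ?thesis by (simp add: algebra_simps)
qed

lemma R_E: "\<Delta> \<in> sets borel \<Longrightarrow> RR * EE \<Delta> = E.calc (\<lambda>t. t * indicator {0..1} t * indicator \<Delta> t)"
  by (simp only: E.calc_mult[OF E.bnn_unit_id E.bnn_indicator] calc_R E.calc_indicator)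

lemma R_E1: "RR * E1 = E1"
proof -
  have "E.calc (\<lambda>t. t * indicator {0..1} t * indicator {1} t) = E.calc (indicator {1})"
    by (rule arg_cong[where f=E.calc], rule ext) (auto simp: indicator_def)
  then show ?thesis by (simp add: R_E E.calc_indicator)
qed

lemma P_E: "\<Delta> \<in> sets borel \<Longrightarrow> PP * EE \<Delta> = EE \<Delta>"
  using E.proj_calc(1)[of "indicator \<Delta>"] by (simp add: E.calc_indicator)

lemma R_E1_apply: "RR \<cdot> E1 \<cdot> x = E1 \<cdot> x"
  using R_E1 by (metis bop_simps(6))

lemma S_E1_apply: "(PP - RR) \<cdot> E1 \<cdot> x = 0"
proof -
  have "PP \<cdot> E1 \<cdot> x = E1 \<cdot> x" using P_E[of "{1}"] by (simp flip: bop_simps(6))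
  then show ?thesis by (simp add: R_E1_apply)
qed

lemma E1_sa: "selfadj E1"
  by (simp add: E.E_selfadj)

lemma R_halfopen_apply: "RR \<cdot> EE {0..<1} \<cdot> x = RR \<cdot> x - E1 \<cdot> x"
proof -
  have "RR \<cdot> PP \<cdot> x = RR \<cdot> x" using R_P by (metis bop_simps(6))
  then show ?thesis by (simp add: E_halfopen R_E1_apply)
qed

text \<open>The value claimed for \<open>[B]A\<close>. It equals \<open>T R E[0,1) T\<close>,
  because \<open>R\<close> acts as the identity on the range of \<open>E1\<close>.\<close>

definition L :: "'a bop" where
  "L = A - TT * E1 * TT"

lemma TET_sa: "selfadj (TT * E1 * TT)"
  by (rule selfadj_sandwich[OF T_sa E1_sa])

lemma L_sa: "selfadj L"
  unfolding L_def by (simp add: TET_sa A pos_selfadj)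

lemma L_form: "inner (L \<cdot> x) x = inner (RR \<cdot> TT \<cdot> x) (TT \<cdot> x) - inner (E1 \<cdot> TT \<cdot> x) (TT \<cdot> x)"
  unfolding L_def bop_simps(2) inner_diff_left T_sandwich_form A_form ..

text \<open>\<open>E1 T x\<close> need not lie in the range of \<open>T\<close>, so it is only
  approximated by \<open>T (f k)\<close>. Moving this part of \<open>x\<close> into
  \<open>f k\<close> costs nothing in \<open>B\<close>, as \<open>1 - R\<close> vanishes on the
  range of \<open>E1\<close>.\<close>

lemma approx_E1:
  obtains f where "(\<lambda>k. inner (A \<cdot> (x - f k)) (x - f k)) \<longlonglongrightarrow> inner (L \<cdot> x) x"
    "(\<lambda>k. inner (B \<cdot> f k) (f k)) \<longlonglongrightarrow> 0"
proof -
  define u where "u = TT \<cdot> x"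
  have "E1 \<cdot> u \<in> HH" by (rule E.E_in) simp
  then obtain f where f: "(\<lambda>n. TT \<cdot> f n) \<longlonglongrightarrow> E1 \<cdot> u" by (rule T_approx)
  have "(\<lambda>k. inner (RR \<cdot> (u - TT \<cdot> f k)) (u - TT \<cdot> f k)) \<longlonglongrightarrow> inner (RR \<cdot> (u - E1 \<cdot> u)) (u - E1 \<cdot> u)"
    by (intro tendsto_intros f)
  moreover have "inner (RR \<cdot> (u - E1 \<cdot> u)) (u - E1 \<cdot> u) = inner (L \<cdot> x) x"
  proof -
    have 1: "inner (RR \<cdot> u) (E1 \<cdot> u) = inner (E1 \<cdot> u) u"
      using selfadjD[OF R_sa, of u "E1 \<cdot> u"] by (simp add: R_E1_apply inner_commute)
    have "E1 \<cdot> E1 \<cdot> u = E1 \<cdot> u" using E.E_idem[of "{1}"] by (simp flip: bop_simps(6))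
    then have 2: "inner (E1 \<cdot> u) (E1 \<cdot> u) = inner (E1 \<cdot> u) u"
      using selfadjD[OF E1_sa, of "E1 \<cdot> u" u] by simp
    show ?thesis unfolding L_form u_def[symmetric]
      by (simp add: inner_diff_left inner_diff_right R_E1_apply 1 2)
  qed
  ultimately have "(\<lambda>k. inner (A \<cdot> (x - f k)) (x - f k)) \<longlonglongrightarrow> inner (L \<cdot> x) x"
    unfolding A_form bop_linear(2)[of TT] u_def by simp
  moreover have "(\<lambda>k. inner ((PP - RR) \<cdot> TT \<cdot> f k) (TT \<cdot> f k)) \<longlonglongrightarrow> inner ((PP - RR) \<cdot> E1 \<cdot> u) (E1 \<cdot> u)"
    by (intro tendsto_intros f)
  then have "(\<lambda>k. inner (B \<cdot> f k) (f k)) \<longlonglongrightarrow> 0" unfolding B_form S_E1_apply by simp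
  ultimately show ?thesis by (rule that)
qed

lemma par_sum_pos: "0 \<le> par_sum A B"
  unfolding par_sum_eq by (rule W_pos)

lemma par_sum_form_le: "inner (par_sum A B \<cdot> x) x \<le> inner (A \<cdot> (x - y)) (x - y) + inner (B \<cdot> y) y"
  unfolding par_sum_eq using q_ge[of x y] by (simp only: q_def)

lemma par_sum_form_approx:
  "0 < e \<Longrightarrow> \<exists>y. inner (A \<cdot> (x - y)) (x - y) + inner (B \<cdot> y) y < inner (par_sum A B \<cdot> x) x + e"
  unfolding par_sum_eq using q_approx[of e x] by (simp only: q_def)

definition RE :: "nat \<Rightarrow> 'a bop" where
  "RE m = RR * EE (DD m)"

lemma bnn_RE: "E.bnn (\<lambda>t. t * indicator {0..1} t * indicator (DD m) t)"
  by (intro E.bnn_mult E.bnn_unit_id E.bnn_indicator) simp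

lemma RE_calc: "RE m = E.calc (\<lambda>t. t * indicator {0..1} t * indicator (DD m) t)"
  unfolding RE_def by (rule R_E) simp

lemma RE_pos: "0 \<le> RE m"
  unfolding RE_calc by (rule E.calc_pos[OF bnn_RE])

lemma RE_tendsto: "(\<lambda>m. RE m \<cdot> x) \<longlonglongrightarrow> RR \<cdot> x - E1 \<cdot> x"
  using tendsto_bop[OF E_DD_tendsto, of RR x] by (simp add: RE_def R_halfopen_apply)

lemma RE_le_R: "RE m \<le> RR"
  unfolding RE_calc calc_R[symmetric]
  by (rule E.calc_mono[OF bnn_RE E.bnn_unit_id]) (auto simp: indicator_def)

lemma S_lower: "(1 / real (Suc m)) * (norm (EE (DD m) \<cdot> v))\<^sup>2 \<le> inner ((PP - RR) \<cdot> v) v"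
proof -
  have p: "0 \<le> 1 / real (Suc m)" by simp
  have "(1 / real (Suc m)) *\<^sub>R EE (DD m) \<le> PP - RR"
    unfolding calc_S[symmetric] E.calc_indicator[OF DD_borel, symmetric] E.calc_scale[OF E.bnn_indicator[OF DD_borel] p, symmetric]
  proof (rule E.calc_mono[OF E.bnn_scale bnn_co])
    fix t show "1 / real (Suc m) * indicator (DD m) t \<le> (1 - t) * indicator {0..1} t"
    proof (cases "t \<in> DD m")
      case True
      then show ?thesis using DD_D[OF True] by (simp add: DD_def)
    qed (auto simp: indicator_def)
  qed (use p in auto)
  from le_bop_form[OF this, of v] show ?thesis by (simp add: E.E_form)
qed

text \<open>For fixed \<open>m\<close>, any choice of \<open>y\<close> lowers the form of
  \<open>RE m\<close> by at most \<open>2 (norm u) s\<close> but costs at least \<open>c s^2\<close>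
  in \<open>n B\<close>. Optimizing over \<open>s\<close> leaves \<open>(norm u)^2 / c\<close>,
  which disappears as \<open>n\<close> grows.\<close>

lemma par_sum_lower:
  assumes n: "0 < n"
  shows "inner (RE m \<cdot> TT \<cdot> x) (TT \<cdot> x) - real (Suc m) / real n * (norm (TT \<cdot> x))\<^sup>2
    \<le> inner (par_sum A (real n *\<^sub>R B) \<cdot> x) x"
proof (rule field_le_epsilon)
  fix e :: real assume e: "0 < e"
  interpret N: pos_pair A "real n *\<^sub>R B" by unfold_locales (simp_all add: A B pos_scaleR)
  obtain y where y: "inner (A \<cdot> (x - y)) (x - y) + real n * inner (B \<cdot> y) y
      < inner (par_sum A (real n *\<^sub>R B) \<cdot> x) x + e"
    using N.par_sum_form_approx[OF e, of x] by auto
  define u where "u = TT \<cdot> x"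
  define v where "v = TT \<cdot> y"
  define s where "s = norm (EE (DD m) \<cdot> v)"
  define c where "c = real n / real (Suc m)"
  have c: "0 < c" using n by (simp add: c_def)
  have saRE: "selfadj (RE m)" by (rule pos_selfadj[OF RE_pos])
  have "inner (RE m \<cdot> (u - v)) (u - v) \<le> inner (RR \<cdot> (u - v)) (u - v)"
    by (rule le_bop_form[OF RE_le_R])
  moreover have "inner (RE m \<cdot> (u - v)) (u - v) = inner (RE m \<cdot> u) u - 2 * inner (RE m \<cdot> u) v + inner (RE m \<cdot> v) v"
    using selfadjD[OF saRE, of v u] by (simp add: inner_diff_left inner_diff_right inner_commute)
  moreover have "0 \<le> inner (RE m \<cdot> v) v" by (rule pos_form[OF RE_pos])
  moreover have "inner (RE m \<cdot> u) v \<le> norm u * s"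
  proof -
    have eq: "EE (DD m) * RE m = RE m"
    proof (rule selfadj_mult_adjI[OF saRE E.E_selfadj[OF DD_borel] saRE])
      show "RE m * EE (DD m) = RE m" unfolding RE_def by (simp only: mult.assoc E.E_idem[OF DD_borel])
    qed
    have "inner (RE m \<cdot> u) v = inner (EE (DD m) \<cdot> RE m \<cdot> u) v" using eq by (simp flip: bop_simps(6))
    also have "\<dots> = inner (RE m \<cdot> u) (EE (DD m) \<cdot> v)" by (rule selfadjD[OF E.E_selfadj[OF DD_borel]])
    also have "\<dots> \<le> norm (RE m \<cdot> u) * s" unfolding s_def by (rule norm_cauchy_schwarz)
    also have "\<dots> \<le> norm u * s"
      unfolding RE_calc s_def by (intro mult_right_mono E.calc_norm_le bnn_RE) (auto simp: indicator_def)
    finally show ?thesis .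
  qed
  ultimately have R: "inner (RE m \<cdot> u) u - 2 * (norm u * s) \<le> inner (RR \<cdot> (u - v)) (u - v)" by linarith
  have S: "c * s\<^sup>2 \<le> real n * inner ((PP - RR) \<cdot> v) v"
    using mult_left_mono[OF S_lower[of m v], of "real n"] by (simp add: c_def s_def)
  have "0 \<le> c * (s - norm u / c)\<^sup>2" using c by simp
  also have "\<dots> = c * s\<^sup>2 - 2 * (norm u * s) + (norm u)\<^sup>2 / c"
    using c by (simp add: power2_eq_square field_simps)
  finally have "inner (RE m \<cdot> u) u - (norm u)\<^sup>2 / c \<le> inner (RR \<cdot> (u - v)) (u - v) + real n * inner ((PP - RR) \<cdot> v) v"
    using R S by linarith
  moreover have "(norm u)\<^sup>2 / c = real (Suc m) / real n * (norm u)\<^sup>2" by (simp add: c_def)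
  ultimately show "inner (RE m \<cdot> TT \<cdot> x) (TT \<cdot> x) - real (Suc m) / real n * (norm (TT \<cdot> x))\<^sup>2
    \<le> inner (par_sum A (real n *\<^sub>R B) \<cdot> x) x + e"
    using y unfolding A_form B_form bop_linear(2)[of TT] u_def v_def by linarith
qed

text \<open>The upper bound inserts the vectors of \<open>approx_E1\<close>. For the lower one the
  order of choices matters: first \<open>m\<close>, to make \<open>RE m\<close> almost exhaust
  \<open>R - E1\<close> at \<open>T x\<close>, and then \<open>n\<close> depending on
  \<open>m\<close>.\<close>

lemma ac_part_eq: "ac_part B A = L"
proof -
  define X where "X n = par_sum A (real n *\<^sub>R B)" for n
  have pp: "pos_pair A (real n *\<^sub>R B)" for n by unfold_locales (simp_all add: A B pos_scaleR)
  have Xpos: "0 \<le> X n" for n unfolding X_def by (rule pos_pair.par_sum_pos[OF pp])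
  have upper: "inner (X n \<cdot> x) x \<le> inner (L \<cdot> x) x" for n x
  proof -
    obtain f where f: "(\<lambda>k. inner (A \<cdot> (x - f k)) (x - f k)) \<longlonglongrightarrow> inner (L \<cdot> x) x"
      "(\<lambda>k. inner (B \<cdot> f k) (f k)) \<longlonglongrightarrow> 0" by (rule approx_E1)
    have "(\<lambda>k. inner (A \<cdot> (x - f k)) (x - f k) + real n * inner (B \<cdot> f k) (f k))
        \<longlonglongrightarrow> inner (L \<cdot> x) x + real n * 0"
      by (intro tendsto_intros f)
    moreover have "inner (X n \<cdot> x) x \<le> inner (A \<cdot> (x - f k)) (x - f k) + real n * inner (B \<cdot> f k) (f k)" for k
      using pos_pair.par_sum_form_le[OF pp, of n x "f k"] by (simp only: X_def bop_simps(7) inner_scaleR_left)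
    ultimately have "inner (X n \<cdot> x) x \<le> inner (L \<cdot> x) x + real n * 0" by (intro LIMSEQ_le_const) auto
    then show ?thesis by simp
  qed
  have Dpos: "0 \<le> L - X n" for n
    by (rule posI) (use upper L_sa Xpos in \<open>auto simp: pos_selfadj inner_diff_left\<close>)
  have Dbd: "inner ((L - X n) \<cdot> x) x \<le> norm L * (norm x)\<^sup>2" for n x
    using form_le_norm[of L x] pos_form[OF Xpos, of n x] by (simp add: inner_diff_left)
  have Dlim: "(\<lambda>n. inner ((L - X n) \<cdot> x) x) \<longlonglongrightarrow> 0" for x
  proof (rule LIMSEQ_I)
    fix r :: real assume r: "0 < r"
    define u where "u = TT \<cdot> x"
    have Lu: "inner (L \<cdot> x) x = inner (RR \<cdot> u - E1 \<cdot> u) u" unfolding L_form u_def by (simp add: inner_diff_left)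
    have "(\<lambda>m. inner (RE m \<cdot> u) u) \<longlonglongrightarrow> inner (RR \<cdot> u - E1 \<cdot> u) u" by (intro tendsto_intros RE_tendsto)
    then have "\<forall>\<^sub>F m in sequentially. inner (L \<cdot> x) x - r / 2 < inner (RE m \<cdot> u) u"
      unfolding Lu[symmetric] using r by (intro order_tendstoD(1)) auto
    then obtain m where m: "inner (L \<cdot> x) x - r / 2 < inner (RE m \<cdot> u) u"
      by (auto simp: eventually_sequentially)
    have "(\<lambda>n. real (Suc m) * (norm u)\<^sup>2 / real n) \<longlonglongrightarrow> 0" by (rule lim_const_over_n)
    then have "\<forall>\<^sub>F n in sequentially. real (Suc m) * (norm u)\<^sup>2 / real n < r / 2"
      using r by (intro order_tendstoD(2)) auto
    then obtain N where N: "\<And>n. n \<ge> N \<Longrightarrow> real (Suc m) * (norm u)\<^sup>2 / real n < r / 2"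
      by (auto simp: eventually_sequentially)
    have "norm (inner ((L - X n) \<cdot> x) x - 0) < r" if "n \<ge> max N 1" for n
    proof -
      have n: "0 < n" "N \<le> n" using that by auto
      have "inner (RE m \<cdot> u) u - real (Suc m) * (norm u)\<^sup>2 / real n \<le> inner (X n \<cdot> x) x"
        using par_sum_lower[OF n(1), of m x] by (simp add: X_def u_def)
      then have "inner (L \<cdot> x) x - inner (X n \<cdot> x) x < r" using m N[OF n(2)] by linarith
      then show ?thesis using upper[of n x] by (simp add: inner_diff_left)
    qed
    then show "\<exists>no. \<forall>n\<ge>no. norm (inner ((L - X n) \<cdot> x) x - 0) < r" by blast
  qed
  have "sot_tendsto X L sequentially"
    unfolding sot_tendsto_def
  proof
    fix x
    have "(\<lambda>n. (L - X n) \<cdot> x) \<longlonglongrightarrow> 0" by (rule form_tendsto_imp_sot[OF Dpos Dbd Dlim])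
    from tendsto_diff[OF tendsto_const[of "L \<cdot> x"] this] show "(\<lambda>n. X n \<cdot> x) \<longlonglongrightarrow> L \<cdot> x" by simp
  qed
  then show ?thesis unfolding ac_part_def X_def by (rule sot_lim_eqI) simp
qed

lemma TET_zero_iff: "(TT * E1 * TT) \<cdot> x = 0 \<longleftrightarrow> E1 \<cdot> TT \<cdot> x = 0"
proof
  assume "(TT * E1 * TT) \<cdot> x = 0"
  then have "inner (E1 \<cdot> TT \<cdot> x) (TT \<cdot> x) = 0" by (simp flip: T_sandwich_form)
  then show "E1 \<cdot> TT \<cdot> x = 0" by (simp add: E.E_form)
qed simp

lemma ker_ac_part: "ker (A - ac_part B A) = {x. E1 \<cdot> TT \<cdot> x = 0}"
  unfolding ac_part_eq L_def ker_def using TET_zero_iff by simp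

text \<open>Each \<open>X n\<close> is dominated by a multiple of \<open>B\<close>, so it does not
  see the part of \<open>x\<close> that can be approximated at vanishing cost in \<open>B\<close>;
  hence \<open>X n <= L\<close>. In the limit \<open>A <= L = A - T E1 T\<close>, so the positive
  operator \<open>T E1 T\<close> is zero.\<close>

lemma abs_cont_imp:
  assumes "abs_cont B A"
  shows "TT * E1 * TT = 0"
proof -
  obtain X where X: "\<And>n. 0 \<le> X n" "incseq X" "sot_tendsto X A sequentially" "\<And>n. \<exists>l\<ge>0. X n \<le> l *\<^sub>R B"
    using assms unfolding abs_cont_def by auto
  have lim: "(\<lambda>n. inner (X n \<cdot> x) x) \<longlonglongrightarrow> inner (A \<cdot> x) x" for x
    using X(3) by (intro tendsto_intros) (simp add: sot_tendsto_def)
  have XA: "inner (X n \<cdot> x) x \<le> inner (A \<cdot> x) x" for n x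
    by (rule LIMSEQ_le_const[OF lim]) (intro exI[of _ n] allI impI le_bop_form incseqD[OF X(2)])
  have XL: "inner (X n \<cdot> x) x \<le> (1 + d) * inner (L \<cdot> x) x" if d: "0 < d" for n x d
  proof -
    obtain l where l: "0 \<le> l" "X n \<le> l *\<^sub>R B" using X(4) by blast
    have XB: "inner (X n \<cdot> y) y \<le> l * inner (B \<cdot> y) y" for y using le_bop_form[OF l(2), of y] by simp
    obtain f where f: "(\<lambda>k. inner (A \<cdot> (x - f k)) (x - f k)) \<longlonglongrightarrow> inner (L \<cdot> x) x"
      "(\<lambda>k. inner (B \<cdot> f k) (f k)) \<longlonglongrightarrow> 0" by (rule approx_E1)
    \<comment> \<open>The cross term of the form at \<open>(x - y) + y\<close> is absorbed with
      weight \<open>d\<close>, through positivity at \<open>d a - y\<close>; then \<open>A\<close>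
      dominates the first piece and \<open>l B\<close> the second.\<close>
    have le: "inner (X n \<cdot> x) x \<le> (1 + d) * inner (A \<cdot> (x - y)) (x - y) + (1 + 1/d) * (l * inner (B \<cdot> y) y)" for y
    proof -
      define a where "a = x - y"
      have x: "x = a + y" by (simp add: a_def)
      have sym: "inner (X n \<cdot> y) a = inner (X n \<cdot> a) y"
        using selfadjD[OF pos_selfadj[OF X(1)], of n y a] by (simp add: inner_commute)
      have "0 \<le> (1/d) * inner (X n \<cdot> (d *\<^sub>R a - y)) (d *\<^sub>R a - y)"
        by (intro mult_nonneg_nonneg pos_form X(1)) (use d in simp)
      also have "\<dots> = d * inner (X n \<cdot> a) a - 2 * inner (X n \<cdot> a) y + (1/d) * inner (X n \<cdot> y) y"
        using d by (simp add: inner_diff_left inner_diff_right sym field_simps)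
      finally have "inner (X n \<cdot> x) x \<le> (1 + d) * inner (X n \<cdot> a) a + (1 + 1/d) * inner (X n \<cdot> y) y"
        unfolding x by (simp add: inner_add_left inner_add_right sym algebra_simps)
      also have "\<dots> \<le> (1 + d) * inner (A \<cdot> a) a + (1 + 1/d) * (l * inner (B \<cdot> y) y)"
        using d by (intro add_mono mult_left_mono XA XB) auto
      finally show ?thesis by (simp only: a_def)
    qed
    have "(\<lambda>k. (1 + d) * inner (A \<cdot> (x - f k)) (x - f k) + (1 + 1/d) * (l * inner (B \<cdot> f k) (f k)))
        \<longlonglongrightarrow> (1 + d) * inner (L \<cdot> x) x + (1 + 1/d) * (l * 0)"
      by (intro tendsto_intros f)
    from LIMSEQ_le_const[OF this] le have "inner (X n \<cdot> x) x \<le> (1 + d) * inner (L \<cdot> x) x + (1 + 1/d) * (l * 0)"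
      by blast
    then show ?thesis by simp
  qed
  have XL': "inner (X n \<cdot> x) x \<le> inner (L \<cdot> x) x" for n x
  proof -
    have "(\<lambda>k. (1 + 1 / real (Suc k)) * inner (L \<cdot> x) x) \<longlonglongrightarrow> (1 + 0) * inner (L \<cdot> x) x"
      by (intro tendsto_intros LIMSEQ_Suc lim_1_over_n)
    then have "inner (X n \<cdot> x) x \<le> (1 + 0) * inner (L \<cdot> x) x"
      by (rule LIMSEQ_le_const) (intro exI allI impI XL, simp)
    then show ?thesis by simp
  qed
  have AL: "inner (A \<cdot> x) x \<le> inner (L \<cdot> x) x" for x
    by (rule LIMSEQ_le_const2[OF lim]) (use XL' in blast)
  show ?thesis
  proof (rule selfadj_form_eqI[OF TET_sa])
    fix x
    have "0 \<le> inner ((TT * E1 * TT) \<cdot> x) x"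
      unfolding T_sandwich_form by (rule pos_form[OF E.E_pos]) simp
    moreover have "inner ((TT * E1 * TT) \<cdot> x) x \<le> 0"
      using AL[of x] unfolding L_def bop_simps(2) inner_diff_left by linarith
    ultimately show "inner ((TT * E1 * TT) \<cdot> x) x = inner (0 \<cdot> x) x" by simp
  qed simp
qed

text \<open>The witnesses are \<open>T R E(DD m) T\<close>. Away from 1 the factor
  \<open>1 - t\<close> is at least \<open>1 / Suc m\<close>, and this gives domination by
  \<open>Suc m\<close> times \<open>B\<close>.\<close>

lemma abs_contI:
  assumes z: "TT * E1 * TT = 0"
  shows "abs_cont B A"
proof -
  define X where "X m = TT * RE m * TT" for m
  have E1z: "E1 \<cdot> TT \<cdot> x = 0" for x using TET_zero_iff[of x] z by simp
  have "0 \<le> X m" for m unfolding X_def by (rule pos_sandwich[OF T_sa RE_pos])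
  moreover have "incseq X"
    unfolding incseq_def
  proof (intro allI impI)
    fix m n :: nat assume "m \<le> n"
    have "RE m \<le> RE n"
      unfolding RE_calc by (rule E.calc_mono[OF bnn_RE bnn_RE])
        (use DD_mono[OF \<open>m \<le> n\<close>] in \<open>auto simp: indicator_def\<close>)
    then show "X m \<le> X n" unfolding X_def by (rule le_bop_sandwich[OF T_sa])
  qed
  moreover have "sot_tendsto X A sequentially"
    unfolding sot_tendsto_def
  proof
    fix x
    have "(\<lambda>m. TT \<cdot> RE m \<cdot> TT \<cdot> x) \<longlonglongrightarrow> TT \<cdot> (RR \<cdot> TT \<cdot> x - E1 \<cdot> TT \<cdot> x)"
      by (intro tendsto_bop RE_tendsto)
    moreover have "TT \<cdot> (RR \<cdot> TT \<cdot> x - E1 \<cdot> TT \<cdot> x) = A \<cdot> x"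
      using arg_cong[OF A_eq, of "\<lambda>Y. Y \<cdot> x"] by (simp only: E1z bop_simps(6)) simp
    ultimately show "(\<lambda>m. X m \<cdot> x) \<longlonglongrightarrow> A \<cdot> x" by (simp add: X_def)
  qed
  moreover have "\<exists>l\<ge>0. X m \<le> l *\<^sub>R B" for m
  proof (intro exI[of _ "real (Suc m)"] conjI)
    have "RE m \<le> real (Suc m) *\<^sub>R (PP - RR)"
    proof -
      have c: "0 \<le> real (Suc m)" by simp
      show ?thesis
        unfolding RE_calc calc_S[symmetric] E.calc_scale[OF bnn_co c, symmetric]
      proof (rule E.calc_mono[OF bnn_RE E.bnn_scale[OF bnn_co c]])
        fix t
        show "t * indicator {0..1} t * indicator (DD m) t \<le> real (Suc m) * ((1 - t) * indicator {0..1} t)"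
        proof (cases "t \<in> DD m")
          case True
          then show ?thesis using DD_D[OF True] by simp
        qed (auto simp: indicator_def)
      qed
    qed
    from le_bop_sandwich[OF T_sa this] have "X m \<le> real (Suc m) *\<^sub>R (TT * (PP - RR) * TT)" by (simp add: X_def)
    then show "X m \<le> real (Suc m) *\<^sub>R B" by (simp only: B_eq[symmetric])
  qed simp
  ultimately show ?thesis unfolding abs_cont_def by blast
qed

lemma abs_cont_iff: "abs_cont B A \<longleftrightarrow> ker (A - ac_part B A) = UNIV"
proof -
  have "TT * E1 * TT = 0 \<longleftrightarrow> (\<forall>x. (TT * E1 * TT) \<cdot> x = 0)"
    by (metis bop_eqI bop_simps(4))
  then show ?thesis using abs_cont_imp abs_contI TET_zero_iff unfolding ker_ac_part by auto
qed

section \<open>Essential part and dense domain\<close>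

definition f0 :: "real \<Rightarrow> real" where
  "f0 t = (if t \<in> {0..<1} then t\<^sup>2 / (1 - t) else 0)"

lemma f0_measurable [measurable]: "f0 \<in> borel_measurable borel"
  unfolding f0_def by measurable

lemma f0_nonneg: "0 \<le> f0 t"
  by (simp add: f0_def)

text \<open>\<open>phi_sq\<close> is infinite at the point 1, where \<open>f0\<close> is set to 0;
  the second summand accounts for that point, with infinity times zero mass being zero.\<close>

lemma phi_sq_integral:
  assumes M: "sets M = sets borel"
  shows "(\<integral>\<^sup>+ r\<in>{0..1}. phi_sq r (1 - r) \<partial>M) = (\<integral>\<^sup>+ t. ennreal (f0 t) \<partial>M) + top * emeasure M {1}"
proof -
  have [measurable_cong]: "sets M = sets borel" by (rule M)
  have "phi_sq r (1 - r) * indicator {0..1} r = ennreal (f0 r) + top * indicator {1} r" for r :: real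
    by (auto simp: phi_sq_def f0_def indicator_def)
  then have "(\<integral>\<^sup>+ r\<in>{0..1}. phi_sq r (1 - r) \<partial>M) = (\<integral>\<^sup>+ r. ennreal (f0 r) + top * indicator {1} r \<partial>M)"
    by simp
  also have "\<dots> = (\<integral>\<^sup>+ t. ennreal (f0 t) \<partial>M) + (\<integral>\<^sup>+ t. top * indicator {1} t \<partial>M)"
    by (rule nn_integral_add) measurable
  also have "(\<integral>\<^sup>+ t. top * indicator {1} t \<partial>M) = top * emeasure M {1}"
    by (rule nn_integral_cmult_indicator) (simp add: M)
  finally show ?thesis .
qed

lemma perspective_vec:
  "perspective_sq A B (\<omega> x) = enn2ereal ((\<integral>\<^sup>+ t. ennreal (f0 t) \<partial>vec_measure EE (TT \<cdot> x))
    + top * emeasure (vec_measure EE (TT \<cdot> x)) {1})"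
proof -
  have "measure_of UNIV (sets borel) (\<lambda>\<Delta>. ennreal (Re (blinfun_apply (\<omega> x) (adj TT * EE \<Delta> * TT))))
    = vec_measure EE (TT \<cdot> x)"
    unfolding vec_measure_def vec_fun.rep_eq adj_T Re_cinner T_sandwich_form ..
  then show ?thesis
    unfolding perspective_sq_def perspective_def by (simp only: phi_sq_integral[OF E.sets_vm])
qed

lemma enn2ereal_less_infinity: "enn2ereal x < \<infinity> \<longleftrightarrow> x < top"
  by (metis enn2ereal_top infinity_ereal_def less_ennreal.rep_eq)

lemma perspective_finite_iff:
  "perspective_sq A B (\<omega> x) < \<infinity> \<longleftrightarrow>
    E1 \<cdot> TT \<cdot> x = 0 \<and> (\<integral>\<^sup>+ t. ennreal (f0 t) \<partial>vec_measure EE (TT \<cdot> x)) < \<infinity>"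
proof -
  have em: "emeasure (vec_measure EE (TT \<cdot> x)) {1} = ennreal ((norm (E1 \<cdot> TT \<cdot> x))\<^sup>2)"
    by (simp add: E.emeasure_vm E.E_form)
  show ?thesis
    unfolding perspective_vec enn2ereal_less_infinity em
    by (cases "E1 \<cdot> TT \<cdot> x = 0") (auto simp: ennreal_top_mult)
qed

lemma dom_eq: "dom_sqrtQ_T A B = {x. (\<integral>\<^sup>+ t. ennreal (f0 t) \<partial>vec_measure EE (TT \<cdot> x)) < \<infinity>}"
proof -
  have "Q_AB A B = spectral_integral HH EE f0"
    unfolding Q_AB_def f0_def ..
  then show ?thesis
    unfolding dom_sqrtQ_T_def by (simp add: E.Domain_graph_sqrt[OF f0_measurable f0_nonneg] T_in)
qed

lemma essential_part_eq:
  "essential_part (perspective_sq A B) = closure (ker (A - ac_part B A) \<inter> dom_sqrtQ_T A B)"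
  unfolding essential_part_def perspective_finite_iff ker_ac_part dom_eq by (simp add: Collect_conj_eq)

lemma closure_subset_ker: "closure (ker (A - ac_part B A) \<inter> dom_sqrtQ_T A B) \<subseteq> ker (A - ac_part B A)"
  by (rule closure_minimal) (use closed_csubspace_ker in \<open>auto simp: closed_csubspace_def\<close>)

lemma dense_domain_iff:
  "dense_domain (perspective_sq A B) \<longleftrightarrow> abs_cont B A \<and> closure (dom_sqrtQ_T A B) = UNIV"
proof
  assume "dense_domain (perspective_sq A B)"
  then have cl: "closure (ker (A - ac_part B A) \<inter> dom_sqrtQ_T A B) = UNIV"
    by (simp add: dense_domain_def essential_part_eq)
  then have "ker (A - ac_part B A) = UNIV" using closure_subset_ker by auto
  with cl show "abs_cont B A \<and> closure (dom_sqrtQ_T A B) = UNIV" by (simp add: abs_cont_iff)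
next
  assume "abs_cont B A \<and> closure (dom_sqrtQ_T A B) = UNIV"
  then show "dense_domain (perspective_sq A B)" by (simp add: dense_domain_def essential_part_eq abs_cont_iff)
qed

end

section \<open>Normal functionals\<close>

lemma normal_pos_nonneg: "\<rho> \<in> normal_pos \<Longrightarrow> 0 \<le> X \<Longrightarrow> 0 \<le> Re (blinfun_apply \<rho> X)"
  by (auto simp: normal_pos_def complex_nonneg_Reals_iff)

lemma normal_pos_mono: "\<rho> \<in> normal_pos \<Longrightarrow> X \<le> Y \<Longrightarrow> Re (blinfun_apply \<rho> X) \<le> Re (blinfun_apply \<rho> Y)"
  using normal_pos_nonneg[of \<rho> "Y - X"] by (simp add: le_bop_iff_diff[of X] blinfun.diff_right)

text \<open>Normality is phrased for directed sets with a least upper bound. The range of an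
  increasing sequence is directed, and its strong limit is the least upper bound.\<close>

lemma normal_pos_tendsto:
  fixes Y :: "nat \<Rightarrow> 'a::complex_hilbert bop"
  assumes rho: "\<rho> \<in> normal_pos" and pos: "\<And>n. 0 \<le> Y n" and inc: "\<And>n. Y n \<le> Y (Suc n)"
    and X: "selfadj X" and lim: "\<And>x. (\<lambda>n. Y n \<cdot> x) \<longlonglongrightarrow> X \<cdot> x"
  shows "(\<lambda>n. Re (blinfun_apply \<rho> (Y n))) \<longlonglongrightarrow> Re (blinfun_apply \<rho> X)"
proof -
  have mono: "m \<le> n \<Longrightarrow> Y m \<le> Y n" for m n using lift_Suc_mono_le[of Y] inc by blast
  have flim: "(\<lambda>n. inner (Y n \<cdot> x) x) \<longlonglongrightarrow> inner (X \<cdot> x) x" for x by (intro tendsto_intros lim)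
  have YX: "Y n \<le> X" for n
  proof (rule le_bopI)
    show "selfadj (X - Y n)" by (simp add: X pos pos_selfadj)
    show "inner (Y n \<cdot> x) x \<le> inner (X \<cdot> x) x" for x
      by (rule LIMSEQ_le_const[OF flim]) (intro exI[of _ n] allI impI le_bop_form mono)
  qed
  have least: "X \<le> Z" if Z: "\<And>n. Y n \<le> Z" for Z
  proof (rule le_bopI)
    have "selfadj ((Z - Y 0) + Y 0)" by (intro selfadj_intros(3) le_bop_selfadj[OF Z] pos_selfadj[OF pos])
    then show "selfadj (Z - X)" using X by simp
    show "inner (X \<cdot> x) x \<le> inner (Z \<cdot> x) x" for x
      by (rule LIMSEQ_le_const2[OF flim]) (use le_bop_form[OF Z] in blast)
  qed
  have dir: "\<forall>U\<in>range Y. \<forall>V\<in>range Y. \<exists>W\<in>range Y. U \<le> W \<and> V \<le> W"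
  proof (intro ballI)
    fix U V assume "U \<in> range Y" "V \<in> range Y"
    then obtain m n where "U = Y m" "V = Y n" by blast
    then show "\<exists>W\<in>range Y. U \<le> W \<and> V \<le> W" using mono by (intro bexI[of _ "Y (max m n)"]) auto
  qed
  have "range Y \<noteq> {} \<and> (\<forall>U\<in>range Y. 0 \<le> U) \<and> (\<forall>U\<in>range Y. \<forall>V\<in>range Y. \<exists>W\<in>range Y. U \<le> W \<and> V \<le> W) \<and>
    (\<forall>U\<in>range Y. U \<le> X) \<and> (\<forall>Z. (\<forall>U\<in>range Y. U \<le> Z) \<longrightarrow> X \<le> Z)"
    using pos YX least dir by auto
  then have sup: "Re (blinfun_apply \<rho> X) = (SUP U\<in>range Y. Re (blinfun_apply \<rho> U))"
    by (rule rho[unfolded normal_pos_def mem_Collect_eq, THEN conjunct2, THEN conjunct2, THEN spec, THEN spec, THEN mp])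
  have "(\<lambda>n. Re (blinfun_apply \<rho> (Y n))) \<longlonglongrightarrow> (SUP n. Re (blinfun_apply \<rho> (Y n)))"
  proof (rule LIMSEQ_incseq_SUP)
    show "bdd_above (range (\<lambda>n. Re (blinfun_apply \<rho> (Y n))))"
      using normal_pos_mono[OF rho YX] by (auto simp: bdd_above_def)
    show "incseq (\<lambda>n. Re (blinfun_apply \<rho> (Y n)))"
      by (auto simp: incseq_def intro!: normal_pos_mono[OF rho] mono)
  qed
  then show ?thesis by (simp add: sup image_image)
qed

text \<open>A least upper bound in the operator order lies below the operator from
  \<open>directed_supremum\<close>, whose form is the pointwise supremum.\<close>

lemma vec_fun_normal: "\<omega> x \<in> normal_pos"
  unfolding normal_pos_def mem_Collect_eq vec_fun.rep_eq
proof (intro conjI allI impI)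
  fix c X show "cinner ((c *\<^sub>C X) \<cdot> x) x = c * cinner (X \<cdot> x) x"
    by (simp add: scaleC_bop.rep_eq cinner_scaleC_left)
next
  fix X :: "'a bop" assume "0 \<le> X"
  then show "cinner (X \<cdot> x) x \<in> \<real>\<^sub>\<ge>\<^sub>0" by (rule pos_cinner)
next
  fix D and X :: "'a bop"
  assume "D \<noteq> {} \<and> (\<forall>Y\<in>D. 0 \<le> Y) \<and> (\<forall>Y\<in>D. \<forall>Z\<in>D. \<exists>W\<in>D. Y \<le> W \<and> Z \<le> W) \<and>
    (\<forall>Y\<in>D. Y \<le> X) \<and> (\<forall>Z. (\<forall>Y\<in>D. Y \<le> Z) \<longrightarrow> X \<le> Z)"
  then have D: "D \<noteq> {}" "\<And>Y. Y \<in> D \<Longrightarrow> 0 \<le> Y" "\<And>Y Z. Y \<in> D \<Longrightarrow> Z \<in> D \<Longrightarrow> \<exists>W\<in>D. Y \<le> W \<and> Z \<le> W"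
    "\<And>Y. Y \<in> D \<Longrightarrow> Y \<le> X" "\<And>Z. (\<forall>Y\<in>D. Y \<le> Z) \<Longrightarrow> X \<le> Z" by blast+
  obtain X0 where X0: "selfadj X0" "\<And>x. inner (X0 \<cdot> x) x = (SUP Y\<in>D. inner (Y \<cdot> x) x)"
    "\<And>Y. Y \<in> D \<Longrightarrow> Y \<le> X0"
    using directed_supremum[OF D(1) D(3) D(2) D(4)] by blast
  have "X \<le> X0" using D(5) X0(3) by blast
  then have "inner (X \<cdot> x) x \<le> (SUP Y\<in>D. inner (Y \<cdot> x) x)" using le_bop_form X0(2) by metis
  moreover have "(SUP Y\<in>D. inner (Y \<cdot> x) x) \<le> inner (X \<cdot> x) x"
    by (rule cSUP_least[OF D(1)]) (use D(4) le_bop_form in blast)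
  ultimately show "Re (cinner (X \<cdot> x) x) = (SUP Y\<in>D. Re (cinner (Y \<cdot> x) x))"
    unfolding Re_cinner by (rule antisym)
qed

section \<open>Boundedness of the perspective\<close>

context pvm
begin

lemma calc_LIMSEQ:
  assumes U: "\<And>i. bnn (U i)" "incseq U" and lim: "\<And>t. (\<lambda>i. U i t) \<longlonglongrightarrow> u t" and u: "bnn u"
  shows "(\<lambda>i. calc (U i) \<cdot> x) \<longlonglongrightarrow> calc u \<cdot> x"
proof -
  have le: "U i t \<le> u t" for i t
    by (rule LIMSEQ_le_const[OF lim]) (use U(2) in \<open>auto simp: incseq_def le_fun_def\<close>)
  have inc: "calc (U i) \<le> calc (U (Suc i))" for i
    by (rule calc_mono[OF U(1) U(1)]) (use U(2) in \<open>auto simp: incseq_Suc_iff le_fun_def\<close>)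
  obtain X where X: "sot_tendsto (\<lambda>i. calc (U i)) X sequentially"
    using incseq_sot_limit[of "\<lambda>i. calc (U i)" "calc u", OF inc calc_pos[OF U(1)] calc_mono[OF U(1) u le]] by blast
  then have Xl: "\<And>x. (\<lambda>i. calc (U i) \<cdot> x) \<longlonglongrightarrow> X \<cdot> x" by (simp add: sot_tendsto_def)
  have "rep u X"
    by (rule rep_limit[OF rep_calc[OF U(1)] _ U(2) _ lim Xl]) (use U(1) in \<open>auto simp: bnn_def\<close>)
  then show ?thesis using Xl[of x] calc_eqI by simp
qed

end

section \<open>The scalar measure of a normal functional\<close>

locale pair_functional = pos_pair +
  fixes \<rho> :: "'a bop \<Rightarrow>\<^sub>L complex"
  assumes rho: "\<rho> \<in> normal_pos"
begin

definition \<nu> :: "real measure" where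
  "\<nu> = measure_of UNIV (sets borel) (\<lambda>\<Delta>. ennreal (Re (blinfun_apply \<rho> (TT * EE \<Delta> * TT))))"

lemma sandwich_pos: "0 \<le> X \<Longrightarrow> 0 \<le> Re (blinfun_apply \<rho> (TT * X * TT))"
  by (rule normal_pos_nonneg[OF rho pos_sandwich[OF T_sa]])

lemma sandwich_tendsto:
  assumes "\<And>n. 0 \<le> Y n" "\<And>n. Y n \<le> Y (Suc n)" "selfadj X" "\<And>x. (\<lambda>n. Y n \<cdot> x) \<longlonglongrightarrow> X \<cdot> x"
  shows "(\<lambda>n. Re (blinfun_apply \<rho> (TT * Y n * TT))) \<longlonglongrightarrow> Re (blinfun_apply \<rho> (TT * X * TT))"
proof (rule normal_pos_tendsto[OF rho])
  show "0 \<le> TT * Y n * TT" for n by (rule pos_sandwich[OF T_sa assms(1)])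
  show "TT * Y n * TT \<le> TT * Y (Suc n) * TT" for n by (rule le_bop_sandwich[OF T_sa assms(2)])
  show "selfadj (TT * X * TT)" by (rule selfadj_sandwich[OF T_sa assms(3)])
  show "(\<lambda>n. (TT * Y n * TT) \<cdot> x) \<longlonglongrightarrow> (TT * X * TT) \<cdot> x" for x
    using tendsto_bop[OF assms(4)[of "TT \<cdot> x"], of TT] by simp
qed

lemma sets_nu [measurable_cong, simp]: "sets \<nu> = sets borel"
  and space_nu [simp]: "space \<nu> = UNIV"
  and emeasure_nu: "\<Delta> \<in> sets borel \<Longrightarrow> emeasure \<nu> \<Delta> = ennreal (Re (blinfun_apply \<rho> (TT * EE \<Delta> * TT)))"
proof -
  have sums: "(\<lambda>n. Re (blinfun_apply \<rho> (TT * EE (F n) * TT))) sums Re (blinfun_apply \<rho> (TT * EE (\<Union>n. F n) * TT))"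
    if F: "range F \<subseteq> sets borel" "disjoint_family F" for F :: "nat \<Rightarrow> real set"
  proof -
    have Fb: "F n \<in> sets borel" "(\<Union>n. F n) \<in> sets borel" for n using F by auto
    define Y where "Y n = (\<Sum>i<n. EE (F i))" for n
    have "0 \<le> Y n" for n by (induction n) (simp_all add: Y_def pos_add E.E_pos Fb)
    moreover have "Y n \<le> Y (Suc n)" for n
      using E.E_pos[OF Fb(1), of n] by (simp add: Y_def le_bop_iff_diff[of "sum _ _"])
    moreover have "(\<lambda>n. Y n \<cdot> x) \<longlonglongrightarrow> EE (\<Union>n. F n) \<cdot> x" for x
      using E.E_sums[OF F, of x] by (simp add: sums_def Y_def)
    ultimately have "(\<lambda>n. Re (blinfun_apply \<rho> (TT * Y n * TT))) \<longlonglongrightarrow> Re (blinfun_apply \<rho> (TT * EE (\<Union>n. F n) * TT))"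
      using E.E_selfadj[OF Fb(2)] by (intro sandwich_tendsto) auto
    moreover have "Re (blinfun_apply \<rho> (TT * Y n * TT)) = (\<Sum>i<n. Re (blinfun_apply \<rho> (TT * EE (F i) * TT)))" for n
      by (simp add: Y_def sum_distrib_left sum_distrib_right blinfun.sum_right)
    ultimately show ?thesis by (simp add: sums_def)
  qed
  note * = real_measure_of[where \<mu>="\<lambda>\<Delta>. Re (blinfun_apply \<rho> (TT * EE \<Delta> * TT))", OF _ _ sums \<nu>_def]
  show "sets \<nu> = sets borel" "space \<nu> = UNIV"
    "\<Delta> \<in> sets borel \<Longrightarrow> emeasure \<nu> \<Delta> = ennreal (Re (blinfun_apply \<rho> (TT * EE \<Delta> * TT)))"
    by (rule *; simp add: sandwich_pos E.E_pos blinfun.zero_right)+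
qed

lemma measurable_nu: "f \<in> borel_measurable borel \<Longrightarrow> f \<in> borel_measurable \<nu>"
  by (simp add: measurable_def)

text \<open>An induction over \<open>u\<close> as for the functional calculus; normality of the
  functional is what carries the monotone limits.\<close>

lemma nn_integral_nu:
  assumes u: "u \<in> borel_measurable borel" "\<And>t. 0 \<le> u t" and bd: "\<And>t. u t \<le> c"
  shows "(\<integral>\<^sup>+ t. ennreal (u t) \<partial>\<nu>) = ennreal (Re (blinfun_apply \<rho> (TT * E.calc u * TT)))"
  using u bd
proof (induction arbitrary: c rule: borel_measurable_induct_real)
  case (set A)
  then show ?case by (simp add: ennreal_indicator emeasure_nu E.calc_indicator)
next
  case (mult u c c')
  show ?case
  proof (cases "c = 0")
    case True
    have "E.calc (\<lambda>t. 0) = 0" by (rule E.calc_eqI) (simp add: E.rep_def)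
    then show ?thesis using True by (simp add: blinfun.zero_right)
  next
    case False
    have b: "u t \<le> c' / c" for t using mult(5)[of t] mult(1) False by (simp add: field_simps)
    have "E.bnn u" unfolding E.bnn_def by (intro conjI allI exI[of _ "c' / c"] b mult(2,3))
    then show ?thesis using mult(1,2,3) mult(4)[OF b]
      by (simp add: ennreal_mult nn_integral_cmult measurable_nu E.calc_scale blinfun.scaleR_right
          sandwich_pos E.calc_pos)
  qed
next
  case (add u v c)
  have b: "u t \<le> c" "v t \<le> c" for t using add(8)[of t] add(2,4)[of t] by linarith+
  have uv: "E.bnn u" "E.bnn v"
    unfolding E.bnn_def by (intro conjI allI exI[of _ c] b add(1-4))+
  show ?case using add(1-4) add(6)[OF b(1)] add(7)[OF b(2)] uv
    by (simp add: nn_integral_add measurable_nu E.calc_add distrib_left distrib_right blinfun.add_right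
        sandwich_pos E.calc_pos ennreal_plus)
next
  case (seq U)
  have lim: "(\<lambda>i. U i t) \<longlonglongrightarrow> u t" for t using seq(4) by simp
  have Uu: "U i t \<le> u t" for i t
    by (rule LIMSEQ_le_const[OF lim]) (use seq(3) in \<open>auto simp: incseq_def le_fun_def\<close>)
  then have Uc: "U i t \<le> c" for i t using seq(6)[of t] by (rule order_trans)
  have bU: "E.bnn (U i)" for i
    unfolding E.bnn_def by (intro conjI allI exI[of _ c] seq(1) seq(2) Uc)
  have u0: "0 \<le> u t" for t using seq(2)[of 0 t] Uu[of 0 t] by linarith
  have "u \<in> borel_measurable borel" by (rule borel_measurable_LIMSEQ_real[OF lim seq(1)])
  then have bu: "E.bnn u" unfolding E.bnn_def by (intro conjI allI exI[of _ c] u0 seq(6))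
  show ?case
  proof (rule LIMSEQ_unique)
    show "(\<lambda>i. \<integral>\<^sup>+ t. ennreal (U i t) \<partial>\<nu>) \<longlonglongrightarrow> (\<integral>\<^sup>+ t. ennreal (u t) \<partial>\<nu>)"
    proof (rule nn_integral_LIMSEQ)
      show "incseq (\<lambda>i t. ennreal (U i t))"
        using seq(3) by (auto simp: incseq_def le_fun_def intro!: ennreal_leI)
      show "(\<lambda>t. ennreal (U i t)) \<in> borel_measurable \<nu>" for i
        by (rule measurable_nu[OF measurable_compose[OF seq(1) measurable_ennreal]])
    qed (auto intro!: tendsto_ennrealI lim)
    have "(\<lambda>i. Re (blinfun_apply \<rho> (TT * E.calc (U i) * TT))) \<longlonglongrightarrow> Re (blinfun_apply \<rho> (TT * E.calc u * TT))"
    proof (rule sandwich_tendsto)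
      show "0 \<le> E.calc (U n)" for n by (rule E.calc_pos[OF bU])
      show "E.calc (U n) \<le> E.calc (U (Suc n))" for n
        by (rule E.calc_mono[OF bU bU]) (use seq(3) in \<open>auto simp: incseq_Suc_iff le_fun_def\<close>)
      show "selfadj (E.calc u)" by (rule E.calc_selfadj[OF bu])
      show "(\<lambda>n. E.calc (U n) \<cdot> x) \<longlonglongrightarrow> E.calc u \<cdot> x" for x
        by (rule E.calc_LIMSEQ[OF bU seq(3) lim bu])
    qed
    then show "(\<lambda>i. \<integral>\<^sup>+ t. ennreal (U i t) \<partial>\<nu>) \<longlonglongrightarrow> ennreal (Re (blinfun_apply \<rho> (TT * E.calc u * TT)))"
      unfolding seq(5)[OF Uc] by (rule tendsto_ennrealI)
  qed
qed

lemma perspective_nu: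
  "perspective_sq A B \<rho> = enn2ereal ((\<integral>\<^sup>+ t. ennreal (f0 t) \<partial>\<nu>) + top * emeasure \<nu> {1})"
  unfolding perspective_sq_def perspective_def adj_T \<nu>_def[symmetric]
  by (simp only: phi_sq_integral[OF sets_nu])

end

section \<open>Cut-offs of the perspective and the condition on \<open>A^2\<close>\<close>

context pos_pair
begin

text \<open>\<open>GG m\<close> is \<open>r (1-r)\<^sup>-\<^sup>1\<^sup>/\<^sup>2\<close> cut off near the singularity; formally \<open>A B\<^sup>-\<^sup>1 A = (G T)\<^sup>*(G T)\<close> for the
  limit \<open>G\<close>, while \<open>A\<^sup>2 \<le> \<lambda> B\<close> amounts to \<open>\<parallel>T G\<parallel>\<^sup>2 \<le> \<lambda>\<close>.\<close>

definition ss :: "nat \<Rightarrow> real \<Rightarrow> real" where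
  "ss m t = 1 / sqrt (1 - t) * indicator (DD m) t"

definition gg :: "nat \<Rightarrow> real \<Rightarrow> real" where
  "gg m t = t / sqrt (1 - t) * indicator (DD m) t"

text \<open>Its operator is the square root of \<open>1 - R\<close>: it cancels the denominators of
  \<open>ss m\<close> and \<open>gg m\<close> on \<open>DD m\<close>.\<close>

definition rr :: "real \<Rightarrow> real" where
  "rr t = sqrt (1 - t) * indicator {0..1} t"

definition GG :: "nat \<Rightarrow> 'a bop" where
  "GG m = E.calc (gg m)"

lemma bnn_ss: "E.bnn (ss m)"
  unfolding E.bnn_def
proof (intro conjI allI exI[of _ "sqrt (real (Suc m))"])
  show "ss m \<in> borel_measurable borel" unfolding ss_def by measurable
  fix t
  show "0 \<le> ss m t" using DD_D[of t m] by (auto simp: ss_def indicator_def)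
  show "ss m t \<le> sqrt (real (Suc m))"
  proof (cases "t \<in> DD m")
    case True
    from DD_D[OF this] have t: "t < 1" "1 \<le> real (Suc m) * (1 - t)" by auto
    have "sqrt 1 \<le> sqrt (real (Suc m) * (1 - t))" by (rule real_sqrt_le_mono[OF t(2)])
    then show ?thesis using t(1) True by (simp add: ss_def real_sqrt_mult pos_divide_le_eq)
  qed (simp add: ss_def)
qed

lemma gg_eq: "gg m t = t * indicator {0..1} t * ss m t"
  using DD_D[of t m] by (auto simp: gg_def ss_def indicator_def)

lemma bnn_gg: "E.bnn (gg m)"
  using E.bnn_mult[OF E.bnn_unit_id bnn_ss[of m]] unfolding gg_eq[symmetric] .

lemma bnn_rr: "E.bnn rr"
  unfolding E.bnn_def
proof (intro conjI allI exI[of _ 1])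
  show "rr \<in> borel_measurable borel" unfolding rr_def by measurable
qed (auto simp: rr_def indicator_def)

lemma GG_sa: "selfadj (GG m)"
  unfolding GG_def by (rule E.calc_selfadj[OF bnn_gg])

lemma GG_eq: "GG m = RR * E.calc (ss m)"
proof -
  have "GG m = E.calc (\<lambda>t. t * indicator {0..1} t * ss m t)"
    unfolding GG_def by (rule arg_cong[where f=E.calc], rule ext) (rule gg_eq)
  then show ?thesis by (simp only: E.calc_mult[OF E.bnn_unit_id bnn_ss] calc_R)
qed

lemma GG_rr: "GG m * E.calc rr = RE m"
proof -
  have "gg m t * rr t = t * indicator {0..1} t * indicator (DD m) t" for t
    using DD_D[of t m] by (auto simp: gg_def rr_def indicator_def)
  then have "E.calc (\<lambda>t. gg m t * rr t) = RE m" unfolding RE_calc by presburger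
  then show ?thesis by (simp only: E.calc_mult[OF bnn_gg bnn_rr] GG_def)
qed

lemma rr_form: "(norm (E.calc rr \<cdot> u))\<^sup>2 = inner ((PP - RR) \<cdot> u) u"
proof -
  have "(\<lambda>t. rr t * rr t) = (\<lambda>t. (1 - t) * indicator {0..1} t)"
    by (auto simp: rr_def indicator_def)
  then show ?thesis by (simp only: E.norm_calc_sq[OF bnn_rr] calc_S)
qed

lemma ss_form: "inner ((PP - RR) \<cdot> E.calc (ss m) \<cdot> z) (E.calc (ss m) \<cdot> z) \<le> (norm z)\<^sup>2"
proof -
  have "rr t * ss m t = indicator (DD m) t" for t
    using DD_D[of t m] by (auto simp: rr_def ss_def indicator_def)
  then have "E.calc (\<lambda>t. rr t * ss m t) = EE (DD m)" using E.calc_indicator[OF DD_borel] by presburger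
  then have "E.calc rr \<cdot> E.calc (ss m) \<cdot> z = EE (DD m) \<cdot> z"
    by (simp only: E.calc_mult[OF bnn_rr bnn_ss] bop_simps(6)[symmetric])
  then have "inner ((PP - RR) \<cdot> E.calc (ss m) \<cdot> z) (E.calc (ss m) \<cdot> z) = (norm (EE (DD m) \<cdot> z))\<^sup>2"
    by (simp only: rr_form[symmetric])
  also have "\<dots> \<le> (norm z)\<^sup>2"
    by (intro power_mono projection_norm_le E.E_selfadj E.E_idem) auto
  finally show ?thesis .
qed

lemma GG_sq: "GG m * GG m = E.calc (\<lambda>t. gg m t * gg m t)"
  by (simp only: E.calc_mult[OF bnn_gg bnn_gg] GG_def)

lemma gg_sq: "gg m t * gg m t = f0 t * indicator (DD m) t"
  using DD_D[of t m] by (auto simp: gg_def f0_def indicator_def power2_eq_square)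

lemma gg_sq_mono: "m \<le> n \<Longrightarrow> gg m t * gg m t \<le> gg n t * gg n t"
  unfolding gg_sq using DD_mono[of m n] f0_nonneg[of t] by (auto simp: indicator_def)

lemma gg_sq_tendsto: "(\<lambda>m. gg m t * gg m t) \<longlonglongrightarrow> f0 t"
proof (cases "t \<in> {0..<1}")
  case True
  then obtain n where "t \<in> DD n" unfolding DD_Union[symmetric] by blast
  then have "gg m t * gg m t = f0 t" if "m \<ge> n" for m
    using DD_mono[OF that] by (auto simp: gg_sq)
  then show ?thesis by (intro tendsto_eventually) (auto simp: eventually_sequentially)
next
  case False
  then have "f0 t = 0" by (auto simp: f0_def)
  then show ?thesis by (simp add: gg_sq)
qed

lemma integral_f0_tendsto:
  assumes M: "sets M = sets borel"
  shows "(\<lambda>m. \<integral>\<^sup>+ t. ennreal (gg m t * gg m t) \<partial>M) \<longlonglongrightarrow> (\<integral>\<^sup>+ t. ennreal (f0 t) \<partial>M)"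
proof (rule nn_integral_LIMSEQ)
  have [measurable_cong]: "sets M = sets borel" by (rule M)
  have [measurable]: "gg m \<in> borel_measurable borel" for m using bnn_gg by (simp add: E.bnn_def)
  show "incseq (\<lambda>m t. ennreal (gg m t * gg m t))"
    by (auto simp: incseq_def le_fun_def intro!: ennreal_leI gg_sq_mono)
  show "(\<lambda>t. ennreal (gg m t * gg m t)) \<in> borel_measurable M" for m by measurable
  show "(\<lambda>m. ennreal (gg m t * gg m t)) \<longlonglongrightarrow> ennreal (f0 t)" for t
    by (intro tendsto_ennrealI gg_sq_tendsto)
qed

definition XX :: "nat \<Rightarrow> 'a bop" where
  "XX m = TT * (GG m * GG m) * TT"

lemma XX_form: "inner (XX m \<cdot> x) x = (norm (GG m \<cdot> TT \<cdot> x))\<^sup>2"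
  unfolding XX_def T_sandwich_form by (simp add: selfadjD[OF GG_sa] power2_norm_eq_inner)

lemma XX_pos: "0 \<le> XX m"
  unfolding XX_def by (rule pos_sandwich[OF T_sa pos_square[OF GG_sa]])

lemma GG_sq_mono: "GG m * GG m \<le> GG (Suc m) * GG (Suc m)"
  unfolding GG_sq by (rule E.calc_mono[OF E.bnn_mult[OF bnn_gg bnn_gg] E.bnn_mult[OF bnn_gg bnn_gg]])
    (simp add: gg_sq_mono)

lemma XX_mono: "XX m \<le> XX (Suc m)"
  unfolding XX_def by (rule le_bop_sandwich[OF T_sa GG_sq_mono])

lemma integral_gg: "(\<integral>\<^sup>+ t. ennreal (gg m t * gg m t) \<partial>vec_measure EE (TT \<cdot> x)) = ennreal (inner (XX m \<cdot> x) x)"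
  unfolding XX_def T_sandwich_form GG_sq by (rule E.calc_nn_integral[OF E.bnn_mult[OF bnn_gg bnn_gg]])

text \<open>A finite value excludes mass at 1, and away from 1 the bound passes between the cut-offs
  and the full integral by monotone convergence.\<close>

lemma perspective_le_iff:
  assumes l: "0 \<le> l"
  shows "(\<forall>x. perspective_sq A B (\<omega> x) \<le> ereal (l * (norm x)\<^sup>2)) \<longleftrightarrow>
    (\<forall>x. E1 \<cdot> TT \<cdot> x = 0) \<and> (\<forall>m x. inner (XX m \<cdot> x) x \<le> l * (norm x)\<^sup>2)"
proof (intro iffI conjI allI)
  assume *: "\<forall>x. perspective_sq A B (\<omega> x) \<le> ereal (l * (norm x)\<^sup>2)"
  show z: "E1 \<cdot> TT \<cdot> x = 0" for x
  proof -
    have "perspective_sq A B (\<omega> x) < \<infinity>" using *[rule_format, of x] by (rule le_less_trans) simp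
    then show ?thesis unfolding perspective_finite_iff by blast
  qed
  fix m x
  have "emeasure (vec_measure EE (TT \<cdot> x)) {1} = 0" by (simp add: E.emeasure_vm E.E_form z)
  then have "enn2ereal (\<integral>\<^sup>+ t. ennreal (f0 t) \<partial>vec_measure EE (TT \<cdot> x)) \<le> ereal (l * (norm x)\<^sup>2)"
    using *[rule_format, of x] by (simp add: perspective_vec)
  also have "ereal (l * (norm x)\<^sup>2) = enn2ereal (ennreal (l * (norm x)\<^sup>2))" using l by simp
  finally have f: "(\<integral>\<^sup>+ t. ennreal (f0 t) \<partial>vec_measure EE (TT \<cdot> x)) \<le> ennreal (l * (norm x)\<^sup>2)"
    by (simp only: less_eq_ennreal.rep_eq)
  have "ennreal (inner (XX m \<cdot> x) x) \<le> (\<integral>\<^sup>+ t. ennreal (f0 t) \<partial>vec_measure EE (TT \<cdot> x))"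
    unfolding integral_gg[symmetric]
    by (intro nn_integral_mono ennreal_leI) (auto simp: gg_sq f0_nonneg indicator_def)
  with f have "ennreal (inner (XX m \<cdot> x) x) \<le> ennreal (l * (norm x)\<^sup>2)" by (rule order_trans[rotated])
  then show "inner (XX m \<cdot> x) x \<le> l * (norm x)\<^sup>2" using l by simp
next
  assume *: "(\<forall>x. E1 \<cdot> TT \<cdot> x = 0) \<and> (\<forall>m x. inner (XX m \<cdot> x) x \<le> l * (norm x)\<^sup>2)"
  fix x
  have "emeasure (vec_measure EE (TT \<cdot> x)) {1} = 0" using * by (simp add: E.emeasure_vm)
  then have eq: "perspective_sq A B (\<omega> x) = enn2ereal (\<integral>\<^sup>+ t. ennreal (f0 t) \<partial>vec_measure EE (TT \<cdot> x))"
    by (simp add: perspective_vec)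
  have "(\<integral>\<^sup>+ t. ennreal (f0 t) \<partial>vec_measure EE (TT \<cdot> x)) \<le> ennreal (l * (norm x)\<^sup>2)"
  proof (rule LIMSEQ_le_const2[OF integral_f0_tendsto[OF E.sets_vm]])
    show "\<exists>N. \<forall>n\<ge>N. (\<integral>\<^sup>+ t. ennreal (gg n t * gg n t) \<partial>vec_measure EE (TT \<cdot> x)) \<le> ennreal (l * (norm x)\<^sup>2)"
      unfolding integral_gg using * by (auto intro!: ennreal_leI)
  qed
  then have "perspective_sq A B (\<omega> x) \<le> enn2ereal (ennreal (l * (norm x)\<^sup>2))"
    unfolding eq by (simp only: less_eq_ennreal.rep_eq)
  then show "perspective_sq A B (\<omega> x) \<le> ereal (l * (norm x)\<^sup>2)" using l by simp
qed

lemma A_square_form: "inner (A\<^sup>2 \<cdot> x) x = (norm (A \<cdot> x))\<^sup>2"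
  by (simp add: power2_eq_square[of A] selfadjD[OF pos_selfadj[OF A]] power2_norm_eq_inner)

lemma A_square_le_iff: "A\<^sup>2 \<le> l *\<^sub>R B \<longleftrightarrow> (\<forall>x. (norm (A \<cdot> x))\<^sup>2 \<le> l * inner (B \<cdot> x) x)"
proof -
  have "selfadj (A\<^sup>2)" "selfadj (l *\<^sub>R B)"
    by (simp_all add: power2_eq_square selfadj_square pos_selfadj A B)
  from le_bop_iff_form[OF this] show ?thesis by (simp add: A_square_form)
qed

lemma A_apply: "A \<cdot> x = TT \<cdot> RR \<cdot> TT \<cdot> x"
  using arg_cong[OF A_eq, of "\<lambda>Y. Y \<cdot> x"] by (simp only: bop_simps(6))

text \<open>\<open>Y X\<close> is the adjoint of \<open>X Y\<close>, so the two have the same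
  norm.\<close>

lemma norm_swap:
  assumes X: "selfadj X" and Y: "selfadj Y" and l: "0 \<le> l"
    and le: "\<And>z. (norm (X \<cdot> Y \<cdot> z))\<^sup>2 \<le> l * (norm z)\<^sup>2"
  shows "(norm (Y \<cdot> X \<cdot> x))\<^sup>2 \<le> l * (norm x)\<^sup>2"
proof -
  define z where "z = Y \<cdot> X \<cdot> x"
  have "(norm z)\<^sup>2 = inner x (X \<cdot> Y \<cdot> z)"
    using selfadjD[OF Y, of "X \<cdot> x" z] selfadjD[OF X, of x "Y \<cdot> z"] by (simp add: power2_norm_eq_inner z_def)
  also have "\<dots> \<le> norm x * norm (X \<cdot> Y \<cdot> z)" by (rule norm_cauchy_schwarz)
  finally have "((norm z)\<^sup>2)\<^sup>2 \<le> (norm x * norm (X \<cdot> Y \<cdot> z))\<^sup>2" by (intro power_mono) auto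
  also have "\<dots> \<le> (norm x)\<^sup>2 * (l * (norm z)\<^sup>2)"
    unfolding power_mult_distrib by (intro mult_left_mono le) simp
  finally have "(norm z)\<^sup>2 * (norm z)\<^sup>2 \<le> (l * (norm x)\<^sup>2) * (norm z)\<^sup>2"
    by (simp add: power2_eq_square mult_ac)
  moreover have "0 < (norm z)\<^sup>2" if "z \<noteq> 0" using that by simp
  ultimately have "(norm z)\<^sup>2 \<le> l * (norm x)\<^sup>2" if "z \<noteq> 0"
    using that mult_le_cancel_right_pos by blast
  then show ?thesis using l by (cases "z = 0") (auto simp: z_def[symmetric])
qed

lemma A_square_le_iff_XX:
  assumes l: "0 \<le> l"
  shows "A\<^sup>2 \<le> l *\<^sub>R B \<longleftrightarrow> (\<forall>x. E1 \<cdot> TT \<cdot> x = 0) \<and> (\<forall>m x. inner (XX m \<cdot> x) x \<le> l * (norm x)\<^sup>2)"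
proof
  assume "A\<^sup>2 \<le> l *\<^sub>R B"
  then have AB: "(norm (A \<cdot> x))\<^sup>2 \<le> l * inner (B \<cdot> x) x" for x unfolding A_square_le_iff by blast
  \<comment> \<open>\<open>A = T R T\<close> turns the hypothesis into this inequality on the range
    of \<open>T\<close>; density extends it to \<open>HH\<close>, in particular to vectors outside
    that range.\<close>
  have TR: "(norm (TT \<cdot> RR \<cdot> u))\<^sup>2 \<le> l * inner ((PP - RR) \<cdot> u) u" if u: "u \<in> HH" for u
  proof -
    obtain f where f: "(\<lambda>n. TT \<cdot> f n) \<longlonglongrightarrow> u" by (rule T_approx[OF u])
    show ?thesis
    proof (rule LIMSEQ_le)
      show "(\<lambda>n. (norm (TT \<cdot> RR \<cdot> TT \<cdot> f n))\<^sup>2) \<longlonglongrightarrow> (norm (TT \<cdot> RR \<cdot> u))\<^sup>2" by (intro tendsto_intros f)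
      show "(\<lambda>n. l * inner ((PP - RR) \<cdot> TT \<cdot> f n) (TT \<cdot> f n)) \<longlonglongrightarrow> l * inner ((PP - RR) \<cdot> u) u"
        by (intro tendsto_intros f)
      show "\<exists>N. \<forall>n\<ge>N. (norm (TT \<cdot> RR \<cdot> TT \<cdot> f n))\<^sup>2 \<le> l * inner ((PP - RR) \<cdot> TT \<cdot> f n) (TT \<cdot> f n)"
        using AB by (simp only: A_apply B_form) blast
    qed
  qed
  \<comment> \<open>On the range of \<open>E1\<close> the right side of \<open>TR\<close> vanishes
    while \<open>R\<close> is the identity, so \<open>T\<close> vanishes there.\<close>
  have "TT * E1 = 0"
  proof (rule bop_eqI)
    fix z
    have "E1 \<cdot> z \<in> HH" by (rule E.E_in) simp
    from TR[OF this] show "(TT * E1) \<cdot> z = 0 \<cdot> z" by (simp only: S_E1_apply R_E1_apply) simp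
  qed
  then have "E1 * TT = 0" by (rule selfadj_mult_adjI[OF T_sa E1_sa selfadj_intros(1)])
  then have "\<forall>x. E1 \<cdot> TT \<cdot> x = 0" by (metis bop_simps(4,6))
  moreover have "inner (XX m \<cdot> x) x \<le> l * (norm x)\<^sup>2" for m x
    unfolding XX_form
  proof (rule norm_swap[OF T_sa GG_sa l])
    fix z
    \<comment> \<open>\<open>TR\<close> is applied to the function \<open>(1 - t)^(-1/2)\<close>,
      cut off to \<open>DD m\<close>, of the operator: this makes the right side at most
      \<open>l (norm z)^2\<close>.\<close>
    have "TT \<cdot> GG m \<cdot> z = TT \<cdot> RR \<cdot> E.calc (ss m) \<cdot> z" by (simp add: GG_eq)
    then have "(norm (TT \<cdot> GG m \<cdot> z))\<^sup>2 \<le> l * inner ((PP - RR) \<cdot> E.calc (ss m) \<cdot> z) (E.calc (ss m) \<cdot> z)"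
      using TR[OF E.calc_in[OF bnn_ss], of m z] by simp
    also have "\<dots> \<le> l * (norm z)\<^sup>2" by (intro mult_left_mono ss_form l)
    finally show "(norm (TT \<cdot> GG m \<cdot> z))\<^sup>2 \<le> l * (norm z)\<^sup>2" .
  qed
  ultimately show "(\<forall>x. E1 \<cdot> TT \<cdot> x = 0) \<and> (\<forall>m x. inner (XX m \<cdot> x) x \<le> l * (norm x)\<^sup>2)" by blast
next
  assume *: "(\<forall>x. E1 \<cdot> TT \<cdot> x = 0) \<and> (\<forall>m x. inner (XX m \<cdot> x) x \<le> l * (norm x)\<^sup>2)"
  have GT: "(norm (GG m \<cdot> TT \<cdot> x))\<^sup>2 \<le> l * (norm x)\<^sup>2" for m x
    using * by (simp add: XX_form)
  have TG: "(norm (TT \<cdot> GG m \<cdot> z))\<^sup>2 \<le> l * (norm z)\<^sup>2" for m z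
    by (rule norm_swap[OF GG_sa T_sa l GT])
  have "(norm (A \<cdot> x))\<^sup>2 \<le> l * inner (B \<cdot> x) x" for x
  proof -
    define u where "u = TT \<cdot> x"
    \<comment> \<open>Taking the square root of \<open>1 - R\<close> applied to \<open>u\<close> as
      the vector in \<open>TG\<close> cancels the denominator of \<open>G\<close> and produces the
      form of \<open>1 - R\<close> on the right.\<close>
    have "(norm (TT \<cdot> RE m \<cdot> u))\<^sup>2 \<le> l * inner ((PP - RR) \<cdot> u) u" for m
      using TG[of m "E.calc rr \<cdot> u"] unfolding rr_form by (simp add: GG_rr[symmetric])
    moreover have "(\<lambda>m. (norm (TT \<cdot> RE m \<cdot> u))\<^sup>2) \<longlonglongrightarrow> (norm (TT \<cdot> (RR \<cdot> u - E1 \<cdot> u)))\<^sup>2"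
      by (intro tendsto_intros RE_tendsto)
    ultimately have "(norm (TT \<cdot> (RR \<cdot> u - E1 \<cdot> u)))\<^sup>2 \<le> l * inner ((PP - RR) \<cdot> u) u"
      by (intro LIMSEQ_le_const2) auto
    moreover have "RR \<cdot> u - E1 \<cdot> u = RR \<cdot> u" using * by (simp add: u_def)
    ultimately show ?thesis by (simp only: A_apply B_form u_def)
  qed
  then show "A\<^sup>2 \<le> l *\<^sub>R B" unfolding A_square_le_iff by blast
qed

lemma perspective_le_iff_A_square:
  "0 \<le> l \<Longrightarrow> (\<forall>x. perspective_sq A B (\<omega> x) \<le> ereal (l * (norm x)\<^sup>2)) \<longleftrightarrow> A\<^sup>2 \<le> l *\<^sub>R B"
  unfolding perspective_le_iff A_square_le_iff_XX ..

section \<open>The representing operator and its norm\<close>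

lemma perspective_nonneg: "0 \<le> perspective_sq A B (\<omega> x)"
  unfolding perspective_vec by simp

lemma represents_vec:
  assumes "represents_form X (perspective_sq A B)"
  shows "perspective_sq A B (\<omega> x) = ereal (inner (X \<cdot> x) x)"
  using assms vec_fun_normal[of x] by (simp add: represents_form_def vec_fun.rep_eq Re_cinner)

lemma represents_pos:
  assumes X: "represents_form X (perspective_sq A B)"
  shows "0 \<le> X"
proof (rule posI)
  show "selfadj X" using X by (simp add: represents_form_def adj_eq_self_iff)
  show "0 \<le> inner (X \<cdot> x) x" for x using perspective_nonneg[of x] by (simp add: represents_vec[OF X])
qed

text \<open>The admissible constants are exactly those not below the norm; the minimum formula and
  one direction of the boundedness criterion both follow.\<close>

lemma represents_le_iff:
  assumes X: "represents_form X (perspective_sq A B)" and l: "0 \<le> l"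
  shows "A\<^sup>2 \<le> l *\<^sub>R B \<longleftrightarrow> norm X \<le> l"
  unfolding perspective_le_iff_A_square[OF l, symmetric] represents_vec[OF X] ereal_less_eq
proof
  show "norm X \<le> l" if "\<forall>x. inner (X \<cdot> x) x \<le> l * (norm x)\<^sup>2"
    using that by (intro pos_norm_le represents_pos[OF X] l) auto
  show "\<forall>x. inner (X \<cdot> x) x \<le> l * (norm x)\<^sup>2" if "norm X \<le> l"
    using order_trans[OF form_le_norm mult_right_mono[OF that zero_le_power2]] by blast
qed

lemma form_norm_eq:
  assumes X: "represents_form X (perspective_sq A B)"
  shows "form_norm (perspective_sq A B) = norm X"
proof -
  have "(THE X. represents_form X (perspective_sq A B)) = X"
  proof (rule the_equality[of "\<lambda>X. represents_form X (perspective_sq A B)", OF X])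
    fix Y assume Y: "represents_form Y (perspective_sq A B)"
    show "Y = X"
    proof (rule selfadj_form_eqI)
      show "selfadj Y" "selfadj X" by (rule pos_selfadj[OF represents_pos[OF Y]] pos_selfadj[OF represents_pos[OF X]])+
      show "inner (Y \<cdot> x) x = inner (X \<cdot> x) x" for x
        using represents_vec[OF X, of x] represents_vec[OF Y, of x] by simp
    qed
  qed
  then show ?thesis by (simp add: form_norm_def)
qed

text \<open>The bound on the cut-offs gives them a strong limit \<open>X\<close>. For every normal
  functional, \<open>\<rho> X\<close> and the perspective are limits of the same numbers, by
  normality and by monotone convergence; there is no mass at 1.\<close>

lemma ex_represents:
  assumes l: "0 \<le> l" and AB: "A\<^sup>2 \<le> l *\<^sub>R B"
  shows "\<exists>X. represents_form X (perspective_sq A B)"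
proof -
  have E1z: "\<And>x. E1 \<cdot> TT \<cdot> x = 0" and Xl: "\<And>m x. inner (XX m \<cdot> x) x \<le> l * (norm x)\<^sup>2"
    using AB unfolding A_square_le_iff_XX[OF l] by blast+
  have bd: "XX m \<le> l *\<^sub>R 1" for m
    by (rule le_bopI) (use Xl XX_pos in \<open>auto simp: pos_selfadj power2_norm_eq_inner\<close>)
  obtain X where X: "selfadj X" "sot_tendsto XX X sequentially"
    using incseq_sot_limit[of XX, OF XX_mono XX_pos bd] by blast
  have "perspective_sq A B \<rho> = ereal (Re (blinfun_apply \<rho> X))" if rho: "\<rho> \<in> normal_pos" for \<rho>
  proof -
    interpret pair_functional A B \<rho> by unfold_locales (rule rho)
    have z: "emeasure \<nu> {1} = 0"
    proof -
      have "TT * E1 * TT = 0" by (rule bop_eqI) (simp add: E1z)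
      then show ?thesis by (simp add: emeasure_nu blinfun.zero_right)
    qed
    have int: "(\<integral>\<^sup>+ t. ennreal (gg m t * gg m t) \<partial>\<nu>) = ennreal (Re (blinfun_apply \<rho> (XX m)))" for m
    proof -
      have "E.bnn (\<lambda>t. gg m t * gg m t)" by (intro E.bnn_mult bnn_gg)
      then obtain c where c: "(\<lambda>t. gg m t * gg m t) \<in> borel_measurable borel" "\<And>t. 0 \<le> gg m t * gg m t"
        "\<And>t. gg m t * gg m t \<le> c" unfolding E.bnn_def by blast
      show ?thesis unfolding XX_def GG_sq by (rule nn_integral_nu[OF c])
    qed
    have "(\<lambda>m. Re (blinfun_apply \<rho> (XX m))) \<longlonglongrightarrow> Re (blinfun_apply \<rho> X)"
      by (rule normal_pos_tendsto[where Y=XX, OF rho XX_pos XX_mono X(1)]) (use X(2) in \<open>simp add: sot_tendsto_def\<close>)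
    then have "(\<lambda>m. ennreal (Re (blinfun_apply \<rho> (XX m)))) \<longlonglongrightarrow> ennreal (Re (blinfun_apply \<rho> X))"
      by (rule tendsto_ennrealI)
    then have eq: "(\<integral>\<^sup>+ t. ennreal (f0 t) \<partial>\<nu>) = ennreal (Re (blinfun_apply \<rho> X))"
      using integral_f0_tendsto[OF sets_nu] unfolding int by (rule LIMSEQ_unique[rotated])
    have "0 \<le> Re (blinfun_apply \<rho> X)"
      using \<open>(\<lambda>m. Re (blinfun_apply \<rho> (XX m))) \<longlonglongrightarrow> Re (blinfun_apply \<rho> X)\<close>
      by (rule LIMSEQ_le_const) (use normal_pos_nonneg[OF rho XX_pos] in blast)
    then show ?thesis unfolding perspective_nu z eq by simp
  qed
  then show ?thesis unfolding represents_form_def adj_eq_self_iff using X(1) by blast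
qed

lemma bounded_form_iff: "bounded_form (perspective_sq A B) \<longleftrightarrow> (\<exists>l>0. A\<^sup>2 \<le> l *\<^sub>R B)"
proof
  assume "bounded_form (perspective_sq A B)"
  then obtain X where X: "represents_form X (perspective_sq A B)" unfolding bounded_form_def by blast
  have p: "0 < norm X + 1" by (simp add: add_nonneg_pos)
  then have "A\<^sup>2 \<le> (norm X + 1) *\<^sub>R B" by (subst represents_le_iff[OF X]) auto
  with p show "\<exists>l>0. A\<^sup>2 \<le> l *\<^sub>R B" by blast
next
  assume "\<exists>l>0. A\<^sup>2 \<le> l *\<^sub>R B"
  then show "bounded_form (perspective_sq A B)"
    unfolding bounded_form_def using ex_represents less_imp_le by blast
qed

lemma form_norm_least:
  assumes "bounded_form (perspective_sq A B)"
  shows "form_norm (perspective_sq A B) \<in> {l. 0 \<le> l \<and> A\<^sup>2 \<le> l *\<^sub>R B} \<and>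
    (\<forall>l \<in> {l. 0 \<le> l \<and> A\<^sup>2 \<le> l *\<^sub>R B}. form_norm (perspective_sq A B) \<le> l)"
proof -
  obtain X where X: "represents_form X (perspective_sq A B)" using assms unfolding bounded_form_def by blast
  show ?thesis unfolding form_norm_eq[OF X] using represents_le_iff[OF X] by auto
qed

text \<open>A positive \<open>A\<close> satisfies \<open>A^2 <= (norm A) A\<close>; adding
  \<open>1\<close> keeps the constant positive when \<open>A = 0\<close>.\<close>

lemma A_square_le_of_le:
  assumes "0 < \<alpha>" "A \<le> \<alpha> *\<^sub>R B"
  shows "\<exists>l>0. A\<^sup>2 \<le> l *\<^sub>R B"
proof (intro exI[of _ "(norm A + 1) * \<alpha>"] conjI)
  show "0 < (norm A + 1) * \<alpha>" using assms by (simp add: add_nonneg_pos)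
  show "A\<^sup>2 \<le> ((norm A + 1) * \<alpha>) *\<^sub>R B"
    unfolding A_square_le_iff
  proof
    fix x
    have "(norm (A \<cdot> x))\<^sup>2 \<le> norm A * inner (A \<cdot> x) x" by (rule pos_norm_sq_le'[OF A])
    also have "\<dots> \<le> (norm A + 1) * (\<alpha> * inner (B \<cdot> x) x)"
      using le_bop_form[OF assms(2), of x] pos_form[OF A, of x] by (intro mult_mono) auto
    finally show "(norm (A \<cdot> x))\<^sup>2 \<le> (norm A + 1) * \<alpha> * inner (B \<cdot> x) x" by (simp add: mult.assoc)
  qed
qed

end

section \<open>Diagonal operators\<close>

lemma ell2_eqI: "(\<And>n. ell2_nth x n = ell2_nth y n) \<Longrightarrow> x = y"
  by (simp add: ell2_nth_inject[symmetric] fun_eq_iff)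

lemma ex_diagonal:
  fixes d :: "nat \<Rightarrow> real"
  assumes d: "\<And>n. 0 \<le> d n" "\<And>n. d n \<le> 1"
  shows "\<exists>D. 0 \<le> D \<and> (\<forall>x n. ell2_nth (D \<cdot> x) n = complex_of_real (d n) * ell2_nth x n)"
proof -
  define f where "f x = Ell2 (\<lambda>n. complex_of_real (d n) * ell2_nth x n)" for x
  have le: "(cmod (complex_of_real (d n) * ell2_nth x n))\<^sup>2 \<le> (cmod (ell2_nth x n))\<^sup>2" for x n
    using d[of n] by (intro power_mono) (auto simp: norm_mult intro: mult_left_le_one_le)
  have sm: "summable (\<lambda>n. (cmod (complex_of_real (d n) * ell2_nth x n))\<^sup>2)" for x
    by (rule summable_comparison_test'[OF summable_ell2_nth[of x]]) (use le in simp)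
  have nth: "ell2_nth (f x) n = complex_of_real (d n) * ell2_nth x n" for x n
    unfolding f_def using sm[of x] by (subst Ell2_inverse) auto
  have "\<exists>D. \<forall>x. D \<cdot> x = f x"
  proof (rule ex_bop)
    show "f (x + y) = f x + f y" for x y
      by (rule ell2_eqI) (simp add: nth plus_ell2.rep_eq distrib_left)
    show "f (r *\<^sub>R x) = r *\<^sub>R f x" for r x
      by (rule ell2_eqI) (simp add: nth scaleR_ell2.rep_eq)
    show "f (\<i> *\<^sub>C x) = \<i> *\<^sub>C f x" for x
      by (rule ell2_eqI) (simp add: nth scaleC_ell2.rep_eq)
    show "norm (f x) \<le> 1 * norm x" for x
    proof -
      have "(norm (f x))\<^sup>2 \<le> (norm x)\<^sup>2"
        unfolding norm_ell2_sq nth by (rule suminf_le[OF le sm summable_ell2_nth])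
      then have "norm (f x) \<le> norm x" by (rule power2_le_imp_le) simp
      then show ?thesis by simp
    qed
  qed
  then obtain D where D: "\<And>x. D \<cdot> x = f x" by blast
  have "0 \<le> D"
  proof (rule posI)
    have "inner (f x) y = inner x (f y)" for x y
      unfolding inner_ell2.rep_eq nth by (rule arg_cong[where f=suminf], rule ext) (simp add: algebra_simps)
    then show "selfadj D" by (simp add: selfadj_def D)
    show "0 \<le> inner (D \<cdot> x) x" for x
      unfolding D inner_ell2.rep_eq
    proof (rule suminf_nonneg)
      show "summable (\<lambda>n. Re (ell2_nth (f x) n * cnj (ell2_nth x n)))"
        by (intro summable_Re ell2_summable_mult summable_ell2_nth)
      fix n
      have "Re (ell2_nth (f x) n * cnj (ell2_nth x n)) = d n * (cmod (ell2_nth x n))\<^sup>2"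
        unfolding nth mult.assoc complex_norm_square[symmetric] by simp
      then show "0 \<le> Re (ell2_nth (f x) n * cnj (ell2_nth x n))" using d(1)[of n] by simp
    qed
  qed
  then show ?thesis using D nth by auto
qed

text \<open>\<open>C\<close> is diagonal with entries \<open>1 / (n + 1)\<close> and
  \<open>D = C^2\<close>. On the basis vector \<open>e\<close> with index \<open>k\<close>, the
  inequality \<open>C <= \<alpha> D\<close> would force \<open>k + 1 <= \<alpha>\<close>, for every
  \<open>k\<close>.\<close>

lemma strictly_weaker_example:
  "\<exists>C D :: ell2 bop. 0 \<le> C \<and> 0 \<le> D \<and> (\<exists>l>0. C\<^sup>2 \<le> l *\<^sub>R D) \<and> \<not> (\<exists>\<alpha>>0. C \<le> \<alpha> *\<^sub>R D)"
proof -
  define c where "c n = 1 / real (Suc n)" for n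
  have c01: "0 \<le> c n" "c n \<le> 1" for n by (simp_all add: c_def divide_le_eq_1)
  obtain C where C: "0 \<le> C" "\<forall>x n. ell2_nth (C \<cdot> x) n = complex_of_real (c n) * ell2_nth x n"
    using ex_diagonal[of c, OF c01] by blast
  have saC: "selfadj C" by (rule pos_selfadj[OF C(1)])
  have "0 \<le> C\<^sup>2" unfolding power2_eq_square by (rule pos_square[OF saC])
  moreover have "\<not> C \<le> \<alpha> *\<^sub>R C\<^sup>2" for \<alpha>
  proof
    assume le: "C \<le> \<alpha> *\<^sub>R C\<^sup>2"
    obtain k :: nat where k: "\<alpha> < real k" using reals_Archimedean2 by blast
    define e where "e = Ell2 (\<lambda>n. if n = k then 1 else 0)"
    have e: "ell2_nth e n = (if n = k then 1 else 0)" for n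
      unfolding e_def
    proof (subst Ell2_inverse)
      have "summable (\<lambda>n. (cmod (if n = k then 1 else 0))\<^sup>2)"
        by (rule summable_finite[of "{k}"]) auto
      then show "(\<lambda>n. if n = k then 1 else 0) \<in> {f. summable (\<lambda>n. (cmod (f n))\<^sup>2)}" by simp
    qed simp
    have Ce: "C \<cdot> e = c k *\<^sub>R e"
      by (rule ell2_eqI) (simp add: C(2) e scaleR_ell2.rep_eq)
    have ee: "inner e e = 1"
    proof -
      have "inner e e = (\<Sum>n. Re (ell2_nth e n * cnj (ell2_nth e n)))" by (simp add: inner_ell2.rep_eq)
      also have "\<dots> = (\<Sum>n\<in>{k}. Re (ell2_nth e n * cnj (ell2_nth e n)))"
        by (rule suminf_finite) (auto simp: e)
      finally show ?thesis by (simp add: e)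
    qed
    have "inner (C \<cdot> e) e \<le> inner ((\<alpha> *\<^sub>R C\<^sup>2) \<cdot> e) e" by (rule le_bop_form[OF le])
    then have le': "c k \<le> \<alpha> * (c k * c k)" by (simp add: power2_eq_square Ce ee)
    define K where "K = real (Suc k)"
    have cK: "c k * K = 1" by (simp add: c_def K_def)
    have "K = (c k * K) * K" by (simp only: cK mult_1_left)
    also have "\<dots> = c k * (K * K)" by (simp only: mult.assoc)
    also have "\<dots> \<le> \<alpha> * (c k * c k) * (K * K)" by (rule mult_right_mono[OF le']) simp
    also have "\<dots> = \<alpha> * ((c k * K) * (c k * K))" by (simp only: mult_ac)
    also have "\<dots> = \<alpha>" by (simp only: cK mult_1_right)
    finally have "real (Suc k) \<le> \<alpha>" by (simp only: K_def)
    then show False using k by simp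
  qed
  moreover have "\<exists>l>0. C\<^sup>2 \<le> l *\<^sub>R C\<^sup>2" by (rule exI[of _ 1]) simp
  ultimately show ?thesis using C(1) by blast
qed

theorem theorem8p6:
  fixes A B :: "'a::complex_hilbert bop"
  assumes "0 \<le> A" and "0 \<le> B"
  shows
    "(essential_part (perspective_sq A B) = closure (ker (A - ac_part B A) \<inter> dom_sqrtQ_T A B) \<and>
      closure (ker (A - ac_part B A) \<inter> dom_sqrtQ_T A B) \<subseteq> ker (A - ac_part B A)) \<and>

     (dense_domain (perspective_sq A B) \<longleftrightarrow> abs_cont B A \<and> closure (dom_sqrtQ_T A B) = UNIV) \<and>

     (bounded_form (perspective_sq A B) \<longleftrightarrow> (\<exists>l>0. A\<^sup>2 \<le> l *\<^sub>R B)) \<and>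
     ((\<exists>\<alpha>>0. A \<le> \<alpha> *\<^sub>R B) \<longrightarrow> (\<exists>l>0. A\<^sup>2 \<le> l *\<^sub>R B)) \<and>
     (\<exists>C D :: ell2 bop. 0 \<le> C \<and> 0 \<le> D \<and> (\<exists>l>0. C\<^sup>2 \<le> l *\<^sub>R D) \<and> \<not> (\<exists>\<alpha>>0. C \<le> \<alpha> *\<^sub>R D)) \<and>
     (bounded_form (perspective_sq A B) \<longrightarrow>
        form_norm (perspective_sq A B) \<in> {l. 0 \<le> l \<and> A\<^sup>2 \<le> l *\<^sub>R B} \<and>
        (\<forall>l \<in> {l. 0 \<le> l \<and> A\<^sup>2 \<le> l *\<^sub>R B}. form_norm (perspective_sq A B) \<le> l))"
proof -
  interpret pos_pair A B using assms by (rule pos_pair.intro)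
  show ?thesis
    using essential_part_eq closure_subset_ker dense_domain_iff bounded_form_iff A_square_le_of_le
      strictly_weaker_example form_norm_least
    by blast
qed

end
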